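(* Let $k$ be a field, $H$ a quasi-bialgebra over $k$, $(\mathfrak A,\rho,\Phi_\rho)$ a right $H$-comodule algebra and $\mathcal A$ an $H$-bimodule algebra. Write $\rho(a)=a_{\langle0\rangle}\otimes a_{\langle1\rangle}$ and $\Phi_\rho^{-1}=\tilde x^1_\rho\otimes\tilde x^2_\rho\otimes\tilde x^3_\rho$. Then $(\mathfrak A,\mathcal A)$ is a wreath in the monoidal category ${}_H\mathcal M$ of left $H$-modules, where $\mathfrak A$ is considered as a left $H$-module in the trivial way (via the counit of $H$) and the structure morphisms are - $\psi:\mathcal A\otimes\mathfrak A\to\mathfrak A\otimes\mathcal A$, $\psi(\varphi\otimes a)=a_{\langle0\rangle}\otimes\varphi\cdot a_{\langle1\rangle}$; - $\zeta:\mathcal A\otimes\mathcal A\to\mathfrak A\otimes\mathcal A$, $\zeta(\varphi\otimes\varphi')=\tilde x^1_\rho\otimes(\varphi\cdot\tilde x^2_\rho)(\varphi'\cdot\tilde x^3_\rho)$; - $\sigma:k\to\mathfrak A\otimes\mathcal A$, $\sigma(1)=1_{\mathfrak A}\otimes1_{\mathcal A}$. Furthermore, the resulting wreath product is the generalized quasi-smash product $\mathfrak A\,\overline{\#}\,\mathcal A$.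
   Context: Quasi-bialgebra: an associative unital $k$-algebra $H$ with algebra maps $\Delta:H\to H\otimes H$, $\varepsilon:H\to k$ and an invertible $\Phi=X^1\otimes X^2\otimes X^3\in H^{\otimes3}$ (inverse $x^1\otimes x^2\otimes x^3$) with $(\mathrm{id}\otimes\Delta)\Delta(h)=\Phi\,(\Delta\otimes\mathrm{id})\Delta(h)\,\Phi^{-1}$, $(\mathrm{id}\otimes\varepsilon)\Delta=\mathrm{id}=(\varepsilon\otimes\mathrm{id})\Delta$, $(1\otimes\Phi)(\mathrm{id}\otimes\Delta\otimes\mathrm{id})(\Phi)(\Phi\otimes1)=(\mathrm{id}\otimes\mathrm{id}\otimes\Delta)(\Phi)(\Delta\otimes\mathrm{id}\otimes\mathrm{id})(\Phi)$, $(\mathrm{id}\otimes\varepsilon\otimes\mathrm{id})(\Phi)=1\otimes1$. Then ${}_H\mathcal M$ is monoidal with $\otimes=\otimes_k$, diagonal action via $\Delta$ and associativity constraint $(u\otimes v)\otimes w\mapsto X^1u\otimes(X^2v\otimes X^3w)$; ${}_H\mathcal M_H$ is monoidal with associativity constraint $(u\otimes v)\otimes w\mapsto X^1ux^1\otimes(X^2vx^2\otimes X^3wx^3)$. An $H$-bimodule algebra is an algebra in ${}_H\mathcal M_H$. Right $H$-comodule algebra: an associative unital algebra $\mathfrak A$ with an algebra map $\rho:\mathfrak A\to\mathfrak A\otimes H$ and an invertible $\Phi_\rho\in\mathfrak A\otimes H\otimes H$ with $\Phi_\rho(\rho\otimes\mathrm{id})\rho(a)=(\mathrm{id}\otimes\Delta)(\rho(a))\Phi_\rho$,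 $(1\otimes\Phi)(\mathrm{id}\otimes\Delta\otimes\mathrm{id})(\Phi_\rho)(\Phi_\rho\otimes1)=(\mathrm{id}\otimes\mathrm{id}\otimes\Delta)(\Phi_\rho)(\rho\otimes\mathrm{id}\otimes\mathrm{id})(\Phi_\rho)$, $(\mathrm{id}\otimes\varepsilon)\rho=\mathrm{id}$, $(\mathrm{id}\otimes\varepsilon\otimes\mathrm{id})(\Phi_\rho)=(\mathrm{id}\otimes\mathrm{id}\otimes\varepsilon)(\Phi_\rho)=1\otimes1$. A wreath $(A,X)$ in a monoidal category $\mathcal C$ with unit $\underline1$ (associativity constraints inserted where needed; identities denoted by objects): an algebra $(A,m_A,\eta_A)$, an object $X$, and morphisms $\psi:X\otimes A\to A\otimes X$, $\zeta:X\otimes X\to A\otimes X$, $\sigma:\underline1\to A\otimes X$ satisfying $\psi(X\otimes m_A)=(m_A\otimes X)(A\otimes\psi)(\psi\otimes A)$, $\psi(X\otimes\eta_A)=\eta_A\otimes X$; $(m_A\otimes X)(A\otimes\psi)(\zeta\otimes A)=(m_A\otimes X)(A\otimes\zeta)(\psi\otimes X)(X\otimes\psi)$; $(m_A\otimes X)(A\otimes\zeta)(\psi\otimes X)(X\otimes\zeta)=(m_A\otimes X)(A\otimes\zeta)(\zeta\otimes X)$; $(m_A\otimes X)(A\otimes\sigma)=(m_A\otimes X)(A\otimes\psi)(\sigma\otimes A)$; $(m_A\otimes X)(A\otimes\zeta)(\psi\otimes X)(X\otimes\sigma)=\eta_A\otimes X=(m_A\otimes X)(A\otimes\zeta)(\sigma\otimes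 X)$. Its wreath product is the algebra $A\otimes X$ with multiplication $(m_A\otimes X)(m_A\otimes\zeta)(A\otimes\psi\otimes X)$ and unit $\sigma$. The generalized quasi-smash product $\mathfrak A\,\overline{\#}\,\mathcal A$ is the algebra in ${}_H\mathcal M$ with underlying space $\mathfrak A\otimes\mathcal A$, $H$-action $h\cdot(a\,\overline{\#}\,\varphi)=a\,\overline{\#}\,h\cdot\varphi$, multiplication $(a\,\overline{\#}\,\varphi)(a'\,\overline{\#}\,\varphi')=aa'_{\langle0\rangle}\tilde x^1_\rho\,\overline{\#}\,(\varphi\cdot a'_{\langle1\rangle}\tilde x^2_\rho)(\varphi'\cdot\tilde x^3_\rho)$ and unit $1_{\mathfrak A}\,\overline{\#}\,1_{\mathcal A}$. *)

theory Defs
  imports "HOL-Algebra.Module"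
begin

section \<open>Monoidal categories, algebras and wreaths\<close>

record ('o, 'm) monoidal =
  Obj :: "'o set"
  Arr :: "'m set"
  Dom :: "'m \<Rightarrow> 'o"
  Cod :: "'m \<Rightarrow> 'o"
  Ident :: "'o \<Rightarrow> 'm"
  Comp :: "'m \<Rightarrow> 'm \<Rightarrow> 'm" (infixl "\<bullet>\<index>" 65)
  TensObj :: "'o \<Rightarrow> 'o \<Rightarrow> 'o" (infixl "\<diamondop>\<index>" 75)
  TensArr :: "'m \<Rightarrow> 'm \<Rightarrow> 'm" (infixl "\<star>\<index>" 75)
  Unit :: 'o
  Assoc :: "'o \<Rightarrow> 'o \<Rightarrow> 'o \<Rightarrow> 'm"  \<comment> \<open>from \<open>(U \<diamondop> V) \<diamondop> W\<close> to \<open>U \<diamondop> (V \<diamondop> W)\<close>\<close>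
  LUnit :: "'o \<Rightarrow> 'm"  \<comment> \<open>from \<open>Unit \<diamondop> U\<close> to \<open>U\<close>\<close>
  RUnit :: "'o \<Rightarrow> 'm"  \<comment> \<open>from \<open>U \<diamondop> Unit\<close> to \<open>U\<close>\<close>

definition Hom :: "('o, 'm, 'z) monoidal_scheme \<Rightarrow> 'o \<Rightarrow> 'o \<Rightarrow> 'm set" where
  "Hom C U V = {f \<in> Arr C. Dom C f = U \<and> Cod C f = V}"

definition inverses :: "('o, 'm, 'z) monoidal_scheme \<Rightarrow> 'm \<Rightarrow> 'm \<Rightarrow> bool" where
  "inverses C f g \<longleftrightarrow> f \<in> Arr C \<and> g \<in> Hom C (Cod C f) (Dom C f) \<and>
     g \<bullet>\<^bsub>C\<^esub> f = Ident C (Dom C f) \<and> f \<bullet>\<^bsub>C\<^esub> g = Ident C (Cod C f)"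

definition iso_arr :: "('o, 'm, 'z) monoidal_scheme \<Rightarrow> 'm \<Rightarrow> bool" where
  "iso_arr C f \<longleftrightarrow> (\<exists>g. inverses C f g)"

definition inv_arr :: "('o, 'm, 'z) monoidal_scheme \<Rightarrow> 'm \<Rightarrow> 'm" where
  "inv_arr C f = (THE g. inverses C f g)"

locale monoidal_category =
  fixes C :: "('o, 'm, 'z) monoidal_scheme" (structure)
  assumes dom_obj: "f \<in> Arr C \<Longrightarrow> Dom C f \<in> Obj C"
    and cod_obj: "f \<in> Arr C \<Longrightarrow> Cod C f \<in> Obj C"
    and ident_hom: "U \<in> Obj C \<Longrightarrow> Ident C U \<in> Hom C U U"
    and comp_hom: "\<lbrakk>f \<in> Hom C U V; g \<in> Hom C V W\<rbrakk> \<Longrightarrow> g \<bullet> f \<in> Hom C U W"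
    and comp_ident: "f \<in> Hom C U V \<Longrightarrow> f \<bullet> Ident C U = f"
    and ident_comp: "f \<in> Hom C U V \<Longrightarrow> Ident C V \<bullet> f = f"
    and comp_assoc:
      "\<lbrakk>f \<in> Hom C U V; g \<in> Hom C V W; h \<in> Hom C W Z\<rbrakk> \<Longrightarrow> h \<bullet> (g \<bullet> f) = h \<bullet> g \<bullet> f"
    and unit_obj: "Unit C \<in> Obj C"
    and tens_obj: "\<lbrakk>U \<in> Obj C; V \<in> Obj C\<rbrakk> \<Longrightarrow> U \<diamondop> V \<in> Obj C"
    and tens_hom:
      "\<lbrakk>f \<in> Hom C U U'; g \<in> Hom C V V'\<rbrakk> \<Longrightarrow> f \<star> g \<in> Hom C (U \<diamondop> V) (U' \<diamondop> V')"
    and tens_ident: "\<lbrakk>U \<in> Obj C; V \<in> Obj C\<rbrakk> \<Longrightarrow> Ident C U \<star> Ident C V = Ident C (U \<diamondop> V)"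
    and tens_comp:
      "\<lbrakk>f \<in> Hom C U U'; f' \<in> Hom C U' U''; g \<in> Hom C V V'; g' \<in> Hom C V' V''\<rbrakk> \<Longrightarrow>
        (f' \<bullet> f) \<star> (g' \<bullet> g) = (f' \<star> g') \<bullet> (f \<star> g)"
    and assoc_hom:
      "\<lbrakk>U \<in> Obj C; V \<in> Obj C; W \<in> Obj C\<rbrakk> \<Longrightarrow>
        Assoc C U V W \<in> Hom C (U \<diamondop> V \<diamondop> W) (U \<diamondop> (V \<diamondop> W))"
    and assoc_iso: "\<lbrakk>U \<in> Obj C; V \<in> Obj C; W \<in> Obj C\<rbrakk> \<Longrightarrow> iso_arr C (Assoc C U V W)"
    and assoc_natural:
      "\<lbrakk>f \<in> Hom C U U'; g \<in> Hom C V V'; h \<in> Hom C W W'\<rbrakk> \<Longrightarrow>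
        Assoc C U' V' W' \<bullet> (f \<star> g \<star> h) = (f \<star> (g \<star> h)) \<bullet> Assoc C U V W"
    and lunit_hom: "U \<in> Obj C \<Longrightarrow> LUnit C U \<in> Hom C (Unit C \<diamondop> U) U"
    and lunit_iso: "U \<in> Obj C \<Longrightarrow> iso_arr C (LUnit C U)"
    and lunit_natural:
      "f \<in> Hom C U V \<Longrightarrow> LUnit C V \<bullet> (Ident C (Unit C) \<star> f) = f \<bullet> LUnit C U"
    and runit_hom: "U \<in> Obj C \<Longrightarrow> RUnit C U \<in> Hom C (U \<diamondop> Unit C) U"
    and runit_iso: "U \<in> Obj C \<Longrightarrow> iso_arr C (RUnit C U)"
    and runit_natural:
      "f \<in> Hom C U V \<Longrightarrow> RUnit C V \<bullet> (f \<star> Ident C (Unit C)) = f \<bullet> RUnit C U"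
    and pentagon:
      "\<lbrakk>U \<in> Obj C; V \<in> Obj C; W \<in> Obj C; Z \<in> Obj C\<rbrakk> \<Longrightarrow>
        (Ident C U \<star> Assoc C V W Z) \<bullet> Assoc C U (V \<diamondop> W) Z \<bullet> (Assoc C U V W \<star> Ident C Z)
          = Assoc C U V (W \<diamondop> Z) \<bullet> Assoc C (U \<diamondop> V) W Z"
    and triangle:
      "\<lbrakk>U \<in> Obj C; V \<in> Obj C\<rbrakk> \<Longrightarrow>
        (Ident C U \<star> LUnit C V) \<bullet> Assoc C U (Unit C) V = RUnit C U \<star> Ident C V"

locale algebra_object =
  fixes C :: "('o, 'm, 'z) monoidal_scheme" (structure) and A :: 'o and m e :: 'm
  assumes obj: "A \<in> Obj C"
    and mult_hom: "m \<in> Hom C (A \<diamondop> A) A"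
    and unit_hom: "e \<in> Hom C (Unit C) A"
    and mult_assoc: "m \<bullet> (m \<star> Ident C A) = m \<bullet> (Ident C A \<star> m) \<bullet> Assoc C A A A"
    and unit_left: "m \<bullet> (e \<star> Ident C A) = LUnit C A"
    and unit_right: "m \<bullet> (Ident C A \<star> e) = RUnit C A"

text \<open>The morphism \<open>m \<otimes> X\<close>, preceded by the constraint that rebrackets its source, so that it
  starts at \<open>A \<diamondop> (A \<diamondop> X)\<close>.\<close>

definition mult_left :: "('o, 'm, 'z) monoidal_scheme \<Rightarrow> 'o \<Rightarrow> 'm \<Rightarrow> 'o \<Rightarrow> 'm" where
  "mult_left C A m X = (m \<star>\<^bsub>C\<^esub> Ident C X) \<bullet>\<^bsub>C\<^esub> inv_arr C (Assoc C A A X)"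

locale wreath = algebra_object +
  fixes X :: 'a and \<psi> \<zeta> \<sigma> :: 'b
  assumes obj_X: "X \<in> Obj C"
    and psi_hom: "\<psi> \<in> Hom C (X \<diamondop> A) (A \<diamondop> X)"
    and zeta_hom: "\<zeta> \<in> Hom C (X \<diamondop> X) (A \<diamondop> X)"
    and sigma_hom: "\<sigma> \<in> Hom C (Unit C) (A \<diamondop> X)"
    and psi_mult:
      "\<psi> \<bullet> (Ident C X \<star> m)
        = mult_left C A m X \<bullet> (Ident C A \<star> \<psi>) \<bullet> Assoc C A X A
            \<bullet> (\<psi> \<star> Ident C A) \<bullet> inv_arr C (Assoc C X A A)"
    and psi_unit:
      "\<psi> \<bullet> (Ident C X \<star> e) = (e \<star> Ident C X) \<bullet> inv_arr C (LUnit C X) \<bullet> RUnit C X"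
    and zeta_psi:
      "mult_left C A m X \<bullet> (Ident C A \<star> \<psi>) \<bullet> Assoc C A X A \<bullet> (\<zeta> \<star> Ident C A)
        = mult_left C A m X \<bullet> (Ident C A \<star> \<zeta>) \<bullet> Assoc C A X X
            \<bullet> (\<psi> \<star> Ident C X) \<bullet> inv_arr C (Assoc C X A X)
            \<bullet> (Ident C X \<star> \<psi>) \<bullet> Assoc C X X A"
    and zeta_zeta:
      "mult_left C A m X \<bullet> (Ident C A \<star> \<zeta>) \<bullet> Assoc C A X X
            \<bullet> (\<psi> \<star> Ident C X) \<bullet> inv_arr C (Assoc C X A X)
            \<bullet> (Ident C X \<star> \<zeta>) \<bullet> Assoc C X X X
        = mult_left C A m X \<bullet> (Ident C A \<star> \<zeta>) \<bullet> Assoc C A X X \<bullet> (\<zeta> \<star> Ident C X)"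
    and sigma_psi:
      "mult_left C A m X \<bullet> (Ident C A \<star> \<sigma>) \<bullet> inv_arr C (RUnit C A)
        = mult_left C A m X \<bullet> (Ident C A \<star> \<psi>) \<bullet> Assoc C A X A
            \<bullet> (\<sigma> \<star> Ident C A) \<bullet> inv_arr C (LUnit C A)"
    and sigma_right:
      "mult_left C A m X \<bullet> (Ident C A \<star> \<zeta>) \<bullet> Assoc C A X X
            \<bullet> (\<psi> \<star> Ident C X) \<bullet> inv_arr C (Assoc C X A X)
            \<bullet> (Ident C X \<star> \<sigma>) \<bullet> inv_arr C (RUnit C X)
        = (e \<star> Ident C X) \<bullet> inv_arr C (LUnit C X)"
    and sigma_left:
      "mult_left C A m X \<bullet> (Ident C A \<star> \<zeta>) \<bullet> Assoc C A X X
            \<bullet> (\<sigma> \<star> Ident C X) \<bullet> inv_arr C (LUnit C X)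
        = (e \<star> Ident C X) \<bullet> inv_arr C (LUnit C X)"

text \<open>An algebra in a monoidal category is presented as a triple (object, multiplication, unit).\<close>

definition wreath_product ::
  "('o, 'm, 'z) monoidal_scheme \<Rightarrow> 'o \<Rightarrow> 'm \<Rightarrow> 'o \<Rightarrow> 'm \<Rightarrow> 'm \<Rightarrow> 'm \<Rightarrow> 'o \<times> 'm \<times> 'm" where
  "wreath_product C A m X \<psi> \<zeta> \<sigma> =
    (A \<diamondop>\<^bsub>C\<^esub> X,
     mult_left C A m X \<bullet>\<^bsub>C\<^esub> (m \<star>\<^bsub>C\<^esub> \<zeta>)
       \<bullet>\<^bsub>C\<^esub> inv_arr C (Assoc C A A (X \<diamondop>\<^bsub>C\<^esub> X))
       \<bullet>\<^bsub>C\<^esub> (Ident C A \<star>\<^bsub>C\<^esub> (Assoc C A X X \<bullet>\<^bsub>C\<^esub> (\<psi> \<star>\<^bsub>C\<^esub> Ident C X) \<bullet>\<^bsub>C\<^esub> inv_arr C (Assoc C X A X)))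
       \<bullet>\<^bsub>C\<^esub> Assoc C A X (A \<diamondop>\<^bsub>C\<^esub> X),
     \<sigma>)"


section \<open>Tensor products over a field\<close>

text \<open>All spaces have their carriers in one universe, which contains an arbitrary type \<open>'u\<close> of
  atoms and the scalars and is closed under forming formal sums of pairs. It is therefore closed under
  tensor products, and the modules carried by its subsets form a monoidal category with a single
  type of objects. Since \<open>'u\<close> is arbitrary, every (small) family of modules can be transported into
  such a universe.

  In the record \<open>module\<close> of the library, the fields \<open>mult\<close> and \<open>one\<close> are ignored when the
  record is used as a vector space.\<close>

datatype ('k, 'u) univ =
    Atom 'u
  | Scal (scalar_of: 'k)
  | Tens (summands: "(('k, 'u) univ \<times> ('k, 'u) univ) list")

type_synonym ('k, 'u) space = "('k, ('k, 'u) univ) module"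

text \<open>The list \<open>[(v\<^sub>1, w\<^sub>1), \<dots>]\<close> stands for the formal sum \<open>v\<^sub>1 \<otimes> w\<^sub>1 + \<dots>\<close>. The relation below is the
  congruence defining \<open>V \<otimes> W\<close>, and an element of \<open>V \<otimes> W\<close> is a chosen representative of
  its congruence class.\<close>

inductive tensor_eq ::
  "('k, 'c) ring_scheme \<Rightarrow> ('k, 'v, 'x) module_scheme \<Rightarrow> ('k, 'v, 'y) module_scheme
    \<Rightarrow> ('v \<times> 'v) list \<Rightarrow> ('v \<times> 'v) list \<Rightarrow> bool"
  for K V W where
    refl: "xs \<in> lists (carrier V \<times> carrier W) \<Longrightarrow> tensor_eq K V W xs xs"
  | sym: "tensor_eq K V W xs ys \<Longrightarrow> tensor_eq K V W ys xs"
  | trans: "\<lbrakk>tensor_eq K V W xs ys; tensor_eq K V W ys zs\<rbrakk> \<Longrightarrow> tensor_eq K V W xs zs"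
  | append: "\<lbrakk>tensor_eq K V W xs xs'; tensor_eq K V W ys ys'\<rbrakk> \<Longrightarrow>
      tensor_eq K V W (xs @ ys) (xs' @ ys')"
  | commute: "\<lbrakk>xs \<in> lists (carrier V \<times> carrier W); ys \<in> lists (carrier V \<times> carrier W)\<rbrakk> \<Longrightarrow>
      tensor_eq K V W (xs @ ys) (ys @ xs)"
  | add_left: "\<lbrakk>v \<in> carrier V; v' \<in> carrier V; w \<in> carrier W\<rbrakk> \<Longrightarrow>
      tensor_eq K V W [(v \<oplus>\<^bsub>V\<^esub> v', w)] [(v, w), (v', w)]"
  | add_right: "\<lbrakk>v \<in> carrier V; w \<in> carrier W; w' \<in> carrier W\<rbrakk> \<Longrightarrow>
      tensor_eq K V W [(v, w \<oplus>\<^bsub>W\<^esub> w')] [(v, w), (v, w')]"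
  | zero: "w \<in> carrier W \<Longrightarrow> tensor_eq K V W [(\<zero>\<^bsub>V\<^esub>, w)] []"
  | scale: "\<lbrakk>c \<in> carrier K; v \<in> carrier V; w \<in> carrier W\<rbrakk> \<Longrightarrow>
      tensor_eq K V W [(c \<odot>\<^bsub>V\<^esub> v, w)] [(v, c \<odot>\<^bsub>W\<^esub> w)]"

definition formal_sum ::
  "('k, 'c) ring_scheme \<Rightarrow> ('k, ('k, 'u) univ, 'x) module_scheme \<Rightarrow> ('k, ('k, 'u) univ, 'y) module_scheme
    \<Rightarrow> (('k, 'u) univ \<times> ('k, 'u) univ) list \<Rightarrow> ('k, 'u) univ" where
  "formal_sum K V W xs = Tens (SOME ys. tensor_eq K V W xs ys)"

definition pure ::
  "('k, 'c) ring_scheme \<Rightarrow> ('k, ('k, 'u) univ, 'x) module_scheme \<Rightarrow> ('k, ('k, 'u) univ, 'y) module_scheme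
    \<Rightarrow> ('k, 'u) univ \<Rightarrow> ('k, 'u) univ \<Rightarrow> ('k, 'u) univ" where
  "pure K V W v w = formal_sum K V W [(v, w)]"

definition tensor_space ::
  "('k, 'c) ring_scheme \<Rightarrow> ('k, ('k, 'u) univ, 'x) module_scheme \<Rightarrow> ('k, ('k, 'u) univ, 'y) module_scheme
    \<Rightarrow> ('k, 'u) space" where
  "tensor_space K V W =
    \<lparr>carrier = formal_sum K V W ` lists (carrier V \<times> carrier W),
     mult = undefined, one = undefined,
     zero = formal_sum K V W [],
     add = (\<lambda>s t. formal_sum K V W (summands s @ summands t)),
     smult = (\<lambda>c t. formal_sum K V W (map (\<lambda>(v, w). (c \<odot>\<^bsub>V\<^esub> v, w)) (summands t)))\<rparr>"

text \<open>For bilinear \<open>\<beta>\<close> with values in \<open>Z\<close>, this is the induced linear map; in Sweedler-type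
  notation, the value at \<open>t = t\<^sub>1 \<otimes> t\<^sub>2\<close> is \<open>\<beta> t\<^sub>1 t\<^sub>2\<close>, summation understood.\<close>

definition tlift ::
  "('k, ('k, 'u) univ, 'z) module_scheme \<Rightarrow> (('k, 'u) univ \<Rightarrow> ('k, 'u) univ \<Rightarrow> ('k, 'u) univ)
    \<Rightarrow> ('k, 'u) univ \<Rightarrow> ('k, 'u) univ" where
  "tlift Z \<beta> t = foldr (\<lambda>(v, w) z. \<beta> v w \<oplus>\<^bsub>Z\<^esub> z) (summands t) \<zero>\<^bsub>Z\<^esub>"

text \<open>Triple tensor products are bracketed to the right.\<close>

definition tlift3 ::
  "('k, ('k, 'u) univ, 'z) module_scheme
    \<Rightarrow> (('k, 'u) univ \<Rightarrow> ('k, 'u) univ \<Rightarrow> ('k, 'u) univ \<Rightarrow> ('k, 'u) univ)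
    \<Rightarrow> ('k, 'u) univ \<Rightarrow> ('k, 'u) univ" where
  "tlift3 Z \<beta> t = tlift Z (\<lambda>u s. tlift Z (\<beta> u) s) t"

text \<open>The map \<open>f \<otimes> g\<close> with target \<open>V \<otimes> W\<close>.\<close>

definition tmap ::
  "('k, 'c) ring_scheme \<Rightarrow> ('k, ('k, 'u) univ, 'x) module_scheme \<Rightarrow> ('k, ('k, 'u) univ, 'y) module_scheme
    \<Rightarrow> (('k, 'u) univ \<Rightarrow> ('k, 'u) univ) \<Rightarrow> (('k, 'u) univ \<Rightarrow> ('k, 'u) univ)
    \<Rightarrow> ('k, 'u) univ \<Rightarrow> ('k, 'u) univ" where
  "tmap K V W f g = tlift (tensor_space K V W) (\<lambda>v w. pure K V W (f v) (g w))"

text \<open>The canonical map from \<open>(U \<otimes> V) \<otimes> W\<close> to \<open>U \<otimes> (V \<otimes> W)\<close>.\<close>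

definition rebracket ::
  "('k, 'c) ring_scheme \<Rightarrow> ('k, ('k, 'u) univ, 'x) module_scheme \<Rightarrow> ('k, ('k, 'u) univ, 'y) module_scheme
    \<Rightarrow> ('k, ('k, 'u) univ, 'z) module_scheme \<Rightarrow> ('k, 'u) univ \<Rightarrow> ('k, 'u) univ" where
  "rebracket K U V W =
    tlift (tensor_space K U (tensor_space K V W))
      (\<lambda>s w. tlift (tensor_space K U (tensor_space K V W))
        (\<lambda>u v. pure K U (tensor_space K V W) u (pure K V W v w)) s)"

definition tensor_algebra ::
  "('k, 'c) ring_scheme \<Rightarrow> ('k, ('k, 'u) univ, 'x) module_scheme \<Rightarrow> ('k, ('k, 'u) univ, 'y) module_scheme
    \<Rightarrow> ('k, 'u) space" where
  "tensor_algebra K A B = (tensor_space K A B)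
    \<lparr>mult := \<lambda>s t. tlift (tensor_space K A B)
       (\<lambda>a b. tmap K A B (\<lambda>a'. a \<otimes>\<^bsub>A\<^esub> a') (\<lambda>b'. b \<otimes>\<^bsub>B\<^esub> b') t) s,
     one := pure K A B \<one>\<^bsub>A\<^esub> \<one>\<^bsub>B\<^esub>\<rparr>"


section \<open>Quasi-bialgebras and comodule algebras\<close>

locale assoc_unital_algebra = module K A + ring A
  for K :: "('k, 'c) ring_scheme" and A :: "('k, 'v, 'x) module_scheme" +
  assumes smult_mult_left:
      "\<lbrakk>c \<in> carrier K; x \<in> carrier A; y \<in> carrier A\<rbrakk> \<Longrightarrow>
        (c \<odot>\<^bsub>A\<^esub> x) \<otimes>\<^bsub>A\<^esub> y = c \<odot>\<^bsub>A\<^esub> (x \<otimes>\<^bsub>A\<^esub> y)"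
    and smult_mult_right:
      "\<lbrakk>c \<in> carrier K; x \<in> carrier A; y \<in> carrier A\<rbrakk> \<Longrightarrow>
        x \<otimes>\<^bsub>A\<^esub> (c \<odot>\<^bsub>A\<^esub> y) = c \<odot>\<^bsub>A\<^esub> (x \<otimes>\<^bsub>A\<^esub> y)"

definition algebra_hom ::
  "('k, 'c) ring_scheme \<Rightarrow> ('k, 'v, 'x) module_scheme \<Rightarrow> ('k, 'w, 'y) module_scheme \<Rightarrow> ('v \<Rightarrow> 'w) set" where
  "algebra_hom K A B = {f \<in> ring_hom A B.
     \<forall>c\<in>carrier K. \<forall>x\<in>carrier A. f (c \<odot>\<^bsub>A\<^esub> x) = c \<odot>\<^bsub>B\<^esub> f x}"

record ('k, 'v) quasi_bialg = "('k, 'v) module" +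
  comult :: "'v \<Rightarrow> 'v"
  counit :: "'v \<Rightarrow> 'k"
  reassociator :: 'v

type_synonym ('k, 'u) qba = "('k, ('k, 'u) univ) quasi_bialg"

definition id_counit :: "('k, ('k, 'u) univ, 'x) module_scheme \<Rightarrow> ('k, 'u) qba \<Rightarrow> ('k, 'u) univ \<Rightarrow> ('k, 'u) univ" where
  "id_counit V H = tlift V (\<lambda>v h. counit H h \<odot>\<^bsub>V\<^esub> v)"

definition counit_id :: "('k, 'u) qba \<Rightarrow> ('k, ('k, 'u) univ, 'x) module_scheme \<Rightarrow> ('k, 'u) univ \<Rightarrow> ('k, 'u) univ" where
  "counit_id H V = tlift V (\<lambda>h v. counit H h \<odot>\<^bsub>V\<^esub> v)"

locale quasi_bialgebra = assoc_unital_algebra K H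
  for K :: "('k, 'c) ring_scheme" and H :: "('k, 'u) qba" +
  fixes H2 H3 H4 :: "('k, 'u) space" and \<Delta> \<Phi>
  defines "H2 \<equiv> tensor_algebra K H H"
    and "H3 \<equiv> tensor_algebra K H H2"
    and "H4 \<equiv> tensor_algebra K H H3"
    and "\<Delta> \<equiv> comult H"
    and "\<Phi> \<equiv> reassociator H"
  assumes comult_hom: "\<Delta> \<in> algebra_hom K H H2"
    and counit_ring_hom: "counit H \<in> ring_hom H K"
    and counit_smult:
      "\<lbrakk>c \<in> carrier K; h \<in> carrier H\<rbrakk> \<Longrightarrow> counit H (c \<odot>\<^bsub>H\<^esub> h) = c \<otimes>\<^bsub>K\<^esub> counit H h"
    and reassociator_unit: "\<Phi> \<in> Units H3"
    and quasi_coassoc: "h \<in> carrier H \<Longrightarrow>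
      tmap K H H2 id \<Delta> (\<Delta> h)
        = \<Phi> \<otimes>\<^bsub>H3\<^esub> rebracket K H H H (tmap K H2 H \<Delta> id (\<Delta> h)) \<otimes>\<^bsub>H3\<^esub> inv\<^bsub>H3\<^esub> \<Phi>"
    and counit_right: "h \<in> carrier H \<Longrightarrow> id_counit H H (\<Delta> h) = h"
    and counit_left: "h \<in> carrier H \<Longrightarrow> counit_id H H (\<Delta> h) = h"
    and cocycle:
      "pure K H H3 \<one>\<^bsub>H\<^esub> \<Phi>
         \<otimes>\<^bsub>H4\<^esub> tmap K H H3 id (\<lambda>s. rebracket K H H H (tmap K H2 H \<Delta> id s)) \<Phi>
         \<otimes>\<^bsub>H4\<^esub> tmap K H H3 id (rebracket K H H H) (rebracket K H H2 H (pure K H3 H \<Phi> \<one>\<^bsub>H\<^esub>))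
       = tmap K H H3 id (tmap K H H2 id \<Delta>) \<Phi>
         \<otimes>\<^bsub>H4\<^esub> rebracket K H H H2 (tmap K H2 H2 \<Delta> id \<Phi>)"
    and counit_reassociator: "tmap K H H id (counit_id H H) \<Phi> = pure K H H \<one>\<^bsub>H\<^esub> \<one>\<^bsub>H\<^esub>"

record ('k, 'v) comod_alg = "('k, 'v) module" +
  coact :: "'v \<Rightarrow> 'v"
  coreassociator :: 'v

type_synonym ('k, 'u) ca = "('k, ('k, 'u) univ) comod_alg"

definition coreassociator_inv :: "('k, 'c) ring_scheme \<Rightarrow> ('k, 'u) qba \<Rightarrow> ('k, 'u) ca \<Rightarrow> ('k, 'u) univ" where
  "coreassociator_inv K H A =
     inv\<^bsub>tensor_algebra K A (tensor_algebra K H H)\<^esub> (coreassociator A)"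

locale right_comodule_algebra = assoc_unital_algebra K A
  for K :: "('k, 'c) ring_scheme" and H :: "('k, 'u) qba" and A :: "('k, 'u) ca" +
  fixes H2 H3 AH AH2 AH3 :: "('k, 'u) space" and \<Delta> \<rho> \<Phi> \<Phi>\<rho>
  defines "H2 \<equiv> tensor_algebra K H H"
    and "H3 \<equiv> tensor_algebra K H H2"
    and "AH \<equiv> tensor_algebra K A H"
    and "AH2 \<equiv> tensor_algebra K A H2"
    and "AH3 \<equiv> tensor_algebra K A H3"
    and "\<Delta> \<equiv> comult H"
    and "\<rho> \<equiv> coact A"
    and "\<Phi> \<equiv> reassociator H"
    and "\<Phi>\<rho> \<equiv> coreassociator A"
  assumes coact_hom: "\<rho> \<in> algebra_hom K A AH"
    and coreassociator_unit: "\<Phi>\<rho> \<in> Units AH2"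
    and quasi_coaction: "a \<in> carrier A \<Longrightarrow>
      \<Phi>\<rho> \<otimes>\<^bsub>AH2\<^esub> rebracket K A H H (tmap K AH H \<rho> id (\<rho> a))
        = tmap K A H2 id \<Delta> (\<rho> a) \<otimes>\<^bsub>AH2\<^esub> \<Phi>\<rho>"
    and cocycle:
      "pure K A H3 \<one>\<^bsub>A\<^esub> \<Phi>
         \<otimes>\<^bsub>AH3\<^esub> tmap K A H3 id (\<lambda>s. rebracket K H H H (tmap K H2 H \<Delta> id s)) \<Phi>\<rho>
         \<otimes>\<^bsub>AH3\<^esub> tmap K A H3 id (rebracket K H H H) (rebracket K A H2 H (pure K AH2 H \<Phi>\<rho> \<one>\<^bsub>H\<^esub>))
       = tmap K A H3 id (tmap K H H2 id \<Delta>) \<Phi>\<rho>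
         \<otimes>\<^bsub>AH3\<^esub> rebracket K A H H2 (tmap K AH H2 \<rho> id \<Phi>\<rho>)"
    and counit_coact: "a \<in> carrier A \<Longrightarrow> id_counit A H (\<rho> a) = a"
    and counit_middle: "tmap K A H id (counit_id H H) \<Phi>\<rho> = pure K A H \<one>\<^bsub>A\<^esub> \<one>\<^bsub>H\<^esub>"
    and counit_last: "tmap K A H id (id_counit H H) \<Phi>\<rho> = pure K A H \<one>\<^bsub>A\<^esub> \<one>\<^bsub>H\<^esub>"


section \<open>The monoidal categories of left modules and of bimodules\<close>

record ('k, 'v) hmod = "('k, 'v) module" +
  lact :: "'v \<Rightarrow> 'v \<Rightarrow> 'v"

record ('k, 'v) hbimod = "('k, 'v) hmod" +
  ract :: "'v \<Rightarrow> 'v \<Rightarrow> 'v"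

type_synonym ('k, 'u) left_mod = "('k, ('k, 'u) univ) hmod"
type_synonym ('k, 'u) bimod = "('k, ('k, 'u) univ) hbimod"

locale left_hmodule = module K M
  for K :: "('k, 'c) ring_scheme" and H :: "('k, 'v, 'x) module_scheme"
    and M :: "('k, 'v, 'y) hmod_scheme" +
  assumes lact_closed: "\<lbrakk>h \<in> carrier H; u \<in> carrier M\<rbrakk> \<Longrightarrow> lact M h u \<in> carrier M"
    and lact_add_left: "\<lbrakk>h \<in> carrier H; h' \<in> carrier H; u \<in> carrier M\<rbrakk> \<Longrightarrow>
      lact M (h \<oplus>\<^bsub>H\<^esub> h') u = lact M h u \<oplus>\<^bsub>M\<^esub> lact M h' u"
    and lact_add_right: "\<lbrakk>h \<in> carrier H; u \<in> carrier M; v \<in> carrier M\<rbrakk> \<Longrightarrow>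
      lact M h (u \<oplus>\<^bsub>M\<^esub> v) = lact M h u \<oplus>\<^bsub>M\<^esub> lact M h v"
    and lact_smult_left: "\<lbrakk>c \<in> carrier K; h \<in> carrier H; u \<in> carrier M\<rbrakk> \<Longrightarrow>
      lact M (c \<odot>\<^bsub>H\<^esub> h) u = c \<odot>\<^bsub>M\<^esub> lact M h u"
    and lact_smult_right: "\<lbrakk>c \<in> carrier K; h \<in> carrier H; u \<in> carrier M\<rbrakk> \<Longrightarrow>
      lact M h (c \<odot>\<^bsub>M\<^esub> u) = c \<odot>\<^bsub>M\<^esub> lact M h u"
    and lact_mult: "\<lbrakk>h \<in> carrier H; h' \<in> carrier H; u \<in> carrier M\<rbrakk> \<Longrightarrow>
      lact M (h \<otimes>\<^bsub>H\<^esub> h') u = lact M h (lact M h' u)"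
    and lact_one: "u \<in> carrier M \<Longrightarrow> lact M \<one>\<^bsub>H\<^esub> u = u"

locale hbimodule = left_hmodule K H M
  for K :: "('k, 'c) ring_scheme" and H :: "('k, 'v, 'x) module_scheme"
    and M :: "('k, 'v, 'y) hbimod_scheme" +
  assumes ract_closed: "\<lbrakk>u \<in> carrier M; h \<in> carrier H\<rbrakk> \<Longrightarrow> ract M u h \<in> carrier M"
    and ract_add_left: "\<lbrakk>u \<in> carrier M; v \<in> carrier M; h \<in> carrier H\<rbrakk> \<Longrightarrow>
      ract M (u \<oplus>\<^bsub>M\<^esub> v) h = ract M u h \<oplus>\<^bsub>M\<^esub> ract M v h"
    and ract_add_right: "\<lbrakk>u \<in> carrier M; h \<in> carrier H; h' \<in> carrier H\<rbrakk> \<Longrightarrow>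
      ract M u (h \<oplus>\<^bsub>H\<^esub> h') = ract M u h \<oplus>\<^bsub>M\<^esub> ract M u h'"
    and ract_smult_left: "\<lbrakk>c \<in> carrier K; u \<in> carrier M; h \<in> carrier H\<rbrakk> \<Longrightarrow>
      ract M (c \<odot>\<^bsub>M\<^esub> u) h = c \<odot>\<^bsub>M\<^esub> ract M u h"
    and ract_smult_right: "\<lbrakk>c \<in> carrier K; u \<in> carrier M; h \<in> carrier H\<rbrakk> \<Longrightarrow>
      ract M u (c \<odot>\<^bsub>H\<^esub> h) = c \<odot>\<^bsub>M\<^esub> ract M u h"
    and ract_mult: "\<lbrakk>u \<in> carrier M; h \<in> carrier H; h' \<in> carrier H\<rbrakk> \<Longrightarrow>
      ract M u (h \<otimes>\<^bsub>H\<^esub> h') = ract M (ract M u h) h'"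
    and ract_one: "u \<in> carrier M \<Longrightarrow> ract M u \<one>\<^bsub>H\<^esub> = u"
    and lact_ract: "\<lbrakk>h \<in> carrier H; u \<in> carrier M; h' \<in> carrier H\<rbrakk> \<Longrightarrow>
      ract M (lact M h u) h' = lact M h (ract M u h')"

definition with_lact ::
  "('k, 'v, 'x) module_scheme \<Rightarrow> ('v \<Rightarrow> 'v \<Rightarrow> 'v) \<Rightarrow> ('k, 'v) hmod" where
  "with_lact V l = \<lparr>carrier = carrier V, mult = mult V, one = one V, zero = zero V, add = add V,
     smult = smult V, lact = l\<rparr>"

definition with_acts ::
  "('k, 'v, 'x) module_scheme \<Rightarrow> ('v \<Rightarrow> 'v \<Rightarrow> 'v) \<Rightarrow> ('v \<Rightarrow> 'v \<Rightarrow> 'v) \<Rightarrow> ('k, 'v) hbimod" where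
  "with_acts V l r = \<lparr>carrier = carrier V, mult = mult V, one = one V, zero = zero V, add = add V,
     smult = smult V, lact = l, ract = r\<rparr>"

definition scalars :: "('k, 'c) ring_scheme \<Rightarrow> ('k, 'u) space" where
  "scalars K = \<lparr>carrier = Scal ` carrier K,
     mult = (\<lambda>x y. Scal (scalar_of x \<otimes>\<^bsub>K\<^esub> scalar_of y)), one = Scal \<one>\<^bsub>K\<^esub>,
     zero = Scal \<zero>\<^bsub>K\<^esub>,
     add = (\<lambda>x y. Scal (scalar_of x \<oplus>\<^bsub>K\<^esub> scalar_of y)),
     smult = (\<lambda>c x. Scal (c \<otimes>\<^bsub>K\<^esub> scalar_of x))\<rparr>"

text \<open>Actions on tensor products and all arrows are restricted to their carriers, so
  that modules and arrows agreeing there are equal.\<close>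

definition diag_lact ::
  "('k, 'c) ring_scheme \<Rightarrow> ('k, 'u) qba \<Rightarrow> ('k, ('k, 'u) univ, 'x) hmod_scheme
    \<Rightarrow> ('k, ('k, 'u) univ, 'y) hmod_scheme \<Rightarrow> ('k, 'u) univ \<Rightarrow> ('k, 'u) univ \<Rightarrow> ('k, 'u) univ" where
  "diag_lact K H M N =
    (\<lambda>h\<in>carrier H. \<lambda>t\<in>carrier (tensor_space K M N).
      tlift (tensor_space K M N) (\<lambda>h1 h2. tmap K M N (lact M h1) (lact N h2) t) (comult H h))"

definition diag_ract ::
  "('k, 'c) ring_scheme \<Rightarrow> ('k, 'u) qba \<Rightarrow> ('k, ('k, 'u) univ, 'x) hbimod_scheme
    \<Rightarrow> ('k, ('k, 'u) univ, 'y) hbimod_scheme \<Rightarrow> ('k, 'u) univ \<Rightarrow> ('k, 'u) univ \<Rightarrow> ('k, 'u) univ" where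
  "diag_ract K H M N =
    (\<lambda>t\<in>carrier (tensor_space K M N). \<lambda>h\<in>carrier H.
      tlift (tensor_space K M N)
        (\<lambda>h1 h2. tmap K M N (\<lambda>u. ract M u h1) (\<lambda>v. ract N v h2) t) (comult H h))"

definition tensor_left ::
  "('k, 'c) ring_scheme \<Rightarrow> ('k, 'u) qba \<Rightarrow> ('k, 'u) left_mod \<Rightarrow> ('k, 'u) left_mod \<Rightarrow> ('k, 'u) left_mod" where
  "tensor_left K H M N = with_lact (tensor_space K M N) (diag_lact K H M N)"

definition tensor_bi ::
  "('k, 'c) ring_scheme \<Rightarrow> ('k, 'u) qba \<Rightarrow> ('k, 'u) bimod \<Rightarrow> ('k, 'u) bimod \<Rightarrow> ('k, 'u) bimod" where
  "tensor_bi K H M N = with_acts (tensor_space K M N) (diag_lact K H M N) (diag_ract K H M N)"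

definition unit_left_mod :: "('k, 'c) ring_scheme \<Rightarrow> ('k, 'u) qba \<Rightarrow> ('k, 'u) left_mod" where
  "unit_left_mod K H = with_lact (scalars K) (\<lambda>h x. counit H h \<odot>\<^bsub>scalars K\<^esub> x)"

definition unit_bimod :: "('k, 'c) ring_scheme \<Rightarrow> ('k, 'u) qba \<Rightarrow> ('k, 'u) bimod" where
  "unit_bimod K H = with_acts (scalars K)
     (\<lambda>h x. counit H h \<odot>\<^bsub>scalars K\<^esub> x) (\<lambda>x h. counit H h \<odot>\<^bsub>scalars K\<^esub> x)"

text \<open>Multiplication by \<open>\<Phi>\<close> on the left and by \<open>\<Phi>\<inverse>\<close> on the right, in \<open>U \<otimes> (V \<otimes> W)\<close>.\<close>

definition lact3 ::
  "('k, 'c) ring_scheme \<Rightarrow> ('k, ('k, 'u) univ, 'x) hmod_scheme \<Rightarrow> ('k, ('k, 'u) univ, 'y) hmod_scheme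
    \<Rightarrow> ('k, ('k, 'u) univ, 'z) hmod_scheme \<Rightarrow> ('k, 'u) univ \<Rightarrow> ('k, 'u) univ \<Rightarrow> ('k, 'u) univ" where
  "lact3 K U V W p t = tlift3 (tensor_space K U (tensor_space K V W))
     (\<lambda>p1 p2 p3. tmap K U (tensor_space K V W) (lact U p1) (tmap K V W (lact V p2) (lact W p3)) t) p"

definition ract3 ::
  "('k, 'c) ring_scheme \<Rightarrow> ('k, ('k, 'u) univ, 'x) hbimod_scheme \<Rightarrow> ('k, ('k, 'u) univ, 'y) hbimod_scheme
    \<Rightarrow> ('k, ('k, 'u) univ, 'z) hbimod_scheme \<Rightarrow> ('k, 'u) univ \<Rightarrow> ('k, 'u) univ \<Rightarrow> ('k, 'u) univ" where
  "ract3 K U V W t q = tlift3 (tensor_space K U (tensor_space K V W))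
     (\<lambda>q1 q2 q3. tmap K U (tensor_space K V W) (\<lambda>u. ract U u q1)
        (tmap K V W (\<lambda>v. ract V v q2) (\<lambda>w. ract W w q3)) t) q"

datatype ('o, 'v) arrow = Arrow (source: 'o) (fn: "'v \<Rightarrow> 'v") (target: 'o)

definition linear_maps ::
  "('k, 'c) ring_scheme \<Rightarrow> ('k, 'v, 'x) module_scheme \<Rightarrow> ('k, 'v, 'y) module_scheme \<Rightarrow> ('v \<Rightarrow> 'v) set" where
  "linear_maps K V W = {f \<in> carrier V \<rightarrow>\<^sub>E carrier W.
     (\<forall>x\<in>carrier V. \<forall>y\<in>carrier V. f (x \<oplus>\<^bsub>V\<^esub> y) = f x \<oplus>\<^bsub>W\<^esub> f y) \<and>
     (\<forall>c\<in>carrier K. \<forall>x\<in>carrier V. f (c \<odot>\<^bsub>V\<^esub> x) = c \<odot>\<^bsub>W\<^esub> f x)}"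

text \<open>The data common to the two categories: objects \<open>Ob\<close>, linear maps subject to the equivariance
  condition \<open>eqv\<close>, tensor product \<open>T\<close> of objects, unit object \<open>I\<close> and associativity constraint \<open>\<alpha>\<close>.\<close>

definition module_monoidal ::
  "('k, 'c) ring_scheme \<Rightarrow> ('k, ('k, 'u) univ, 'x) module_scheme set
    \<Rightarrow> (('k, ('k, 'u) univ, 'x) module_scheme \<Rightarrow> ('k, ('k, 'u) univ, 'x) module_scheme
         \<Rightarrow> (('k, 'u) univ \<Rightarrow> ('k, 'u) univ) \<Rightarrow> bool)
    \<Rightarrow> (('k, ('k, 'u) univ, 'x) module_scheme \<Rightarrow> ('k, ('k, 'u) univ, 'x) module_scheme
         \<Rightarrow> ('k, ('k, 'u) univ, 'x) module_scheme)
    \<Rightarrow> ('k, ('k, 'u) univ, 'x) module_scheme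
    \<Rightarrow> (('k, ('k, 'u) univ, 'x) module_scheme \<Rightarrow> ('k, ('k, 'u) univ, 'x) module_scheme
         \<Rightarrow> ('k, ('k, 'u) univ, 'x) module_scheme \<Rightarrow> ('k, 'u) univ \<Rightarrow> ('k, 'u) univ)
    \<Rightarrow> (('k, ('k, 'u) univ, 'x) module_scheme,
        (('k, ('k, 'u) univ, 'x) module_scheme, ('k, 'u) univ) arrow) monoidal" where
  "module_monoidal K Ob eqv T I \<alpha> =
    \<lparr>Obj = Ob,
     Arr = {f. source f \<in> Ob \<and> target f \<in> Ob \<and>
       fn f \<in> linear_maps K (source f) (target f) \<and> eqv (source f) (target f) (fn f)},
     Dom = source,
     Cod = target,
     Ident = (\<lambda>M. Arrow M (\<lambda>x\<in>carrier M. x) M),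
     Comp = (\<lambda>g f. Arrow (source f) (compose (carrier (source f)) (fn g) (fn f)) (target g)),
     TensObj = T,
     TensArr = (\<lambda>f g. Arrow (T (source f) (source g))
       (\<lambda>t\<in>carrier (T (source f) (source g)). tmap K (target f) (target g) (fn f) (fn g) t)
       (T (target f) (target g))),
     Unit = I,
     Assoc = (\<lambda>U V W. Arrow (T (T U V) W) (\<lambda>t\<in>carrier (T (T U V) W). \<alpha> U V W t) (T U (T V W))),
     LUnit = (\<lambda>U. Arrow (T I U)
       (\<lambda>t\<in>carrier (T I U). tlift U (\<lambda>x u. scalar_of x \<odot>\<^bsub>U\<^esub> u) t) U),
     RUnit = (\<lambda>U. Arrow (T U I)
       (\<lambda>t\<in>carrier (T U I). tlift U (\<lambda>u x. scalar_of x \<odot>\<^bsub>U\<^esub> u) t) U)\<rparr>"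

definition left_mod_cat ::
  "('k, 'c) ring_scheme \<Rightarrow> ('k, 'u) qba
    \<Rightarrow> (('k, 'u) left_mod, (('k, 'u) left_mod, ('k, 'u) univ) arrow) monoidal" where
  "left_mod_cat K H =
    module_monoidal K {M. left_hmodule K H M}
      (\<lambda>M N f. \<forall>h\<in>carrier H. \<forall>u\<in>carrier M. f (lact M h u) = lact N h (f u))
      (tensor_left K H) (unit_left_mod K H)
      (\<lambda>U V W t. lact3 K U V W (reassociator H) (rebracket K U V W t))"

definition bimod_cat ::
  "('k, 'c) ring_scheme \<Rightarrow> ('k, 'u) qba
    \<Rightarrow> (('k, 'u) bimod, (('k, 'u) bimod, ('k, 'u) univ) arrow) monoidal" where
  "bimod_cat K H =
    module_monoidal K {M. hbimodule K H M}
      (\<lambda>M N f. \<forall>h\<in>carrier H. \<forall>u\<in>carrier M.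
         f (lact M h u) = lact N h (f u) \<and> f (ract M u h) = ract N (f u) h)
      (tensor_bi K H) (unit_bimod K H)
      (\<lambda>U V W t. ract3 K U V W (lact3 K U V W (reassociator H) (rebracket K U V W t))
         (inv\<^bsub>tensor_algebra K H (tensor_algebra K H H)\<^esub> (reassociator H)))"

text \<open>An \<open>H\<close>-bimodule algebra is given by a bimodule and two arrows \<open>m\<close> and \<open>e\<close> of the category of
  bimodules; the product of two elements and the identity are recovered as follows.\<close>

abbreviation bimodule_algebra ::
  "('k, 'c) ring_scheme \<Rightarrow> ('k, 'u) qba \<Rightarrow> ('k, 'u) bimod
    \<Rightarrow> (('k, 'u) bimod, ('k, 'u) univ) arrow \<Rightarrow> (('k, 'u) bimod, ('k, 'u) univ) arrow \<Rightarrow> bool" where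
  "bimodule_algebra K H B m e \<equiv> algebra_object (bimod_cat K H) B m e"

definition bimod_mult ::
  "('k, 'c) ring_scheme \<Rightarrow> ('k, 'u) bimod \<Rightarrow> (('k, 'u) bimod, ('k, 'u) univ) arrow
    \<Rightarrow> ('k, 'u) univ \<Rightarrow> ('k, 'u) univ \<Rightarrow> ('k, 'u) univ" where
  "bimod_mult K B m x y = fn m (pure K B B x y)"

definition bimod_one ::
  "('k, 'c) ring_scheme \<Rightarrow> (('k, 'u) bimod, ('k, 'u) univ) arrow \<Rightarrow> ('k, 'u) univ" where
  "bimod_one K e = fn e (Scal \<one>\<^bsub>K\<^esub>)"


section \<open>The structure morphisms and the generalized quasi-smash product\<close>

definition trivial_mod :: "('k, 'u) qba \<Rightarrow> ('k, ('k, 'u) univ, 'x) module_scheme \<Rightarrow> ('k, 'u) left_mod" where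
  "trivial_mod H A = with_lact A (\<lambda>h a. counit H h \<odot>\<^bsub>A\<^esub> a)"

abbreviation underlying_left :: "('k, 'u) bimod \<Rightarrow> ('k, 'u) left_mod" where
  "underlying_left B \<equiv> hmod.truncate B"

definition trivial_mult ::
  "('k, 'c) ring_scheme \<Rightarrow> ('k, 'u) qba \<Rightarrow> ('k, ('k, 'u) univ, 'x) module_scheme
    \<Rightarrow> (('k, 'u) left_mod, ('k, 'u) univ) arrow" where
  "trivial_mult K H A =
    (let AA = tensor_left K H (trivial_mod H A) (trivial_mod H A)
     in Arrow AA (\<lambda>t\<in>carrier AA. tlift A (mult A) t) (trivial_mod H A))"

definition trivial_unit ::
  "('k, 'c) ring_scheme \<Rightarrow> ('k, 'u) qba \<Rightarrow> ('k, ('k, 'u) univ, 'x) module_scheme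
    \<Rightarrow> (('k, 'u) left_mod, ('k, 'u) univ) arrow" where
  "trivial_unit K H A =
    Arrow (unit_left_mod K H) (\<lambda>x\<in>Scal ` carrier K. scalar_of x \<odot>\<^bsub>A\<^esub> \<one>\<^bsub>A\<^esub>) (trivial_mod H A)"

definition psi ::
  "('k, 'c) ring_scheme \<Rightarrow> ('k, 'u) qba \<Rightarrow> ('k, 'u) ca \<Rightarrow> ('k, 'u) bimod
    \<Rightarrow> (('k, 'u) left_mod, ('k, 'u) univ) arrow" where
  "psi K H A B =
    (let S = tensor_left K H (underlying_left B) (trivial_mod H A);
         T = tensor_left K H (trivial_mod H A) (underlying_left B)
     in Arrow S
       (\<lambda>t\<in>carrier S. tlift T (\<lambda>x a. tlift T (\<lambda>a0 a1. pure K A B a0 (ract B x a1)) (coact A a)) t)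
       T)"

definition zeta ::
  "('k, 'c) ring_scheme \<Rightarrow> ('k, 'u) qba \<Rightarrow> ('k, 'u) ca \<Rightarrow> ('k, 'u) bimod
    \<Rightarrow> (('k, 'u) bimod, ('k, 'u) univ) arrow \<Rightarrow> (('k, 'u) left_mod, ('k, 'u) univ) arrow" where
  "zeta K H A B m =
    (let S = tensor_left K H (underlying_left B) (underlying_left B);
         T = tensor_left K H (trivial_mod H A) (underlying_left B)
     in Arrow S
       (\<lambda>t\<in>carrier S. tlift T (\<lambda>x y. tlift3 T
          (\<lambda>q1 q2 q3. pure K A B q1 (bimod_mult K B m (ract B x q2) (ract B y q3)))
          (coreassociator_inv K H A)) t)
       T)"

definition sigma ::
  "('k, 'c) ring_scheme \<Rightarrow> ('k, 'u) qba \<Rightarrow> ('k, 'u) ca \<Rightarrow> ('k, 'u) bimod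
    \<Rightarrow> (('k, 'u) bimod, ('k, 'u) univ) arrow \<Rightarrow> (('k, 'u) left_mod, ('k, 'u) univ) arrow" where
  "sigma K H A B e =
    (let T = tensor_left K H (trivial_mod H A) (underlying_left B)
     in Arrow (unit_left_mod K H)
       (\<lambda>x\<in>Scal ` carrier K. scalar_of x \<odot>\<^bsub>T\<^esub> pure K A B \<one>\<^bsub>A\<^esub> (bimod_one K e)) T)"

text \<open>The action on the second factor only is what distinguishes the definition of the module
  \<open>quasi_smash_mod\<close> from that of the tensor product of \<open>A\<close> and \<open>B\<close> in the category of
  left modules.\<close>

definition quasi_smash_mod ::
  "('k, 'c) ring_scheme \<Rightarrow> ('k, 'u) qba \<Rightarrow> ('k, 'u) ca \<Rightarrow> ('k, 'u) bimod \<Rightarrow> ('k, 'u) left_mod" where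
  "quasi_smash_mod K H A B = with_lact (tensor_space K A B)
     (\<lambda>h\<in>carrier H. \<lambda>t\<in>carrier (tensor_space K A B). tmap K A B id (lact B h) t)"

definition quasi_smash_mult ::
  "('k, 'c) ring_scheme \<Rightarrow> ('k, 'u) qba \<Rightarrow> ('k, 'u) ca \<Rightarrow> ('k, 'u) bimod
    \<Rightarrow> (('k, 'u) bimod, ('k, 'u) univ) arrow \<Rightarrow> ('k, 'u) univ \<Rightarrow> ('k, 'u) univ \<Rightarrow> ('k, 'u) univ" where
  "quasi_smash_mult K H A B m s s' =
    (let T = tensor_space K A B in
     tlift T (\<lambda>a x. tlift T (\<lambda>a' x'. tlift T (\<lambda>a0 a1. tlift3 T
       (\<lambda>q1 q2 q3. pure K A B (a \<otimes>\<^bsub>A\<^esub> a0 \<otimes>\<^bsub>A\<^esub> q1)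
          (bimod_mult K B m (ract B x (a1 \<otimes>\<^bsub>H\<^esub> q2)) (ract B x' q3)))
       (coreassociator_inv K H A)) (coact A a')) s') s)"

definition quasi_smash_product ::
  "('k, 'c) ring_scheme \<Rightarrow> ('k, 'u) qba \<Rightarrow> ('k, 'u) ca \<Rightarrow> ('k, 'u) bimod
    \<Rightarrow> (('k, 'u) bimod, ('k, 'u) univ) arrow \<Rightarrow> (('k, 'u) bimod, ('k, 'u) univ) arrow
    \<Rightarrow> ('k, 'u) left_mod \<times> (('k, 'u) left_mod, ('k, 'u) univ) arrow
        \<times> (('k, 'u) left_mod, ('k, 'u) univ) arrow" where
  "quasi_smash_product K H A B m e =
    (let Q = quasi_smash_mod K H A B; QQ = tensor_left K H Q Q
     in (Q,
         Arrow QQ (\<lambda>t\<in>carrier QQ. tlift Q (quasi_smash_mult K H A B m) t) Q,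
         Arrow (unit_left_mod K H)
           (\<lambda>x\<in>Scal ` carrier K. scalar_of x \<odot>\<^bsub>Q\<^esub> pure K A B \<one>\<^bsub>A\<^esub> (bimod_one K e)) Q))"

end

theory Submission
  imports Defs
begin

text \<open>A linear map out of a tensor product is determined by its values on pure tensors, and
  these may be prescribed bilinearly. Hence arrows between iterated tensor products of
  modules are equal once they agree on pure tensors, and every identity is checked there.

  In the category of left modules, the associativity constraint rebrackets and then lets \<open>\<Phi>\<close>
  act on \<open>U \<otimes> (V \<otimes> W)\<close>. The actions that occur are actions of tensor powers of the algebra
  \<open>H\<close>, pulled back along maps built from the comultiplication (\<open>lact_base_change\<close>), and
  rebracketing intertwines them (\<open>semilinear_rebracket\<close>). Quasi-coassociativity therefore
  says that the constraint is a module map, the two sides of the pentagon are rebracketing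
  followed by the two sides of the cocycle identity acting on \<open>U \<otimes> (V \<otimes> (W \<otimes> Z))\<close>, and the
  triangle comes from the counit in the middle factor of \<open>\<Phi>\<close>.

  For the wreath, the point is that \<open>H\<close> acts on \<open>A\<close> through the counit. A constraint with a
  factor \<open>A\<close> sees \<open>\<Phi>\<close> only after the counit has been applied to the corresponding factor of
  \<open>\<Phi>\<close>, and all three such contractions are trivial: the middle one by assumption, the outer
  two because the counit may be applied to one factor of the cocycle identity
  (\<open>counit_left_\<Phi>\<close>, \<open>counit_right_\<Phi>\<close>). So every constraint involving \<open>A\<close> is plain
  rebracketing (\<open>assoc_triv\<close>), and \<open>\<Phi>\<close> is visible only on \<open>X \<otimes> X \<otimes> X\<close>.

  Evaluated on pure tensors, both sides of a wreath axiom arise from an element of \<open>A \<otimes> H\<close>,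
  \<open>A \<otimes> H \<otimes> H\<close> or \<open>A \<otimes> H \<otimes> H \<otimes> H\<close> by letting the factors in \<open>H\<close> act from the right on
  elements of the bimodule algebra and multiplying the results there. The axioms thereby
  become identities between such elements, namely the axioms of the comodule algebra
  rewritten for the inverse of its reassociator: the compatibility of \<open>\<psi>\<close> with the
  multiplication of \<open>A\<close> is multiplicativity of the coaction, the compatibility of \<open>\<zeta>\<close> with
  \<open>\<psi>\<close> is quasi-coassociativity of the coaction (\<open>inverse_coaction\<close>), the associativity of
  \<open>\<zeta>\<close> is the cocycle identity (\<open>inverse_cocycle\<close>), and the unit axioms are the unit and
  counit identities of the coaction and of the reassociator (\<open>inverse_counit\<close>). In the
  associativity of \<open>\<zeta>\<close>, the inverse of \<open>\<Phi>\<close> in the cocycle identity is the one by which the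
  bimodule algebra fails to be associative on the right, while its \<open>\<Phi>\<close> on the left is the
  constraint of \<open>X \<otimes> X \<otimes> X\<close>.

  All constraints in the wreath product involve \<open>A\<close>, so its multiplication on pure tensors
  is literally that of the generalized quasi-smash product.\<close>

section \<open>Linear and bilinear maps\<close>

definition lin ::
  "('k, 'c) ring_scheme \<Rightarrow> ('k, 'v, 'x) module_scheme \<Rightarrow> ('k, 'w, 'y) module_scheme \<Rightarrow> ('v \<Rightarrow> 'w) \<Rightarrow>
    bool" where
  "lin K V W f \<longleftrightarrow> (\<forall>x\<in>carrier V. f x \<in> carrier W) \<and>
     (\<forall>x\<in>carrier V. \<forall>y\<in>carrier V. f (x \<oplus>\<^bsub>V\<^esub> y) = f x \<oplus>\<^bsub>W\<^esub> f y) \<and>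
     (\<forall>c\<in>carrier K. \<forall>x\<in>carrier V. f (c \<odot>\<^bsub>V\<^esub> x) = c \<odot>\<^bsub>W\<^esub> f x)"

definition bilin ::
  "('k, 'c) ring_scheme \<Rightarrow> ('k, 'v, 'x) module_scheme \<Rightarrow> ('k, 'w, 'y) module_scheme
    \<Rightarrow> ('k, 'z, 'q) module_scheme \<Rightarrow> ('v \<Rightarrow> 'w \<Rightarrow> 'z) \<Rightarrow> bool" where
  "bilin K V W Z \<beta> \<longleftrightarrow> (\<forall>v\<in>carrier V. lin K W Z (\<beta> v)) \<and> (\<forall>w\<in>carrier W. lin K V Z (\<lambda>v. \<beta> v w))"

lemma linI:
  assumes "\<And>x. x \<in> carrier V \<Longrightarrow> f x \<in> carrier W"
    and "\<And>x y. x \<in> carrier V \<Longrightarrow> y \<in> carrier V \<Longrightarrow> f (x \<oplus>\<^bsub>V\<^esub> y) = f x \<oplus>\<^bsub>W\<^esub> f y"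
    and "\<And>c x. c \<in> carrier K \<Longrightarrow> x \<in> carrier V \<Longrightarrow> f (c \<odot>\<^bsub>V\<^esub> x) = c \<odot>\<^bsub>W\<^esub> f x"
  shows "lin K V W f"
  using assms by (simp add: lin_def)

lemma lin_closed: "lin K V W f \<Longrightarrow> x \<in> carrier V \<Longrightarrow> f x \<in> carrier W"
  and lin_add: "lin K V W f \<Longrightarrow> x \<in> carrier V \<Longrightarrow> y \<in> carrier V \<Longrightarrow> f (x \<oplus>\<^bsub>V\<^esub> y) = f x \<oplus>\<^bsub>W\<^esub> f y"
  and lin_smult: "lin K V W f \<Longrightarrow> c \<in> carrier K \<Longrightarrow> x \<in> carrier V \<Longrightarrow> f (c \<odot>\<^bsub>V\<^esub> x) = c \<odot>\<^bsub>W\<^esub> f x"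
  by (simp_all add: lin_def)

lemma lin_zero:
  assumes "module K V" "module K W" "lin K V W f" shows "f \<zero>\<^bsub>V\<^esub> = \<zero>\<^bsub>W\<^esub>"
proof -
  interpret V: module K V by fact
  interpret W: module K W by fact
  have "f (\<zero>\<^bsub>K\<^esub> \<odot>\<^bsub>V\<^esub> \<zero>\<^bsub>V\<^esub>) = \<zero>\<^bsub>K\<^esub> \<odot>\<^bsub>W\<^esub> f \<zero>\<^bsub>V\<^esub>"
    using assms(3) by (simp add: lin_smult del: V.smult_l_null V.smult_r_null)
  then show ?thesis using assms(3) by (simp add: lin_closed)
qed

lemma bilinI:
  assumes "\<And>v. v \<in> carrier V \<Longrightarrow> lin K W Z (\<lambda>w. \<beta> v w)"
    and "\<And>w. w \<in> carrier W \<Longrightarrow> lin K V Z (\<lambda>v. \<beta> v w)"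
  shows "bilin K V W Z \<beta>"
  using assms by (simp add: bilin_def)

lemma bilin_closed: "bilin K V W Z \<beta> \<Longrightarrow> v \<in> carrier V \<Longrightarrow> w \<in> carrier W \<Longrightarrow> \<beta> v w \<in> carrier Z"
  unfolding bilin_def lin_def by blast

lemma lin_compose: "lin K W Z g \<Longrightarrow> lin K V W f \<Longrightarrow> lin K V Z (\<lambda>v. g (f v))"
  by (simp add: lin_def)

lemma lin_ident: "lin K V V (\<lambda>v. v)"
  by (simp add: lin_def)

lemma lin_cong: "(\<And>x. x \<in> carrier V \<Longrightarrow> f x = g x) \<Longrightarrow> module K V \<Longrightarrow> lin K V W g \<Longrightarrow> lin K V W f"
proof -
  assume eq: "\<And>x. x \<in> carrier V \<Longrightarrow> f x = g x" and V: "module K V" and g: "lin K V W g"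
  interpret V: module K V by fact
  show ?thesis using eq g by (simp add: lin_def)
qed

section \<open>The universal property of the tensor product\<close>

text \<open>The value of \<open>tlift Z \<beta>\<close> on a formal sum, with the list of summands as the argument, so
  that it can be studied by induction on the list and compared on different representatives
  of one tensor.\<close>

definition tsum ::
  "('k, 'z, 'q) module_scheme \<Rightarrow> ('v \<Rightarrow> 'w \<Rightarrow> 'z) \<Rightarrow> ('v \<times> 'w) list \<Rightarrow> 'z" where
  "tsum Z \<beta> xs = foldr (\<lambda>(v, w) z. \<beta> v w \<oplus>\<^bsub>Z\<^esub> z) xs \<zero>\<^bsub>Z\<^esub>"

lemma tsum_simps [simp]:
  "tsum Z \<beta> [] = \<zero>\<^bsub>Z\<^esub>" "tsum Z \<beta> (p # xs) = \<beta> (fst p) (snd p) \<oplus>\<^bsub>Z\<^esub> tsum Z \<beta> xs"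
  by (simp_all add: tsum_def case_prod_beta)

lemma tlift_tsum: "tlift Z \<beta> t = tsum Z \<beta> (summands t)"
  by (simp add: tlift_def tsum_def)

locale tensor_factors = V: module K V + W: module K W
  for K :: "('k, 'c) ring_scheme" and V :: "('k, ('k, 'u) univ, 'x) module_scheme"
    and W :: "('k, ('k, 'u) univ, 'y) module_scheme"
begin

abbreviation sums where "sums \<equiv> lists (carrier V \<times> carrier W)"
abbreviation fs where "fs \<equiv> formal_sum K V W"
abbreviation T where "T \<equiv> tensor_space K V W"
abbreviation cmap where "cmap c \<equiv> map (\<lambda>(v, w). (c \<odot>\<^bsub>V\<^esub> v, w))"

lemma cmap_sums: "c \<in> carrier K \<Longrightarrow> xs \<in> sums \<Longrightarrow> cmap c xs \<in> sums"
  by (induction xs) auto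

lemma tensor_eq_sums: "tensor_eq K V W xs ys \<Longrightarrow> xs \<in> sums \<and> ys \<in> sums"
  by (induction rule: tensor_eq.induct) auto

lemma tsum_closed:
  assumes "module K Z" "\<And>v w. v \<in> carrier V \<Longrightarrow> w \<in> carrier W \<Longrightarrow> \<beta> v w \<in> carrier Z" "xs \<in> sums"
  shows "tsum Z \<beta> xs \<in> carrier Z"
proof -
  interpret Z: module K Z by fact
  show ?thesis using assms(3,2) by (induction xs) auto
qed

lemma tsum_append:
  assumes "module K Z" "\<And>v w. v \<in> carrier V \<Longrightarrow> w \<in> carrier W \<Longrightarrow> \<beta> v w \<in> carrier Z" "xs \<in> sums"
    "ys \<in> sums"
  shows "tsum Z \<beta> (xs @ ys) = tsum Z \<beta> xs \<oplus>\<^bsub>Z\<^esub> tsum Z \<beta> ys"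
proof -
  interpret Z: module K Z by fact
  show ?thesis using assms(3)
  proof (induction xs)
    case Nil
    then show ?case using tsum_closed[OF assms(1,2,4)] by simp
  next
    case (Cons p xs)
    then have "\<beta> (fst p) (snd p) \<in> carrier Z" "tsum Z \<beta> xs \<in> carrier Z" "tsum Z \<beta> ys \<in> carrier Z"
      using tsum_closed[OF assms(1,2)] assms(2,4) by auto
    then show ?case using Cons.IH by (simp add: Z.a_assoc)
  qed
qed

lemma tsum_cmap:
  assumes "module K Z" "bilin K V W Z \<beta>" "xs \<in> sums" "c \<in> carrier K"
  shows "tsum Z \<beta> (cmap c xs) = c \<odot>\<^bsub>Z\<^esub> tsum Z \<beta> xs"
proof -
  interpret Z: module K Z by fact
  show ?thesis using assms(3)
  proof (induction xs)
    case Nil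
    then show ?case using assms(4) by simp
  next
    case (Cons p xs)
    obtain v w where p: "p = (v, w)" "v \<in> carrier V" "w \<in> carrier W" using Cons.hyps(1) by auto
    have cl: "tsum Z \<beta> xs \<in> carrier Z" "\<beta> v w \<in> carrier Z"
      using tsum_closed[OF assms(1) bilin_closed[OF assms(2)]] Cons p assms(2)
        by (auto simp: bilin_closed)
    have "\<beta> (c \<odot>\<^bsub>V\<^esub> v) w = c \<odot>\<^bsub>Z\<^esub> \<beta> v w"
      using assms(2,4) p lin_smult[of K V Z "\<lambda>v. \<beta> v w" c v] by (simp add: bilin_def)
    then show ?case using Cons.IH assms(4) cl p by (simp add: Z.smult_r_distr)
  qed
qed

text \<open>Bilinearity respects each generating relation of the congruence that defines the tensor
  product. This makes \<open>tlift\<close> independent of the chosen representatives.\<close>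

lemma tensor_eq_tsum:
  assumes "module K Z" "bilin K V W Z \<beta>" "tensor_eq K V W xs ys"
  shows "tsum Z \<beta> xs = tsum Z \<beta> ys"
proof -
  interpret Z: module K Z by fact
  have cl: "\<And>v w. v \<in> carrier V \<Longrightarrow> w \<in> carrier W \<Longrightarrow> \<beta> v w \<in> carrier Z"
    using assms(2) by (simp add: bilin_closed)
  have l1: "lin K W Z (\<beta> v)" if "v \<in> carrier V" for v using assms(2) that by (simp add: bilin_def)
  have l2: "lin K V Z (\<lambda>v. \<beta> v w)" if "w \<in> carrier W" for w using assms(2) that
    by (simp add: bilin_def)
  show ?thesis using assms(3)
  proof (induction rule: tensor_eq.induct)
    case (append xs xs' ys ys')
    then show ?case
      using tsum_append[OF assms(1) cl] tensor_eq_sums[OF append.hyps(1)] tensor_eq_sums[OF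
        append.hyps(2)] by simp
  next
    case (commute xs ys)
    then show ?case
      using tsum_append[OF assms(1) cl] tsum_closed[OF assms(1) cl] Z.a_comm by simp
  next
    case (add_left v v' w)
    then show ?case using lin_add[OF l2] cl by (simp add: Z.a_assoc)
  next
    case (add_right v w w')
    then show ?case using lin_add[OF l1] cl by (simp add: Z.a_assoc)
  next
    case (zero w)
    then show ?case using lin_zero[OF V.module_axioms assms(1) l2] by simp
  next
    case (scale c v w)
    then show ?case using lin_smult[OF l2] lin_smult[OF l1] by simp
  qed simp_all
qed

lemma tensor_eq_cmap:
  assumes "tensor_eq K V W xs ys" "c \<in> carrier K"
  shows "tensor_eq K V W (cmap c xs) (cmap c ys)"
  using assms(1)
proof (induction rule: tensor_eq.induct)
  case (refl xs)
  then show ?case using assms(2) by (intro tensor_eq.refl) (rule cmap_sums)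
next
  case (sym xs ys)
  from sym.IH show ?case by (rule tensor_eq.sym)
next
  case (trans xs ys zs)
  then show ?case by (blast intro: tensor_eq.trans)
next
  case (append xs xs' ys ys')
  then show ?case by (simp add: tensor_eq.append)
next
  case (commute xs ys)
  then show ?case using assms(2) by (simp add: tensor_eq.commute cmap_sums)
next
  case (add_left v v' w)
  then show ?case using assms(2) by (simp add: tensor_eq.add_left V.smult_r_distr)
next
  case (add_right v w w')
  then show ?case using assms(2) by (simp add: tensor_eq.add_right)
next
  case (zero w)
  then show ?case using assms(2) by (simp add: tensor_eq.zero)
next
  case (scale d v w)
  have "c \<odot>\<^bsub>V\<^esub> (d \<odot>\<^bsub>V\<^esub> v) = d \<odot>\<^bsub>V\<^esub> (c \<odot>\<^bsub>V\<^esub> v)"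
    using scale assms(2) by (simp add: V.smult_assoc1[symmetric] V.R.m_comm)
  then show ?case using scale assms(2) by (simp add: tensor_eq.scale)
qed

lemma fs_eqI: "tensor_eq K V W xs ys \<Longrightarrow> fs xs = fs ys"
proof -
  assume h: "tensor_eq K V W xs ys"
  have "tensor_eq K V W xs zs = tensor_eq K V W ys zs" for zs
    using h by (blast intro: tensor_eq.sym tensor_eq.trans)
  then show ?thesis by (simp add: formal_sum_def)
qed

lemma summands_fs: "xs \<in> sums \<Longrightarrow> tensor_eq K V W xs (summands (fs xs))"
proof -
  assume "xs \<in> sums"
  then have "tensor_eq K V W xs xs" by (rule tensor_eq.refl)
  then show ?thesis by (simp add: formal_sum_def) (rule someI)
qed

lemma carrier_T: "t \<in> carrier T \<longleftrightarrow> (\<exists>xs\<in>sums. t = fs xs)"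
  by (auto simp: tensor_space_def)

lemma fs_closed: "xs \<in> sums \<Longrightarrow> fs xs \<in> carrier T"
  by (auto simp: tensor_space_def)

lemma summands_sums: "t \<in> carrier T \<Longrightarrow> summands t \<in> sums"
  using carrier_T summands_fs tensor_eq_sums by metis

lemma zero_T: "\<zero>\<^bsub>T\<^esub> = fs []"
  by (simp add: tensor_space_def)

lemma add_fs: "xs \<in> sums \<Longrightarrow> ys \<in> sums \<Longrightarrow> fs xs \<oplus>\<^bsub>T\<^esub> fs ys = fs (xs @ ys)"
  unfolding tensor_space_def
  by (simp, rule fs_eqI, intro tensor_eq.append tensor_eq.sym[OF summands_fs])

lemma smult_fs: "c \<in> carrier K \<Longrightarrow> xs \<in> sums \<Longrightarrow> c \<odot>\<^bsub>T\<^esub> fs xs = fs (cmap c xs)"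
  unfolding tensor_space_def
  by (simp, rule fs_eqI, intro tensor_eq_cmap tensor_eq.sym[OF summands_fs])

lemma abelian_monoid_T: "abelian_monoid T"
proof (rule abelian_monoidI)
  fix x y assume "x \<in> carrier T" "y \<in> carrier T"
  then obtain xs ys where xs: "xs \<in> sums" "x = fs xs" and ys: "ys \<in> sums" "y = fs ys"
    by (auto simp: carrier_T)
  then show "x \<oplus>\<^bsub>T\<^esub> y \<in> carrier T" by (simp add: add_fs fs_closed)
  show "x \<oplus>\<^bsub>T\<^esub> y = y \<oplus>\<^bsub>T\<^esub> x"
    using xs ys by (simp add: add_fs) (rule fs_eqI, rule tensor_eq.commute)
next
  fix x y z assume "x \<in> carrier T" "y \<in> carrier T" "z \<in> carrier T"
  then obtain xs ys zs where "xs \<in> sums" "x = fs xs" "ys \<in> sums" "y = fs ys" "zs \<in> sums" "z = fs zs"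
    by (auto simp: carrier_T)
  then show "(x \<oplus>\<^bsub>T\<^esub> y) \<oplus>\<^bsub>T\<^esub> z = x \<oplus>\<^bsub>T\<^esub> (y \<oplus>\<^bsub>T\<^esub> z)" by (simp add: add_fs)
next
  fix x assume "x \<in> carrier T"
  then obtain xs where "xs \<in> sums" "x = fs xs" by (auto simp: carrier_T)
  then show "\<zero>\<^bsub>T\<^esub> \<oplus>\<^bsub>T\<^esub> x = x" using add_fs[of "[]" xs] by (simp add: zero_T)
qed (simp add: zero_T fs_closed)

lemma fs_Cons: "p \<in> carrier V \<times> carrier W \<Longrightarrow> xs \<in> sums \<Longrightarrow> fs (p # xs) = fs [p] \<oplus>\<^bsub>T\<^esub> fs xs"
  using add_fs[of "[p]" xs] by simp

text \<open>Negatives exist because the scalar \<open>- 1\<close> can be applied to the left components and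
  \<open>(- v) \<otimes> w + v \<otimes> w = 0 \<otimes> w\<close> vanishes.\<close>

lemma neg_fs:
  assumes "xs \<in> sums"
  shows "fs (cmap (\<ominus>\<^bsub>K\<^esub> \<one>\<^bsub>K\<^esub>) xs) \<oplus>\<^bsub>T\<^esub> fs xs = \<zero>\<^bsub>T\<^esub>"
  using assms
proof (induction xs)
  case Nil
  then show ?case by (simp add: add_fs zero_T)
next
  case (Cons p xs)
  interpret T: abelian_monoid T by (rule abelian_monoid_T)
  obtain v w where p: "p = (v, w)" "v \<in> carrier V" "w \<in> carrier W" using Cons.hyps(1) by auto
  let ?n = "\<ominus>\<^bsub>K\<^esub> \<one>\<^bsub>K\<^esub>"
  have n: "?n \<in> carrier K" by simp
  have "fs [(?n \<odot>\<^bsub>V\<^esub> v, w)] \<oplus>\<^bsub>T\<^esub> fs [(v, w)] = fs [(?n \<odot>\<^bsub>V\<^esub> v, w), (v, w)]"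
    using p n by (simp add: add_fs)
  also have "\<dots> = fs [(?n \<odot>\<^bsub>V\<^esub> v \<oplus>\<^bsub>V\<^esub> v, w)]"
    using p n by (intro fs_eqI tensor_eq.sym[OF tensor_eq.add_left]) auto
  also have "?n \<odot>\<^bsub>V\<^esub> v \<oplus>\<^bsub>V\<^esub> v = \<zero>\<^bsub>V\<^esub>"
    using p by (simp add: V.smult_l_minus V.l_neg)
  also have "fs [(\<zero>\<^bsub>V\<^esub>, w)] = \<zero>\<^bsub>T\<^esub>"
    unfolding zero_T using p by (intro fs_eqI tensor_eq.zero) auto
  finally have 1: "fs [(?n \<odot>\<^bsub>V\<^esub> v, w)] \<oplus>\<^bsub>T\<^esub> fs [(v, w)] = \<zero>\<^bsub>T\<^esub>" .
  let ?a = "fs [(?n \<odot>\<^bsub>V\<^esub> v, w)]" and ?b = "fs [(v, w)]" and ?c = "fs (cmap ?n xs)" and ?d = "fs xs"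
  have cl: "?a \<in> carrier T" "?b \<in> carrier T" "?c \<in> carrier T" "?d \<in> carrier T"
    using p n Cons fs_closed[OF cmap_sums[OF n]] fs_closed[of xs] fs_closed[of "[p]"]
      fs_closed[of "[(?n \<odot>\<^bsub>V\<^esub> v, w)]"] by simp_all
  have "fs (cmap ?n (p # xs)) \<oplus>\<^bsub>T\<^esub> fs (p # xs) = (?a \<oplus>\<^bsub>T\<^esub> ?c) \<oplus>\<^bsub>T\<^esub> (?b \<oplus>\<^bsub>T\<^esub> ?d)"
    using p n Cons cmap_sums[OF n] fs_Cons[of "(?n \<odot>\<^bsub>V\<^esub> v, w)" "cmap ?n xs"] fs_Cons[of p xs]
      by simp
  also have "\<dots> = (?a \<oplus>\<^bsub>T\<^esub> ?b) \<oplus>\<^bsub>T\<^esub> (?c \<oplus>\<^bsub>T\<^esub> ?d)"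
    using cl by (simp add: T.a_ac)
  finally show ?case using 1 Cons.IH by simp
qed

lemma abelian_group_T: "abelian_group T"
proof -
  interpret T: abelian_monoid T by (rule abelian_monoid_T)
  show ?thesis
  proof (rule abelian_groupI)
    fix x assume "x \<in> carrier T"
    then obtain xs where xs: "xs \<in> sums" "x = fs xs" by (auto simp: carrier_T)
    have "\<ominus>\<^bsub>K\<^esub> \<one>\<^bsub>K\<^esub> \<in> carrier K" by simp
    from fs_closed[OF cmap_sums[OF this xs(1)]] show "\<exists>y\<in>carrier T. y \<oplus>\<^bsub>T\<^esub> x = \<zero>\<^bsub>T\<^esub>"
      using neg_fs[OF xs(1)] xs(2) by blast
  qed (auto simp: T.a_ac)
qed

lemma module_T: "module K T"
proof -
  interpret T: abelian_group T by (rule abelian_group_T)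
  show ?thesis
  proof (rule moduleI)
    show "cring K" by (rule V.R.is_cring)
    show "abelian_group T" by (rule abelian_group_T)
    fix c x assume c: "c \<in> carrier K" and "x \<in> carrier T"
    then obtain xs where xs: "xs \<in> sums" "x = fs xs" by (auto simp: carrier_T)
    show "c \<odot>\<^bsub>T\<^esub> x \<in> carrier T" using c xs by (simp add: smult_fs fs_closed cmap_sums)
    {
      fix y assume "y \<in> carrier T"
      then obtain ys where ys: "ys \<in> sums" "y = fs ys" by (auto simp: carrier_T)
      then show "c \<odot>\<^bsub>T\<^esub> (x \<oplus>\<^bsub>T\<^esub> y) = c \<odot>\<^bsub>T\<^esub> x \<oplus>\<^bsub>T\<^esub> c \<odot>\<^bsub>T\<^esub> y"
        using xs c by (simp add: add_fs smult_fs cmap_sums)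
    next
      fix d assume d: "d \<in> carrier K"
      have "cmap (c \<otimes>\<^bsub>K\<^esub> d) xs = cmap c (cmap d xs)"
        using xs(1) c d by (induction xs) (auto simp: V.smult_assoc1)
      then show "(c \<otimes>\<^bsub>K\<^esub> d) \<odot>\<^bsub>T\<^esub> x = c \<odot>\<^bsub>T\<^esub> (d \<odot>\<^bsub>T\<^esub> x)"
        using xs c d by (simp add: smult_fs cmap_sums del: map_map)
      have "fs (cmap (c \<oplus>\<^bsub>K\<^esub> d) xs) = fs (cmap c xs) \<oplus>\<^bsub>T\<^esub> fs (cmap d xs)"
        using xs(1)
      proof (induction xs)
        case Nil
        then show ?case by (simp add: add_fs)
      next
        case (Cons p xs)
        obtain v w where p: "p = (v, w)" "v \<in> carrier V" "w \<in> carrier W" using Cons.hyps(1) by auto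
        let ?a = "fs [(c \<odot>\<^bsub>V\<^esub> v, w)]" and ?b = "fs [(d \<odot>\<^bsub>V\<^esub> v, w)]"
        let ?c = "fs (cmap c xs)" and ?d = "fs (cmap d xs)"
        have cl: "?a \<in> carrier T" "?b \<in> carrier T" "?c \<in> carrier T" "?d \<in> carrier T"
          using p c d Cons by (simp_all add: fs_closed cmap_sums del: in_lists_conv_set)
        have "fs [((c \<oplus>\<^bsub>K\<^esub> d) \<odot>\<^bsub>V\<^esub> v, w)] = fs [(c \<odot>\<^bsub>V\<^esub> v, w), (d \<odot>\<^bsub>V\<^esub> v, w)]"
          using p c d by (auto simp: V.smult_l_distr intro!: fs_eqI tensor_eq.add_left)
        also have "\<dots> = ?a \<oplus>\<^bsub>T\<^esub> ?b" using p c d by (simp add: add_fs)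
        finally have e: "fs [((c \<oplus>\<^bsub>K\<^esub> d) \<odot>\<^bsub>V\<^esub> v, w)] = ?a \<oplus>\<^bsub>T\<^esub> ?b" .
        have "fs (cmap (c \<oplus>\<^bsub>K\<^esub> d) (p # xs)) = (?a \<oplus>\<^bsub>T\<^esub> ?b) \<oplus>\<^bsub>T\<^esub> (?c \<oplus>\<^bsub>T\<^esub> ?d)"
          using p c d Cons e fs_Cons[of "((c \<oplus>\<^bsub>K\<^esub> d) \<odot>\<^bsub>V\<^esub> v, w)" "cmap (c \<oplus>\<^bsub>K\<^esub> d) xs"]
            cmap_sums[of "c \<oplus>\<^bsub>K\<^esub> d" xs] by simp
        also have "\<dots> = (?a \<oplus>\<^bsub>T\<^esub> ?c) \<oplus>\<^bsub>T\<^esub> (?b \<oplus>\<^bsub>T\<^esub> ?d)" using cl by (simp add: T.a_ac)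
        also have "\<dots> = fs (cmap c (p # xs)) \<oplus>\<^bsub>T\<^esub> fs (cmap d (p # xs))"
          using p c d Cons fs_Cons[of "(c \<odot>\<^bsub>V\<^esub> v, w)" "cmap c xs"] fs_Cons[of "(d \<odot>\<^bsub>V\<^esub> v, w)"
            "cmap d xs"]
            cmap_sums[of c xs] cmap_sums[of d xs] by simp
        finally show ?case .
      qed
      then show "(c \<oplus>\<^bsub>K\<^esub> d) \<odot>\<^bsub>T\<^esub> x = c \<odot>\<^bsub>T\<^esub> x \<oplus>\<^bsub>T\<^esub> d \<odot>\<^bsub>T\<^esub> x"
        using xs c d by (simp add: smult_fs)
    }
  next
    fix x assume "x \<in> carrier T"
    then obtain xs where xs: "xs \<in> sums" "x = fs xs" by (auto simp: carrier_T)
    have "cmap \<one>\<^bsub>K\<^esub> xs = xs" using xs(1) by (induction xs) auto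
    then show "\<one>\<^bsub>K\<^esub> \<odot>\<^bsub>T\<^esub> x = x" using xs by (simp add: smult_fs)
  qed
qed

lemma pure_T: "v \<in> carrier V \<Longrightarrow> w \<in> carrier W \<Longrightarrow> pure K V W v w \<in> carrier T"
  by (simp add: pure_def fs_closed)

lemma bilin_pure: "bilin K V W T (pure K V W)"
proof (rule bilinI; rule linI)
  fix v x y assume h: "v \<in> carrier V" "x \<in> carrier W" "y \<in> carrier W"
  then have "fs [(v, x \<oplus>\<^bsub>W\<^esub> y)] = fs [(v, x), (v, y)]" by (intro fs_eqI tensor_eq.add_right)
  then show "pure K V W v (x \<oplus>\<^bsub>W\<^esub> y) = pure K V W v x \<oplus>\<^bsub>T\<^esub> pure K V W v y"
    using h by (simp add: pure_def add_fs)
next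
  fix v c x assume h: "v \<in> carrier V" "c \<in> carrier K" "x \<in> carrier W"
  then have "fs [(v, c \<odot>\<^bsub>W\<^esub> x)] = fs [(c \<odot>\<^bsub>V\<^esub> v, x)]"
    by (intro fs_eqI tensor_eq.sym[OF tensor_eq.scale])
  then show "pure K V W v (c \<odot>\<^bsub>W\<^esub> x) = c \<odot>\<^bsub>T\<^esub> pure K V W v x"
    using h by (simp add: pure_def smult_fs)
next
  fix w x y assume h: "w \<in> carrier W" "x \<in> carrier V" "y \<in> carrier V"
  then have "fs [(x \<oplus>\<^bsub>V\<^esub> y, w)] = fs [(x, w), (y, w)]" by (intro fs_eqI tensor_eq.add_left)
  then show "pure K V W (x \<oplus>\<^bsub>V\<^esub> y) w = pure K V W x w \<oplus>\<^bsub>T\<^esub> pure K V W y w"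
    using h by (simp add: pure_def add_fs)
next
  fix w c x assume h: "w \<in> carrier W" "c \<in> carrier K" "x \<in> carrier V"
  then show "pure K V W (c \<odot>\<^bsub>V\<^esub> x) w = c \<odot>\<^bsub>T\<^esub> pure K V W x w"
    by (simp add: pure_def smult_fs)
qed (simp_all add: pure_T)

lemma tlift_fs:
  assumes "module K Z" "bilin K V W Z \<beta>" "xs \<in> sums"
  shows "tlift Z \<beta> (fs xs) = tsum Z \<beta> xs"
  unfolding tlift_tsum using tensor_eq_tsum[OF assms(1,2) summands_fs[OF assms(3)]] by simp

lemma tlift_closed_T:
  assumes "module K Z" "\<And>v w. v \<in> carrier V \<Longrightarrow> w \<in> carrier W \<Longrightarrow> \<beta> v w \<in> carrier Z" "t \<in> carrier T"
  shows "tlift Z \<beta> t \<in> carrier Z"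
  unfolding tlift_tsum using tsum_closed[OF assms(1,2) summands_sums[OF assms(3)]] .

lemma lin_tlift:
  assumes "module K Z" "bilin K V W Z \<beta>"
  shows "lin K T Z (tlift Z \<beta>)"
proof (rule linI)
  have cl: "\<And>v w. v \<in> carrier V \<Longrightarrow> w \<in> carrier W \<Longrightarrow> \<beta> v w \<in> carrier Z"
    using assms(2) by (simp add: bilin_closed)
  fix x assume "x \<in> carrier T"
  then obtain xs where xs: "xs \<in> sums" "x = fs xs" by (auto simp: carrier_T)
  then show "tlift Z \<beta> x \<in> carrier Z"
    using tlift_closed_T[OF assms(1) cl] by (simp add: fs_closed)
  {
    fix y assume "y \<in> carrier T"
    then obtain ys where ys: "ys \<in> sums" "y = fs ys" by (auto simp: carrier_T)
    then show "tlift Z \<beta> (x \<oplus>\<^bsub>T\<^esub> y) = tlift Z \<beta> x \<oplus>\<^bsub>Z\<^esub> tlift Z \<beta> y"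
      using xs by (simp add: add_fs tlift_fs[OF assms] tsum_append[OF assms(1) cl])
  next
    fix c assume "c \<in> carrier K"
    then show "tlift Z \<beta> (c \<odot>\<^bsub>T\<^esub> x) = c \<odot>\<^bsub>Z\<^esub> tlift Z \<beta> x"
      using xs by (simp add: smult_fs tlift_fs[OF assms] tsum_cmap[OF assms] cmap_sums)
  }
qed

lemma tlift_pure_T:
  assumes "module K Z" "bilin K V W Z \<beta>" "v \<in> carrier V" "w \<in> carrier W"
  shows "tlift Z \<beta> (pure K V W v w) = \<beta> v w"
proof -
  interpret Z: module K Z by fact
  show ?thesis
    using assms tlift_fs[OF assms(1,2), of "[(v, w)]"] bilin_closed[OF assms(2)]
      by (simp add: pure_def)
qed

text \<open>The pure tensors generate the tensor product additively, so linear maps that agree on them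
  are equal. The hypotheses and the conclusion are pointwise on carriers because maps are
  arbitrary outside.\<close>

lemma tensor_ext_T:
  assumes "module K Z" "lin K T Z f" "lin K T Z g"
    and "\<And>v w. v \<in> carrier V \<Longrightarrow> w \<in> carrier W \<Longrightarrow> f (pure K V W v w) = g (pure K V W v w)"
    and "t \<in> carrier T"
  shows "f t = g t"
proof -
  have "f (fs xs) = g (fs xs)" if "xs \<in> sums" for xs
    using that
  proof (induction xs)
    case Nil
    then show ?case
      using lin_zero[OF module_T assms(1,2)] lin_zero[OF module_T assms(1,3)] by (simp add: zero_T)
  next
    case (Cons p xs)
    then have "f (fs [p]) = g (fs [p])" using assms(4)[of "fst p" "snd p"] by (auto simp: pure_def)
    then show ?case
      using Cons fs_Cons[of p xs] lin_add[OF assms(2)] lin_add[OF assms(3)] fs_closed[of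
        "[p]"] fs_closed[of xs]
      by simp
  qed
  then show ?thesis using assms(5) by (auto simp: carrier_T)
qed

lemma lin_tlift_commute:
  assumes "module K Z" "module K Z'" "lin K Z Z' f"
    and cl: "\<And>v w. v \<in> carrier V \<Longrightarrow> w \<in> carrier W \<Longrightarrow> \<beta> v w \<in> carrier Z" and "t \<in> carrier T"
  shows "f (tlift Z \<beta> t) = tlift Z' (\<lambda>v w. f (\<beta> v w)) t"
proof -
  interpret Z: module K Z by fact
  have "f (tsum Z \<beta> xs) = tsum Z' (\<lambda>v w. f (\<beta> v w)) xs" if "xs \<in> sums" for xs
    using that
  proof (induction xs)
    case Nil
    then show ?case using lin_zero[OF assms(1,2,3)] by simp
  next
    case (Cons p xs)
    then have "tsum Z \<beta> xs \<in> carrier Z" using tsum_closed[OF assms(1) cl] by auto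
    then show ?case using Cons lin_add[OF assms(3)] cl by auto
  qed
  then show ?thesis unfolding tlift_tsum using summands_sums[OF assms(5)] by simp
qed

lemma tlift_cong_T:
  assumes "\<And>v w. v \<in> carrier V \<Longrightarrow> w \<in> carrier W \<Longrightarrow> \<beta> v w = \<beta>' v w" "t \<in> carrier T"
  shows "tlift Z \<beta> t = tlift Z \<beta>' t"
proof -
  have "tsum Z \<beta> xs = tsum Z \<beta>' xs" if "xs \<in> sums" for xs
    using that by (induction xs) (auto simp: assms(1))
  then show ?thesis unfolding tlift_tsum using summands_sums[OF assms(2)] by simp
qed

lemma lin_tlift_param_T:
  assumes "module K Z" "\<And>v w. v \<in> carrier V \<Longrightarrow> w \<in> carrier W \<Longrightarrow> lin K U Z (\<lambda>u. \<beta> u v w)" "t \<in> carrier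
    T"
  shows "lin K U Z (\<lambda>u. tlift Z (\<beta> u) t)"
proof -
  interpret Z: module K Z by fact
  have "lin K U Z (\<lambda>u. tsum Z (\<beta> u) xs)" if "xs \<in> sums" for xs
    using that
  proof (induction xs)
    case Nil
    then show ?case by (simp add: lin_def)
  next
    case (Cons p xs)
    have l: "lin K U Z (\<lambda>u. \<beta> u (fst p) (snd p))" using Cons assms(2) by auto
    have r: "lin K U Z (\<lambda>u. tsum Z (\<beta> u) xs)" using Cons by auto
    show ?case unfolding tsum_simps
    proof (rule linI)
      fix x y assume x: "x \<in> carrier U" and y: "y \<in> carrier U"
      note cl = lin_closed[OF l x] lin_closed[OF l y] lin_closed[OF r x] lin_closed[OF r y]
      show "\<beta> (x \<oplus>\<^bsub>U\<^esub> y) (fst p) (snd p) \<oplus>\<^bsub>Z\<^esub> tsum Z (\<beta> (x \<oplus>\<^bsub>U\<^esub> y)) xs =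
        \<beta> x (fst p) (snd p) \<oplus>\<^bsub>Z\<^esub> tsum Z (\<beta> x) xs \<oplus>\<^bsub>Z\<^esub> (\<beta> y (fst p) (snd p) \<oplus>\<^bsub>Z\<^esub> tsum Z (\<beta> y) xs)"
        unfolding lin_add[OF l x y] lin_add[OF r x y] using cl by (simp add: Z.a_ac)
    next
      fix c x assume c: "c \<in> carrier K" and x: "x \<in> carrier U"
      show "\<beta> (c \<odot>\<^bsub>U\<^esub> x) (fst p) (snd p) \<oplus>\<^bsub>Z\<^esub> tsum Z (\<beta> (c \<odot>\<^bsub>U\<^esub> x)) xs =
         c \<odot>\<^bsub>Z\<^esub> (\<beta> x (fst p) (snd p) \<oplus>\<^bsub>Z\<^esub> tsum Z (\<beta> x) xs)"
        unfolding lin_smult[OF l c x] lin_smult[OF r c x]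
        using c lin_closed[OF l x] lin_closed[OF r x] by (simp add: Z.smult_r_distr)
    qed (use lin_closed[OF l] lin_closed[OF r] in auto)
  qed
  then show ?thesis unfolding tlift_tsum using summands_sums[OF assms(3)] by simp
qed

end

section \<open>Proving linearity\<close>

text \<open>In the terms that occur, a linear variable appears exactly once, so linearity follows by
  descending along the outermost operations: each rule peels off one of them. General
  composition of linear maps is absent from the collection because its conclusion unifies
  with every linearity goal; instead, the rules carry an inner map \<open>f\<close> that is treated next.\<close>

named_theorems tensor_intros

lemma tensor_factorsI: "module K V \<Longrightarrow> module K W \<Longrightarrow> tensor_factors K V W"
  by (simp add: tensor_factors_def)

lemma module_tensor [tensor_intros]:
  "module K V \<Longrightarrow> module K W \<Longrightarrow> module K (tensor_space K V W)"
  by (rule tensor_factors.module_T[OF tensor_factorsI])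

lemma pure_closed [tensor_intros]:
  "\<lbrakk>module K V; module K W; v \<in> carrier V; w \<in> carrier W\<rbrakk> \<Longrightarrow> pure K V W v w \<in> carrier (tensor_space K
    V W)"
  by (rule tensor_factors.pure_T[OF tensor_factorsI])

lemma tlift_closed [tensor_intros]:
  "\<lbrakk>t \<in> carrier (tensor_space K V W); module K V; module K W; module K Z;
    \<And>v w. v \<in> carrier V \<Longrightarrow> w \<in> carrier W \<Longrightarrow> \<beta> v w \<in> carrier Z\<rbrakk> \<Longrightarrow> tlift Z \<beta> t \<in> carrier Z"
  by (rule tensor_factors.tlift_closed_T[OF tensor_factorsI])

lemma tlift_cong:
  "\<lbrakk>t \<in> carrier (tensor_space K V W); module K V; module K W;
    \<And>v w. v \<in> carrier V \<Longrightarrow> w \<in> carrier W \<Longrightarrow> \<beta> v w = \<beta>' v w\<rbrakk> \<Longrightarrow> tlift Z \<beta> t = tlift Z \<beta>' t"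
  by (rule tensor_factors.tlift_cong_T[OF tensor_factorsI])

lemma tlift_pure:
  "\<lbrakk>bilin K V W Z \<beta>; module K V; module K W; module K Z; v \<in> carrier V; w \<in> carrier W\<rbrakk>
    \<Longrightarrow> tlift Z \<beta> (pure K V W v w) = \<beta> v w"
  by (rule tensor_factors.tlift_pure_T[OF tensor_factorsI])

lemma linear_tlift:
  "\<lbrakk>bilin K V W Z \<beta>; module K V; module K W; module K Z\<rbrakk> \<Longrightarrow> lin K (tensor_space K V W) Z (tlift Z \<beta>)"
  by (rule tensor_factors.lin_tlift[OF tensor_factorsI])

lemma linear_apply_tlift:
  "\<lbrakk>lin K Z Z' f; t \<in> carrier (tensor_space K V W); module K V; module K W; module K Z; module K Z';
    \<And>v w. v \<in> carrier V \<Longrightarrow> w \<in> carrier W \<Longrightarrow> \<beta> v w \<in> carrier Z\<rbrakk>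
    \<Longrightarrow> f (tlift Z \<beta> t) = tlift Z' (\<lambda>v w. f (\<beta> v w)) t"
  by (rule tensor_factors.lin_tlift_commute[OF tensor_factorsI])

lemma tensor_ext:
  assumes "module K V" "module K W" "module K Z"
    and "lin K (tensor_space K V W) Z (\<lambda>t. f t)" "lin K (tensor_space K V W) Z (\<lambda>t. g t)"
    and "\<And>v w. v \<in> carrier V \<Longrightarrow> w \<in> carrier W \<Longrightarrow> f (pure K V W v w) = g (pure K V W v w)"
  shows "\<forall>t\<in>carrier (tensor_space K V W). f t = g t"
  using tensor_factors.tensor_ext_T[OF tensor_factorsI[OF assms(1,2)] assms(3,4,5)] assms(6)
    by blast

lemma lin_tlift_param [tensor_intros]:
  "\<lbrakk>t \<in> carrier (tensor_space K V W); module K V; module K W; module K Z;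
    \<And>v w. v \<in> carrier V \<Longrightarrow> w \<in> carrier W \<Longrightarrow> lin K U Z (\<lambda>u. \<beta> u v w)\<rbrakk> \<Longrightarrow>
      lin K U Z (\<lambda>u. tlift Z (\<beta> u) t)"
  by (rule tensor_factors.lin_tlift_param_T[OF tensor_factorsI])

lemma lin_tlift_arg [tensor_intros]:
  "\<lbrakk>lin K U (tensor_space K V W) (\<lambda>u. f u); module K V; module K W; module K Z; bilin K V W Z \<beta>\<rbrakk>
    \<Longrightarrow> lin K U Z (\<lambda>u. tlift Z \<beta> (f u))"
  by (rule lin_compose[OF linear_tlift])

lemma lin_pure_left [tensor_intros]:
  "\<lbrakk>module K V; module K W; w \<in> carrier W; lin K U V (\<lambda>u. f u)\<rbrakk>
    \<Longrightarrow> lin K U (tensor_space K V W) (\<lambda>u. pure K V W (f u) w)"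
  using tensor_factors.bilin_pure[OF tensor_factorsI, of K V W]
  by (rule_tac lin_compose[of _ _ _ "\<lambda>v. pure K V W v w"]) (auto simp: bilin_def)

lemma lin_pure_right [tensor_intros]:
  "\<lbrakk>module K V; module K W; v \<in> carrier V; lin K U W (\<lambda>u. f u)\<rbrakk>
    \<Longrightarrow> lin K U (tensor_space K V W) (\<lambda>u. pure K V W v (f u))"
  using tensor_factors.bilin_pure[OF tensor_factorsI, of K V W]
  by (rule_tac lin_compose[of _ _ _ "pure K V W v"]) (auto simp: bilin_def)

lemmas [tensor_intros] = lin_ident bilinI

lemma module_smult_closed [tensor_intros]:
  "\<lbrakk>module K V; c \<in> carrier K; v \<in> carrier V\<rbrakk> \<Longrightarrow> c \<odot>\<^bsub>V\<^esub> v \<in> carrier V"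
  by (rule module.smult_closed)

lemma lin_smult_right [tensor_intros]:
  assumes "module K V" "c \<in> carrier K" "lin K U V (\<lambda>u. f u)"
  shows "lin K U V (\<lambda>u. c \<odot>\<^bsub>V\<^esub> f u)"
proof -
  interpret module K V by fact
  have "lin K V V (\<lambda>v. c \<odot>\<^bsub>V\<^esub> v)"
    using assms(2) by (intro linI) (auto simp: smult_r_distr smult_assoc1[symmetric] R.m_comm)
  from lin_compose[OF this assms(3)] show ?thesis .
qed

section \<open>Tensor products of maps and rebracketing\<close>

lemma bilin_tmap:
  "\<lbrakk>module K V; module K W; module K V'; module K W'; lin K V V' f; lin K W W' g\<rbrakk>
    \<Longrightarrow> bilin K V W (tensor_space K V' W') (\<lambda>v w. pure K V' W' (f v) (g w))"
  by (assumption | rule tensor_intros lin_closed[of K V V' f] lin_closed[of K W W' g])+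

lemma lin_tmap:
  "\<lbrakk>module K V; module K W; module K V'; module K W'; lin K V V' f; lin K W W' g\<rbrakk>
    \<Longrightarrow> lin K (tensor_space K V W) (tensor_space K V' W') (tmap K V' W' f g)"
  unfolding tmap_def by (intro linear_tlift bilin_tmap module_tensor)

lemma tmap_pure:
  "\<lbrakk>lin K V V' f; lin K W W' g; module K V; module K W; module K V'; module K W'; v \<in> carrier V; w \<in>
    carrier W\<rbrakk>
    \<Longrightarrow> tmap K V' W' f g (pure K V W v w) = pure K V' W' (f v) (g w)"
  unfolding tmap_def by (rule tlift_pure) (auto intro: bilin_tmap module_tensor)

lemma tmap_closed [tensor_intros]:
  "\<lbrakk>t \<in> carrier (tensor_space K V W); module K V; module K W; module K V'; module K W';
    lin K V V' (\<lambda>v. f v); lin K W W' (\<lambda>w. g w)\<rbrakk>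
    \<Longrightarrow> tmap K V' W' f g t \<in> carrier (tensor_space K V' W')"
  by (rule lin_closed[OF lin_tmap])

lemma lin_tmap_arg [tensor_intros]:
  "\<lbrakk>lin K U (tensor_space K V W) (\<lambda>u. t u); module K V; module K W; module K V'; module K W';
    lin K V V' (\<lambda>v. f v); lin K W W' (\<lambda>w. g w)\<rbrakk>
    \<Longrightarrow> lin K U (tensor_space K V' W') (\<lambda>u. tmap K V' W' f g (t u))"
  by (rule lin_compose[OF lin_tmap])

lemma lin_tmap_left [tensor_intros]:
  assumes "t \<in> carrier (tensor_space K V W)" "module K V" "module K W" "module K V'" "module K W'"
    "lin K W W' (\<lambda>w. g w)" "\<And>v. v \<in> carrier V \<Longrightarrow> lin K U V' (\<lambda>u. f u v)"
  shows "lin K U (tensor_space K V' W') (\<lambda>u. tmap K V' W' (f u) g t)"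
  unfolding tmap_def using assms
  by (intro lin_tlift_param[of t K V W] module_tensor lin_pure_left) (auto simp: lin_closed)

lemma lin_tmap_right [tensor_intros]:
  assumes "t \<in> carrier (tensor_space K V W)" "module K V" "module K W" "module K V'" "module K W'"
    "lin K V V' (\<lambda>v. f v)" "\<And>w. w \<in> carrier W \<Longrightarrow> lin K U W' (\<lambda>u. g u w)"
  shows "lin K U (tensor_space K V' W') (\<lambda>u. tmap K V' W' f (g u) t)"
  unfolding tmap_def using assms
  by (intro lin_tlift_param[of t K V W] module_tensor lin_pure_right) (auto simp: lin_closed)

lemma lin_id [tensor_intros]: "lin K V V id"
  by (simp add: lin_def)

lemma tmap_id:
  assumes "module K V" "module K W" "t \<in> carrier (tensor_space K V W)"
    "\<And>v. v \<in> carrier V \<Longrightarrow> f v = v" "\<And>w. w \<in> carrier W \<Longrightarrow> g w = w"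
  shows "tmap K V W f g t = t"
proof -
  have l: "lin K V V f" "lin K W W g" using assms lin_cong[OF _ assms(1) lin_ident] lin_cong[OF _
    assms(2) lin_ident] by blast+
  have "\<forall>t\<in>carrier (tensor_space K V W). tmap K V W f g t = t"
    by (rule tensor_ext[of K V W "tensor_space K V W"])
      ((assumption | rule assms(1,2) module_tensor lin_tmap lin_ident l)+, simp add: tmap_pure[OF l]
        assms)
  then show ?thesis using assms by blast
qed

lemma tmap_tmap:
  assumes "t \<in> carrier (tensor_space K V W)" "module K V" "module K W" "module K V'" "module K W'"
    "module K V''" "module K W''"
    "lin K V V' f" "lin K W W' g" "lin K V' V'' f'" "lin K W' W'' g'"
  shows "tmap K V'' W'' f' g' (tmap K V' W' f g t) = tmap K V'' W'' (\<lambda>v. f' (f v)) (\<lambda>w. g' (g w)) t"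
proof -
  have "\<forall>t\<in>carrier (tensor_space K V W). tmap K V'' W'' f' g' (tmap K V' W' f g t)
      = tmap K V'' W'' (\<lambda>v. f' (f v)) (\<lambda>w. g' (g w)) t"
  proof (rule tensor_ext[of K V W "tensor_space K V'' W''"])
    fix v w assume "v \<in> carrier V" "w \<in> carrier W"
    then show "tmap K V'' W'' f' g' (tmap K V' W' f g (pure K V W v w))
        = tmap K V'' W'' (\<lambda>v. f' (f v)) (\<lambda>w. g' (g w)) (pure K V W v w)"
      using assms by (simp add: tmap_pure[of K V V' f W W' g] tmap_pure[of K V' V'' f' W' W'' g']
        lin_closed[of K V V' f] lin_closed[of K W W' g]
        tmap_pure[OF lin_compose[OF assms(10,8)] lin_compose[OF assms(11,9)]])
  qed (assumption | rule assms module_tensor lin_compose[OF assms(10,8)] lin_compose[OF assms(11,9)]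
    lin_tmap_arg lin_tmap)+
  then show ?thesis using assms by blast
qed

lemma tmap_cong:
  assumes "t \<in> carrier (tensor_space K V W)" "module K V" "module K W"
    "\<And>v. v \<in> carrier V \<Longrightarrow> f v = f' v" "\<And>w. w \<in> carrier W \<Longrightarrow> g w = g' w"
  shows "tmap K V' W' f g t = tmap K V' W' f' g' t"
  unfolding tmap_def using assms by (intro tlift_cong[of t K V W]) auto

lemma bilin_rebracket_inner:
  "\<lbrakk>module K U; module K V; module K W; w \<in> carrier W\<rbrakk>
    \<Longrightarrow> bilin K U V (tensor_space K U (tensor_space K V W))
         (\<lambda>u v. pure K U (tensor_space K V W) u (pure K V W v w))"
  by (assumption | rule tensor_intros)+

lemma bilin_rebracket:
  "\<lbrakk>module K U; module K V; module K W\<rbrakk>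
    \<Longrightarrow> bilin K (tensor_space K U V) W (tensor_space K U (tensor_space K V W))
      (\<lambda>s w. tlift (tensor_space K U (tensor_space K V W))
        (\<lambda>u v. pure K U (tensor_space K V W) u (pure K V W v w)) s)"
  by (assumption | rule tensor_intros)+

lemma lin_rebracket:
  "\<lbrakk>module K U; module K V; module K W\<rbrakk> \<Longrightarrow>
   lin K (tensor_space K (tensor_space K U V) W) (tensor_space K U (tensor_space K V W)) (rebracket
     K U V W)"
  unfolding rebracket_def by (intro linear_tlift bilin_rebracket module_tensor)

lemma rebracket_pure:
  "\<lbrakk>module K U; module K V; module K W; u \<in> carrier U; v \<in> carrier V; w \<in> carrier W\<rbrakk> \<Longrightarrow>
   rebracket K U V W (pure K (tensor_space K U V) W (pure K U V u v) w)
     = pure K U (tensor_space K V W) u (pure K V W v w)"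
  unfolding rebracket_def
  by (simp add: tlift_pure[OF bilin_rebracket] tlift_pure[OF bilin_rebracket_inner] module_tensor
    pure_closed)

lemma rebracket_closed [tensor_intros]:
  "\<lbrakk>t \<in> carrier (tensor_space K (tensor_space K U V) W); module K U; module K V; module K W\<rbrakk> \<Longrightarrow>
   rebracket K U V W t \<in> carrier (tensor_space K U (tensor_space K V W))"
  by (rule lin_closed[OF lin_rebracket])

lemma lin_rebracket_arg [tensor_intros]:
  "\<lbrakk>lin K X (tensor_space K (tensor_space K U V) W) (\<lambda>x. t x); module K U; module K V; module K W\<rbrakk> \<Longrightarrow>
   lin K X (tensor_space K U (tensor_space K V W)) (\<lambda>x. rebracket K U V W (t x))"
  by (rule lin_compose[OF lin_rebracket])

text \<open>The inverse of rebracketing, which makes the associativity constraint bijective.\<close>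

definition unbracket ::
  "('k, 'c) ring_scheme \<Rightarrow> ('k, ('k, 'u) univ, 'x) module_scheme \<Rightarrow> ('k, ('k, 'u) univ, 'y)
    module_scheme
    \<Rightarrow> ('k, ('k, 'u) univ, 'z) module_scheme \<Rightarrow> ('k, 'u) univ \<Rightarrow> ('k, 'u) univ" where
  "unbracket K U V W =
    tlift (tensor_space K (tensor_space K U V) W)
      (\<lambda>u s. tlift (tensor_space K (tensor_space K U V) W)
        (\<lambda>v w. pure K (tensor_space K U V) W (pure K U V u v) w) s)"

lemma bilin_unbracket_inner:
  "\<lbrakk>module K U; module K V; module K W; u \<in> carrier U\<rbrakk>
    \<Longrightarrow> bilin K V W (tensor_space K (tensor_space K U V) W)
         (\<lambda>v w. pure K (tensor_space K U V) W (pure K U V u v) w)"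
  by (assumption | rule tensor_intros)+

lemma bilin_unbracket:
  "\<lbrakk>module K U; module K V; module K W\<rbrakk>
    \<Longrightarrow> bilin K U (tensor_space K V W) (tensor_space K (tensor_space K U V) W)
      (\<lambda>u s. tlift (tensor_space K (tensor_space K U V) W)
        (\<lambda>v w. pure K (tensor_space K U V) W (pure K U V u v) w) s)"
  by (assumption | rule tensor_intros)+

lemma lin_unbracket:
  "\<lbrakk>module K U; module K V; module K W\<rbrakk> \<Longrightarrow>
   lin K (tensor_space K U (tensor_space K V W)) (tensor_space K (tensor_space K U V) W) (unbracket
     K U V W)"
  unfolding unbracket_def by (intro linear_tlift bilin_unbracket module_tensor)

lemma unbracket_pure:
  "\<lbrakk>module K U; module K V; module K W; u \<in> carrier U; v \<in> carrier V; w \<in> carrier W\<rbrakk> \<Longrightarrow>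
   unbracket K U V W (pure K U (tensor_space K V W) u (pure K V W v w))
     = pure K (tensor_space K U V) W (pure K U V u v) w"
  unfolding unbracket_def
  by (simp add: tlift_pure[OF bilin_unbracket] tlift_pure[OF bilin_unbracket_inner] module_tensor
    pure_closed)

lemma tensor_ext_left3:
  assumes mods: "module K U" "module K V" "module K W" "module K Z"
    and f: "lin K (tensor_space K (tensor_space K U V) W) Z (\<lambda>t. f t)"
    and g: "lin K (tensor_space K (tensor_space K U V) W) Z (\<lambda>t. g t)"
    and eq: "\<And>u v w. u \<in> carrier U \<Longrightarrow> v \<in> carrier V \<Longrightarrow> w \<in> carrier W \<Longrightarrow>
      f (pure K (tensor_space K U V) W (pure K U V u v) w) = g (pure K (tensor_space K U V) W (pure
        K U V u v) w)"
  shows "\<forall>t\<in>carrier (tensor_space K (tensor_space K U V) W). f t = g t"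
proof (rule tensor_ext[of K "tensor_space K U V" W Z])
  fix s w assume s: "s \<in> carrier (tensor_space K U V)" and w: "w \<in> carrier W"
  have "\<forall>s\<in>carrier (tensor_space K U V). f (pure K (tensor_space K U V) W s w)
    = g (pure K (tensor_space K U V) W s w)"
    by (rule tensor_ext[of K U V Z]) (assumption | rule mods w eq lin_compose[OF f] lin_compose[OF
      g] tensor_intros)+
  then show "f (pure K (tensor_space K U V) W s w) = g (pure K (tensor_space K U V) W s w)" using s
    by blast
qed (use mods f g in \<open>auto intro: module_tensor\<close>)

lemma tensor_ext_right3:
  assumes mods: "module K U" "module K V" "module K W" "module K Z"
    and f: "lin K (tensor_space K U (tensor_space K V W)) Z (\<lambda>t. f t)"
    and g: "lin K (tensor_space K U (tensor_space K V W)) Z (\<lambda>t. g t)"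
    and eq: "\<And>u v w. u \<in> carrier U \<Longrightarrow> v \<in> carrier V \<Longrightarrow> w \<in> carrier W \<Longrightarrow>
      f (pure K U (tensor_space K V W) u (pure K V W v w)) = g (pure K U (tensor_space K V W) u
        (pure K V W v w))"
  shows "\<forall>t\<in>carrier (tensor_space K U (tensor_space K V W)). f t = g t"
proof (rule tensor_ext[of K U "tensor_space K V W" Z])
  fix u s assume s: "s \<in> carrier (tensor_space K V W)" and u: "u \<in> carrier U"
  have "\<forall>s\<in>carrier (tensor_space K V W). f (pure K U (tensor_space K V W) u s)
    = g (pure K U (tensor_space K V W) u s)"
    by (rule tensor_ext[of K V W Z]) (assumption | rule mods u eq lin_compose[OF f] lin_compose[OF
      g] tensor_intros)+
  then show "f (pure K U (tensor_space K V W) u s) = g (pure K U (tensor_space K V W) u s)" using s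
    by blast
qed (use mods f g in \<open>auto intro: module_tensor\<close>)

lemma unbracket_rebracket:
  assumes "module K U" "module K V" "module K W"
  shows "\<forall>t\<in>carrier (tensor_space K (tensor_space K U V) W). unbracket K U V W (rebracket K U V W t)
    = t"
  by (rule tensor_ext_left3[of K U V W "tensor_space K (tensor_space K U V) W"])
    ((assumption | rule assms lin_compose[OF lin_unbracket] tensor_intros)+, simp add: assms
      rebracket_pure unbracket_pure)

lemma rebracket_unbracket:
  assumes "module K U" "module K V" "module K W"
  shows "\<forall>t\<in>carrier (tensor_space K U (tensor_space K V W)). rebracket K U V W (unbracket K U V W t)
    = t"
  by (rule tensor_ext_right3[of K U V W "tensor_space K U (tensor_space K V W)"])
    ((assumption | rule assms lin_unbracket tensor_intros)+, simp add: assms rebracket_pure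
      unbracket_pure)

lemma rebracket_tmap:
  assumes "module K U" "module K V" "module K W" "module K U'" "module K V'" "module K W'"
    "lin K U U' f" "lin K V V' g" "lin K W W' h"
  shows "\<forall>t\<in>carrier (tensor_space K (tensor_space K U V) W).
    rebracket K U' V' W' (tmap K (tensor_space K U' V') W' (tmap K U' V' f g) h t)
      = tmap K U' (tensor_space K V' W') f (tmap K V' W' g h) (rebracket K U V W t)"
  by (rule tensor_ext_left3[of K U V W "tensor_space K U' (tensor_space K V' W')"])
    ((assumption | rule assms tensor_intros lin_tmap)+,
      simp add: assms rebracket_pure tmap_pure[OF assms(7,8)] tmap_pure[OF assms(8,9)] tmap_pure[OF
        lin_tmap assms(9)]
        tmap_pure[OF assms(7) lin_tmap] module_tensor lin_tmap pure_closed lin_closed[OF assms(7)]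
          lin_closed[OF assms(8)] lin_closed[OF assms(9)])

text \<open>The coherence of the bare rebracketing. The pentagon for modules is this identity followed
  by the action of both sides of the cocycle identity.\<close>

lemma rebracket_pentagon:
  assumes "module K U" "module K V" "module K W" "module K Z"
  shows "\<forall>t\<in>carrier (tensor_space K (tensor_space K (tensor_space K U V) W) Z).
    tmap K U (tensor_space K V (tensor_space K W Z)) id (rebracket K V W Z)
      (rebracket K U (tensor_space K V W) Z
        (tmap K (tensor_space K U (tensor_space K V W)) Z (rebracket K U V W) id t))
    = rebracket K U V (tensor_space K W Z) (rebracket K (tensor_space K U V) W Z t)" (is "\<forall>t\<in>_. ?f t
      = ?g t")
proof (rule tensor_ext_left3[of K "tensor_space K U V" W Z "tensor_space K U (tensor_space K V
  (tensor_space K W Z))"])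
  fix s w z assume s: "s \<in> carrier (tensor_space K U V)" and wz: "w \<in> carrier W" "z \<in> carrier Z"
  let ?p = "\<lambda>s. pure K (tensor_space K (tensor_space K U V) W) Z (pure K (tensor_space K U V) W s w)
    z"
  have "\<forall>s\<in>carrier (tensor_space K U V). ?f (?p s) = ?g (?p s)"
    by (rule tensor_ext[of K U V "tensor_space K U (tensor_space K V (tensor_space K W Z))"])
      ((assumption | rule assms wz tensor_intros lin_rebracket)+, simp add: assms wz rebracket_pure
        tmap_pure[OF lin_rebracket lin_id]
         tmap_pure[OF lin_id lin_rebracket] module_tensor pure_closed)
  then show "?f (?p s) = ?g (?p s)" using s by blast
qed (assumption | rule assms tensor_intros lin_rebracket)+

section \<open>Equality of underlying spaces\<close>

text \<open>The same vector space is carried by several records: with an action, two actions, or none,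
  and with different multiplications. The tensor constructions depend on the four fields
  below only, which gives the rewrite rules \<open>strips\<close> that reduce all these records to the
  bare space. Each new kind of module gets its own extension of this set of rules.\<close>

definition same_space :: "('k, 'v, 'x) module_scheme \<Rightarrow> ('k, 'v, 'y) module_scheme \<Rightarrow> bool" where
  "same_space V V' \<longleftrightarrow> carrier V = carrier V' \<and> zero V = zero V' \<and> add V = add V' \<and> smult V
    = smult V'"

lemma same_space_sym: "same_space V W \<Longrightarrow> same_space W V"
  by (simp add: same_space_def)

lemma tensor_eq_transfer:
  assumes "tensor_eq K V W xs ys" "same_space V V'" "same_space W W'"
  shows "tensor_eq K V' W' xs ys"
  using assms(1)
proof (induction rule: tensor_eq.induct)
  case (sym xs ys)
  from sym.IH show ?case by (rule tensor_eq.sym)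
next
  case (trans xs ys zs)
  from trans.IH show ?case by (rule tensor_eq.trans)
next
  case (append xs xs' ys ys')
  from append.IH show ?case by (rule tensor_eq.append)
qed (auto simp: assms(2,3)[unfolded same_space_def] simp del: in_lists_conv_set intro:
  tensor_eq.intros(1,5-9))

lemma same_space_tensor_eq:
  assumes "same_space V V'" "same_space W W'"
  shows "tensor_eq K V W = tensor_eq K V' W'"
  using tensor_eq_transfer[OF _ assms] tensor_eq_transfer[OF _ assms[THEN same_space_sym]]
  by (intro ext iffI)

lemma same_space_pure:
  assumes "same_space V V'" "same_space W W'"
  shows "formal_sum K V W = formal_sum K V' W'" "pure K V W = pure K V' W'"
    "tensor_space K V W = tensor_space K V' W'"
proof -
  show f: "formal_sum K V W = formal_sum K V' W'"
    by (simp add: fun_eq_iff formal_sum_def same_space_tensor_eq[OF assms])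
  show "pure K V W = pure K V' W'" by (simp add: fun_eq_iff pure_def f)
  show "tensor_space K V W = tensor_space K V' W'"
    using assms by (simp add: tensor_space_def f same_space_def)
qed

lemma same_space_tlift: "same_space Z Z' \<Longrightarrow> tlift Z = tlift Z'"
  by (simp add: fun_eq_iff tlift_def same_space_def)

lemma same_space_lin: "same_space V V' \<Longrightarrow> same_space W W' \<Longrightarrow> lin K V W = lin K V' W'"
  by (simp add: fun_eq_iff lin_def same_space_def)

lemma same_space_module: "same_space V V' \<Longrightarrow> module K V = module K V'"
  by (simp add: module_def module_axioms_def abelian_group_def abelian_monoid_def
      abelian_group_axioms_def same_space_def comm_monoid_def comm_monoid_axioms_def monoid_def
      comm_group_def group_def group_axioms_def Units_def)

lemma same_space_refl: "same_space V V"
  by (simp add: same_space_def)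

lemma same_space_wrappers:
  "same_space (with_lact V l) V" "same_space (with_acts V l r) V" "same_space (hmod.truncate B) B"
  "same_space (tensor_algebra K V W) (tensor_space K V W)"
  by (simp_all add: same_space_def with_lact_def with_acts_def hmod.truncate_def tensor_algebra_def)

lemma wrapper_fields:
  "carrier (with_lact V l) = carrier V" "zero (with_lact V l) = zero V"
  "add (with_lact V l) = add V" "smult (with_lact V l) = smult V" "lact (with_lact V l) = l"
  "carrier (with_acts V l r) = carrier V" "zero (with_acts V l r) = zero V"
  "add (with_acts V l r) = add V" "smult (with_acts V l r) = smult V"
  "lact (with_acts V l r) = l" "ract (with_acts V l r) = r"
  "carrier (hmod.truncate B) = carrier B" "zero (hmod.truncate B) = zero B"
  "add (hmod.truncate B) = add B" "smult (hmod.truncate B) = smult B" "lact (hmod.truncate B)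
    = lact B"
  "carrier (tensor_algebra K X Y) = carrier (tensor_space K X Y)"
  "zero (tensor_algebra K X Y) = zero (tensor_space K X Y)"
  "add (tensor_algebra K X Y) = add (tensor_space K X Y)"
  "smult (tensor_algebra K X Y) = smult (tensor_space K X Y)"
  by (simp_all add: with_lact_def with_acts_def hmod.truncate_def tensor_algebra_def)

lemmas wrapper_strips = wrapper_fields
  same_space_wrappers[THEN same_space_pure(2)[OF _ same_space_refl]]
  same_space_wrappers[THEN same_space_pure(2)[OF same_space_refl]]
  same_space_wrappers[THEN same_space_pure(3)[OF _ same_space_refl]]
  same_space_wrappers[THEN same_space_pure(3)[OF same_space_refl]]
  same_space_wrappers[THEN same_space_tlift]
  same_space_wrappers[THEN same_space_lin[OF _ same_space_refl]]
  same_space_wrappers[THEN same_space_lin[OF same_space_refl]]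
  same_space_wrappers[THEN same_space_module]

lemma strip_tmap:
  "tmap K (with_lact V l) W = tmap K V W" "tmap K V (with_lact W l) = tmap K V W"
  "tmap K (with_acts V l r) W = tmap K V W" "tmap K V (with_acts W l r) = tmap K V W"
  "tmap K (hmod.truncate B) W = tmap K B W" "tmap K V (hmod.truncate B) = tmap K V B"
  "tmap K (tensor_algebra K V1 V2) W = tmap K (tensor_space K V1 V2) W"
  "tmap K V (tensor_algebra K V1 V2) = tmap K V (tensor_space K V1 V2)"
  by (simp_all add: tmap_def fun_eq_iff wrapper_strips)

lemma strip_rebracket:
  "rebracket K (with_lact U l) V W = rebracket K U V W"
  "rebracket K U (with_lact V l) W = rebracket K U V W"
  "rebracket K U V (with_lact W l) = rebracket K U V W"
  "rebracket K (with_acts U l r) V W = rebracket K U V W"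
  "rebracket K U (with_acts V l r) W = rebracket K U V W"
  "rebracket K U V (with_acts W l r) = rebracket K U V W"
  "rebracket K (hmod.truncate B) V W = rebracket K B V W"
  "rebracket K U (hmod.truncate B) W = rebracket K U B W"
  "rebracket K U V (hmod.truncate B) = rebracket K U V B"
  "rebracket K (tensor_algebra K V1 V2) V W = rebracket K (tensor_space K V1 V2) V W"
  "rebracket K U (tensor_algebra K V1 V2) W = rebracket K U (tensor_space K V1 V2) W"
  "rebracket K U V (tensor_algebra K V1 V2) = rebracket K U V (tensor_space K V1 V2)"
  by (simp_all add: rebracket_def wrapper_strips)

lemma strip_counit:
  "id_counit (tensor_algebra K V W) H = id_counit (tensor_space K V W) H"
  "counit_id H (tensor_algebra K V W) = counit_id H (tensor_space K V W)"
  by (simp_all add: id_counit_def counit_id_def wrapper_strips)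

lemmas strips = wrapper_strips strip_tmap strip_rebracket strip_counit

section \<open>Modules over tensor products of algebras\<close>

lemma module_algebra [tensor_intros]: "assoc_unital_algebra K P \<Longrightarrow> module K P"
  by (rule assoc_unital_algebra.axioms(1))

lemma mult_closed [tensor_intros]:
  "\<lbrakk>assoc_unital_algebra K P; x \<in> carrier P; y \<in> carrier P\<rbrakk> \<Longrightarrow> x \<otimes>\<^bsub>P\<^esub> y \<in> carrier P"
proof -
  assume "assoc_unital_algebra K P" and h: "x \<in> carrier P" "y \<in> carrier P"
  then interpret P: assoc_unital_algebra K P by blast
  show ?thesis using h by simp
qed

lemma one_closed [tensor_intros]: "assoc_unital_algebra K P \<Longrightarrow> \<one>\<^bsub>P\<^esub> \<in> carrier P"
proof -
  assume "assoc_unital_algebra K P"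
  then interpret P: assoc_unital_algebra K P by blast
  show ?thesis by simp
qed

lemma lin_mult_left [tensor_intros]:
  assumes "assoc_unital_algebra K P" "y \<in> carrier P" "lin K U P (\<lambda>u. f u)"
  shows "lin K U P (\<lambda>u. f u \<otimes>\<^bsub>P\<^esub> y)"
proof -
  interpret P: assoc_unital_algebra K P by fact
  have "lin K P P (\<lambda>x. x \<otimes>\<^bsub>P\<^esub> y)"
    using assms(2) by (intro linI) (auto simp: P.l_distr P.smult_mult_left)
  from lin_compose[OF this assms(3)] show ?thesis .
qed

lemma lin_mult_right [tensor_intros]:
  assumes "assoc_unital_algebra K P" "x \<in> carrier P" "lin K U P (\<lambda>u. f u)"
  shows "lin K U P (\<lambda>u. x \<otimes>\<^bsub>P\<^esub> f u)"
proof -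
  interpret P: assoc_unital_algebra K P by fact
  have "lin K P P (\<lambda>y. x \<otimes>\<^bsub>P\<^esub> y)"
    using assms(2) by (intro linI) (auto simp: P.r_distr P.smult_mult_right)
  from lin_compose[OF this assms(3)] show ?thesis .
qed

lemma module_left_hmodule [tensor_intros]: "left_hmodule K P M \<Longrightarrow> module K M"
  by (rule left_hmodule.axioms(1))

lemma lact_closed [tensor_intros]:
  "\<lbrakk>left_hmodule K P M; p \<in> carrier P; u \<in> carrier M\<rbrakk> \<Longrightarrow> lact M p u \<in> carrier M"
  by (rule left_hmodule.lact_closed)

lemma lin_lact_left [tensor_intros]:
  assumes "left_hmodule K P M" "x \<in> carrier M" "lin K U P (\<lambda>u. f u)"
  shows "lin K U M (\<lambda>u. lact M (f u) x)"
proof -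
  interpret left_hmodule K P M by fact
  have "lin K P M (\<lambda>p. lact M p x)"
    using assms(2) by (intro linI) (auto simp: lact_closed lact_add_left lact_smult_left)
  from lin_compose[OF this assms(3)] show ?thesis .
qed

lemma lin_lact_right [tensor_intros]:
  assumes "left_hmodule K P M" "p \<in> carrier P" "lin K U M (\<lambda>u. f u)"
  shows "lin K U M (\<lambda>u. lact M p (f u))"
proof -
  interpret left_hmodule K P M by fact
  have "lin K M M (\<lambda>x. lact M p x)"
    using assms(2) by (intro linI) (auto simp: lact_closed lact_add_right lact_smult_right)
  from lin_compose[OF this assms(3)] show ?thesis .
qed

lemma left_hmoduleI:
  assumes "module K M"
    and "\<And>u. u \<in> carrier M \<Longrightarrow> lin K P M (\<lambda>p. lact M p u)"
    and "\<And>p. p \<in> carrier P \<Longrightarrow> lin K M M (\<lambda>u. lact M p u)"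
    and "\<And>p q u. p \<in> carrier P \<Longrightarrow> q \<in> carrier P \<Longrightarrow> u \<in> carrier M \<Longrightarrow>
      lact M (p \<otimes>\<^bsub>P\<^esub> q) u = lact M p (lact M q u)"
    and "\<And>u. u \<in> carrier M \<Longrightarrow> lact M \<one>\<^bsub>P\<^esub> u = u"
  shows "left_hmodule K P M"
  using assms by (intro left_hmodule.intro left_hmodule_axioms.intro) (auto simp: lin_def)

text \<open>The tensor product of a module over \<open>P\<close> and a module over \<open>Q\<close>, as a module over the tensor
  product of \<open>P\<close> and \<open>Q\<close>. The diagonal action is pulled back from it along the
  comultiplication, the threefold action in the associativity constraint is an iterate of
  it, and the multiplication of the tensor algebra is its case of regular modules, so that
  facts on this one action serve for all of them.\<close>

definition tens_mod ::
  "('k, 'c) ring_scheme \<Rightarrow> ('k, ('k, 'u) univ, 'x) hmod_scheme \<Rightarrow> ('k, ('k, 'u) univ, 'y) hmod_scheme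
    \<Rightarrow> ('k, 'u) left_mod" where
  "tens_mod K M N = with_lact (tensor_space K M N)
     (\<lambda>p t. tlift (tensor_space K M N) (\<lambda>p1 p2. tmap K M N (lact M p1) (lact N p2) t) p)"

lemma same_space_tens_mod: "same_space (tens_mod K M N) (tensor_space K M N)"
  unfolding tens_mod_def by (rule same_space_wrappers)

lemma tens_mod_fields:
  "carrier (tens_mod K M N) = carrier (tensor_space K M N)"
  "zero (tens_mod K M N) = zero (tensor_space K M N)"
  "add (tens_mod K M N) = add (tensor_space K M N)"
  "smult (tens_mod K M N) = smult (tensor_space K M N)"
  using same_space_tens_mod by (auto simp: same_space_def)

lemma lact_tens_mod:
  "lact (tens_mod K M N) p t = tlift (tensor_space K M N) (\<lambda>p1 p2. tmap K M N (lact M p1) (lact N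
    p2) t) p"
  by (simp add: tens_mod_def wrapper_fields)

lemmas strip_tens_mod = tens_mod_fields
  same_space_tens_mod[THEN same_space_pure(2)[OF _ same_space_refl]]
  same_space_tens_mod[THEN same_space_pure(2)[OF same_space_refl]]
  same_space_tens_mod[THEN same_space_pure(3)[OF _ same_space_refl]]
  same_space_tens_mod[THEN same_space_pure(3)[OF same_space_refl]]
  same_space_tens_mod[THEN same_space_tlift]
  same_space_tens_mod[THEN same_space_lin[OF _ same_space_refl]]
  same_space_tens_mod[THEN same_space_lin[OF same_space_refl]]
  same_space_tens_mod[THEN same_space_module]

lemma strip_tens_mod_maps:
  "tmap K (tens_mod K M N) W = tmap K (tensor_space K M N) W"
  "tmap K V (tens_mod K M N) = tmap K V (tensor_space K M N)"
  "rebracket K (tens_mod K M N) V W = rebracket K (tensor_space K M N) V W"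
  "rebracket K U (tens_mod K M N) W = rebracket K U (tensor_space K M N) W"
  "rebracket K U V (tens_mod K M N) = rebracket K U V (tensor_space K M N)"
  by (simp_all add: tens_mod_def strips)

lemmas all_strips = strips strip_tens_mod strip_tens_mod_maps

context
  fixes K :: "('k, 'c) ring_scheme" and P :: "('k, ('k, 'u) univ, 'p) module_scheme" and Q ::
    "('k, ('k, 'u) univ, 'q) module_scheme"
    and M :: "('k, ('k, 'u) univ, 'm) hmod_scheme" and N :: "('k, ('k, 'u) univ, 'n) hmod_scheme"
  assumes P: "assoc_unital_algebra K P" and Q: "assoc_unital_algebra K Q"
    and M: "left_hmodule K P M" and N: "left_hmodule K Q N"
begin

lemma mods: "module K P" "module K Q" "module K M" "module K N"
  "module K (tensor_space K P Q)" "module K (tensor_space K M N)"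
  by (assumption | rule P Q M N tensor_intros)+

lemma lin_lact_tens_mod_right:
  "p \<in> carrier (tensor_space K P Q) \<Longrightarrow> lin K (tensor_space K M N) (tensor_space K M N) (\<lambda>t. lact
    (tens_mod K M N) p t)"
  unfolding lact_tens_mod by (assumption | rule P Q M N mods tensor_intros)+

lemma lin_lact_tens_mod_left:
  "t \<in> carrier (tensor_space K M N) \<Longrightarrow> lin K (tensor_space K P Q) (tensor_space K M N) (\<lambda>p. lact
    (tens_mod K M N) p t)"
  unfolding lact_tens_mod by (assumption | rule P Q M N mods tensor_intros)+

lemma lact_tens_mod_pure:
  assumes "p \<in> carrier P" "q \<in> carrier Q" "u \<in> carrier M" "v \<in> carrier N"
  shows "lact (tens_mod K M N) (pure K P Q p q) (pure K M N u v) = pure K M N (lact M p u) (lact N q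
    v)"
proof -
  have b: "bilin K P Q (tensor_space K M N) (\<lambda>p1 p2. tmap K M N (lact M p1) (lact N p2) (pure K M N
    u v))"
    by (assumption | rule P Q M N mods tensor_intros assms)+
  have l: "lin K M M (lact M p)" "lin K N N (lact N q)"
    by (assumption | rule P Q M N mods tensor_intros assms)+
  show ?thesis
    using assms by (simp add: lact_tens_mod tlift_pure[OF b] mods tmap_pure[OF l])
qed

text \<open>On pure tensors the action is componentwise; the module axioms are linear in every
  argument, so they are extended from pure tensors one argument at a time.\<close>

lemma left_hmodule_tens_mod: "left_hmodule K (tensor_algebra K P Q) (tens_mod K M N)"
proof (rule left_hmoduleI)
  show "module K (tens_mod K M N)" by (simp add: all_strips mods)
  show "lin K (tensor_algebra K P Q) (tens_mod K M N) (\<lambda>p. lact (tens_mod K M N) p u)"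
    if "u \<in> carrier (tens_mod K M N)" for u
    using that lin_lact_tens_mod_left by (simp add: all_strips)
  show "lin K (tens_mod K M N) (tens_mod K M N) (\<lambda>u. lact (tens_mod K M N) p u)"
    if "p \<in> carrier (tensor_algebra K P Q)" for p
    using that lin_lact_tens_mod_right by (simp add: all_strips)
next
  let ?a = "lact (tens_mod K M N)" and ?T = "tensor_space K M N"
  have cl: "?a p u \<in> carrier ?T" if "p \<in> carrier (tensor_space K P Q)" "u \<in> carrier ?T" for p u
    using lin_closed[OF lin_lact_tens_mod_right] that .
  note L = lin_compose[OF lin_lact_tens_mod_right] lin_compose[OF lin_lact_tens_mod_left]
  interpret P: assoc_unital_algebra K P by (rule P)
  interpret Q: assoc_unital_algebra K Q by (rule Q)
  interpret M: left_hmodule K P M by (rule M)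
  interpret N: left_hmodule K Q N by (rule N)
  fix p q u assume "p \<in> carrier (tensor_algebra K P Q)" "q \<in> carrier (tensor_algebra K P Q)"
    "u \<in> carrier (tens_mod K M N)"
  then have pqu: "p \<in> carrier (tensor_space K P Q)" "q \<in> carrier (tensor_space K P Q)" "u \<in> carrier
    ?T"
    by (simp_all add: all_strips)
  let ?m = "\<lambda>s t. tlift (tensor_space K P Q) (\<lambda>a b. tmap K P Q (\<lambda>a'. a \<otimes>\<^bsub>P\<^esub> a') (\<lambda>b'. b \<otimes>\<^bsub>Q\<^esub> b') t)
    s"
  have m_eq: "p \<otimes>\<^bsub>tensor_algebra K P Q\<^esub> q = ?m p q" for p q
    by (simp add: tensor_algebra_def)
  have m1: "lin K (tensor_space K P Q) (tensor_space K P Q) (\<lambda>s. ?m s t)"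
    if "t \<in> carrier (tensor_space K P Q)" for t
    using that by - (assumption | rule P Q mods tensor_intros)+
  have m2: "lin K (tensor_space K P Q) (tensor_space K P Q) (\<lambda>t. ?m s t)"
    if "s \<in> carrier (tensor_space K P Q)" for s
    using that by - (assumption | rule P Q mods tensor_intros)+
  have mp: "?m (pure K P Q a b) (pure K P Q a' b') = pure K P Q (a \<otimes>\<^bsub>P\<^esub> a') (b \<otimes>\<^bsub>Q\<^esub> b')"
    if h: "a \<in> carrier P" "b \<in> carrier Q" "a' \<in> carrier P" "b' \<in> carrier Q" for a b a' b'
  proof -
    have bl: "bilin K P Q (tensor_space K P Q) (\<lambda>a b. tmap K P Q (\<lambda>a'. a \<otimes>\<^bsub>P\<^esub> a') (\<lambda>b'. b \<otimes>\<^bsub>Q\<^esub> b')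
      (pure K P Q a' b'))"
      using h by - (assumption | rule P Q mods tensor_intros)+
    have l: "lin K P P (\<lambda>a'. a \<otimes>\<^bsub>P\<^esub> a')" "lin K Q Q (\<lambda>b'. b \<otimes>\<^bsub>Q\<^esub> b')"
      using h by - (assumption | rule P Q mods tensor_intros)+
    show ?thesis using h by (simp add: tlift_pure[OF bl] mods tmap_pure[OF l])
  qed
  have e1: "?a (?m (pure K P Q a b) (pure K P Q a' b')) u = ?a (pure K P Q a b) (?a (pure K P Q a'
    b') u)"
    if h: "a \<in> carrier P" "b \<in> carrier Q" "a' \<in> carrier P" "b' \<in> carrier Q" for a b a' b'
  proof -
    have "\<forall>u\<in>carrier ?T. ?a (?m (pure K P Q a b) (pure K P Q a' b')) u = ?a (pure K P Q a b) (?a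
      (pure K P Q a' b') u)"
      unfolding mp[OF h]
      by (rule tensor_ext[of K M N ?T])
        ((assumption | rule mods h tensor_intros P.m_closed Q.m_closed L)+,
         simp add: h lact_tens_mod_pure M.lact_closed N.lact_closed M.lact_mult N.lact_mult)
    then show ?thesis using pqu by blast
  qed
  have e2: "?a (?m (pure K P Q a b) q) u = ?a (pure K P Q a b) (?a q u)"
    if h: "a \<in> carrier P" "b \<in> carrier Q" for a b
  proof -
    have "\<forall>q\<in>carrier (tensor_space K P Q). ?a (?m (pure K P Q a b) q) u = ?a (pure K P Q a b) (?a q
      u)"
      by (rule tensor_ext[of K P Q ?T])
        ((assumption | rule mods h m2 pqu e1 L lin_lact_tens_mod_left pure_closed)+)
    then show ?thesis using pqu by blast
  qed
  have "\<forall>p\<in>carrier (tensor_space K P Q). ?a (?m p q) u = ?a p (?a q u)"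
    by (rule tensor_ext[of K P Q ?T])
      ((assumption | rule mods m1 pqu e2 cl L lin_lact_tens_mod_left)+)
  then show "?a (p \<otimes>\<^bsub>tensor_algebra K P Q\<^esub> q) u = ?a p (?a q u)" unfolding m_eq using pqu by blast
next
  let ?a = "lact (tens_mod K M N)" and ?T = "tensor_space K M N"
  fix u assume "u \<in> carrier (tens_mod K M N)"
  then have u: "u \<in> carrier ?T" by (simp add: all_strips)
  interpret M: left_hmodule K P M by (rule M)
  interpret N: left_hmodule K Q N by (rule N)
  have "\<forall>u\<in>carrier ?T. ?a (pure K P Q \<one>\<^bsub>P\<^esub> \<one>\<^bsub>Q\<^esub>) u = u"
    by (rule tensor_ext[of K M N ?T])
      ((assumption | rule mods lin_lact_tens_mod_right tensor_intros P Q)+,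
        simp add: lact_tens_mod_pure one_closed[OF P] one_closed[OF Q] M.lact_one N.lact_one)
  then show "?a \<one>\<^bsub>tensor_algebra K P Q\<^esub> u = u" using u by (simp add: tensor_algebra_def)
qed

end

text \<open>Through the regular module, statements on modules specialize to statements on
  multiplication: semilinear maps become multiplicative maps.\<close>

definition regular :: "('k, ('k, 'u) univ, 'x) module_scheme \<Rightarrow> ('k, 'u) left_mod" where
  "regular P = with_lact P (mult P)"

lemma left_hmodule_regular: "assoc_unital_algebra K P \<Longrightarrow> left_hmodule K P (regular P)"
proof -
  assume P: "assoc_unital_algebra K P"
  then interpret P: assoc_unital_algebra K P .
  show ?thesis
    by (rule left_hmoduleI)
      (auto simp: regular_def wrapper_strips P.m_assoc P.module_axioms intro!: lin_mult_left[OF P]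
        lin_mult_right[OF P] lin_ident)
qed

lemma lact_regular: "lact (regular P) = mult P"
  by (simp add: regular_def wrapper_strips)

lemma mult_tensor_algebra:
  "s \<otimes>\<^bsub>tensor_algebra K P Q\<^esub> t = lact (tens_mod K (regular P) (regular Q)) s t"
  by (simp add: lact_tens_mod regular_def strips) (simp add: tensor_algebra_def)

lemma mult_pure:
  assumes "assoc_unital_algebra K P" "assoc_unital_algebra K Q"
    "a \<in> carrier P" "b \<in> carrier Q" "a' \<in> carrier P" "b' \<in> carrier Q"
  shows "pure K P Q a b \<otimes>\<^bsub>tensor_algebra K P Q\<^esub> pure K P Q a' b' = pure K P Q (a \<otimes>\<^bsub>P\<^esub> a') (b \<otimes>\<^bsub>Q\<^esub>
    b')"
  using lact_tens_mod_pure[OF assms(1,2) left_hmodule_regular[OF assms(1)] left_hmodule_regular[OF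
    assms(2)]] assms
  by (simp add: mult_tensor_algebra) (simp add: regular_def strips)

lemma assoc_unital_algebra_tensor:
  assumes P: "assoc_unital_algebra K P" and Q: "assoc_unital_algebra K Q"
  shows "assoc_unital_algebra K (tensor_algebra K P Q)"
proof -
  let ?T = "tensor_algebra K P Q"
  interpret P: assoc_unital_algebra K P by fact
  interpret Q: assoc_unital_algebra K Q by fact
  interpret L: left_hmodule K ?T "tens_mod K (regular P) (regular Q)"
    by (rule left_hmodule_tens_mod[OF P Q left_hmodule_regular[OF P] left_hmodule_regular[OF Q]])
  have fields: "carrier (tens_mod K (regular P) (regular Q)) = carrier ?T"
    "add (tens_mod K (regular P) (regular Q)) = add ?T" "smult (tens_mod K (regular P) (regular Q))
      = smult ?T"
    by (simp_all add: all_strips regular_def)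
  have T: "module K ?T" using P.module_axioms Q.module_axioms by (simp add: strips module_tensor)
  have lin1: "lin K ?T ?T (\<lambda>s. s \<otimes>\<^bsub>?T\<^esub> t)" if "t \<in> carrier ?T" for t
    using that L.lact_closed L.lact_add_left L.lact_smult_left unfolding mult_tensor_algebra fields
      by (intro linI)
  have lin2: "lin K ?T ?T (\<lambda>t. s \<otimes>\<^bsub>?T\<^esub> t)" if "s \<in> carrier ?T" for s
    using that L.lact_closed L.lact_add_right L.lact_smult_right
      unfolding mult_tensor_algebra fields by (intro linI)
  have one: "\<one>\<^bsub>?T\<^esub> = pure K P Q \<one>\<^bsub>P\<^esub> \<one>\<^bsub>Q\<^esub>" by (simp add: tensor_algebra_def)
  have one_cl: "\<one>\<^bsub>?T\<^esub> \<in> carrier ?T"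
    unfolding one using P.module_axioms Q.module_axioms by (simp add: strips pure_closed)
  have one_r: "s \<otimes>\<^bsub>?T\<^esub> \<one>\<^bsub>?T\<^esub> = s" if "s \<in> carrier ?T" for s
  proof -
    have "\<forall>s\<in>carrier (tensor_space K P Q). s \<otimes>\<^bsub>?T\<^esub> \<one>\<^bsub>?T\<^esub> = s"
      by (rule tensor_ext[of K P Q "tensor_space K P Q"])
        (use lin1[OF one_cl] P.module_axioms Q.module_axioms in \<open>simp_all add: strips module_tensor
          lin_ident one mult_pure[OF P Q]\<close>)
    then show ?thesis using that by (simp add: strips)
  qed
  show ?thesis
  proof (intro assoc_unital_algebra.intro assoc_unital_algebra_axioms.intro ringI)
    show "module K ?T" by (rule T)
    then show "abelian_group ?T" by (rule module.axioms)
    show "monoid ?T"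
      by (rule monoidI)
        (use one_cl one_r lin_closed[OF lin1] L.lact_mult L.lact_one in \<open>simp_all add:
          mult_tensor_algebra fields\<close>)
  qed (use lin_add[OF lin1] lin_add[OF lin2] lin_smult[OF lin1] lin_smult[OF lin2] in auto)
qed

lemma one_tensor_algebra: "\<one>\<^bsub>tensor_algebra K P Q\<^esub> = pure K P Q \<one>\<^bsub>P\<^esub> \<one>\<^bsub>Q\<^esub>"
  by (simp add: tensor_algebra_def)

section \<open>Semilinear maps\<close>

text \<open>Both sides are linear in the acting tensor and in the tensor acted upon, so a
  semilinearity condition need only be tested on pure tensors in both places.\<close>

lemma semilinear_tensor_ext:
  assumes P: "assoc_unital_algebra K P" and Q: "assoc_unital_algebra K Q"
    and M: "left_hmodule K P M" and N: "left_hmodule K Q N" and L: "left_hmodule K S L"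
      and S: "module K S"
    and \<phi>: "lin K (tensor_space K P Q) S \<phi>" and f: "lin K (tensor_space K M N) L f"
    and eq: "\<And>p q u v. \<lbrakk>p \<in> carrier P; q \<in> carrier Q; u \<in> carrier M; v \<in> carrier N\<rbrakk> \<Longrightarrow>
      f (pure K M N (lact M p u) (lact N q v)) = lact L (\<phi> (pure K P Q p q)) (f (pure K M N u v))"
    and p: "p \<in> carrier (tensor_space K P Q)" and t: "t \<in> carrier (tensor_space K M N)"
  shows "f (lact (tens_mod K M N) p t) = lact L (\<phi> p) (f t)"
proof -
  note mods = mods[OF P Q M N] module_left_hmodule[OF L] S
  have 1: "\<forall>p\<in>carrier (tensor_space K P Q). f (lact (tens_mod K M N) p (pure K M N u v))
    = lact L (\<phi> p) (f (pure K M N u v))"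
    if uv: "u \<in> carrier M" "v \<in> carrier N" for u v
    by (rule tensor_ext[of K P Q L])
      ((assumption | rule mods uv L lin_compose[OF f lin_lact_tens_mod_left[OF P Q M N]] \<phi>
        lin_lact_left lin_closed[OF f] pure_closed)+,
       simp add: lact_tens_mod_pure[OF P Q M N] uv eq)
  have "\<forall>t\<in>carrier (tensor_space K M N). f (lact (tens_mod K M N) p t) = lact L (\<phi> p) (f t)"
    by (rule tensor_ext[of K M N L])
      ((assumption | rule mods L lin_compose[OF f lin_lact_tens_mod_right[OF P Q M N]] f p
        lin_lact_right lin_closed[OF \<phi>] 1[rule_format])+)
  then show ?thesis using t by blast
qed

lemma semilinear_tmap:
  assumes P: "assoc_unital_algebra K P" and Q: "assoc_unital_algebra K Q"
    and P': "assoc_unital_algebra K P'" and Q': "assoc_unital_algebra K Q'"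
    and M: "left_hmodule K P M" and N: "left_hmodule K Q N"
    and M': "left_hmodule K P' M'" and N': "left_hmodule K Q' N'"
    and \<phi>: "lin K P P' \<phi>" and \<gamma>: "lin K Q Q' \<gamma>" and f: "lin K M M' f" and g: "lin K N N' g"
    and eqf: "\<And>p u. p \<in> carrier P \<Longrightarrow> u \<in> carrier M \<Longrightarrow> f (lact M p u) = lact M' (\<phi> p) (f u)"
    and eqg: "\<And>q v. q \<in> carrier Q \<Longrightarrow> v \<in> carrier N \<Longrightarrow> g (lact N q v) = lact N' (\<gamma> q) (g v)"
    and p: "p \<in> carrier (tensor_space K P Q)" and t: "t \<in> carrier (tensor_space K M N)"
  shows "tmap K M' N' f g (lact (tens_mod K M N) p t)
    = lact (tens_mod K M' N') (tmap K P' Q' \<phi> \<gamma> p) (tmap K M' N' f g t)"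
proof (rule semilinear_tensor_ext[OF P Q M N left_hmodule_tens_mod[OF P' Q' M' N'] _ _ _ _ p t])
  note mods = mods[OF P Q M N] mods[OF P' Q' M' N']
  show "module K (tensor_algebra K P' Q')" by (simp add: all_strips mods)
  show "lin K (tensor_space K P Q) (tensor_algebra K P' Q') (tmap K P' Q' \<phi> \<gamma>)"
    by (simp add: all_strips mods lin_tmap \<phi> \<gamma>)
  show "lin K (tensor_space K M N) (tens_mod K M' N') (tmap K M' N' f g)"
    by (simp add: all_strips mods lin_tmap f g)
  fix p q u v assume h: "p \<in> carrier P" "q \<in> carrier Q" "u \<in> carrier M" "v \<in> carrier N"
  then show "tmap K M' N' f g (pure K M N (lact M p u) (lact N q v))
      = lact (tens_mod K M' N') (tmap K P' Q' \<phi> \<gamma> (pure K P Q p q)) (tmap K M' N' f g (pure K M N u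
        v))"
    by (simp add: tmap_pure[OF f g] tmap_pure[OF \<phi> \<gamma>] mods lact_tens_mod_pure[OF P' Q' M' N'] eqf
      eqg
      lin_closed[OF f] lin_closed[OF g] lin_closed[OF \<phi>] lin_closed[OF \<gamma>] lact_closed[OF M]
        lact_closed[OF N])
qed

text \<open>This is \<open>semilinear_tmap\<close> for identity maps: if two actions are pulled back along \<open>\<phi>\<close> and
  \<open>\<gamma>\<close>, then their tensor product is pulled back along \<open>\<phi> \<otimes> \<gamma>\<close>. It moves the comultiplication
  out of a diagonal action into the acting element.\<close>

lemma lact_base_change:
  assumes P: "assoc_unital_algebra K P" and Q: "assoc_unital_algebra K Q"
    and P': "assoc_unital_algebra K P'" and Q': "assoc_unital_algebra K Q'"
    and M: "left_hmodule K P M" and N: "left_hmodule K Q N"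
    and M': "left_hmodule K P' M'" and N': "left_hmodule K Q' N'"
    and same: "same_space M M'" "same_space N N'"
    and \<phi>: "lin K P P' \<phi>" and \<gamma>: "lin K Q Q' \<gamma>"
    and eqf: "\<And>p u. p \<in> carrier P \<Longrightarrow> u \<in> carrier M \<Longrightarrow> lact M p u = lact M' (\<phi> p) u"
    and eqg: "\<And>q v. q \<in> carrier Q \<Longrightarrow> v \<in> carrier N \<Longrightarrow> lact N q v = lact N' (\<gamma> q) v"
    and p: "p \<in> carrier (tensor_space K P Q)" and t: "t \<in> carrier (tensor_space K M N)"
  shows "lact (tens_mod K M N) p t = lact (tens_mod K M' N') (tmap K P' Q' \<phi> \<gamma> p) t"
proof -
  note mods = mods[OF P Q M N] mods[OF P' Q' M' N']
  have l: "lin K M M' id" "lin K N N' id"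
    using lin_id[of K M] lin_id[of K N] same_space_lin[OF same_space_refl same(1)] same_space_lin[OF
      same_space_refl same(2)]
    by metis+
  have tm: "tmap K M' N' id id s = s" if "s \<in> carrier (tensor_space K M N)" for s
    by (rule tmap_id) (use that mods same_space_pure(3)[OF same, of K] in simp_all)
  have "tmap K M' N' id id (lact (tens_mod K M N) p t)
    = lact (tens_mod K M' N') (tmap K P' Q' \<phi> \<gamma> p) (tmap K M' N' id id t)"
    by (rule semilinear_tmap[OF P Q P' Q' M N M' N' \<phi> \<gamma> l _ _ p t]) (simp_all add: eqf eqg)
  then show ?thesis using tm t lin_closed[OF lin_lact_tens_mod_right[OF P Q M N p] t] by simp
qed

text \<open>Rebracketing the acting tensor and the tensor acted upon in the same way changes nothing,
  since on pure tensors the three factors act separately.\<close>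

lemma semilinear_rebracket:
  assumes P: "assoc_unital_algebra K P" and Q: "assoc_unital_algebra K Q"
    and R: "assoc_unital_algebra K R"
    and M: "left_hmodule K P M" and N: "left_hmodule K Q N" and L: "left_hmodule K R L"
    and p: "p \<in> carrier (tensor_space K (tensor_space K P Q) R)"
    and t: "t \<in> carrier (tensor_space K (tensor_space K M N) L)"
  shows "rebracket K M N L (lact (tens_mod K (tens_mod K M N) L) p t)
    = lact (tens_mod K M (tens_mod K N L)) (rebracket K P Q R p) (rebracket K M N L t)"
proof -
  note mods = mods[OF P Q M N] mods[OF Q R N L]
  note PQ = assoc_unital_algebra_tensor[OF P Q] and QR = assoc_unital_algebra_tensor[OF Q R]
  note MN = left_hmodule_tens_mod[OF P Q M N] and NL = left_hmodule_tens_mod[OF Q R N L]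
  let ?Z = "tensor_space K M (tensor_space K N L)"
  let ?f = "\<lambda>p t. rebracket K M N L (lact (tens_mod K (tens_mod K M N) L) p t)"
  let ?g = "\<lambda>p t. lact (tens_mod K M (tens_mod K N L)) (rebracket K P Q R p) (rebracket K M N L t)"
  note l1 = lin_lact_tens_mod_left[OF PQ R MN L, unfolded all_strips]
  note l2 = lin_lact_tens_mod_right[OF PQ R MN L, unfolded all_strips]
  note l3 = lin_lact_tens_mod_left[OF P QR M NL, unfolded all_strips]
  note l4 = lin_lact_tens_mod_right[OF P QR M NL, unfolded all_strips]
  have e1: "lact (tens_mod K (tens_mod K M N) L) (pure K (tensor_space K P Q) R s r) (pure K
    (tensor_space K M N) L x w)
    = pure K (tensor_space K M N) L (lact (tens_mod K M N) s x) (lact L r w)"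
    if "s \<in> carrier (tensor_space K P Q)" "r \<in> carrier R" "x \<in> carrier (tensor_space K M N)"
      "w \<in> carrier L" for s r x w
    using lact_tens_mod_pure[OF PQ R MN L, unfolded all_strips, OF that] .
  have e2: "lact (tens_mod K M (tens_mod K N L)) (pure K P (tensor_space K Q R) s r) (pure K M
    (tensor_space K N L) x w)
    = pure K M (tensor_space K N L) (lact M s x) (lact (tens_mod K N L) r w)"
    if "s \<in> carrier P" "r \<in> carrier (tensor_space K Q R)" "x \<in> carrier M" "w \<in> carrier (tensor_space
      K N L)" for s r x w
    using lact_tens_mod_pure[OF P QR M NL, unfolded all_strips, OF that] .
  have 1: "\<forall>p\<in>carrier (tensor_space K (tensor_space K P Q) R).
      ?f p (pure K (tensor_space K M N) L (pure K M N u v) w) = ?g p (pure K (tensor_space K M N) L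
        (pure K M N u v) w)"
    if uvw: "u \<in> carrier M" "v \<in> carrier N" "w \<in> carrier L" for u v w
    by (rule tensor_ext_left3[of K P Q R ?Z])
      ((assumption | rule mods uvw l1 lin_compose[OF l3] tensor_intros)+,
       simp add: e1 e2 lact_tens_mod_pure[OF P Q M N] lact_tens_mod_pure[OF Q R N L] mods
         rebracket_pure pure_closed uvw
         lact_closed[OF M] lact_closed[OF N] lact_closed[OF L])
  have "\<forall>t\<in>carrier (tensor_space K (tensor_space K M N) L). ?f p t = ?g p t"
    by (rule tensor_ext_left3[of K M N L ?Z])
      ((assumption | rule mods p l2 lin_compose[OF l4] tensor_intros 1[rule_format])+)
  then show ?thesis using t by blast
qed

section \<open>Quasi-bialgebras\<close>

locale quasi_setting =
  fixes K :: "('k, 'c) ring_scheme" and H :: "('k, 'u) qba"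
  assumes qb: "quasi_bialgebra K H"
begin

abbreviation HH where "HH \<equiv> tensor_space K H H"
abbreviation HHH where "HHH \<equiv> tensor_space K H HH"
abbreviation HHHH where "HHHH \<equiv> tensor_space K H HHH"
abbreviation H2 where "H2 \<equiv> tensor_algebra K H H"
abbreviation H3 where "H3 \<equiv> tensor_algebra K H H2"
abbreviation H4 where "H4 \<equiv> tensor_algebra K H H3"
abbreviation \<Delta> where "\<Delta> \<equiv> comult H"
abbreviation \<epsilon> where "\<epsilon> \<equiv> counit H"
abbreviation \<Phi> where "\<Phi> \<equiv> reassociator H"
abbreviation \<Phi>' where "\<Phi>' \<equiv> inv\<^bsub>H3\<^esub> \<Phi>"

lemma algH: "assoc_unital_algebra K H"
  using qb by (rule quasi_bialgebra.axioms)
lemma algH2: "assoc_unital_algebra K H2" by (rule assoc_unital_algebra_tensor[OF algH algH])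
lemma algH3: "assoc_unital_algebra K H3" by (rule assoc_unital_algebra_tensor[OF algH algH2])
lemma algH4: "assoc_unital_algebra K H4" by (rule assoc_unital_algebra_tensor[OF algH algH3])

lemma modH: "module K H" "module K HH" "module K HHH" "module K HHHH"
  by (intro module_tensor module_algebra[OF algH])+

lemma cringK: "cring K" using modH(1) by (rule module.axioms)

lemma lin_comult: "lin K H HH \<Delta>"
proof -
  have "\<Delta> \<in> algebra_hom K H H2" by (rule quasi_bialgebra.comult_hom[OF qb])
  then have "lin K H H2 \<Delta>" by (auto simp: algebra_hom_def ring_hom_def lin_def)
  then show ?thesis by (simp add: strips)
qed

lemma comult_mult: "x \<in> carrier H \<Longrightarrow> y \<in> carrier H \<Longrightarrow> \<Delta> (x \<otimes>\<^bsub>H\<^esub> y) = \<Delta> x \<otimes>\<^bsub>H2\<^esub> \<Delta> y"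
  and comult_one: "\<Delta> \<one>\<^bsub>H\<^esub> = \<one>\<^bsub>H2\<^esub>"
  using quasi_bialgebra.comult_hom[OF qb] by (auto simp: algebra_hom_def ring_hom_def)

lemma comult_closed: "h \<in> carrier H \<Longrightarrow> \<Delta> h \<in> carrier HH"
  by (rule lin_closed[OF lin_comult])

lemma counit_closed: "h \<in> carrier H \<Longrightarrow> \<epsilon> h \<in> carrier K"
  and counit_mult: "h \<in> carrier H \<Longrightarrow> h' \<in> carrier H \<Longrightarrow> \<epsilon> (h \<otimes>\<^bsub>H\<^esub> h') = \<epsilon> h \<otimes>\<^bsub>K\<^esub> \<epsilon> h'"
  and counit_add: "h \<in> carrier H \<Longrightarrow> h' \<in> carrier H \<Longrightarrow> \<epsilon> (h \<oplus>\<^bsub>H\<^esub> h') = \<epsilon> h \<oplus>\<^bsub>K\<^esub> \<epsilon> h'"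
  and counit_one: "\<epsilon> \<one>\<^bsub>H\<^esub> = \<one>\<^bsub>K\<^esub>"
  using quasi_bialgebra.counit_ring_hom[OF qb] by (auto simp: ring_hom_def)

lemma lin_counit_smult:
  assumes "module K V" "v \<in> carrier V" "lin K U H (\<lambda>u. f u)"
  shows "lin K U V (\<lambda>u. \<epsilon> (f u) \<odot>\<^bsub>V\<^esub> v)"
proof -
  interpret V: module K V by fact
  have "lin K H V (\<lambda>h. \<epsilon> h \<odot>\<^bsub>V\<^esub> v)"
    using assms(2)
    by (intro linI) (auto simp: counit_closed counit_add V.smult_l_distr
      quasi_bialgebra.counit_smult[OF qb] V.smult_assoc1)
  from lin_compose[OF this assms(3)] show ?thesis .
qed

lemma counit_smult_closed: "module K V \<Longrightarrow> h \<in> carrier H \<Longrightarrow> v \<in> carrier V \<Longrightarrow> \<epsilon> h \<odot>\<^bsub>V\<^esub> v \<in> carrier V"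
  by (simp add: module_smult_closed counit_closed)

lemmas H_intros = algH modH lin_compose[OF lin_comult] comult_closed lin_counit_smult counit_closed
  tensor_intros

lemma bilin_counit:
  assumes "module K V"
  shows "bilin K H V V (\<lambda>h v. \<epsilon> h \<odot>\<^bsub>V\<^esub> v)" "bilin K V H V (\<lambda>v h. \<epsilon> h \<odot>\<^bsub>V\<^esub> v)"
  by (assumption | rule assms H_intros)+

lemma lin_counit_id: "module K V \<Longrightarrow> lin K (tensor_space K H V) V (counit_id H V)"
  and lin_id_counit: "module K V \<Longrightarrow> lin K (tensor_space K V H) V (id_counit V H)"
  unfolding counit_id_def id_counit_def by (intro linear_tlift bilin_counit modH; assumption)+

lemma counit_id_pure: "module K V \<Longrightarrow> h \<in> carrier H \<Longrightarrow> v \<in> carrier V \<Longrightarrow> counit_id H V (pure K H V h v)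
  = \<epsilon> h \<odot>\<^bsub>V\<^esub> v"
  and id_counit_pure: "module K V \<Longrightarrow> h \<in> carrier H \<Longrightarrow> v \<in> carrier V \<Longrightarrow> id_counit V H (pure K V H v h)
    = \<epsilon> h \<odot>\<^bsub>V\<^esub> v"
  unfolding counit_id_def id_counit_def by (simp_all add: tlift_pure[OF bilin_counit(1)]
    tlift_pure[OF bilin_counit(2)] modH)

lemmas H_arg = lin_compose[OF lin_counit_id] lin_compose[OF lin_id_counit]

lemma \<Phi>_unit: "\<Phi> \<in> Units H3" by (rule quasi_bialgebra.reassociator_unit[OF qb])

lemma \<Phi>_closed: "\<Phi> \<in> carrier HHH"
  using \<Phi>_unit by (simp add: Units_def strips)

lemma monoidH3: "monoid H3" using algH3 by (simp add: assoc_unital_algebra_def ring_def)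

lemma \<Phi>'_closed: "\<Phi>' \<in> carrier HHH"
  using monoid.Units_inv_closed[OF monoidH3 \<Phi>_unit] by (simp add: strips)

lemma \<Phi>_inv: "\<Phi> \<otimes>\<^bsub>H3\<^esub> \<Phi>' = \<one>\<^bsub>H3\<^esub>" "\<Phi>' \<otimes>\<^bsub>H3\<^esub> \<Phi> = \<one>\<^bsub>H3\<^esub>"
  using monoid.Units_r_inv[OF monoidH3 \<Phi>_unit] monoid.Units_l_inv[OF monoidH3 \<Phi>_unit] by simp_all

end

section \<open>Multiplicativity of induced maps\<close>

lemma regular_tensor:
  "carrier (regular P) = carrier P" "tensor_space K (regular P) (regular Q) = tensor_space K P Q"
  "tmap K (regular P) (regular Q) = tmap K P Q" "lin K (regular P) (regular Q) = lin K P Q"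
  "tensor_space K (regular P) W = tensor_space K P W" "tensor_space K W (regular P) = tensor_space K
    W P"
  "lin K V (regular P) = lin K V P" "lin K (regular P) V = lin K P V" "pure K (regular P) (regular
    Q) = pure K P Q"
  by (simp_all add: regular_def strips)

text \<open>A multiplicative map is a semilinear map of regular modules, so this is an instance of
  \<open>semilinear_tmap\<close>; in the same way \<open>rebracket_mult\<close> is an instance of
  \<open>semilinear_rebracket\<close>.\<close>

lemma tmap_mult:
  assumes P: "assoc_unital_algebra K P" and Q: "assoc_unital_algebra K Q"
    and P': "assoc_unital_algebra K P'" and Q': "assoc_unital_algebra K Q'"
    and \<phi>: "lin K P P' \<phi>" and \<gamma>: "lin K Q Q' \<gamma>"
    and mult: "\<And>x y. x \<in> carrier P \<Longrightarrow> y \<in> carrier P \<Longrightarrow> \<phi> (x \<otimes>\<^bsub>P\<^esub> y) = \<phi> x \<otimes>\<^bsub>P'\<^esub> \<phi> y"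
      "\<And>x y. x \<in> carrier Q \<Longrightarrow> y \<in> carrier Q \<Longrightarrow> \<gamma> (x \<otimes>\<^bsub>Q\<^esub> y) = \<gamma> x \<otimes>\<^bsub>Q'\<^esub> \<gamma> y"
    and st: "s \<in> carrier (tensor_space K P Q)" "t \<in> carrier (tensor_space K P Q)"
  shows "tmap K P' Q' \<phi> \<gamma> (s \<otimes>\<^bsub>tensor_algebra K P Q\<^esub> t)
    = tmap K P' Q' \<phi> \<gamma> s \<otimes>\<^bsub>tensor_algebra K P' Q'\<^esub> tmap K P' Q' \<phi> \<gamma> t"
proof -
  note reg = left_hmodule_regular[OF P] left_hmodule_regular[OF Q] left_hmodule_regular[OF P']
    left_hmodule_regular[OF Q']
  show ?thesis
    using semilinear_tmap[OF P Q P' Q' reg \<phi> \<gamma>, of \<phi> \<gamma> s t] \<phi> \<gamma> mult st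
    by (simp add: mult_tensor_algebra regular_tensor lact_regular)
qed

lemma rebracket_mult:
  assumes P: "assoc_unital_algebra K P" and Q: "assoc_unital_algebra K Q"
    and R: "assoc_unital_algebra K R"
    and s: "s \<in> carrier (tensor_space K (tensor_space K P Q) R)"
      and t: "t \<in> carrier (tensor_space K (tensor_space K P Q) R)"
  shows "rebracket K P Q R (s \<otimes>\<^bsub>tensor_algebra K (tensor_algebra K P Q) R\<^esub> t)
    = rebracket K P Q R s \<otimes>\<^bsub>tensor_algebra K P (tensor_algebra K Q R)\<^esub> rebracket K P Q R t"
proof -
  note reg = left_hmodule_regular[OF P] left_hmodule_regular[OF Q] left_hmodule_regular[OF R]
  have lr: "lact (regular (tensor_algebra K P Q)) = lact (tens_mod K (regular P) (regular Q))"
    for P Q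
    by (simp add: fun_eq_iff lact_regular mult_tensor_algebra)
  have 1: "tmap K (regular (tensor_algebra K P Q)) (regular R) = tmap K (tensor_space K P Q) R"
    "tmap K (regular P) (regular (tensor_algebra K Q R)) = tmap K P (tensor_space K Q R)" for P Q R
    by (simp_all add: regular_def strips)
  have "lact (tens_mod K (regular (tensor_algebra K P Q)) (regular R)) s t
      = lact (tens_mod K (tens_mod K (regular P) (regular Q)) (regular R)) s t"
    by (simp add: lact_tens_mod lr) (simp add: all_strips regular_def lact_tens_mod)
  moreover have "lact (tens_mod K (regular P) (regular (tensor_algebra K Q R))) s t
      = lact (tens_mod K (regular P) (tens_mod K (regular Q) (regular R))) s t" for s t
    by (simp add: lact_tens_mod lr) (simp add: all_strips regular_def lact_tens_mod)
  moreover have "rebracket K (regular P) (regular Q) (regular R) = rebracket K P Q R"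
    by (simp add: regular_def strips)
  ultimately show ?thesis
    using semilinear_rebracket[OF P Q R reg, of s t] s t
      by (simp add: mult_tensor_algebra regular_tensor)
qed

lemma pure_smult_left:
  "\<lbrakk>module K V; module K W; c \<in> carrier K; v \<in> carrier V; w \<in> carrier W\<rbrakk> \<Longrightarrow>
    pure K V W (c \<odot>\<^bsub>V\<^esub> v) w = c \<odot>\<^bsub>tensor_space K V W\<^esub> pure K V W v w"
  by (rule lin_smult[OF lin_pure_left[OF _ _ _ lin_ident]])

lemma pure_smult_right:
  "\<lbrakk>module K V; module K W; c \<in> carrier K; v \<in> carrier V; w \<in> carrier W\<rbrakk> \<Longrightarrow>
    pure K V W v (c \<odot>\<^bsub>W\<^esub> w) = c \<odot>\<^bsub>tensor_space K V W\<^esub> pure K V W v w"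
  by (rule lin_smult[OF lin_pure_right[OF _ _ _ lin_ident]])

context quasi_setting begin

lemma counit_id_mult:
  assumes V: "assoc_unital_algebra K V" and st: "s \<in> carrier (tensor_space K H V)" "t \<in> carrier
    (tensor_space K H V)"
  shows "counit_id H V (s \<otimes>\<^bsub>tensor_algebra K H V\<^esub> t) = counit_id H V s \<otimes>\<^bsub>V\<^esub> counit_id H V t"
proof -
  interpret V: assoc_unital_algebra K V by fact
  interpret H: assoc_unital_algebra K H by (rule algH)
  have "counit_id H V (lact (tens_mod K (regular H) (regular V)) s t) = lact (regular V) (counit_id
    H V s) (counit_id H V t)"
    by (rule semilinear_tensor_ext[OF algH V left_hmodule_regular[OF algH] left_hmodule_regular[OF
      V]
         left_hmodule_regular[OF V] V.module_axioms lin_counit_id[OF V.module_axioms] _ _ st(1)])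
      (simp_all add: regular_tensor lact_regular lin_counit_id V.module_axioms counit_id_pure
        counit_closed counit_mult
        V.smult_mult_left V.smult_mult_right V.smult_assoc1[symmetric] V.R.m_comm st)
  then show ?thesis by (simp add: mult_tensor_algebra lact_regular)
qed

lemma id_counit_mult:
  assumes V: "assoc_unital_algebra K V" and st: "s \<in> carrier (tensor_space K V H)" "t \<in> carrier
    (tensor_space K V H)"
  shows "id_counit V H (s \<otimes>\<^bsub>tensor_algebra K V H\<^esub> t) = id_counit V H s \<otimes>\<^bsub>V\<^esub> id_counit V H t"
proof -
  interpret V: assoc_unital_algebra K V by fact
  interpret H: assoc_unital_algebra K H by (rule algH)
  have "id_counit V H (lact (tens_mod K (regular V) (regular H)) s t) = lact (regular V) (id_counit
    V H s) (id_counit V H t)"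
    by (rule semilinear_tensor_ext[OF V algH left_hmodule_regular[OF V] left_hmodule_regular[OF
      algH]
         left_hmodule_regular[OF V] V.module_axioms lin_id_counit[OF V.module_axioms] _ _ st(1)])
      (simp_all add: regular_tensor lact_regular lin_id_counit V.module_axioms id_counit_pure
        counit_closed counit_mult
        V.smult_mult_left V.smult_mult_right V.smult_assoc1[symmetric] V.R.m_comm st)
  then show ?thesis by (simp add: mult_tensor_algebra lact_regular)
qed

lemma cocycle:
  "pure K H HHH \<one>\<^bsub>H\<^esub> \<Phi>
     \<otimes>\<^bsub>H4\<^esub> tmap K H HHH id (\<lambda>s. rebracket K H H H (tmap K HH H \<Delta> id s)) \<Phi>
     \<otimes>\<^bsub>H4\<^esub> tmap K H HHH id (rebracket K H H H) (rebracket K H HH H (pure K HHH H \<Phi> \<one>\<^bsub>H\<^esub>))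
   = tmap K H HHH id (tmap K H HH id \<Delta>) \<Phi>
     \<otimes>\<^bsub>H4\<^esub> rebracket K H H HH (tmap K HH HH \<Delta> id \<Phi>)"
  using quasi_bialgebra.cocycle[OF qb] by (simp add: strips)

lemma counit_middle_\<Phi>: "tmap K H H id (counit_id H H) \<Phi> = \<one>\<^bsub>H2\<^esub>"
  using quasi_bialgebra.counit_reassociator[OF qb] by (simp add: one_tensor_algebra)

lemma counit_comult: "h \<in> carrier H \<Longrightarrow> counit_id H H (\<Delta> h) = h" "h \<in> carrier H \<Longrightarrow> id_counit H H (\<Delta> h)
  = h"
  using quasi_bialgebra.counit_left[OF qb] quasi_bialgebra.counit_right[OF qb] by auto

lemma one_H: "\<one>\<^bsub>H\<^esub> \<in> carrier H" by (rule one_closed[OF algH])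

lemma cocycle_factors_closed:
  "pure K H HHH \<one>\<^bsub>H\<^esub> \<Phi> \<in> carrier HHHH"
  "tmap K H HHH id (\<lambda>s. rebracket K H H H (tmap K HH H \<Delta> id s)) \<Phi> \<in> carrier HHHH"
  "tmap K H HHH id (rebracket K H H H) (rebracket K H HH H (pure K HHH H \<Phi> \<one>\<^bsub>H\<^esub>)) \<in> carrier HHHH"
  "tmap K H HHH id (tmap K H HH id \<Delta>) \<Phi> \<in> carrier HHHH"
  "rebracket K H H HH (tmap K HH HH \<Delta> id \<Phi>) \<in> carrier HHHH"
  by (assumption | rule H_intros \<Phi>_closed one_H lin_comult lin_rebracket lin_tmap)+

text \<open>Only the counit in the middle factor of \<open>\<Phi>\<close> is assumed to be trivial. For the left factor,
  the algebra map that applies the counit to the second of the four factors turns the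
  cocycle identity into \<open>(1 \<otimes> (\<epsilon> \<otimes> id \<otimes> id) \<Phi>) \<Phi> = \<Phi>\<close>, and \<open>\<Phi>\<close> can be cancelled.\<close>

lemma counit_left_\<Phi>: "counit_id H HH \<Phi> = \<one>\<^bsub>H2\<^esub>"
proof -
  interpret H: assoc_unital_algebra K H by (rule algH)
  interpret H2: assoc_unital_algebra K H2 by (rule algH2)
  interpret H3: assoc_unital_algebra K H3 by (rule algH3)
  let ?E = "tmap K H HH id (counit_id H HH)"
  have cl: "lin K H H id" "lin K HHH HH (counit_id H HH)"
    by (simp_all add: lin_id lin_counit_id modH module_tensor)
  have E_mult: "?E (s \<otimes>\<^bsub>H4\<^esub> t) = ?E s \<otimes>\<^bsub>H3\<^esub> ?E t" if "s \<in> carrier HHHH" "t \<in> carrier HHHH" for s t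
    using tmap_mult[OF algH algH3 algH algH2, of id "counit_id H HH" s t] that
    by (simp add: strips cl counit_id_mult[OF algH2, unfolded strips])
  have E_closed: "?E s \<in> carrier HHH" if "s \<in> carrier HHHH" for s
    by (assumption | rule that cl tmap_closed modH)+
  have 1: "?E (pure K H HHH \<one>\<^bsub>H\<^esub> \<Phi>) = pure K H HH \<one>\<^bsub>H\<^esub> (counit_id H HH \<Phi>)"
    by (simp add: tmap_pure[OF cl] modH module_tensor \<Phi>_closed)
  have "\<forall>s\<in>carrier HH. counit_id H HH (rebracket K H H H (tmap K HH H \<Delta> id s)) = s"
  proof (rule tensor_ext[of K H H HH])
    fix v w assume vw: "v \<in> carrier H" "w \<in> carrier H"
    have "\<forall>s\<in>carrier HH. counit_id H HH (rebracket K H H H (pure K HH H s w))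
      = pure K H H (counit_id H H s) w"
      by (rule tensor_ext[of K H H HH])
        ((assumption | rule vw H_intros H_arg)+, simp add: rebracket_pure counit_id_pure modH
          module_tensor vw pure_closed
           pure_smult_left counit_closed)
    then show "counit_id H HH (rebracket K H H H (tmap K HH H \<Delta> id (pure K H H v w)))
      = pure K H H v w"
      using vw by (simp add: tmap_pure[OF lin_comult lin_id] modH module_tensor comult_closed
        counit_comult)
  qed (assumption | rule H_intros H_arg lin_comult)+
  note A = this
  have 2: "?E (tmap K H HHH id (\<lambda>s. rebracket K H H H (tmap K HH H \<Delta> id s)) \<Phi>) = \<Phi>"
    by (rule HOL.trans[OF tmap_tmap[of _ K H HH H HHH] tmap_id];
      (assumption | rule H_intros cl lin_comult \<Phi>_closed | simp add: A)+)
  have "\<forall>p\<in>carrier HHH. ?E (tmap K H HHH id (rebracket K H H H) (rebracket K H HH H (pure K HHH H p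
    \<one>\<^bsub>H\<^esub>)))
     = rebracket K H H H (pure K HH H (tmap K H H id (counit_id H H) p) \<one>\<^bsub>H\<^esub>)"
    by (rule tensor_ext_right3[of K H H H HHH])
      ((assumption | rule one_H H_intros cl lin_rebracket lin_counit_id)+,
       simp add: tmap_pure[OF cl] tmap_pure[OF lin_id lin_rebracket] tmap_pure[OF lin_id
         lin_counit_id] rebracket_pure counit_id_pure one_H modH module_tensor pure_closed
         counit_smult_closed pure_smult_left counit_closed)
  then have 3: "?E (tmap K H HHH id (rebracket K H H H) (rebracket K H HH H (pure K HHH H \<Phi> \<one>\<^bsub>H\<^esub>)))
    = \<one>\<^bsub>H3\<^esub>"
    by (simp add: \<Phi>_closed counit_middle_\<Phi> one_tensor_algebra rebracket_pure modH module_tensor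
      one_H strips)
  have "\<forall>s\<in>carrier HH. counit_id H HH (tmap K H HH id \<Delta> s) = \<Delta> (counit_id H H s)"
    by (rule tensor_ext[of K H H HH])
      ((assumption | rule H_intros H_arg lin_comult)+, simp add: tmap_pure[OF lin_id lin_comult]
        counit_id_pure modH module_tensor comult_closed
         lin_smult[OF lin_comult] counit_closed)
  note A = this
  have "?E (tmap K H HHH id (tmap K H HH id \<Delta>) \<Phi>) = tmap K H HH id (\<lambda>s. \<Delta> (counit_id H H s)) \<Phi>"
    by (rule HOL.trans[OF tmap_tmap[of _ K H HH H HHH] tmap_cong[of _ K H HH]];
      (assumption | rule H_intros cl lin_comult lin_tmap \<Phi>_closed | simp add: A)+)
  also have "\<dots> = tmap K H HH id \<Delta> (tmap K H H id (counit_id H H) \<Phi>)"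
    by (rule HOL.sym, rule HOL.trans[OF tmap_tmap[of _ K H HH H H] tmap_cong[of _ K H HH]];
      (assumption | rule H_intros lin_counit_id lin_comult \<Phi>_closed | simp)+)
  also have "\<dots> = \<one>\<^bsub>H3\<^esub>"
    by (simp add: counit_middle_\<Phi> one_tensor_algebra tmap_pure[OF lin_id lin_comult] modH
      module_tensor one_H comult_one strips)
  finally have 4: "?E (tmap K H HHH id (tmap K H HH id \<Delta>) \<Phi>) = \<one>\<^bsub>H3\<^esub>" .
  have "\<forall>p\<in>carrier HHH. ?E (rebracket K H H HH (tmap K HH HH \<Delta> id p)) = p"
  proof (rule tensor_ext[of K H HH HHH])
    fix v w assume vw: "v \<in> carrier H" "w \<in> carrier HH"
    have "\<forall>s\<in>carrier HH. ?E (rebracket K H H HH (pure K HH HH s w)) = pure K H HH (id_counit H H s)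
      w"
      by (rule tensor_ext[of K H H HHH])
        ((assumption | rule vw H_intros H_arg cl)+, simp add: rebracket_pure counit_id_pure
          id_counit_pure tmap_pure[OF cl] modH module_tensor vw pure_closed
           pure_smult_left pure_smult_right counit_closed)
    then show "?E (rebracket K H H HH (tmap K HH HH \<Delta> id (pure K H HH v w))) = pure K H HH v w"
      using vw by (simp add: tmap_pure[OF lin_comult lin_id] modH module_tensor comult_closed
        counit_comult)
  qed (assumption | rule H_intros H_arg lin_comult cl)+
  then have 5: "?E (rebracket K H H HH (tmap K HH HH \<Delta> id \<Phi>)) = \<Phi>" by (simp add: \<Phi>_closed)
  let ?x = "pure K H HH \<one>\<^bsub>H\<^esub> (counit_id H HH \<Phi>)"
  have xcl: "?x \<in> carrier H3" "\<Phi> \<in> carrier H3"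
    using \<Phi>_closed lin_closed[OF cl(2)] by (simp_all add: strips pure_closed modH module_tensor
      one_H)
  \<comment> \<open>The five factors of the cocycle identity have become \<open>?x\<close>, \<open>\<Phi>\<close>, \<open>1\<close> and \<open>1\<close>, \<open>\<Phi>\<close>.\<close>
  have "?x \<otimes>\<^bsub>H3\<^esub> \<Phi> = \<Phi>"
    using arg_cong[OF cocycle, of ?E] cocycle_factors_closed xcl mult_closed[OF algH4]
    by (simp add: E_mult 1 2 3 4 5 strips H3.l_one[unfolded strips] H3.r_one[unfolded strips]
      mult_closed[OF algH3, unfolded strips])
  then have "?x \<otimes>\<^bsub>H3\<^esub> (\<Phi> \<otimes>\<^bsub>H3\<^esub> \<Phi>') = \<Phi> \<otimes>\<^bsub>H3\<^esub> \<Phi>'"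
    using xcl \<Phi>'_closed by (simp add: H3.m_assoc[symmetric] strips)
  then have "?x = \<one>\<^bsub>H3\<^esub>" using xcl by (simp add: \<Phi>_inv)
  then have "counit_id H HH ?x = counit_id H HH \<one>\<^bsub>H3\<^esub>" by simp
  then show ?thesis
    using lin_closed[OF cl(2) \<Phi>_closed] H2.one_closed
    by (simp add: one_tensor_algebra counit_id_pure modH module_tensor one_H counit_one strips
      pure_closed module.smult_one)
qed

text \<open>The counit in the third of the four factors turns the cocycle identity into
  \<open>\<Phi> ((id \<otimes> id \<otimes> \<epsilon>) \<Phi> \<otimes> 1) = \<Phi>\<close>.\<close>

lemma counit_right_\<Phi>: "tmap K H H id (id_counit H H) \<Phi> = \<one>\<^bsub>H2\<^esub>"
proof -
  interpret H: assoc_unital_algebra K H by (rule algH)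
  interpret H3: assoc_unital_algebra K H3 by (rule algH3)
  let ?F = "tmap K H H id (counit_id H H)"
  let ?E = "tmap K H HH id ?F"
  have lc: "lin K HH H (counit_id H H)" "lin K HH H (id_counit H H)"
    by (simp_all add: lin_id_counit lin_counit_id modH module_tensor)
  have cl: "lin K H H id" "lin K HHH HH ?F" by (simp_all add: lin_id lin_tmap lc modH module_tensor)
  have F_mult: "?F (s \<otimes>\<^bsub>H3\<^esub> t) = ?F s \<otimes>\<^bsub>H2\<^esub> ?F t" if "s \<in> carrier HHH" "t \<in> carrier HHH" for s t
    using tmap_mult[OF algH algH2 algH algH, of id "counit_id H H" s t] that
    by (simp add: strips lin_id lc counit_id_mult[OF algH, unfolded strips])
  have E_mult: "?E (s \<otimes>\<^bsub>H4\<^esub> t) = ?E s \<otimes>\<^bsub>H3\<^esub> ?E t" if "s \<in> carrier HHHH" "t \<in> carrier HHHH" for s t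
    using tmap_mult[OF algH algH3 algH algH2, of id ?F s t] that
    by (simp add: strips cl F_mult)
  have 1: "?E (pure K H HHH \<one>\<^bsub>H\<^esub> \<Phi>) = \<one>\<^bsub>H3\<^esub>"
    by (simp add: tmap_pure[OF cl] modH module_tensor \<Phi>_closed counit_middle_\<Phi> one_tensor_algebra
      strips)
  have "\<forall>s\<in>carrier HH. ?F (rebracket K H H H (tmap K HH H \<Delta> id s)) = s"
  proof (rule tensor_ext[of K H H HH])
    fix v w assume vw: "v \<in> carrier H" "w \<in> carrier H"
    have "\<forall>s\<in>carrier HH. ?F (rebracket K H H H (pure K HH H s w)) = pure K H H (id_counit H H s) w"
      by (rule tensor_ext[of K H H HH])
        ((assumption | rule vw lc H_intros H_arg)+, simp add: rebracket_pure counit_id_pure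
          id_counit_pure tmap_pure[OF lin_id lc(1)] modH module_tensor vw pure_closed
           pure_smult_left pure_smult_right counit_closed)
    then show "?F (rebracket K H H H (tmap K HH H \<Delta> id (pure K H H v w))) = pure K H H v w"
      using vw by (simp add: tmap_pure[OF lin_comult lin_id] modH module_tensor comult_closed
        counit_comult)
  qed (assumption | rule lc H_intros H_arg lin_comult)+
  note A = this
  have 2: "?E (tmap K H HHH id (\<lambda>s. rebracket K H H H (tmap K HH H \<Delta> id s)) \<Phi>) = \<Phi>"
    by (rule HOL.trans[OF tmap_tmap[of _ K H HH H HHH] tmap_id];
      (assumption | rule cl lc H_intros lin_comult \<Phi>_closed | simp add: A)+)
  let ?k = "\<lambda>s. tmap K H HH id (\<lambda>h. pure K H H h \<one>\<^bsub>H\<^esub>) s"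
  have lk: "lin K H HH (\<lambda>h. pure K H H h \<one>\<^bsub>H\<^esub>)" by (assumption | rule H_intros one_H)+
  have "\<forall>p\<in>carrier HHH. ?E (tmap K H HHH id (rebracket K H H H) (rebracket K H HH H (pure K HHH H p
    \<one>\<^bsub>H\<^esub>)))
     = ?k (tmap K H H id (id_counit H H) p)"
    by (rule tensor_ext_right3[of K H H H HHH])
      ((assumption | rule one_H cl lc lk H_intros lin_rebracket)+,
       simp add: tmap_pure[OF cl] tmap_pure[OF lin_id lin_rebracket] tmap_pure[OF lin_id lc(1)]
         tmap_pure[OF lin_id lc(2)] tmap_pure[OF lin_id lk]
         rebracket_pure counit_id_pure id_counit_pure one_H modH module_tensor pure_closed
           counit_smult_closed counit_closed,
       simp add: pure_smult_left pure_smult_right one_H modH module_tensor pure_closed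
         counit_closed)
  then have 3: "?E (tmap K H HHH id (rebracket K H H H) (rebracket K H HH H (pure K HHH H \<Phi> \<one>\<^bsub>H\<^esub>)))
      = ?k (tmap K H H id (id_counit H H) \<Phi>)"
    by (simp add: \<Phi>_closed)
  have "\<forall>s\<in>carrier HH. ?F (tmap K H HH id \<Delta> s) = s"
    by (rule tensor_ext[of K H H HH])
      ((assumption | rule lc H_intros H_arg lin_comult)+, simp add: tmap_pure[OF lin_id lin_comult]
        tmap_pure[OF lin_id lc(1)] modH module_tensor comult_closed counit_comult)
  note A = this
  have 4: "?E (tmap K H HHH id (tmap K H HH id \<Delta>) \<Phi>) = \<Phi>"
    by (rule HOL.trans[OF tmap_tmap[of _ K H HH H HHH] tmap_id];
      (assumption | rule cl lc H_intros lin_comult lin_tmap \<Phi>_closed | simp add: A)+)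
  have "\<forall>p\<in>carrier HHH. ?E (rebracket K H H HH (tmap K HH HH \<Delta> id p)) = rebracket K H H H (tmap K HH
    H \<Delta> id (?F p))"
  proof (rule tensor_ext[of K H HH HHH])
    fix v w assume vw: "v \<in> carrier H" "w \<in> carrier HH"
    have "\<forall>s\<in>carrier HH. ?E (rebracket K H H HH (pure K HH HH s w)) = rebracket K H H H (pure K HH H
      s (counit_id H H w))"
      by (rule tensor_ext[of K H H HHH])
        ((assumption | rule vw cl lc lin_closed[OF lc(1)] H_intros H_arg)+, simp add: rebracket_pure
          tmap_pure[OF lin_id lc(1)] tmap_pure[OF cl] modH module_tensor vw pure_closed
          lin_closed[OF lc(1)])
    then show "?E (rebracket K H H HH (tmap K HH HH \<Delta> id (pure K H HH v w)))
        = rebracket K H H H (tmap K HH H \<Delta> id (?F (pure K H HH v w)))"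
      using vw by (simp add: tmap_pure[OF lin_comult lin_id] tmap_pure[OF lin_id lc(1)] modH
        module_tensor comult_closed lin_closed[OF lc(1)])
  qed (assumption | rule cl lc H_intros H_arg lin_comult)+
  then have 5: "?E (rebracket K H H HH (tmap K HH HH \<Delta> id \<Phi>)) = \<one>\<^bsub>H3\<^esub>"
    by (simp add: \<Phi>_closed counit_middle_\<Phi> one_tensor_algebra tmap_pure[OF lin_comult lin_id] modH
      module_tensor one_H comult_one rebracket_pure strips)
  let ?y = "tmap K H H id (id_counit H H) \<Phi>"
  have ycl: "?y \<in> carrier HH" by (assumption | rule H_intros lc \<Phi>_closed)+
  have "?k ?y \<in> carrier HHH" by (assumption | rule ycl lk H_intros)+
  then have kcl: "?k ?y \<in> carrier H3" "\<Phi> \<in> carrier H3"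
    using \<Phi>_closed by (simp_all add: strips)
  \<comment> \<open>The five factors of the cocycle identity have become \<open>1\<close>, \<open>\<Phi>\<close>, \<open>?k ?y\<close> and \<open>\<Phi>\<close>, \<open>1\<close>.\<close>
  have "\<Phi> \<otimes>\<^bsub>H3\<^esub> ?k ?y = \<Phi>"
    using arg_cong[OF cocycle, of ?E] cocycle_factors_closed kcl mult_closed[OF algH4]
    by (simp add: E_mult 1 2 3 4 5 strips H3.l_one[unfolded strips] H3.r_one[unfolded strips]
      mult_closed[OF algH3, unfolded strips])
  then have "(\<Phi>' \<otimes>\<^bsub>H3\<^esub> \<Phi>) \<otimes>\<^bsub>H3\<^esub> ?k ?y = \<Phi>' \<otimes>\<^bsub>H3\<^esub> \<Phi>"
    using kcl \<Phi>'_closed by (simp add: H3.m_assoc strips)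
  then have "?k ?y = \<one>\<^bsub>H3\<^esub>" using kcl by (simp add: \<Phi>_inv)
  then have "tmap K H H id (id_counit H H) (?k ?y) = tmap K H H id (id_counit H H) \<one>\<^bsub>H3\<^esub>" by simp
  moreover have "tmap K H H id (id_counit H H) (?k ?y) = ?y"
    by (rule HOL.trans[OF tmap_tmap[OF ycl modH(1,1,1,2,1,1) lin_id lk lin_id lc(2)] tmap_id[OF
      modH(1,1) ycl]])
      (simp_all add: id_counit_pure modH one_H counit_one module.smult_one[OF modH(1)])
  ultimately show ?thesis
    by (simp add: one_tensor_algebra tmap_pure[OF lin_id lc(2)] id_counit_pure modH module_tensor
      one_H counit_one strips pure_closed)
qed

end

lemma same_space_tensor_left: "same_space (tensor_left K H M N) (tensor_space K M N)"
  unfolding tensor_left_def by (rule same_space_wrappers)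

lemma tensor_left_fields:
  "carrier (tensor_left K H M N) = carrier (tensor_space K M N)"
  "zero (tensor_left K H M N) = zero (tensor_space K M N)"
  "add (tensor_left K H M N) = add (tensor_space K M N)"
  "smult (tensor_left K H M N) = smult (tensor_space K M N)"
  using same_space_tensor_left[of K H M N] by (simp_all add: same_space_def)

lemmas strip_tensor_left = tensor_left_fields
  same_space_tensor_left[THEN same_space_pure(2)[OF _ same_space_refl]]
  same_space_tensor_left[THEN same_space_pure(2)[OF same_space_refl]]
  same_space_tensor_left[THEN same_space_pure(3)[OF _ same_space_refl]]
  same_space_tensor_left[THEN same_space_pure(3)[OF same_space_refl]]
  same_space_tensor_left[THEN same_space_tlift]
  same_space_tensor_left[THEN same_space_lin[OF _ same_space_refl]]
  same_space_tensor_left[THEN same_space_lin[OF same_space_refl]]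
  same_space_tensor_left[THEN same_space_module]

lemma strip_tensor_left_maps:
  "tmap K (tensor_left K H M N) W = tmap K (tensor_space K M N) W"
  "tmap K V (tensor_left K H M N) = tmap K V (tensor_space K M N)"
  "rebracket K (tensor_left K H M N) V W = rebracket K (tensor_space K M N) V W"
  "rebracket K U (tensor_left K H M N) W = rebracket K U (tensor_space K M N) W"
  "rebracket K U V (tensor_left K H M N) = rebracket K U V (tensor_space K M N)"
  by (simp_all add: tensor_left_def strips)

lemmas diag_strips = all_strips strip_tensor_left strip_tensor_left_maps

lemma lact_pure:
  assumes P: "assoc_unital_algebra K P" and Q: "assoc_unital_algebra K Q"
    and M: "left_hmodule K P M" and N: "left_hmodule K Q N"
    and pq: "p \<in> carrier P" "q \<in> carrier Q" and t: "t \<in> carrier (tensor_space K M N)"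
  shows "lact (tens_mod K M N) (pure K P Q p q) t = tmap K M N (lact M p) (lact N q) t"
proof -
  have b: "bilin K P Q (tensor_space K M N) (\<lambda>p1 p2. tmap K M N (lact M p1) (lact N p2) t)"
    by (assumption | rule P Q M N mods[OF P Q M N] tensor_intros t)+
  show ?thesis using pq by (simp add: lact_tens_mod tlift_pure[OF b] mods[OF P Q M N])
qed

text \<open>The threefold action is the action of a tensor algebra on an iterated tensor product of
  modules, so the semilinearity lemmas apply to associativity constraints.\<close>

lemma lact3_eq:
  assumes P: "assoc_unital_algebra K P" and L: "left_hmodule K P U" "left_hmodule K P V"
    "left_hmodule K P W"
    and p: "p \<in> carrier (tensor_space K P (tensor_space K P P))"
      and t: "t \<in> carrier (tensor_space K U (tensor_space K V W))"
  shows "lact3 K U V W p t = lact (tens_mod K U (tens_mod K V W)) p t"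
proof -
  note M = L[THEN module_left_hmodule] and mP = module_algebra[OF P]
  let ?VW = "tensor_space K V W" and ?T = "tensor_space K U (tensor_space K V W)"
  have inner: "\<forall>t\<in>carrier ?T. tlift ?T (\<lambda>p2 p3. tmap K U ?VW (lact U p1) (tmap K V W (lact V p2)
    (lact W p3)) t) s
      = tmap K U ?VW (lact U p1) (lact (tens_mod K V W) s) t"
    if p1: "p1 \<in> carrier P" and s: "s \<in> carrier (tensor_space K P P)" for p1 s
  proof (rule tensor_ext[of K U ?VW ?T])
    have l1: "lin K U U (lact U p1)" by (assumption | rule p1 L tensor_intros)+
    have l2: "lin K ?VW ?VW (lact (tens_mod K V W) s)"
      by (rule lin_lact_tens_mod_right[OF P P L(2,3) s])
    have l3: "lin K ?VW ?VW (tmap K V W (lact V p2) (lact W p3))"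
      if "p2 \<in> carrier P" "p3 \<in> carrier P" for p2 p3
      using that by - (assumption | rule M L tensor_intros lin_tmap)+
    show "lin K ?T ?T (tmap K U ?VW (lact U p1) (lact (tens_mod K V W) s))"
      by (assumption | rule lin_tmap M module_tensor l1 l2)+
    show "lin K ?T ?T (\<lambda>t. tlift ?T (\<lambda>p2 p3. tmap K U ?VW (lact U p1) (tmap K V W (lact V p2) (lact
      W p3)) t) s)"
      by (assumption | rule s M mP p1 L tensor_intros lin_tmap_arg)+
    fix u r assume ur: "u \<in> carrier U" "r \<in> carrier ?VW"
    have "tmap K U ?VW (lact U p1) (lact (tens_mod K V W) s) (pure K U ?VW u r)
       = pure K U ?VW (lact U p1 u) (tlift ?VW (\<lambda>p2 p3. tmap K V W (lact V p2) (lact W p3) r) s)"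
      using ur by (simp add: tmap_pure[OF l1 l2] M module_tensor) (simp add: lact_tens_mod)
    also have "\<dots> = tlift ?T (\<lambda>p2 p3. pure K U ?VW (lact U p1 u) (tmap K V W (lact V p2) (lact W p3)
      r)) s"
      by (rule linear_apply_tlift[where f = "pure K U ?VW (lact U p1 u)" and V = P and W = P])
        (assumption | rule s M mP ur p1 L tensor_intros)+
    also have "\<dots> = tlift ?T (\<lambda>p2 p3. tmap K U ?VW (lact U p1) (tmap K V W (lact V p2) (lact W p3))
      (pure K U ?VW u r)) s"
      by (rule tlift_cong[OF s mP mP]) (simp add: tmap_pure[OF l1 l3] ur M module_tensor)
    finally show "tlift ?T (\<lambda>p2 p3. tmap K U ?VW (lact U p1) (tmap K V W (lact V p2) (lact W p3))
      (pure K U ?VW u r)) s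
       = tmap K U ?VW (lact U p1) (lact (tens_mod K V W) s) (pure K U ?VW u r)" ..
  qed (use M in \<open>simp_all add: module_tensor\<close>)
  show ?thesis
    unfolding lact3_def tlift3_def lact_tens_mod[of K U]
    by (simp add: all_strips, rule tlift_cong[OF p mP module_tensor[OF mP mP]]) (simp add: inner t)
qed

context quasi_setting begin

section \<open>The category of left modules\<close>

abbreviation tprod where "tprod \<equiv> tensor_left K H"
abbreviation C where "C \<equiv> left_mod_cat K H"
abbreviation lmod where "lmod \<equiv> left_hmodule K H"

lemma lmod_module: "lmod M \<Longrightarrow> module K M"
  by (rule module_left_hmodule)

lemma lact_tprod: "h \<in> carrier H \<Longrightarrow> t \<in> carrier (tensor_space K M N) \<Longrightarrow> lact (tprod M N) h t
  = lact (tens_mod K M N) (\<Delta> h) t"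
  by (simp add: tensor_left_def wrapper_fields diag_lact_def lact_tens_mod)

lemma tens2: "lmod M \<Longrightarrow> lmod N \<Longrightarrow> left_hmodule K H2 (tens_mod K M N)"
  by (rule left_hmodule_tens_mod[OF algH algH])

lemma lmod_tprod: assumes "lmod M" "lmod N" shows "lmod (tprod M N)"
proof -
  interpret L: left_hmodule K H2 "tens_mod K M N" using assms by (rule tens2)
  have mods: "module K (tensor_space K M N)" using assms by (intro module_tensor lmod_module)
  show ?thesis
  proof (rule left_hmoduleI)
    show "module K (tprod M N)" using mods by (simp add: diag_strips)
    note ll = tens2[OF assms]
    show "lin K H (tprod M N) (\<lambda>h. lact (tprod M N) h u)" if "u \<in> carrier (tprod M N)" for u
    proof (rule lin_cong)
      show "lin K H (tprod M N) (\<lambda>h. lact (tens_mod K M N) (\<Delta> h) u)"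
        using lin_lact_left[OF ll _ lin_comult[folded wrapper_strips]] that
        using lin_lact_left[OF ll, of u H \<Delta>] lin_comult by (simp add: diag_strips)
    qed (use that in \<open>simp_all add: diag_strips lact_tprod modH\<close>)
    show "lin K (tprod M N) (tprod M N) (\<lambda>u. lact (tprod M N) h u)" if "h \<in> carrier H" for h
    proof (rule lin_cong)
      show "lin K (tprod M N) (tprod M N) (\<lambda>u. lact (tens_mod K M N) (\<Delta> h) u)"
        using lin_lact_right[OF ll, of "\<Delta> h", OF _ lin_ident] that
          by (simp add: diag_strips comult_closed)
    qed (use that mods in \<open>simp_all add: diag_strips lact_tprod\<close>)
    fix h h' u assume h: "h \<in> carrier H" "h' \<in> carrier H" and u: "u \<in> carrier (tprod M N)"
    then show "lact (tprod M N) (h \<otimes>\<^bsub>H\<^esub> h') u = lact (tprod M N) h (lact (tprod M N) h' u)"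
      using L.lact_mult[of "\<Delta> h" "\<Delta> h'" u] L.lact_closed[of "\<Delta> h'" u]
      by (simp add: diag_strips lact_tprod mult_closed[OF algH] comult_closed comult_mult)
  next
    fix u assume "u \<in> carrier (tprod M N)"
    then show "lact (tprod M N) \<one>\<^bsub>H\<^esub> u = u"
      using L.lact_one[of u] by (simp add: diag_strips lact_tprod one_H comult_one)
  qed
qed

lemma C_fields:
  "Obj C = {M. lmod M}" "Dom C = source" "Cod C = target"
  "Ident C M = Arrow M (\<lambda>x\<in>carrier M. x) M"
  "g \<bullet>\<^bsub>C\<^esub> f = Arrow (source f) (compose (carrier (source f)) (fn g) (fn f)) (target g)"
  "TensObj C = tprod"
  "f \<star>\<^bsub>C\<^esub> g = Arrow (tprod (source f) (source g))
     (\<lambda>t\<in>carrier (tprod (source f) (source g)). tmap K (target f) (target g) (fn f) (fn g) t) (tprod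
       (target f) (target g))"
  "Unit C = unit_left_mod K H"
  "Assoc C U V W = Arrow (tprod (tprod U V) W)
     (\<lambda>t\<in>carrier (tprod (tprod U V) W). lact3 K U V W \<Phi> (rebracket K U V W t)) (tprod U (tprod V
       W))"
  "LUnit C U = Arrow (tprod (unit_left_mod K H) U)
     (\<lambda>t\<in>carrier (tprod (unit_left_mod K H) U). tlift U (\<lambda>x u. scalar_of x \<odot>\<^bsub>U\<^esub> u) t) U"
  "RUnit C U = Arrow (tprod U (unit_left_mod K H))
     (\<lambda>t\<in>carrier (tprod U (unit_left_mod K H)). tlift U (\<lambda>u x. scalar_of x \<odot>\<^bsub>U\<^esub> u) t) U"
  by (simp_all add: left_mod_cat_def module_monoidal_def)

lemma hom_iff: "f \<in> Hom C U V \<longleftrightarrow> lmod U \<and> lmod V \<and> source f = U \<and> target f = V \<and>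
   fn f \<in> extensional (carrier U) \<and> lin K U V (fn f) \<and>
   (\<forall>h\<in>carrier H. \<forall>u\<in>carrier U. fn f (lact U h u) = lact V h (fn f u))"
  by (auto simp: Hom_def left_mod_cat_def module_monoidal_def linear_maps_def lin_def PiE_def
    Pi_def)

lemma hom_arrowI:
  assumes "lmod U" "lmod V" "lin K U V g"
    and "\<And>h u. h \<in> carrier H \<Longrightarrow> u \<in> carrier U \<Longrightarrow> g (lact U h u) = lact V h (g u)"
  shows "Arrow U (\<lambda>t\<in>carrier U. g t) V \<in> Hom C U V"
  using assms lin_cong[of U "\<lambda>t\<in>carrier U. g t" g K V] lmod_module
  by (auto simp: hom_iff left_hmodule.lact_closed)

lemma homD:
  assumes "f \<in> Hom C U V"
  shows "lmod U" "lmod V" "source f = U" "target f = V" "lin K U V (fn f)"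
    "\<And>x. x \<in> carrier U \<Longrightarrow> fn f x \<in> carrier V" "module K U" "module K V"
  using assms by (auto simp: hom_iff lin_closed lmod_module)

text \<open>Arrows are extensional on the carrier of their source, so equality there suffices.\<close>

lemma hom_eqI:
  assumes "f \<in> Hom C U V" "g \<in> Hom C U V" "\<forall>x\<in>carrier U. fn f x = fn g x"
  shows "f = g"
  using assms by (cases f; cases g) (auto simp: hom_iff intro: extensionalityI)

lemma fn_comp: "x \<in> carrier (source f) \<Longrightarrow> fn (g \<bullet>\<^bsub>C\<^esub> f) x = fn g (fn f x)"
  by (simp add: C_fields compose_def)

lemma fn_ident: "x \<in> carrier U \<Longrightarrow> fn (Ident C U) x = x"
  by (simp add: C_fields)

lemma source_target:
  "source (g \<bullet>\<^bsub>C\<^esub> f) = source f" "target (g \<bullet>\<^bsub>C\<^esub> f) = target g"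
  "source (Ident C U) = U" "target (Ident C U) = U"
  "source (f \<star>\<^bsub>C\<^esub> g) = tprod (source f) (source g)" "target (f \<star>\<^bsub>C\<^esub> g) = tprod (target f) (target
    g)"
  "source (Assoc C U V W) = tprod (tprod U V) W" "target (Assoc C U V W) = tprod U (tprod V W)"
  by (simp_all add: C_fields)

lemma fn_tens: "t \<in> carrier (tensor_space K (source f) (source g)) \<Longrightarrow>
    fn (f \<star>\<^bsub>C\<^esub> g) t = tmap K (target f) (target g) (fn f) (fn g) t"
  by (simp add: C_fields diag_strips)

lemma fn_tens_pure:
  assumes "f \<in> Hom C U U'" "g \<in> Hom C V V'" "u \<in> carrier U" "v \<in> carrier V"
  shows "fn (f \<star>\<^bsub>C\<^esub> g) (pure K U V u v) = pure K U' V' (fn f u) (fn g v)"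
  using assms homD[OF assms(1)] homD[OF assms(2)]
  by (simp add: fn_tens pure_closed tmap_pure[OF homD(5)[OF assms(1)] homD(5)[OF assms(2)]])

lemma c_ident_hom: "U \<in> Obj C \<Longrightarrow> Ident C U \<in> Hom C U U"
  by (simp add: C_fields hom_arrowI lin_ident)

lemma c_comp_hom: "\<lbrakk>f \<in> Hom C U V; g \<in> Hom C V W\<rbrakk> \<Longrightarrow> g \<bullet>\<^bsub>C\<^esub> f \<in> Hom C U W"
proof -
  assume f: "f \<in> Hom C U V" and g: "g \<in> Hom C V W"
  have "g \<bullet>\<^bsub>C\<^esub> f = Arrow U (\<lambda>x\<in>carrier U. fn g (fn f x)) W"
    using f g by (simp add: C_fields compose_def hom_iff)
  also have "\<dots> \<in> Hom C U W"
    using f g by (intro hom_arrowI) (auto simp: hom_iff lin_closed intro: lin_compose)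
  finally show ?thesis .
qed

lemma c_tens_hom:
  assumes f: "f \<in> Hom C U U'" and g: "g \<in> Hom C V V'"
  shows "f \<star>\<^bsub>C\<^esub> g \<in> Hom C (U \<diamondop>\<^bsub>C\<^esub> V) (U' \<diamondop>\<^bsub>C\<^esub> V')"
proof -
  note F = homD[OF f] and G = homD[OF g]
  have "f \<star>\<^bsub>C\<^esub> g = Arrow (tprod U V) (\<lambda>t\<in>carrier (tprod U V). tmap K U' V' (fn f) (fn g) t) (tprod
    U' V')"
    using F G by (simp add: C_fields)
  also have "\<dots> \<in> Hom C (tprod U V) (tprod U' V')"
  proof (rule hom_arrowI)
    show "lin K (tprod U V) (tprod U' V') (tmap K U' V' (fn f) (fn g))"
      using F G by (simp add: diag_strips lin_tmap)
    fix h t assume h: "h \<in> carrier H" and t: "t \<in> carrier (tprod U V)"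
    have "tmap K U' V' (fn f) (fn g) (lact (tens_mod K U V) (\<Delta> h) t)
        = lact (tens_mod K U' V') (tmap K H H id id (\<Delta> h)) (tmap K U' V' (fn f) (fn g) t)"
      by (rule semilinear_tmap[OF algH algH algH algH F(1) G(1) F(2) G(2) lin_id lin_id F(5) G(5)])
        (use f g h t in \<open>auto simp: hom_iff diag_strips comult_closed\<close>)
    then show "tmap K U' V' (fn f) (fn g) (lact (tprod U V) h t) = lact (tprod U' V') h (tmap K U'
      V' (fn f) (fn g) t)"
      using h t F G by (simp add: diag_strips lact_tprod tmap_id[OF modH(1,1)] comult_closed
        tmap_closed[OF _ F(7) G(7) F(8) G(8) F(5) G(5)])
  qed (use F G in \<open>simp_all add: lmod_tprod\<close>)
  finally show ?thesis by (simp add: C_fields)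
qed

lemma hom_tensor_eqI:
  assumes f: "f \<in> Hom C (tprod U V) Z" and g: "g \<in> Hom C (tprod U V) Z" and "lmod U" "lmod V"
    and "\<And>u v. u \<in> carrier U \<Longrightarrow> v \<in> carrier V \<Longrightarrow> fn f (pure K U V u v) = fn g (pure K U V u v)"
  shows "f = g"
proof (rule hom_eqI[OF f g])
  have "\<forall>x\<in>carrier (tensor_space K U V). fn f x = fn g x"
    using assms homD(5,8)[OF f] homD(5)[OF g] by (intro tensor_ext) (auto simp: lmod_module
      diag_strips)
  then show "\<forall>x\<in>carrier (tprod U V). fn f x = fn g x" by (simp add: diag_strips)
qed

lemma hom_tensor3_eqI:
  assumes f: "f \<in> Hom C (tprod (tprod U V) W) Z" and g: "g \<in> Hom C (tprod (tprod U V) W) Z"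
    and "lmod U" "lmod V" "lmod W"
    and "\<And>u v w. u \<in> carrier U \<Longrightarrow> v \<in> carrier V \<Longrightarrow> w \<in> carrier W \<Longrightarrow>
      fn f (pure K (tensor_space K U V) W (pure K U V u v) w) = fn g (pure K (tensor_space K U V) W
        (pure K U V u v) w)"
  shows "f = g"
proof (rule hom_eqI[OF f g])
  have "\<forall>x\<in>carrier (tensor_space K (tensor_space K U V) W). fn f x = fn g x"
    using assms homD(5,8)[OF f] homD(5)[OF g] by (intro tensor_ext_left3) (auto simp: lmod_module
      diag_strips)
  then show "\<forall>x\<in>carrier (tprod (tprod U V) W). fn f x = fn g x" by (simp add: diag_strips)
qed

text \<open>The set-theoretic inverse of a bijective module map is again a module map. It is the only
  two-sided inverse, so the definite description in \<open>inv_arr\<close> denotes it.\<close>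

lemma iso_inverses:
  assumes f: "f \<in> Hom C U V" and b: "bij_betw (fn f) (carrier U) (carrier V)"
  shows "inverses C f (inv_arr C f)"
proof -
  let ?i = "inv_into (carrier U) (fn f)"
  note F = homD[OF f]
  have r: "?i y \<in> carrier U" "fn f (?i y) = y" if "y \<in> carrier V" for y
    using b that by (auto simp: bij_betw_def inv_into_into f_inv_into_f)
  have l: "?i (fn f x) = x" if "x \<in> carrier U" for x
    using b that by (auto simp: bij_betw_def inv_into_f_f)
  interpret U: module K U by (rule F)
  interpret V: module K V by (rule F)
  have add: "?i (x \<oplus>\<^bsub>V\<^esub> y) = ?i x \<oplus>\<^bsub>U\<^esub> ?i y" if "x \<in> carrier V" "y \<in> carrier V" for x y
    using l[of "?i x \<oplus>\<^bsub>U\<^esub> ?i y"] r that lin_add[OF F(5), of "?i x" "?i y"] by simp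
  have smult: "?i (c \<odot>\<^bsub>V\<^esub> x) = c \<odot>\<^bsub>U\<^esub> ?i x" if "c \<in> carrier K" "x \<in> carrier V" for c x
    using l[of "c \<odot>\<^bsub>U\<^esub> ?i x"] r that lin_smult[OF F(5), of c "?i x"] by simp
  have act: "?i (lact V h x) = lact U h (?i x)" if "h \<in> carrier H" "x \<in> carrier V" for h x
    using l[of "lact U h (?i x)"] r that f F(1) by (simp add: hom_iff left_hmodule.lact_closed)
  let ?g = "Arrow V (\<lambda>y\<in>carrier V. ?i y) U"
  have g: "?g \<in> Hom C V U"
    using F by (intro hom_arrowI linI) (simp_all add: r add smult act)
  have inv: "inverses C f ?g"
  proof -
    have "?g \<bullet>\<^bsub>C\<^esub> f = Ident C U"
      by (rule hom_eqI[OF c_comp_hom[OF f g] c_ident_hom])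
        (use F in \<open>auto simp: C_fields(1) fn_comp l fn_ident lin_closed\<close>)
    moreover have "f \<bullet>\<^bsub>C\<^esub> ?g = Ident C V"
      by (rule hom_eqI[OF c_comp_hom[OF g f] c_ident_hom])
        (use F in \<open>auto simp: C_fields(1) fn_comp r fn_ident\<close>)
    ultimately show ?thesis using f g F by (auto simp: inverses_def C_fields(2,3)) (simp add:
      Hom_def)
  qed
  moreover have "g' = ?g" if "inverses C f g'" for g'
  proof -
    have g': "g' \<in> Hom C V U" "g' \<bullet>\<^bsub>C\<^esub> f = Ident C U"
      using that F by (auto simp: inverses_def C_fields(2,3))
    show ?thesis
    proof (rule hom_eqI[OF g'(1) g], safe)
      fix y assume y: "y \<in> carrier V"
      then have "fn g' (fn f (?i y)) = ?i y"
        using fn_comp[of "?i y" f g'] g'(2) r(1)[OF y] F(3) fn_ident[of "?i y" U] by metis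
      then show "fn g' y = fn ?g y" using r y by simp
    qed
  qed
  ultimately show ?thesis unfolding inv_arr_def by (rule theI)
qed

lemma inv_arr_hom:
  assumes f: "f \<in> Hom C U V" and b: "bij_betw (fn f) (carrier U) (carrier V)"
  shows "inv_arr C f \<in> Hom C V U"
  using iso_inverses[OF assms] homD[OF f] by (simp add: inverses_def C_fields(2,3))

lemma inv_arr_apply:
  assumes f: "f \<in> Hom C U V" and b: "bij_betw (fn f) (carrier U) (carrier V)" and x: "x \<in> carrier U"
  shows "fn (inv_arr C f) (fn f x) = x"
proof -
  have "inv_arr C f \<bullet>\<^bsub>C\<^esub> f = Ident C U"
    using iso_inverses[OF f b] homD[OF f] by (simp add: inverses_def C_fields(2,3))
  then show ?thesis using fn_comp[of x f "inv_arr C f"] x homD[OF f] by (simp add: fn_ident)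
qed

section \<open>The associativity constraint\<close>

lemma tens3: "lmod U \<Longrightarrow> lmod V \<Longrightarrow> lmod W \<Longrightarrow> left_hmodule K H3 (tens_mod K U (tens_mod K V W))"
  by (intro left_hmodule_tens_mod[OF algH algH2] tens2)

lemma tens3': "lmod U \<Longrightarrow> lmod V \<Longrightarrow> lmod W \<Longrightarrow> left_hmodule K (tensor_algebra K H2 H) (tens_mod K
  (tens_mod K U V) W)"
  by (intro left_hmodule_tens_mod[OF algH2 algH] tens2)

text \<open>In a tensor product with a factor \<open>U \<otimes> V\<close>, the diagonal action on that factor is the
  action of \<open>H \<otimes> H\<close> after the comultiplication.\<close>

lemma lact_diag_left:
  assumes "lmod U" "lmod V" and Q: "assoc_unital_algebra K Q" and N: "left_hmodule K Q N"
    and p: "p \<in> carrier (tensor_space K H Q)" and t: "t \<in> carrier (tensor_space K (tensor_space K U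
      V) N)"
  shows "lact (tens_mod K (tprod U V) N) p t = lact (tens_mod K (tens_mod K U V) N) (tmap K HH Q \<Delta>
    id p) t"
proof -
  have "lact (tens_mod K (tprod U V) N) p t = lact (tens_mod K (tens_mod K U V) N) (tmap K H2 Q \<Delta> id
    p) t"
    by (rule lact_base_change[OF algH Q algH2 Q lmod_tprod[OF assms(1,2)] N tens2[OF assms(1,2)] N])
      (use p t in \<open>simp_all add: diag_strips same_space_def lin_comult lin_id lact_tprod\<close>)
  then show ?thesis by (simp add: diag_strips)
qed

lemma lact_diag_right:
  assumes P: "assoc_unital_algebra K P" and M: "left_hmodule K P M" and "lmod V" "lmod W"
    and p: "p \<in> carrier (tensor_space K P H)" and t: "t \<in> carrier (tensor_space K M (tensor_space K
      V W))"
  shows "lact (tens_mod K M (tprod V W)) p t = lact (tens_mod K M (tens_mod K V W)) (tmap K P HH id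
    \<Delta> p) t"
proof -
  have "lact (tens_mod K M (tprod V W)) p t = lact (tens_mod K M (tens_mod K V W)) (tmap K P H2 id \<Delta>
    p) t"
    by (rule lact_base_change[OF P algH P algH2 M lmod_tprod[OF assms(3,4)] M tens2[OF assms(3,4)]])
      (use p t in \<open>simp_all add: diag_strips same_space_def lin_comult lin_id lact_tprod\<close>)
  then show ?thesis by (simp add: diag_strips)
qed

abbreviation act3 where "act3 U V W \<equiv> lact (tens_mod K U (tens_mod K V W))"

lemma act3_closed:
  assumes "lmod U" "lmod V" "lmod W" "p \<in> carrier HHH" "t \<in> carrier (tensor_space K U (tensor_space
    K V W))"
  shows "act3 U V W p t \<in> carrier (tensor_space K U (tensor_space K V W))"
  using left_hmodule.lact_closed[OF tens3[OF assms(1-3)], of p t] assms by (simp add: diag_strips)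

lemma act3_mult:
  assumes "lmod U" "lmod V" "lmod W" "p \<in> carrier HHH" "q \<in> carrier HHH" "t \<in> carrier (tensor_space
    K U (tensor_space K V W))"
  shows "act3 U V W (p \<otimes>\<^bsub>H3\<^esub> q) t = act3 U V W p (act3 U V W q t)"
  using left_hmodule.lact_mult[OF tens3[OF assms(1-3)], of p q t] assms by (simp add: diag_strips)

lemma act3_one:
  assumes "lmod U" "lmod V" "lmod W" "t \<in> carrier (tensor_space K U (tensor_space K V W))"
  shows "act3 U V W \<one>\<^bsub>H3\<^esub> t = t"
  using left_hmodule.lact_one[OF tens3[OF assms(1-3)], of t] assms by (simp add: diag_strips)

lemma lin_act3:
  assumes "lmod U" "lmod V" "lmod W" "p \<in> carrier HHH"
  shows "lin K (tensor_space K U (tensor_space K V W)) (tensor_space K U (tensor_space K V W)) (act3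
    U V W p)"
  using lin_lact_right[OF tens3[OF assms(1-3)], of p, OF _ lin_ident] assms
    by (simp add: diag_strips)

lemma fn_assoc:
  assumes "lmod U" "lmod V" "lmod W" and t: "t \<in> carrier (tensor_space K (tensor_space K U V) W)"
  shows "fn (Assoc C U V W) t = act3 U V W \<Phi> (rebracket K U V W t)"
  using assms by (simp add: C_fields diag_strips lact3_eq[OF algH] \<Phi>_closed rebracket_closed
    lmod_module)

lemma quasi_coassoc:
  assumes h: "h \<in> carrier H"
  shows "\<Phi> \<otimes>\<^bsub>H3\<^esub> rebracket K H H H (tmap K HH H \<Delta> id (\<Delta> h)) = tmap K H HH id \<Delta> (\<Delta> h) \<otimes>\<^bsub>H3\<^esub> \<Phi>"
proof -
  interpret H3: assoc_unital_algebra K H3 by (rule algH3)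
  let ?r = "rebracket K H H H (tmap K HH H \<Delta> id (\<Delta> h))"
  have r: "?r \<in> carrier H3" unfolding strips by (assumption | rule h lin_comult H_intros)+
  have "tmap K H HH id \<Delta> (\<Delta> h) = \<Phi> \<otimes>\<^bsub>H3\<^esub> ?r \<otimes>\<^bsub>H3\<^esub> \<Phi>'"
    using quasi_bialgebra.quasi_coassoc[OF qb h] by (simp add: strips)
  moreover have "\<Phi> \<in> carrier H3" "\<Phi>' \<in> carrier H3" using \<Phi>_closed \<Phi>'_closed
    by (simp_all add: strips)
  ultimately show ?thesis using r by (simp add: H3.m_assoc \<Phi>_inv)
qed

text \<open>Rebracketing intertwines the diagonal action on \<open>(U \<otimes> V) \<otimes> W\<close> with the action of the
  rebracketed \<open>(\<Delta> \<otimes> id) \<Delta>(h)\<close>, and quasi-coassociativity moves the latter across \<open>\<Phi>\<close>, where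
  it becomes \<open>(id \<otimes> \<Delta>) \<Delta>(h)\<close>, that is, the diagonal action on \<open>U \<otimes> (V \<otimes> W)\<close>.\<close>

lemma assoc_arr_hom:
  assumes L: "lmod U" "lmod V" "lmod W"
  shows "Assoc C U V W \<in> Hom C (tprod (tprod U V) W) (tprod U (tprod V W))"
proof -
  note M = L[THEN lmod_module]
  let ?r = "rebracket K U V W" and ?T = "tensor_space K (tensor_space K U V) W"
  have eq: "Assoc C U V W = Arrow (tprod (tprod U V) W) (\<lambda>t\<in>carrier (tprod (tprod U V) W). act3 U V
    W \<Phi> (?r t)) (tprod U (tprod V W))"
    using fn_assoc[OF L] by (simp add: C_fields diag_strips cong: restrict_cong)
  show ?thesis unfolding eq
  proof (rule hom_arrowI)
    show "lin K (tprod (tprod U V) W) (tprod U (tprod V W)) (\<lambda>t. act3 U V W \<Phi> (?r t))"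
      using M lin_compose[OF lin_act3[OF L \<Phi>_closed] lin_rebracket] by (simp add: diag_strips)
    fix h t assume h: "h \<in> carrier H" and "t \<in> carrier (tprod (tprod U V) W)"
    then have t: "t \<in> carrier ?T" by (simp add: diag_strips)
    have rt: "?r t \<in> carrier (tensor_space K U (tensor_space K V W))" using t M
      by (intro rebracket_closed)
    let ?d = "tmap K HH H \<Delta> id (\<Delta> h)"
    have d: "?d \<in> carrier (tensor_space K HH H)" by (assumption | rule h lin_comult H_intros)+
    have rd: "rebracket K H H H ?d \<in> carrier HHH" using d by (intro rebracket_closed modH)
    have dd: "tmap K H HH id \<Delta> (\<Delta> h) \<in> carrier HHH" by (assumption | rule h lin_comult H_intros)+
    have "?r (lact (tprod (tprod U V) W) h t) = ?r (lact (tens_mod K (tens_mod K U V) W) ?d t)"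
      using h t lact_diag_left[OF L(1,2) algH L(3), of "\<Delta> h" t]
        by (simp add: lact_tprod diag_strips comult_closed)
    also have "\<dots> = act3 U V W (rebracket K H H H ?d) (?r t)"
      by (rule semilinear_rebracket[OF algH algH algH L]) (use d t in simp_all)
    finally have "act3 U V W \<Phi> (?r (lact (tprod (tprod U V) W) h t)) = act3 U V W (\<Phi> \<otimes>\<^bsub>H3\<^esub> rebracket
      K H H H ?d) (?r t)"
      using rt rd \<Phi>_closed by (simp add: act3_mult[OF L])
    also have "\<dots> = act3 U V W (tmap K H HH id \<Delta> (\<Delta> h)) (act3 U V W \<Phi> (?r t))"
      using rt dd \<Phi>_closed by (simp add: quasi_coassoc[OF h] act3_mult[OF L])
    also have "\<dots> = lact (tprod U (tprod V W)) h (act3 U V W \<Phi> (?r t))"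
      using h rt lact_diag_right[OF algH L, of "\<Delta> h"] act3_closed[OF L \<Phi>_closed rt]
        by (simp add: lact_tprod diag_strips comult_closed)
    finally show "act3 U V W \<Phi> (?r (lact (tprod (tprod U V) W) h t)) = lact (tprod U (tprod V W)) h
      (act3 U V W \<Phi> (?r t))" .
  qed (use L in \<open>simp_all add: lmod_tprod\<close>)
qed

lemma assoc_bij:
  assumes L: "lmod U" "lmod V" "lmod W"
  shows "bij_betw (fn (Assoc C U V W)) (carrier (tprod (tprod U V) W)) (carrier (tprod U (tprod V
    W)))"
proof (rule bij_betw_byWitness[where f' = "\<lambda>s. unbracket K U V W (act3 U V W \<Phi>' s)"])
  note M = L[THEN lmod_module]
  let ?T = "tensor_space K (tensor_space K U V) W" and ?T' = "tensor_space K U (tensor_space K V W)"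
  have inv: "act3 U V W \<Phi> (act3 U V W \<Phi>' s) = s" "act3 U V W \<Phi>' (act3 U V W \<Phi> s) = s"
    if "s \<in> carrier ?T'" for s
    using act3_mult[OF L \<Phi>_closed \<Phi>'_closed that] act3_mult[OF L \<Phi>'_closed \<Phi>_closed that]
      act3_one[OF L that]
    by (simp_all add: \<Phi>_inv)
  have cl: "unbracket K U V W s \<in> carrier ?T" if "s \<in> carrier ?T'" for s
    using lin_closed[OF lin_unbracket that] M by simp
  show "\<forall>a\<in>carrier (tprod (tprod U V) W). unbracket K U V W (act3 U V W \<Phi>' (fn (Assoc C U V W) a))
    = a"
    using unbracket_rebracket[OF M] M by (simp add: diag_strips fn_assoc[OF L] inv rebracket_closed)
  show "\<forall>a'\<in>carrier (tprod U (tprod V W)). fn (Assoc C U V W) (unbracket K U V W (act3 U V W \<Phi>' a'))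
    = a'"
    using rebracket_unbracket[OF M] cl act3_closed[OF L \<Phi>'_closed]
      by (simp add: diag_strips fn_assoc[OF L] inv)
  show "fn (Assoc C U V W) ` carrier (tprod (tprod U V) W) \<subseteq> carrier (tprod U (tprod V W))"
    using homD(6)[OF assoc_arr_hom[OF L]] by blast
  show "(\<lambda>s. unbracket K U V W (act3 U V W \<Phi>' s)) ` carrier (tprod U (tprod V W)) \<subseteq> carrier (tprod
    (tprod U V) W)"
    using cl act3_closed[OF L \<Phi>'_closed] by (auto simp: diag_strips)
qed

section \<open>The unit object\<close>

abbreviation I where "I \<equiv> unit_left_mod K H"

lemma I_fields:
  "carrier I = Scal ` carrier K" "zero I = Scal \<zero>\<^bsub>K\<^esub>"
  "x \<oplus>\<^bsub>I\<^esub> y = Scal (scalar_of x \<oplus>\<^bsub>K\<^esub> scalar_of y)" "c \<odot>\<^bsub>I\<^esub> x = Scal (c \<otimes>\<^bsub>K\<^esub> scalar_of x)"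
  "lact I h x = Scal (\<epsilon> h \<otimes>\<^bsub>K\<^esub> scalar_of x)"
  by (simp_all add: unit_left_mod_def with_lact_def scalars_def)

lemma scalar_of_closed: "x \<in> carrier I \<Longrightarrow> scalar_of x \<in> carrier K"
  by (auto simp: I_fields)

lemma lmod_I: "lmod I"
proof -
  interpret K: cring K by (rule cringK)
  have "abelian_group I"
  proof (rule abelian_groupI)
    fix x assume "x \<in> carrier I"
    then obtain a where "a \<in> carrier K" "x = Scal a" by (auto simp: I_fields)
    then show "\<exists>y\<in>carrier I. y \<oplus>\<^bsub>I\<^esub> x = \<zero>\<^bsub>I\<^esub>"
      by (intro bexI[of _ "Scal (\<ominus>\<^bsub>K\<^esub> a)"]) (auto simp: I_fields K.l_neg)
  qed (auto simp: I_fields K.a_ac)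
  then have "module K I"
    by (intro moduleI cringK) (auto simp: I_fields K.l_distr K.r_distr K.m_assoc)
  then show ?thesis
    by (rule left_hmoduleI)
      (auto simp: I_fields lin_def counit_closed counit_add counit_mult counit_one
        K.l_distr K.r_distr K.m_ac quasi_bialgebra.counit_smult[OF qb])
qed

lemma bilin_scale:
  assumes "module K U"
  shows "bilin K I U U (\<lambda>x u. scalar_of x \<odot>\<^bsub>U\<^esub> u)" "bilin K U I U (\<lambda>u x. scalar_of x \<odot>\<^bsub>U\<^esub> u)"
proof -
  interpret U: module K U by fact
  have "lin K U U (\<lambda>u. scalar_of x \<odot>\<^bsub>U\<^esub> u)" if "x \<in> carrier I" for x
    using that assms by (intro lin_smult_right lin_ident) (auto simp: scalar_of_closed)
  moreover have "lin K I U (\<lambda>x. scalar_of x \<odot>\<^bsub>U\<^esub> u)" if "u \<in> carrier U" for u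
    using that by (intro linI) (auto simp: I_fields U.smult_l_distr U.smult_assoc1)
  ultimately show "bilin K I U U (\<lambda>x u. scalar_of x \<odot>\<^bsub>U\<^esub> u)" "bilin K U I U (\<lambda>u x. scalar_of x \<odot>\<^bsub>U\<^esub>
    u)"
    by (auto intro: bilinI)
qed

lemma modI: "module K I" by (rule lmod_module[OF lmod_I])

lemma fn_lunit: "t \<in> carrier (tensor_space K I U) \<Longrightarrow> fn (LUnit C U) t = tlift U (\<lambda>x u. scalar_of x
  \<odot>\<^bsub>U\<^esub> u) t"
  and fn_runit: "t \<in> carrier (tensor_space K U I) \<Longrightarrow> fn (RUnit C U) t = tlift U (\<lambda>u x. scalar_of x
    \<odot>\<^bsub>U\<^esub> u) t"
  by (simp_all add: C_fields diag_strips)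

lemma fn_lunit_pure: "module K U \<Longrightarrow> x \<in> carrier I \<Longrightarrow> u \<in> carrier U \<Longrightarrow> fn (LUnit C U) (pure K I U x u)
  = scalar_of x \<odot>\<^bsub>U\<^esub> u"
  and fn_runit_pure: "module K U \<Longrightarrow> x \<in> carrier I \<Longrightarrow> u \<in> carrier U \<Longrightarrow> fn (RUnit C U) (pure K U I u x)
    = scalar_of x \<odot>\<^bsub>U\<^esub> u"
  by (simp_all add: fn_lunit fn_runit pure_closed modI tlift_pure[OF bilin_scale(1)] tlift_pure[OF
    bilin_scale(2)])

lemma lin_lunit: "module K U \<Longrightarrow> lin K (tensor_space K I U) U (fn (LUnit C U))"
  and lin_runit: "module K U \<Longrightarrow> lin K (tensor_space K U I) U (fn (RUnit C U))"
  using linear_tlift[OF bilin_scale(1) modI] linear_tlift[OF bilin_scale(2) _ modI]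
  by (auto intro!: lin_cong[OF _ _ linear_tlift[OF bilin_scale(1)]] lin_cong[OF _ _ linear_tlift[OF
    bilin_scale(2)]]
     simp: fn_lunit fn_runit module_tensor modI)

text \<open>The counit describes the action on the unit object, so a unit constraint turns the action
  of a tensor \<open>p\<close> into the action of \<open>p\<close> with one factor contracted by the counit. For
  \<open>p = \<Delta>(h)\<close> this makes the constraint a module map, and for \<open>\<Phi>\<close> it yields the triangle.\<close>

lemma lunit_semilinear:
  assumes U: "lmod U" and p: "p \<in> carrier HH" and t: "t \<in> carrier (tensor_space K I U)"
  shows "fn (LUnit C U) (lact (tens_mod K I U) p t) = lact U (counit_id H H p) (fn (LUnit C U) t)"
proof (rule semilinear_tensor_ext[OF algH algH lmod_I U U modH(1) lin_counit_id[OF modH(1)]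
  lin_lunit[OF lmod_module[OF U]] _ p t])
  interpret U: left_hmodule K H U by (rule U)
  fix p q x u assume h: "p \<in> carrier H" "q \<in> carrier H" "x \<in> carrier I" "u \<in> carrier U"
  then have "fn (LUnit C U) (pure K I U (lact I p x) (lact U q u)) = (\<epsilon> p \<otimes>\<^bsub>K\<^esub> scalar_of x) \<odot>\<^bsub>U\<^esub>
    lact U q u"
    using lact_closed[OF lmod_I, of p x] by (simp add: fn_lunit_pure U.module_axioms U.lact_closed)
      (simp add: I_fields)
  also have "\<dots> = lact U (counit_id H H (pure K H H p q)) (fn (LUnit C U) (pure K I U x u))"
    using h by (simp add: counit_id_pure modH fn_lunit_pure U.module_axioms U.lact_smult_left
      U.lact_smult_right
      counit_closed scalar_of_closed U.smult_assoc1 U.lact_closed)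
  finally show "fn (LUnit C U) (pure K I U (lact I p x) (lact U q u)) = lact U (counit_id H H (pure
    K H H p q)) (fn (LUnit C U) (pure K I U x u))" .
qed

lemma runit_semilinear:
  assumes U: "lmod U" and p: "p \<in> carrier HH" and t: "t \<in> carrier (tensor_space K U I)"
  shows "fn (RUnit C U) (lact (tens_mod K U I) p t) = lact U (id_counit H H p) (fn (RUnit C U) t)"
proof (rule semilinear_tensor_ext[OF algH algH U lmod_I U modH(1) lin_id_counit[OF modH(1)]
  lin_runit[OF lmod_module[OF U]] _ p t])
  interpret U: left_hmodule K H U by (rule U)
  fix p q u x assume h: "p \<in> carrier H" "q \<in> carrier H" "u \<in> carrier U" "x \<in> carrier I"
  then have "fn (RUnit C U) (pure K U I (lact U p u) (lact I q x)) = (\<epsilon> q \<otimes>\<^bsub>K\<^esub> scalar_of x) \<odot>\<^bsub>U\<^esub>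
    lact U p u"
    using lact_closed[OF lmod_I, of q x] by (simp add: fn_runit_pure U.module_axioms U.lact_closed)
      (simp add: I_fields)
  also have "\<dots> = lact U (id_counit H H (pure K H H p q)) (fn (RUnit C U) (pure K U I u x))"
    using h by (simp add: id_counit_pure modH fn_runit_pure U.module_axioms U.lact_smult_left
      U.lact_smult_right
      counit_closed scalar_of_closed U.smult_assoc1 U.lact_closed)
  finally show "fn (RUnit C U) (pure K U I (lact U p u) (lact I q x)) = lact U (id_counit H H (pure
    K H H p q)) (fn (RUnit C U) (pure K U I u x))" .
qed

lemma lunit_arr_hom: "lmod U \<Longrightarrow> LUnit C U \<in> Hom C (tprod I U) U"
proof -
  assume U: "lmod U"
  have eq: "LUnit C U = Arrow (tprod I U) (\<lambda>t\<in>carrier (tprod I U). fn (LUnit C U) t) U"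
    by (simp add: C_fields restrict_def fun_eq_iff)
  show ?thesis
    by (subst eq, rule hom_arrowI)
      (use U in \<open>simp_all add: lmod_tprod lmod_I diag_strips lin_lunit lmod_module lact_tprod
        lunit_semilinear comult_closed counit_comult\<close>)
qed

lemma runit_arr_hom: "lmod U \<Longrightarrow> RUnit C U \<in> Hom C (tprod U I) U"
proof -
  assume U: "lmod U"
  have eq: "RUnit C U = Arrow (tprod U I) (\<lambda>t\<in>carrier (tprod U I). fn (RUnit C U) t) U"
    by (simp add: C_fields restrict_def fun_eq_iff)
  show ?thesis
    by (subst eq, rule hom_arrowI)
      (use U in \<open>simp_all add: lmod_tprod lmod_I diag_strips lin_runit lmod_module lact_tprod
        runit_semilinear comult_closed counit_comult\<close>)
qed

lemma one_I: "Scal \<one>\<^bsub>K\<^esub> \<in> carrier I"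
proof -
  interpret K: cring K by (rule cringK)
  show ?thesis by (simp add: I_fields)
qed

lemma scale_one_I: "x \<in> carrier I \<Longrightarrow> scalar_of x \<odot>\<^bsub>I\<^esub> Scal \<one>\<^bsub>K\<^esub> = x"
proof -
  interpret K: cring K by (rule cringK)
  show "x \<in> carrier I \<Longrightarrow> ?thesis" by (auto simp: I_fields)
qed

lemma lunit_bij:
  assumes U: "lmod U" shows "bij_betw (fn (LUnit C U)) (carrier (tprod I U)) (carrier U)"
proof (rule bij_betw_byWitness[where f' = "\<lambda>u. pure K I U (Scal \<one>\<^bsub>K\<^esub>) u"])
  note M = lmod_module[OF U]
  have "\<forall>t\<in>carrier (tensor_space K I U). pure K I U (Scal \<one>\<^bsub>K\<^esub>) (fn (LUnit C U) t) = t"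
    by (rule tensor_ext[of K I U "tensor_space K I U"])
      (use M in \<open>simp_all add: modI module_tensor lin_ident lin_pure_right one_I lin_lunit
        fn_lunit_pure pure_smult_right
        pure_smult_left[symmetric] scalar_of_closed scale_one_I\<close>)
  then show "\<forall>t\<in>carrier (tprod I U). pure K I U (Scal \<one>\<^bsub>K\<^esub>) (fn (LUnit C U) t) = t"
    by (simp add: diag_strips)
  show "\<forall>u\<in>carrier U. fn (LUnit C U) (pure K I U (Scal \<one>\<^bsub>K\<^esub>) u) = u"
    using M by (simp add: fn_lunit_pure one_I module.smult_one)
  show "fn (LUnit C U) ` carrier (tprod I U) \<subseteq> carrier U" using homD(6)[OF lunit_arr_hom[OF U]]
    by blast
  show "pure K I U (Scal \<one>\<^bsub>K\<^esub>) ` carrier U \<subseteq> carrier (tprod I U)"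
    using M by (auto simp: diag_strips pure_closed modI one_I)
qed

lemma runit_bij:
  assumes U: "lmod U" shows "bij_betw (fn (RUnit C U)) (carrier (tprod U I)) (carrier U)"
proof (rule bij_betw_byWitness[where f' = "\<lambda>u. pure K U I u (Scal \<one>\<^bsub>K\<^esub>)"])
  note M = lmod_module[OF U]
  have "\<forall>t\<in>carrier (tensor_space K U I). pure K U I (fn (RUnit C U) t) (Scal \<one>\<^bsub>K\<^esub>) = t"
    by (rule tensor_ext[of K U I "tensor_space K U I"])
      (use M in \<open>simp_all add: modI module_tensor lin_ident lin_pure_left one_I lin_runit
        fn_runit_pure pure_smult_left
        pure_smult_right[symmetric] scalar_of_closed scale_one_I\<close>)
  then show "\<forall>t\<in>carrier (tprod U I). pure K U I (fn (RUnit C U) t) (Scal \<one>\<^bsub>K\<^esub>) = t"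
    by (simp add: diag_strips)
  show "\<forall>u\<in>carrier U. fn (RUnit C U) (pure K U I u (Scal \<one>\<^bsub>K\<^esub>)) = u"
    using M by (simp add: fn_runit_pure one_I module.smult_one)
  show "fn (RUnit C U) ` carrier (tprod U I) \<subseteq> carrier U" using homD(6)[OF runit_arr_hom[OF U]]
    by blast
  show "(\<lambda>u. pure K U I u (Scal \<one>\<^bsub>K\<^esub>)) ` carrier U \<subseteq> carrier (tprod U I)"
    using M by (auto simp: diag_strips pure_closed modI one_I)
qed

lemma iso_arrI: "f \<in> Hom C U V \<Longrightarrow> bij_betw (fn f) (carrier U) (carrier V) \<Longrightarrow> iso_arr C f"
  unfolding iso_arr_def using iso_inverses by blast

lemma arrows_source_target:
  "source (LUnit C U) = tprod I U" "target (LUnit C U) = U" "source (RUnit C U) = tprod U I"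
    "target (RUnit C U) = U"
  by (simp_all add: C_fields)

section \<open>Naturality and coherence\<close>

lemma c_ident: "lmod U \<Longrightarrow> Ident C U \<in> Hom C U U"
  using c_ident_hom by (simp add: C_fields(1))

lemma tens_arr_hom: "f \<in> Hom C U U' \<Longrightarrow> g \<in> Hom C V V' \<Longrightarrow> f \<star>\<^bsub>C\<^esub> g \<in> Hom C (tprod U V) (tprod U' V')"
  using c_tens_hom by (simp add: C_fields(6))

lemma c_tens_ident:
  assumes "lmod U" "lmod V" shows "Ident C U \<star>\<^bsub>C\<^esub> Ident C V = Ident C (tprod U V)"
proof (rule hom_tensor_eqI[OF tens_arr_hom[OF c_ident c_ident] c_ident])
  fix u v assume "u \<in> carrier U" "v \<in> carrier V"
  then show "fn (Ident C U \<star>\<^bsub>C\<^esub> Ident C V) (pure K U V u v) = fn (Ident C (tprod U V)) (pure K U V u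
    v)"
    using assms by (simp add: fn_tens_pure[OF c_ident c_ident] fn_ident diag_strips pure_closed
      lmod_module)
qed (use assms in \<open>simp_all add: lmod_tprod\<close>)

lemma c_tens_comp:
  assumes f: "f \<in> Hom C U U'" and f': "f' \<in> Hom C U' U''"
    and g: "g \<in> Hom C V V'" and g': "g' \<in> Hom C V' V''"
  shows "(f' \<bullet>\<^bsub>C\<^esub> f) \<star>\<^bsub>C\<^esub> (g' \<bullet>\<^bsub>C\<^esub> g) = (f' \<star>\<^bsub>C\<^esub> g') \<bullet>\<^bsub>C\<^esub> (f \<star>\<^bsub>C\<^esub> g)"
proof (rule hom_tensor_eqI[OF tens_arr_hom[OF c_comp_hom[OF f f'] c_comp_hom[OF g g']]
      c_comp_hom[OF tens_arr_hom[OF f g] tens_arr_hom[OF f' g']]])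
  note F = homD[OF f] homD[OF g]
  show "lmod U" "lmod V" by (rule F)+
  fix u v assume "u \<in> carrier U" "v \<in> carrier V"
  then show "fn ((f' \<bullet>\<^bsub>C\<^esub> f) \<star>\<^bsub>C\<^esub> (g' \<bullet>\<^bsub>C\<^esub> g)) (pure K U V u v)
    = fn ((f' \<star>\<^bsub>C\<^esub> g') \<bullet>\<^bsub>C\<^esub> (f \<star>\<^bsub>C\<^esub> g)) (pure K U V u v)"
    using F by (simp add: fn_tens_pure[OF c_comp_hom[OF f f'] c_comp_hom[OF g g']] fn_comp
      source_target diag_strips pure_closed
      fn_tens_pure[OF f g] fn_tens_pure[OF f' g'])
qed

text \<open>A tensor product of module maps commutes with the componentwise action of \<open>\<Phi>\<close> and with
  rebracketing.\<close>

lemma c_assoc_natural: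
  assumes f: "f \<in> Hom C U U'" and g: "g \<in> Hom C V V'" and h: "h \<in> Hom C W W'"
  shows "Assoc C U' V' W' \<bullet>\<^bsub>C\<^esub> (f \<star>\<^bsub>C\<^esub> g \<star>\<^bsub>C\<^esub> h) = (f \<star>\<^bsub>C\<^esub> (g \<star>\<^bsub>C\<^esub> h)) \<bullet>\<^bsub>C\<^esub> Assoc C U V W"
proof (rule hom_eqI)
  note F = homD[OF f] and G = homD[OF g] and E = homD[OF h]
  note L = F(1) G(1) E(1) and L' = F(2) G(2) E(2)
  note M = L[THEN lmod_module] and M' = L'[THEN lmod_module]
  show "Assoc C U' V' W' \<bullet>\<^bsub>C\<^esub> (f \<star>\<^bsub>C\<^esub> g \<star>\<^bsub>C\<^esub> h) \<in> Hom C (tprod (tprod U V) W) (tprod U' (tprod V'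
    W'))"
    by (rule c_comp_hom[OF tens_arr_hom[OF tens_arr_hom[OF f g] h] assoc_arr_hom[OF L']])
  show "(f \<star>\<^bsub>C\<^esub> (g \<star>\<^bsub>C\<^esub> h)) \<bullet>\<^bsub>C\<^esub> Assoc C U V W \<in> Hom C (tprod (tprod U V) W) (tprod U' (tprod V'
    W'))"
    by (rule c_comp_hom[OF assoc_arr_hom[OF L] tens_arr_hom[OF f tens_arr_hom[OF g h]]])
  show "\<forall>t\<in>carrier (tprod (tprod U V) W). fn (Assoc C U' V' W' \<bullet>\<^bsub>C\<^esub> (f \<star>\<^bsub>C\<^esub> g \<star>\<^bsub>C\<^esub> h)) t
    = fn ((f \<star>\<^bsub>C\<^esub> (g \<star>\<^bsub>C\<^esub> h)) \<bullet>\<^bsub>C\<^esub> Assoc C U V W) t"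
  proof
    fix t assume "t \<in> carrier (tprod (tprod U V) W)"
    then have t: "t \<in> carrier (tensor_space K (tensor_space K U V) W)" by (simp add: diag_strips)
    let ?fg = "tmap K U' V' (fn f) (fn g)" and ?gh = "tmap K V' W' (fn g) (fn h)"
    have lfg: "lin K (tensor_space K U V) (tensor_space K U' V') ?fg"
      and lgh: "lin K (tensor_space K V W) (tensor_space K V' W') ?gh"
      using M M' F(5) G(5) E(5) by (simp_all add: lin_tmap)
    have s1: "fn (f \<star>\<^bsub>C\<^esub> g \<star>\<^bsub>C\<^esub> h) t = tmap K (tensor_space K U' V') W' ?fg (fn h) t"
      using t F G E by (simp add: fn_tens source_target diag_strips)
        (rule tmap_cong[OF t], simp_all add: module_tensor fn_tens)
    have s1c: "tmap K (tensor_space K U' V') W' ?fg (fn h) t \<in> carrier (tensor_space K (tensor_space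
      K U' V') W')"
      by (rule tmap_closed[OF t]) (use M M' lfg E(5) in \<open>simp_all add: module_tensor\<close>)
    have rt: "rebracket K U V W t \<in> carrier (tensor_space K U (tensor_space K V W))"
      by (intro rebracket_closed t M)
    note at = act3_closed[OF L \<Phi>_closed rt]
    have s2: "fn (f \<star>\<^bsub>C\<^esub> (g \<star>\<^bsub>C\<^esub> h)) s = tmap K U' (tensor_space K V' W') (fn f) ?gh s"
      if s: "s \<in> carrier (tensor_space K U (tensor_space K V W))" for s
      using s F G E by (simp add: fn_tens source_target diag_strips)
        (rule tmap_cong[OF s], simp_all add: module_tensor fn_tens)
    have eqv: "fn k (lact X p x) = lact X' (id p) (fn k x)"
      if "k \<in> Hom C X X'" "p \<in> carrier H" "x \<in> carrier X" for k X X' p x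
      using that by (simp add: hom_iff)
    have inner: "?gh (lact (tens_mod K V W) p s) = lact (tens_mod K V' W') (id p) (?gh s)"
      if "p \<in> carrier HH" "s \<in> carrier (tensor_space K V W)" for p s
    proof -
      have "?gh (lact (tens_mod K V W) p s) = lact (tens_mod K V' W') (tmap K H H id id p) (?gh s)"
        by (rule semilinear_tmap[OF algH algH algH algH L(2,3) L'(2,3) lin_id lin_id G(5) E(5)])
          (use g h eqv that in auto)
      then show ?thesis using that by (simp add: tmap_id modH)
    qed
    have "tmap K U' (tensor_space K V' W') (fn f) ?gh (act3 U V W \<Phi> (rebracket K U V W t))
        = act3 U' V' W' (tmap K H H2 id id \<Phi>) (tmap K U' (tensor_space K V' W') (fn f) ?gh
          (rebracket K U V W t))"
      using semilinear_tmap[OF algH algH2 algH algH2 L(1) tens2[OF L(2,3)] L'(1) tens2[OF L'(2,3)]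
        lin_id lin_id F(5), of ?gh \<Phi> "rebracket K U V W t"]
        lgh eqv[OF f] inner rt \<Phi>_closed by (simp add: diag_strips)
    also have "\<dots> = act3 U' V' W' \<Phi> (tmap K U' (tensor_space K V' W') (fn f) ?gh (rebracket K U V W
      t))"
      by (simp add: diag_strips tmap_id modH \<Phi>_closed)
    also have "tmap K U' (tensor_space K V' W') (fn f) ?gh (rebracket K U V W t)
      = rebracket K U' V' W' (tmap K (tensor_space K U' V') W' ?fg (fn h) t)"
      using rebracket_tmap[OF M M' F(5) G(5) E(5)] t by simp
    finally have key: "tmap K U' (tensor_space K V' W') (fn f) ?gh (act3 U V W \<Phi> (rebracket K U V W
      t))
      = act3 U' V' W' \<Phi> (rebracket K U' V' W' (tmap K (tensor_space K U' V') W' ?fg (fn h) t))" .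
    show "fn (Assoc C U' V' W' \<bullet>\<^bsub>C\<^esub> (f \<star>\<^bsub>C\<^esub> g \<star>\<^bsub>C\<^esub> h)) t = fn ((f \<star>\<^bsub>C\<^esub> (g \<star>\<^bsub>C\<^esub> h)) \<bullet>\<^bsub>C\<^esub> Assoc C U V
      W) t"
      using t s1c at F G E by (simp add: fn_comp source_target diag_strips s1 fn_assoc[OF L]
        fn_assoc[OF L'] s2 key)
  qed
qed

lemma c_lunit_natural:
  assumes f: "f \<in> Hom C U V" shows "LUnit C V \<bullet>\<^bsub>C\<^esub> (Ident C I \<star>\<^bsub>C\<^esub> f) = f \<bullet>\<^bsub>C\<^esub> LUnit C U"
proof -
  note F = homD[OF f]
  show ?thesis
  proof (rule hom_tensor_eqI[OF c_comp_hom[OF tens_arr_hom[OF c_ident[OF lmod_I] f] lunit_arr_hom[OF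
    F(2)]]
        c_comp_hom[OF lunit_arr_hom[OF F(1)] f] lmod_I F(1)])
    fix x u assume h: "x \<in> carrier I" "u \<in> carrier U"
    then show "fn (LUnit C V \<bullet>\<^bsub>C\<^esub> (Ident C I \<star>\<^bsub>C\<^esub> f)) (pure K I U x u) = fn (f \<bullet>\<^bsub>C\<^esub> LUnit C U) (pure
      K I U x u)"
      using F by (simp add: fn_comp source_target arrows_source_target diag_strips pure_closed modI
        fn_tens_pure[OF c_ident[OF lmod_I] f]
        fn_ident fn_lunit_pure lin_smult[OF F(5)] scalar_of_closed)
  qed
qed

lemma c_runit_natural:
  assumes f: "f \<in> Hom C U V" shows "RUnit C V \<bullet>\<^bsub>C\<^esub> (f \<star>\<^bsub>C\<^esub> Ident C I) = f \<bullet>\<^bsub>C\<^esub> RUnit C U"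
proof -
  note F = homD[OF f]
  show ?thesis
  proof (rule hom_tensor_eqI[OF c_comp_hom[OF tens_arr_hom[OF f c_ident[OF lmod_I]] runit_arr_hom[OF
    F(2)]]
        c_comp_hom[OF runit_arr_hom[OF F(1)] f] F(1) lmod_I])
    fix u x assume h: "u \<in> carrier U" "x \<in> carrier I"
    then show "fn (RUnit C V \<bullet>\<^bsub>C\<^esub> (f \<star>\<^bsub>C\<^esub> Ident C I)) (pure K U I u x) = fn (f \<bullet>\<^bsub>C\<^esub> RUnit C U) (pure
      K U I u x)"
      using F by (simp add: fn_comp source_target arrows_source_target diag_strips pure_closed modI
        fn_tens_pure[OF f c_ident[OF lmod_I]]
        fn_ident fn_runit_pure lin_smult[OF F(5)] scalar_of_closed)
  qed
qed

lemma c_triangle: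
  assumes U: "lmod U" and V: "lmod V"
  shows "(Ident C U \<star>\<^bsub>C\<^esub> LUnit C V) \<bullet>\<^bsub>C\<^esub> Assoc C U I V = RUnit C U \<star>\<^bsub>C\<^esub> Ident C V"
proof (rule hom_tensor3_eqI[OF c_comp_hom[OF assoc_arr_hom[OF U lmod_I V] tens_arr_hom[OF c_ident[OF
  U] lunit_arr_hom[OF V]]]
      tens_arr_hom[OF runit_arr_hom[OF U] c_ident[OF V]] U lmod_I V])
  note M = U[THEN lmod_module] V[THEN lmod_module] modI
  interpret T: left_hmodule K H2 "tens_mod K U V" by (rule tens2[OF U V])
  fix u x v assume h: "u \<in> carrier U" "x \<in> carrier I" "v \<in> carrier V"
  let ?s = "pure K U (tensor_space K I V) u (pure K I V x v)" and ?IV = "tensor_space K I V"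
  have s: "?s \<in> carrier (tensor_space K U ?IV)" using h M by (simp add: pure_closed module_tensor)
  have l: "lin K U U id" "lin K ?IV V (fn (LUnit C V))" using M by (simp_all add: lin_id lin_lunit)
  have eqt: "fn (Ident C U \<star>\<^bsub>C\<^esub> LUnit C V) y = tmap K U V id (fn (LUnit C V)) y"
    if "y \<in> carrier (tensor_space K U ?IV)" for y
    using that M by (simp add: fn_tens source_target arrows_source_target diag_strips)
      (rule tmap_cong[OF that], simp_all add: module_tensor fn_ident)
  have "tmap K U V id (fn (LUnit C V)) (act3 U I V \<Phi> ?s)
      = lact (tens_mod K U V) (tmap K H H id (counit_id H H) \<Phi>) (tmap K U V id (fn (LUnit C V)) ?s)"
    using semilinear_tmap[OF algH algH2 algH algH U tens2[OF lmod_I V] U V lin_id _ lin_id, of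
      "counit_id H H" "fn (LUnit C V)" \<Phi> ?s]
      lunit_semilinear[OF V] l s \<Phi>_closed by (simp add: diag_strips lin_counit_id modH)
  also have "\<dots> = lact (tens_mod K U V) \<one>\<^bsub>H2\<^esub> (pure K U V u (scalar_of x \<odot>\<^bsub>V\<^esub> v))"
    using h M by (simp add: counit_middle_\<Phi> tmap_pure[OF l] pure_closed module_tensor fn_lunit_pure)
  also have "\<dots> = pure K U V u (scalar_of x \<odot>\<^bsub>V\<^esub> v)"
    using h M by (intro T.lact_one) (simp add: diag_strips pure_closed module_smult_closed
      scalar_of_closed)
  also have "\<dots> = pure K U V (scalar_of x \<odot>\<^bsub>U\<^esub> u) v"
    using h M by (simp add: pure_smult_left pure_smult_right scalar_of_closed)
  finally show "fn ((Ident C U \<star>\<^bsub>C\<^esub> LUnit C V) \<bullet>\<^bsub>C\<^esub> Assoc C U I V) (pure K (tensor_space K U I) V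
    (pure K U I u x) v)
    = fn (RUnit C U \<star>\<^bsub>C\<^esub> Ident C V) (pure K (tensor_space K U I) V (pure K U I u x) v)"
    using h M s act3_closed[OF U lmod_I V \<Phi>_closed s]
      fn_tens_pure[OF runit_arr_hom[OF U] c_ident[OF V], of "pure K U I u x" v]
    by (simp add: fn_comp source_target diag_strips pure_closed module_tensor fn_assoc[OF U lmod_I
      V] rebracket_pure eqt
      fn_runit_pure fn_ident)
qed

text \<open>Each constraint is rebracketing followed by an action. Moving all rebracketings to the
  front, where both sides rebracket equally, leaves on each side a product of factors that
  acts on \<open>U \<otimes> (V \<otimes> (W \<otimes> Z))\<close>, and these are the two sides of the cocycle identity.\<close>

lemma c_pentagon:
  assumes L: "lmod U" "lmod V" "lmod W" "lmod Z"
  shows "(Ident C U \<star>\<^bsub>C\<^esub> Assoc C V W Z) \<bullet>\<^bsub>C\<^esub> Assoc C U (tprod V W) Z \<bullet>\<^bsub>C\<^esub> (Assoc C U V W \<star>\<^bsub>C\<^esub> Ident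
    C Z)
    = Assoc C U V (tprod W Z) \<bullet>\<^bsub>C\<^esub> Assoc C (tprod U V) W Z"
proof (rule hom_eqI)
  let ?S = "tprod (tprod (tprod U V) W) Z" and ?T = "tprod U (tprod V (tprod W Z))"
  show "(Ident C U \<star>\<^bsub>C\<^esub> Assoc C V W Z) \<bullet>\<^bsub>C\<^esub> Assoc C U (tprod V W) Z \<bullet>\<^bsub>C\<^esub> (Assoc C U V W \<star>\<^bsub>C\<^esub> Ident C
    Z) \<in> Hom C ?S ?T"
    by (rule c_comp_hom[OF tens_arr_hom[OF assoc_arr_hom c_ident] c_comp_hom[OF assoc_arr_hom
      tens_arr_hom[OF c_ident assoc_arr_hom]]])
      (simp_all add: lmod_tprod L)
  show "Assoc C U V (tprod W Z) \<bullet>\<^bsub>C\<^esub> Assoc C (tprod U V) W Z \<in> Hom C ?S ?T"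
    by (rule c_comp_hom[OF assoc_arr_hom assoc_arr_hom]) (simp_all add: lmod_tprod L)
  note M = L[THEN lmod_module]
  let ?UV = "tensor_space K U V" and ?VW = "tensor_space K V W" and ?WZ = "tensor_space K W Z"
  let ?UVW = "tensor_space K U ?VW" and ?VWZ = "tensor_space K V ?WZ"
  let ?X = "tensor_space K U ?VWZ"
  let ?a4 = "lact (tens_mod K U (tens_mod K V (tens_mod K W Z)))"
  have M4: "left_hmodule K H4 (tens_mod K U (tens_mod K V (tens_mod K W Z)))"
    by (intro left_hmodule_tens_mod[OF algH algH3] tens3 L)
  interpret A4: left_hmodule K H4 "tens_mod K U (tens_mod K V (tens_mod K W Z))" by (rule M4)
  have a4_mult: "?a4 (p \<otimes>\<^bsub>H4\<^esub> q) t = ?a4 p (?a4 q t)" if "p \<in> carrier HHHH" "q \<in> carrier HHHH"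
    "t \<in> carrier ?X" for p q t
    using A4.lact_mult[of p q t] that by (simp add: diag_strips)
  have a4_closed: "?a4 p t \<in> carrier ?X" if "p \<in> carrier HHHH" "t \<in> carrier ?X" for p t
    using A4.lact_closed[of p t] that by (simp add: diag_strips)
  show "\<forall>t\<in>carrier ?S. fn ((Ident C U \<star>\<^bsub>C\<^esub> Assoc C V W Z) \<bullet>\<^bsub>C\<^esub> Assoc C U (tprod V W) Z \<bullet>\<^bsub>C\<^esub> (Assoc C
    U V W \<star>\<^bsub>C\<^esub> Ident C Z)) t
     = fn (Assoc C U V (tprod W Z) \<bullet>\<^bsub>C\<^esub> Assoc C (tprod U V) W Z) t"
  proof
    fix t assume "t \<in> carrier ?S"
    then have t: "t \<in> carrier (tensor_space K (tensor_space K ?UV W) Z)" by (simp add: diag_strips)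
    let ?p1 = "pure K H HHH \<one>\<^bsub>H\<^esub> \<Phi>"
      and ?p2 = "tmap K H HHH id (\<lambda>s. rebracket K H H H (tmap K HH H \<Delta> id s)) \<Phi>"
      and ?p3 = "tmap K H HHH id (rebracket K H H H) (rebracket K H HH H (pure K HHH H \<Phi> \<one>\<^bsub>H\<^esub>))"
      and ?p4 = "tmap K H HHH id (tmap K H HH id \<Delta>) \<Phi>"
      and ?p5 = "rebracket K H H HH (tmap K HH HH \<Delta> id \<Phi>)"
    note pc = cocycle_factors_closed
    let ?r0 = "tmap K ?UVW Z (rebracket K U V W) id t"
    have r0: "?r0 \<in> carrier (tensor_space K ?UVW Z)"
      by (rule tmap_closed[OF t]) (simp_all add: M module_tensor lin_rebracket lin_id lin_ident)
    let ?r1 = "rebracket K U ?VW Z ?r0"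
    have r1: "?r1 \<in> carrier (tensor_space K U (tensor_space K ?VW Z))" using r0 M
      by (simp add: rebracket_closed module_tensor)
    let ?r2 = "tmap K U ?VWZ id (rebracket K V W Z) ?r1"
    have r2: "?r2 \<in> carrier ?X"
      by (rule tmap_closed[OF r1]) (simp_all add: M module_tensor lin_rebracket lin_id lin_ident)
    \<comment> \<open>The constraint of \<open>U\<close>, \<open>V\<close>, \<open>W\<close> tensored with the identity is the action of \<open>\<Phi> \<otimes> 1\<close>
      after rebracketing.\<close>
    have "fn (Assoc C U V W \<star>\<^bsub>C\<^esub> Ident C Z) t = tmap K ?UVW Z (\<lambda>s. act3 U V W \<Phi> (rebracket K U V W
      s)) (\<lambda>z. id (id z)) t"
      using t by (simp add: fn_tens source_target diag_strips)
        (rule tmap_cong[OF t], simp_all add: M module_tensor fn_assoc[OF L(1-3)] fn_ident)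
    also have "\<dots> = tmap K ?UVW Z (act3 U V W \<Phi>) id ?r0"
      by (rule HOL.sym, rule tmap_tmap[OF t]) (simp_all add: M module_tensor lin_rebracket lin_id
        lin_ident lin_act3[OF L(1-3) \<Phi>_closed])
    also have "\<dots> = lact (tens_mod K (tens_mod K U (tens_mod K V W)) Z) (pure K HHH H \<Phi> \<one>\<^bsub>H\<^esub>) ?r0"
      using lact_pure[OF algH3 algH tens3[OF L(1-3)] L(4), of \<Phi> "\<one>\<^bsub>H\<^esub>" ?r0] r0
      by (simp add: diag_strips \<Phi>_closed one_H)
        (rule tmap_cong[OF r0], simp_all add: M module_tensor left_hmodule.lact_one[OF L(4)])
    finally have x1: "fn (Assoc C U V W \<star>\<^bsub>C\<^esub> Ident C Z) t
      = lact (tens_mod K (tens_mod K U (tens_mod K V W)) Z) (pure K HHH H \<Phi> \<one>\<^bsub>H\<^esub>) ?r0" .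
    let ?x1 = "lact (tens_mod K (tens_mod K U (tens_mod K V W)) Z) (pure K HHH H \<Phi> \<one>\<^bsub>H\<^esub>) ?r0"
    have \<Phi>1: "pure K HHH H \<Phi> \<one>\<^bsub>H\<^esub> \<in> carrier (tensor_space K HHH H)"
      by (simp add: pure_closed modH \<Phi>_closed one_H)
    have x1c: "?x1 \<in> carrier (tensor_space K ?UVW Z)"
      using left_hmodule.lact_closed[OF left_hmodule_tens_mod[OF algH3 algH tens3[OF L(1-3)] L(4)],
        of "pure K HHH H \<Phi> \<one>\<^bsub>H\<^esub>" ?r0] \<Phi>1 r0
      by (simp add: diag_strips)
    \<comment> \<open>In the constraint of \<open>U\<close>, \<open>V \<otimes> W\<close>, \<open>Z\<close>, the middle factor of \<open>\<Phi>\<close> acts diagonally,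
      which brings in \<open>\<Delta>\<close> there; the module \<open>?M'\<close> keeps the intermediate bracketing
      \<open>U \<otimes> ((V \<otimes> W) \<otimes> Z)\<close>.\<close>
    let ?q3 = "rebracket K H HH H (pure K HHH H \<Phi> \<one>\<^bsub>H\<^esub>)"
    have q3: "?q3 \<in> carrier (tensor_space K H (tensor_space K HH H))" using \<Phi>1
      by (simp add: rebracket_closed modH)
    let ?M' = "tens_mod K U (tens_mod K (tens_mod K V W) Z)"
    have rx1: "rebracket K U ?VW Z ?x1 = lact ?M' ?q3 ?r1"
      using semilinear_rebracket[OF algH algH2 algH L(1) tens2[OF L(2,3)] L(4), of "pure K HHH H \<Phi>
        \<one>\<^bsub>H\<^esub>" ?r0] \<Phi>1 r0
      by (simp add: diag_strips)
    have alg21: "assoc_unital_algebra K (tensor_algebra K H2 H)"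
      by (rule assoc_unital_algebra_tensor[OF algH2 algH])
    have M'm: "left_hmodule K (tensor_algebra K H (tensor_algebra K H2 H)) ?M'"
      by (intro left_hmodule_tens_mod[OF algH alg21] tens3' L)
    let ?q2 = "tmap K H (tensor_space K HH H) id (tmap K HH H \<Delta> id) \<Phi>"
    have q2: "?q2 \<in> carrier (tensor_space K H (tensor_space K HH H))"
      by (rule tmap_closed[OF \<Phi>_closed]) (simp_all add: modH module_tensor lin_id lin_ident lin_tmap
        lin_comult)
    have y1c: "lact ?M' ?q3 ?r1 \<in> carrier (tensor_space K U (tensor_space K ?VW Z))"
      using left_hmodule.lact_closed[OF M'm, of ?q3 ?r1] q3 r1 by (simp add: diag_strips)
    have "act3 U (tprod V W) Z \<Phi> s = lact ?M' ?q2 s"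
      if s: "s \<in> carrier (tensor_space K U (tensor_space K ?VW Z))" for s
    proof -
      have "act3 U (tprod V W) Z \<Phi> s = lact ?M' (tmap K H (tensor_algebra K H2 H) id (tmap K HH H \<Delta>
        id) \<Phi>) s"
        by (rule lact_base_change[OF algH algH2 algH alg21 L(1) tens2[OF lmod_tprod[OF L(2,3)] L(4)]
          L(1) tens3'[OF L(2-4)]])
          (use s \<Phi>_closed in \<open>simp_all add: diag_strips same_space_def lin_id lin_ident lin_tmap
            modH module_tensor lin_comult lact_diag_left[OF L(2,3) algH L(4)]\<close>)
      then show ?thesis by (simp add: diag_strips)
    qed
    then have x2: "fn (Assoc C U (tprod V W) Z) ?x1 = lact ?M' ?q2 (lact ?M' ?q3 ?r1)"
      using x1c y1c by (simp add: fn_assoc[OF L(1) lmod_tprod[OF L(2,3)] L(4)] diag_strips rx1)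
    have x2c: "lact ?M' ?q2 (lact ?M' ?q3 ?r1) \<in> carrier (tensor_space K U (tensor_space K ?VW Z))"
      using left_hmodule.lact_closed[OF M'm, of ?q2 "lact ?M' ?q3 ?r1"] q2 y1c
        by (simp add: diag_strips)
    \<comment> \<open>The last rebracketing is carried past the two actions already collected, which
      rebrackets their acting elements and brings them to \<open>H \<otimes> (H \<otimes> (H \<otimes> H))\<close>.\<close>
    let ?rb = "\<lambda>s. tmap K U ?VWZ id (rebracket K V W Z) s"
    have rb_lact: "?rb (lact ?M' q s) = ?a4 (tmap K H HHH id (rebracket K H H H) q) (?rb s)"
      if "q \<in> carrier (tensor_space K H (tensor_space K HH H))" "s \<in> carrier (tensor_space K U
        (tensor_space K ?VW Z))" for q s
      using semilinear_tmap[OF algH alg21 algH algH3 L(1) tens3'[OF L(2-4)] L(1) tens3[OF L(2-4)]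
        lin_id _ lin_id,
          of "rebracket K H H H" "rebracket K V W Z" q s] semilinear_rebracket[OF algH algH algH
            L(2-4)] that
      by (simp add: diag_strips lin_rebracket modH M)
    have "fn (Ident C U \<star>\<^bsub>C\<^esub> Assoc C V W Z) s = ?a4 ?p1 (?rb s)"
      if s: "s \<in> carrier (tensor_space K U (tensor_space K ?VW Z))" for s
    proof -
      have rbs: "?rb s \<in> carrier ?X" by (rule tmap_closed[OF s]) (simp_all add: M module_tensor
        lin_rebracket lin_id lin_ident)
      have "fn (Ident C U \<star>\<^bsub>C\<^esub> Assoc C V W Z) s = tmap K U ?VWZ (\<lambda>u. id (id u)) (\<lambda>s. act3 V W Z \<Phi>
        (rebracket K V W Z s)) s"
        using s by (simp add: fn_tens source_target diag_strips)
          (rule tmap_cong[OF s], simp_all add: M module_tensor fn_assoc[OF L(2-4)] fn_ident)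
      also have "\<dots> = tmap K U ?VWZ id (act3 V W Z \<Phi>) (?rb s)"
        by (rule HOL.sym, rule tmap_tmap[OF s]) (simp_all add: M module_tensor lin_rebracket lin_id
          lin_ident lin_act3[OF L(2-4) \<Phi>_closed])
      also have "\<dots> = ?a4 ?p1 (?rb s)"
        using lact_pure[OF algH algH3 L(1) tens3[OF L(2-4)], of "\<one>\<^bsub>H\<^esub>" \<Phi> "?rb s"] rbs
        by (simp add: diag_strips \<Phi>_closed one_H)
          (rule tmap_cong[OF rbs], simp_all add: M module_tensor left_hmodule.lact_one[OF L(1)])
      finally show ?thesis .
    qed
    then have "fn (Ident C U \<star>\<^bsub>C\<^esub> Assoc C V W Z) (lact ?M' ?q2 (lact ?M' ?q3 ?r1))
      = ?a4 ?p1 (?a4 (tmap K H HHH id (rebracket K H H H) ?q2) (?a4 ?p3 ?r2))"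
      using x2c y1c r1 q2 q3 by (simp add: rb_lact)
    also have "tmap K H HHH id (rebracket K H H H) ?q2 = ?p2"
      by (rule HOL.trans[OF tmap_tmap[OF \<Phi>_closed] tmap_cong[OF \<Phi>_closed]])
        (simp_all add: modH module_tensor lin_id lin_ident lin_tmap lin_comult lin_rebracket)
    also have "?a4 ?p1 (?a4 ?p2 (?a4 ?p3 ?r2)) = ?a4 (?p1 \<otimes>\<^bsub>H4\<^esub> ?p2 \<otimes>\<^bsub>H4\<^esub> ?p3) ?r2"
      using pc r2 by (simp add: a4_mult a4_closed mult_closed[OF algH4, unfolded strips])
    finally have lhs: "fn (Ident C U \<star>\<^bsub>C\<^esub> Assoc C V W Z) (lact ?M' ?q2 (lact ?M' ?q3 ?r1))
      = ?a4 (?p1 \<otimes>\<^bsub>H4\<^esub> ?p2 \<otimes>\<^bsub>H4\<^esub> ?p3) ?r2" .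
    \<comment> \<open>On the other side the two constraints contribute \<open>\<Phi>\<close> with \<open>\<Delta>\<close> applied to its first and
      to its third factor.\<close>
    let ?s1 = "rebracket K ?UV W Z t"
    have s1: "?s1 \<in> carrier (tensor_space K ?UV ?WZ)" using t M
      by (simp add: rebracket_closed module_tensor)
    let ?N = "tens_mod K (tens_mod K U V) (tens_mod K W Z)" and ?q5 = "tmap K HH HH \<Delta> id \<Phi>"
    have q5: "?q5 \<in> carrier (tensor_space K HH HH)"
      by (rule tmap_closed[OF \<Phi>_closed]) (simp_all add: modH lin_id lin_ident lin_comult)
    have y1: "fn (Assoc C (tprod U V) W Z) t = lact ?N ?q5 ?s1"
      using t s1 lact_diag_left[OF L(1,2) algH2 tens2[OF L(3,4)], of \<Phi> ?s1]
        by (simp add: fn_assoc[OF lmod_tprod[OF L(1,2)] L(3,4)] diag_strips \<Phi>_closed)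
    have y1c': "lact ?N ?q5 ?s1 \<in> carrier (tensor_space K ?UV ?WZ)"
      using left_hmodule.lact_closed[OF left_hmodule_tens_mod[OF algH2 algH2 tens2[OF L(1,2)]
        tens2[OF L(3,4)]], of ?q5 ?s1] q5 s1 by (simp add: diag_strips)
    have ry1: "rebracket K U V ?WZ (lact ?N ?q5 ?s1) = ?a4 ?p5 (rebracket K U V ?WZ ?s1)"
      using semilinear_rebracket[OF algH algH algH2 L(1,2) tens2[OF L(3,4)], of ?q5 ?s1] q5 s1
        by (simp add: diag_strips)
    have rs1: "rebracket K U V ?WZ ?s1 \<in> carrier ?X" using s1 M
      by (simp add: rebracket_closed module_tensor)
    have "act3 U V (tprod W Z) \<Phi> s = ?a4 ?p4 s" if s: "s \<in> carrier ?X" for s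
    proof -
      have "act3 U V (tprod W Z) \<Phi> s = ?a4 (tmap K H H3 id (tmap K H HH id \<Delta>) \<Phi>) s"
        by (rule lact_base_change[OF algH algH2 algH algH3 L(1) tens2[OF L(2) lmod_tprod[OF L(3,4)]]
          L(1) tens3[OF L(2-4)]])
          (use s \<Phi>_closed in \<open>simp_all add: diag_strips same_space_def lin_id lin_ident lin_tmap
            modH module_tensor lin_comult lact_diag_right[OF algH L(2-4)]\<close>)
      then show ?thesis by (simp add: diag_strips)
    qed
    then have rhs: "fn (Assoc C U V (tprod W Z)) (lact ?N ?q5 ?s1) = ?a4 (?p4 \<otimes>\<^bsub>H4\<^esub> ?p5) (rebracket
      K U V ?WZ ?s1)"
      using y1c' rs1 pc by (simp add: fn_assoc[OF L(1,2) lmod_tprod[OF L(3,4)]] diag_strips ry1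
        a4_closed a4_mult)
    have "?r2 = rebracket K U V ?WZ ?s1" using rebracket_pentagon[OF M] t by blast
    then show "fn ((Ident C U \<star>\<^bsub>C\<^esub> Assoc C V W Z) \<bullet>\<^bsub>C\<^esub> Assoc C U (tprod V W) Z \<bullet>\<^bsub>C\<^esub> (Assoc C U V W
      \<star>\<^bsub>C\<^esub> Ident C Z)) t
      = fn (Assoc C U V (tprod W Z) \<bullet>\<^bsub>C\<^esub> Assoc C (tprod U V) W Z) t"
      using t x1c y1c' by (simp add: fn_comp source_target diag_strips x1 x2 lhs y1 rhs cocycle)
  qed
qed

theorem monoidal_left_mod_cat: "monoidal_category C"
proof (rule monoidal_category.intro)
  show "f \<in> Arr C \<Longrightarrow> Dom C f \<in> Obj C" for f by (auto simp: left_mod_cat_def module_monoidal_def)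
  show "f \<in> Arr C \<Longrightarrow> Cod C f \<in> Obj C" for f by (auto simp: left_mod_cat_def module_monoidal_def)
  show "f \<in> Hom C U V \<Longrightarrow> f \<bullet>\<^bsub>C\<^esub> Ident C U = f" for f U V
    by (rule hom_eqI[OF c_comp_hom[OF c_ident]]) (auto simp: homD fn_comp source_target fn_ident)
  show "f \<in> Hom C U V \<Longrightarrow> Ident C V \<bullet>\<^bsub>C\<^esub> f = f" for f U V
    by (rule hom_eqI[OF c_comp_hom[OF _ c_ident]]) (auto simp: homD fn_comp source_target fn_ident)
  show "h \<bullet>\<^bsub>C\<^esub> (g \<bullet>\<^bsub>C\<^esub> f) = h \<bullet>\<^bsub>C\<^esub> g \<bullet>\<^bsub>C\<^esub> f"
    if "f \<in> Hom C U V" "g \<in> Hom C V W" "h \<in> Hom C W Z" for f g h U V W Z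
    by (rule hom_eqI[OF c_comp_hom[OF c_comp_hom[OF that(1,2)] that(3)] c_comp_hom[OF that(1)
      c_comp_hom[OF that(2,3)]]])
      (use that in \<open>auto simp: homD fn_comp source_target\<close>)
  show "Unit C \<in> Obj C" by (simp add: C_fields lmod_I)
  show "U \<diamondop>\<^bsub>C\<^esub> V \<in> Obj C" if "U \<in> Obj C" "V \<in> Obj C" for U V using that
    by (simp add: C_fields lmod_tprod)
  show "iso_arr C (Assoc C U V W)" if "U \<in> Obj C" "V \<in> Obj C" "W \<in> Obj C" for U V W
    using that by (intro iso_arrI[OF assoc_arr_hom assoc_bij]) (simp_all add: C_fields(1))
  show "iso_arr C (LUnit C U)" if "U \<in> Obj C" for U
    using that by (intro iso_arrI[OF lunit_arr_hom lunit_bij]) (simp_all add: C_fields(1))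
  show "iso_arr C (RUnit C U)" if "U \<in> Obj C" for U
    using that by (intro iso_arrI[OF runit_arr_hom runit_bij]) (simp_all add: C_fields(1))
qed (simp_all only: C_fields(1,6,8) mem_Collect_eq c_ident c_comp_hom tens_arr_hom c_tens_ident
  c_tens_comp
   assoc_arr_hom c_assoc_natural lunit_arr_hom runit_arr_hom c_lunit_natural c_runit_natural
     c_pentagon c_triangle)

end

section \<open>Right modules as modules over the opposite algebra\<close>

text \<open>A right module over an algebra is a left module over the opposite algebra. In this form
  the right actions on the bimodule algebra and its tensor powers are instances of
  \<open>tens_mod\<close>.\<close>

definition op_algebra :: "('k, 'v, 'x) module_scheme \<Rightarrow> ('k, 'v, 'x) module_scheme" where
  "op_algebra P = P\<lparr>mult := \<lambda>a b. b \<otimes>\<^bsub>P\<^esub> a\<rparr>"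

lemma same_space_op: "same_space (op_algebra P) P"
  by (simp add: same_space_def op_algebra_def)

lemma op_fields:
  "carrier (op_algebra P) = carrier P" "zero (op_algebra P) = zero P" "add (op_algebra P) = add P"
  "smult (op_algebra P) = smult P" "one (op_algebra P) = one P" "a \<otimes>\<^bsub>op_algebra P\<^esub> b = b \<otimes>\<^bsub>P\<^esub> a"
  by (simp_all add: op_algebra_def)

lemmas strip_op = op_fields
  same_space_op[THEN same_space_pure(2)[OF _ same_space_refl]]
  same_space_op[THEN same_space_pure(2)[OF same_space_refl]]
  same_space_op[THEN same_space_pure(3)[OF _ same_space_refl]]
  same_space_op[THEN same_space_pure(3)[OF same_space_refl]]
  same_space_op[THEN same_space_tlift]
  same_space_op[THEN same_space_lin[OF _ same_space_refl]]
  same_space_op[THEN same_space_lin[OF same_space_refl]]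
  same_space_op[THEN same_space_module]

lemma strip_op_maps:
  "tmap K (op_algebra P) W = tmap K P W" "tmap K V (op_algebra P) = tmap K V P"
  "rebracket K (op_algebra P) V W = rebracket K P V W"
  "rebracket K U (op_algebra P) W = rebracket K U P W"
  "rebracket K U V (op_algebra P) = rebracket K U V P"
  by (simp_all add: tmap_def rebracket_def fun_eq_iff strip_op)

lemmas op_strips = diag_strips strip_op strip_op_maps

lemma assoc_unital_algebra_op:
  assumes P: "assoc_unital_algebra K P" shows "assoc_unital_algebra K (op_algebra P)"
proof -
  interpret P: assoc_unital_algebra K P by (rule P)
  show ?thesis
  proof (intro assoc_unital_algebra.intro assoc_unital_algebra_axioms.intro ringI)
    show "module K (op_algebra P)" using P.module_axioms by (simp add: strip_op)
    then show "abelian_group (op_algebra P)" by (rule module.axioms)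
    show "monoid (op_algebra P)" by (rule monoidI) (simp_all add: op_fields P.m_assoc)
  qed (simp_all add: op_fields P.l_distr P.r_distr P.smult_mult_left P.smult_mult_right)
qed

text \<open>Opposites commute with tensor products of algebras, so that a tensor product of right
  modules is again a right module over the tensor algebra.\<close>

lemma mult_op_tensor:
  assumes P: "assoc_unital_algebra K P" and Q: "assoc_unital_algebra K Q"
    and st: "s \<in> carrier (tensor_space K P Q)" "t \<in> carrier (tensor_space K P Q)"
  shows "s \<otimes>\<^bsub>tensor_algebra K (op_algebra P) (op_algebra Q)\<^esub> t = t \<otimes>\<^bsub>tensor_algebra K P Q\<^esub> s"
proof -
  note oP = assoc_unital_algebra_op[OF P] and oQ = assoc_unital_algebra_op[OF Q]
  note mods = module_algebra[OF P] module_algebra[OF Q] module_tensor[OF module_algebra[OF P]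
    module_algebra[OF Q]]
  let ?O = "tensor_algebra K (op_algebra P) (op_algebra Q)" and ?A = "tensor_algebra K P Q" and ?T
    = "tensor_space K P Q"
  note aO = assoc_unital_algebra_tensor[OF oP oQ] and aA = assoc_unital_algebra_tensor[OF P Q]
  note l = lin_mult_left[OF aO _ lin_ident, unfolded op_strips] lin_mult_right[OF aO _ lin_ident,
    unfolded op_strips]
    lin_mult_left[OF aA _ lin_ident, unfolded op_strips] lin_mult_right[OF aA _ lin_ident, unfolded
      op_strips]
  have pc: "pure K P Q a b \<in> carrier ?T" if "a \<in> carrier P" "b \<in> carrier Q" for a b
    using that mods by (simp add: pure_closed)
  have mp: "pure K P Q a b \<otimes>\<^bsub>?O\<^esub> pure K P Q a' b' = pure K P Q (a' \<otimes>\<^bsub>P\<^esub> a) (b' \<otimes>\<^bsub>Q\<^esub> b)"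
    if "a \<in> carrier P" "b \<in> carrier Q" "a' \<in> carrier P" "b' \<in> carrier Q" for a b a' b'
    using mult_pure[OF oP oQ, of a b a' b'] that by (simp add: op_strips)
  have "\<forall>t\<in>carrier ?T. pure K P Q a b \<otimes>\<^bsub>?O\<^esub> t = t \<otimes>\<^bsub>?A\<^esub> pure K P Q a b"
    if "a \<in> carrier P" "b \<in> carrier Q" for a b
    by (rule tensor_ext[of K P Q ?T]) (use that mods in \<open>simp_all add: l pc mp mult_pure[OF P Q]\<close>)
  then have "\<forall>s\<in>carrier ?T. s \<otimes>\<^bsub>?O\<^esub> t = t \<otimes>\<^bsub>?A\<^esub> s"
    by (intro tensor_ext[of K P Q ?T]) (use st mods in \<open>simp_all add: l\<close>)
  then show ?thesis using st by simp
qed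

lemma left_hmodule_op_tensor:
  assumes P: "assoc_unital_algebra K P" and Q: "assoc_unital_algebra K Q"
    and M: "left_hmodule K (op_algebra P) M" and N: "left_hmodule K (op_algebra Q) N"
  shows "left_hmodule K (op_algebra (tensor_algebra K P Q)) (tens_mod K M N)"
proof -
  interpret L: left_hmodule K "tensor_algebra K (op_algebra P) (op_algebra Q)" "tens_mod K M N"
    by (rule left_hmodule_tens_mod[OF assoc_unital_algebra_op[OF P] assoc_unital_algebra_op[OF Q] M
      N])
  show ?thesis
    using L.left_hmodule_axioms mult_op_tensor[OF P Q]
    unfolding left_hmodule_def left_hmodule_axioms_def by (simp add: op_strips one_tensor_algebra)
qed

text \<open>The shape in which the cocycle identity is inverted: each side becomes the product of the
  inverses of its factors in reverse order.\<close>

lemma monoid_inverse_products: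
  assumes "monoid G" and c: "u1 \<in> carrier G" "u2 \<in> carrier G" "u3 \<in> carrier G" "u4 \<in> carrier G"
    "u5 \<in> carrier G"
    "v1 \<in> carrier G" "v2 \<in> carrier G" "v3 \<in> carrier G" "v4 \<in> carrier G" "v5 \<in> carrier G"
    and "u1 \<otimes>\<^bsub>G\<^esub> u2 \<otimes>\<^bsub>G\<^esub> u3 = u4 \<otimes>\<^bsub>G\<^esub> u5"
    and i: "v1 \<otimes>\<^bsub>G\<^esub> u1 = \<one>\<^bsub>G\<^esub>" "v2 \<otimes>\<^bsub>G\<^esub> u2 = \<one>\<^bsub>G\<^esub>" "v3 \<otimes>\<^bsub>G\<^esub> u3 = \<one>\<^bsub>G\<^esub>" "u4 \<otimes>\<^bsub>G\<^esub> v4 = \<one>\<^bsub>G\<^esub>" "u5 \<otimes>\<^bsub>G\<^esub>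
      v5 = \<one>\<^bsub>G\<^esub>"
  shows "v5 \<otimes>\<^bsub>G\<^esub> v4 = v3 \<otimes>\<^bsub>G\<^esub> (v2 \<otimes>\<^bsub>G\<^esub> v1)"
proof -
  interpret monoid G by fact
  have cancel: "a \<otimes>\<^bsub>G\<^esub> (b \<otimes>\<^bsub>G\<^esub> x) = x" if "a \<otimes>\<^bsub>G\<^esub> b = \<one>\<^bsub>G\<^esub>" "a \<in> carrier G" "b \<in> carrier G"
    "x \<in> carrier G" for a b x
    using that by (simp add: m_assoc[symmetric])
  have "u1 \<otimes>\<^bsub>G\<^esub> (u2 \<otimes>\<^bsub>G\<^esub> (u3 \<otimes>\<^bsub>G\<^esub> (v5 \<otimes>\<^bsub>G\<^esub> v4))) = (u1 \<otimes>\<^bsub>G\<^esub> u2 \<otimes>\<^bsub>G\<^esub> u3) \<otimes>\<^bsub>G\<^esub> (v5 \<otimes>\<^bsub>G\<^esub> v4)"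
    using c by (simp add: m_assoc)
  also have "\<dots> = u4 \<otimes>\<^bsub>G\<^esub> (u5 \<otimes>\<^bsub>G\<^esub> (v5 \<otimes>\<^bsub>G\<^esub> v4))"
    using c assms(12) by (simp add: m_assoc)
  also have "\<dots> = \<one>\<^bsub>G\<^esub>" using c i by (simp add: cancel)
  finally have "v3 \<otimes>\<^bsub>G\<^esub> (v2 \<otimes>\<^bsub>G\<^esub> (v1 \<otimes>\<^bsub>G\<^esub> (u1 \<otimes>\<^bsub>G\<^esub> (u2 \<otimes>\<^bsub>G\<^esub> (u3 \<otimes>\<^bsub>G\<^esub> (v5 \<otimes>\<^bsub>G\<^esub> v4))))))
      = v3 \<otimes>\<^bsub>G\<^esub> (v2 \<otimes>\<^bsub>G\<^esub> (v1 \<otimes>\<^bsub>G\<^esub> \<one>\<^bsub>G\<^esub>))" by simp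
  then show ?thesis using c i by (simp add: cancel)
qed

section \<open>A comodule algebra and a bimodule algebra\<close>

locale wreath_setting = quasi_setting K H
  for K :: "('k, 'c) ring_scheme" and H :: "('k, 'u) qba" +
  fixes A :: "('k, 'u) ca" and B :: "('k, 'u) bimod" and m e :: "(('k, 'u) bimod, ('k, 'u) univ)
    arrow"
  assumes ca: "right_comodule_algebra K H A" and ba: "bimodule_algebra K H B m e"
begin

abbreviation AH where "AH \<equiv> tensor_space K A H"
abbreviation AHH where "AHH \<equiv> tensor_space K A HH"
abbreviation AHHH where "AHHH \<equiv> tensor_space K A HHH"
abbreviation AH1 where "AH1 \<equiv> tensor_algebra K A H"
abbreviation AH2 where "AH2 \<equiv> tensor_algebra K A H2"
abbreviation AH3 where "AH3 \<equiv> tensor_algebra K A H3"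
abbreviation \<rho> where "\<rho> \<equiv> coact A"
abbreviation \<Phi>\<rho> where "\<Phi>\<rho> \<equiv> coreassociator A"
abbreviation q where "q \<equiv> coreassociator_inv K H A"

lemma algA: "assoc_unital_algebra K A" using ca by (rule right_comodule_algebra.axioms)
lemma algAH1: "assoc_unital_algebra K AH1" by (rule assoc_unital_algebra_tensor[OF algA algH])
lemma algAH2: "assoc_unital_algebra K AH2" by (rule assoc_unital_algebra_tensor[OF algA algH2])
lemma algAH3: "assoc_unital_algebra K AH3" by (rule assoc_unital_algebra_tensor[OF algA algH3])

lemma modA: "module K A" "module K AH" "module K AHH" "module K AHHH"
  by (intro module_tensor modH module_algebra[OF algA])+

lemma one_A: "\<one>\<^bsub>A\<^esub> \<in> carrier A" by (rule one_closed[OF algA])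

lemma lin_coact: "lin K A AH \<rho>"
proof -
  have "\<rho> \<in> algebra_hom K A AH1" by (rule right_comodule_algebra.coact_hom[OF ca])
  then have "lin K A AH1 \<rho>" by (auto simp: algebra_hom_def ring_hom_def lin_def)
  then show ?thesis by (simp add: strips)
qed

lemma coact_mult: "x \<in> carrier A \<Longrightarrow> y \<in> carrier A \<Longrightarrow> \<rho> (x \<otimes>\<^bsub>A\<^esub> y) = \<rho> x \<otimes>\<^bsub>AH1\<^esub> \<rho> y"
  and coact_one: "\<rho> \<one>\<^bsub>A\<^esub> = pure K A H \<one>\<^bsub>A\<^esub> \<one>\<^bsub>H\<^esub>"
  using right_comodule_algebra.coact_hom[OF ca]
    by (auto simp: algebra_hom_def ring_hom_def one_tensor_algebra)

lemma coact_closed: "a \<in> carrier A \<Longrightarrow> \<rho> a \<in> carrier AH" by (rule lin_closed[OF lin_coact])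

lemma monoid_of_algebra: "assoc_unital_algebra K P \<Longrightarrow> monoid P"
  by (simp add: assoc_unital_algebra_def ring_def)

lemma \<Phi>\<rho>_closed: "\<Phi>\<rho> \<in> carrier AHH" "q \<in> carrier AHH"
  and \<Phi>\<rho>_inv: "\<Phi>\<rho> \<otimes>\<^bsub>AH2\<^esub> q = \<one>\<^bsub>AH2\<^esub>" "q \<otimes>\<^bsub>AH2\<^esub> \<Phi>\<rho> = \<one>\<^bsub>AH2\<^esub>"
proof -
  have u: "\<Phi>\<rho> \<in> Units AH2" by (rule right_comodule_algebra.coreassociator_unit[OF ca])
  interpret monoid AH2 by (rule monoid_of_algebra[OF algAH2])
  show "\<Phi>\<rho> \<in> carrier AHH" "q \<in> carrier AHH" "\<Phi>\<rho> \<otimes>\<^bsub>AH2\<^esub> q = \<one>\<^bsub>AH2\<^esub>" "q \<otimes>\<^bsub>AH2\<^esub> \<Phi>\<rho> = \<one>\<^bsub>AH2\<^esub>"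
    using Units_closed[OF u] Units_inv_closed[OF u] Units_r_inv[OF u] Units_l_inv[OF u]
    by (simp_all add: coreassociator_inv_def strips)
qed

lemma A_cocycle:
  "pure K A HHH \<one>\<^bsub>A\<^esub> \<Phi>
     \<otimes>\<^bsub>AH3\<^esub> tmap K A HHH id (\<lambda>s. rebracket K H H H (tmap K HH H \<Delta> id s)) \<Phi>\<rho>
     \<otimes>\<^bsub>AH3\<^esub> tmap K A HHH id (rebracket K H H H) (rebracket K A HH H (pure K AHH H \<Phi>\<rho> \<one>\<^bsub>H\<^esub>))
   = tmap K A HHH id (tmap K H HH id \<Delta>) \<Phi>\<rho>
     \<otimes>\<^bsub>AH3\<^esub> rebracket K A H HH (tmap K AH HH \<rho> id \<Phi>\<rho>)"
  using right_comodule_algebra.cocycle[OF ca] by (simp add: strips)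

lemma tmap_one:
  assumes "\<phi> \<one>\<^bsub>P\<^esub> = \<one>\<^bsub>P'\<^esub>" "\<gamma> \<one>\<^bsub>Q\<^esub> = \<one>\<^bsub>Q'\<^esub>" "assoc_unital_algebra K P" "assoc_unital_algebra K Q"
    "assoc_unital_algebra K P'" "assoc_unital_algebra K Q'" "lin K P P' \<phi>" "lin K Q Q' \<gamma>"
  shows "tmap K P' Q' \<phi> \<gamma> \<one>\<^bsub>tensor_algebra K P Q\<^esub> = \<one>\<^bsub>tensor_algebra K P' Q'\<^esub>"
  using assms by (simp add: one_tensor_algebra tmap_pure[OF assms(7,8)] module_algebra one_closed)

text \<open>The axioms of a comodule algebra are formulated for its reassociator, but the structure
  maps involve its inverse \<open>q\<close>. Algebra maps send \<open>q\<close> to an inverse of the image of the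
  reassociator, and all maps in the axioms are algebra maps, so the axioms can be rewritten
  for \<open>q\<close>.\<close>

definition alghom where
  "alghom P Q f \<longleftrightarrow> lin K P Q f \<and> f \<one>\<^bsub>P\<^esub> = \<one>\<^bsub>Q\<^esub> \<and>
    (\<forall>x\<in>carrier P. \<forall>y\<in>carrier P. f (x \<otimes>\<^bsub>P\<^esub> y) = f x \<otimes>\<^bsub>Q\<^esub> f y)"

lemma alghomD: "alghom P Q f \<Longrightarrow> lin K P Q f" "alghom P Q f \<Longrightarrow> f \<one>\<^bsub>P\<^esub> = \<one>\<^bsub>Q\<^esub>"
  "alghom P Q f \<Longrightarrow> x \<in> carrier P \<Longrightarrow> y \<in> carrier P \<Longrightarrow> f (x \<otimes>\<^bsub>P\<^esub> y) = f x \<otimes>\<^bsub>Q\<^esub> f y"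
  by (simp_all add: alghom_def)

lemma alghom_id: "alghom P P id"
  by (simp add: alghom_def lin_id)

lemma alghom_compose: "alghom P Q f \<Longrightarrow> alghom Q R g \<Longrightarrow> alghom P R (\<lambda>x. g (f x))"
  by (simp add: alghom_def lin_compose[of K Q R g P f] lin_closed[of K P Q f])

lemma alghom_tmap:
  assumes "assoc_unital_algebra K P" "assoc_unital_algebra K Q" "assoc_unital_algebra K P'"
    "assoc_unital_algebra K Q'"
    "alghom P P' \<phi>" "alghom Q Q' \<gamma>"
  shows "alghom (tensor_algebra K P Q) (tensor_algebra K P' Q') (tmap K P' Q' \<phi> \<gamma>)"
  using assms alghomD[OF assms(5)] alghomD[OF assms(6)]
  by (simp add: alghom_def tmap_one[of \<phi> P P' \<gamma> Q Q'] tmap_mult[of K P Q P' Q' \<phi> \<gamma>] strips lin_tmap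
    module_algebra)

lemma alghom_rebracket:
  assumes "assoc_unital_algebra K P" "assoc_unital_algebra K Q" "assoc_unital_algebra K R"
  shows "alghom (tensor_algebra K (tensor_algebra K P Q) R) (tensor_algebra K P (tensor_algebra K Q
    R)) (rebracket K P Q R)"
  using assms by (simp add: alghom_def rebracket_mult strips lin_rebracket module_algebra
    one_tensor_algebra rebracket_pure one_closed)

lemma alghom_pure_one:
  assumes P: "assoc_unital_algebra K P" and Q: "assoc_unital_algebra K Q"
  shows "alghom P (tensor_algebra K P Q) (\<lambda>x. pure K P Q x \<one>\<^bsub>Q\<^esub>)" "alghom Q (tensor_algebra K P Q)
    (\<lambda>x. pure K P Q \<one>\<^bsub>P\<^esub> x)"
proof -
  interpret P: assoc_unital_algebra K P by (rule P)
  interpret Q: assoc_unital_algebra K Q by (rule Q)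
  show "alghom P (tensor_algebra K P Q) (\<lambda>x. pure K P Q x \<one>\<^bsub>Q\<^esub>)" "alghom Q (tensor_algebra K P Q)
    (\<lambda>x. pure K P Q \<one>\<^bsub>P\<^esub> x)"
    by (simp_all add: alghom_def strips one_tensor_algebra mult_pure[OF P Q] lin_pure_left
      lin_pure_right lin_ident
       P.module_axioms Q.module_axioms)
qed

lemma alghom_comult: "alghom H H2 \<Delta>"
  by (simp add: alghom_def strips lin_comult comult_mult comult_one)

lemma alghom_coact: "alghom A AH1 \<rho>"
  by (simp add: alghom_def strips lin_coact coact_mult coact_one one_tensor_algebra)

lemma alghom_inverse:
  assumes f: "alghom AH2 R f"
  shows "f \<Phi>\<rho> \<otimes>\<^bsub>R\<^esub> f q = \<one>\<^bsub>R\<^esub>" "f q \<otimes>\<^bsub>R\<^esub> f \<Phi>\<rho> = \<one>\<^bsub>R\<^esub>" "f \<Phi>\<rho> \<in> carrier R" "f q \<in> carrier R"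
  using alghomD(3)[OF f, of \<Phi>\<rho> q] alghomD(3)[OF f, of q \<Phi>\<rho>] \<Phi>\<rho>_closed \<Phi>\<rho>_inv alghomD(2)[OF f]
    lin_closed[OF alghomD(1)[OF f], of q] lin_closed[OF alghomD(1)[OF f], of \<Phi>\<rho>]
      by (simp_all add: strips)

lemmas algs = algA algH algH2 algH3 algAH1 algAH2 algAH3

text \<open>The maps whose values at the reassociator of \<open>A\<close> are the second to fifth factors of its
  cocycle identity; the first factor is \<open>1 \<otimes> \<Phi>\<close>.\<close>

abbreviation E2 where "E2 \<equiv> tmap K A HHH id (\<lambda>s. rebracket K H H H (tmap K HH H \<Delta> id s))"
abbreviation E3 where "E3 s \<equiv> tmap K A HHH id (rebracket K H H H) (rebracket K A HH H (pure K AHH H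
  s \<one>\<^bsub>H\<^esub>))"
abbreviation E4 where "E4 \<equiv> tmap K A HHH id (tmap K H HH id \<Delta>)"
abbreviation E5 where "E5 s \<equiv> rebracket K A H HH (tmap K AH HH \<rho> id s)"

lemma alghom_E:
  "alghom AH2 AH3 E2" "alghom AH2 AH3 E3" "alghom AH2 AH3 E4" "alghom AH2 AH3 E5"
proof -
  have t21: "assoc_unital_algebra K (tensor_algebra K H2 H)" "assoc_unital_algebra K (tensor_algebra
    K AH2 H)"
    "assoc_unital_algebra K (tensor_algebra K A (tensor_algebra K H2 H))" "assoc_unital_algebra K
      (tensor_algebra K AH1 H2)"
    by (intro assoc_unital_algebra_tensor algs)+
  have d: "alghom H2 (tensor_algebra K H2 H) (tmap K H2 H \<Delta> id)"
    by (rule alghom_tmap[OF algH algH algH2 algH alghom_comult alghom_id])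
  have "alghom AH2 AH3 (tmap K A H3 id (\<lambda>s. rebracket K H H H (tmap K H2 H \<Delta> id s)))"
    by (rule alghom_tmap[OF algA algH2 algA algH3 alghom_id alghom_compose[OF d alghom_rebracket[OF
      algH algH algH]]])
  then show "alghom AH2 AH3 E2" by (simp add: strips)
  have "alghom AH2 AH3 (\<lambda>s. tmap K A H3 id (rebracket K H H H) (rebracket K A H2 H (pure K AH2 H s
    \<one>\<^bsub>H\<^esub>)))"
    by (rule alghom_compose[OF alghom_compose[OF alghom_pure_one(1)[OF algAH2 algH]
      alghom_rebracket[OF algA algH2 algH]]
      alghom_tmap[OF algA t21(1) algA algH3 alghom_id alghom_rebracket[OF algH algH algH]]])
  then show "alghom AH2 AH3 E3" by (simp add: strips)
  have "alghom AH2 AH3 (tmap K A H3 id (tmap K H H2 id \<Delta>))"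
    by (rule alghom_tmap[OF algA algH2 algA algH3 alghom_id alghom_tmap[OF algH algH algH algH2
      alghom_id alghom_comult]])
  then show "alghom AH2 AH3 E4" by (simp add: strips)
  have "alghom AH2 AH3 (\<lambda>s. rebracket K A H H2 (tmap K AH1 H2 \<rho> id s))"
    by (rule alghom_compose[OF alghom_tmap[OF algA algH2 algAH1 algH2 alghom_coact alghom_id]
      alghom_rebracket[OF algA algH algH2]])
  then show "alghom AH2 AH3 E5" by (simp add: strips)
qed

lemma inverse_cocycle: "E5 q \<otimes>\<^bsub>AH3\<^esub> E4 q = E3 q \<otimes>\<^bsub>AH3\<^esub> (E2 q \<otimes>\<^bsub>AH3\<^esub> pure K A HHH \<one>\<^bsub>A\<^esub> \<Phi>')"
proof (rule monoid_inverse_products[OF monoid_of_algebra[OF algAH3], of "pure K A HHH \<one>\<^bsub>A\<^esub> \<Phi>"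
  "E2 \<Phi>\<rho>" "E3 \<Phi>\<rho>" "E4 \<Phi>\<rho>" "E5 \<Phi>\<rho>"
      "pure K A HHH \<one>\<^bsub>A\<^esub> \<Phi>'" "E2 q" "E3 q" "E4 q" "E5 q"])
  have p: "alghom H3 AH3 (\<lambda>x. pure K A H3 \<one>\<^bsub>A\<^esub> x)" by (rule alghom_pure_one(2)[OF algA algH3])
  have p': "pure K A HHH \<one>\<^bsub>A\<^esub> x \<in> carrier AH3" if "x \<in> carrier HHH" for x
    using that by (simp add: strips pure_closed modA modH one_A)
  show "pure K A HHH \<one>\<^bsub>A\<^esub> \<Phi> \<in> carrier AH3" "pure K A HHH \<one>\<^bsub>A\<^esub> \<Phi>' \<in> carrier AH3"
    using p' \<Phi>_closed \<Phi>'_closed by simp_all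
  show "pure K A HHH \<one>\<^bsub>A\<^esub> \<Phi>' \<otimes>\<^bsub>AH3\<^esub> pure K A HHH \<one>\<^bsub>A\<^esub> \<Phi> = \<one>\<^bsub>AH3\<^esub>"
    using alghomD(3)[OF p, of \<Phi>' \<Phi>] alghomD(2)[OF p] \<Phi>_closed \<Phi>'_closed by (simp add: strips \<Phi>_inv)
qed (use A_cocycle alghom_inverse[OF alghom_E(1)] alghom_inverse[OF alghom_E(2)] alghom_inverse[OF
  alghom_E(3)] alghom_inverse[OF alghom_E(4)]
   in simp_all)

lemma inverse_coaction:
  assumes a: "a \<in> carrier A"
  shows "q \<otimes>\<^bsub>AH2\<^esub> tmap K A HH id \<Delta> (\<rho> a) = rebracket K A H H (tmap K AH H \<rho> id (\<rho> a)) \<otimes>\<^bsub>AH2\<^esub> q"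
proof -
  interpret M: monoid AH2 by (rule monoid_of_algebra[OF algAH2])
  let ?l = "tmap K A HH id \<Delta> (\<rho> a)" and ?r = "rebracket K A H H (tmap K AH H \<rho> id (\<rho> a))"
  have c: "?l \<in> carrier AH2" "?r \<in> carrier AH2" "q \<in> carrier AH2" "\<Phi>\<rho> \<in> carrier AH2"
    unfolding strips by (assumption | rule \<Phi>\<rho>_closed a coact_closed modA lin_coact lin_comult
      H_intros)+
  have "\<Phi>\<rho> \<otimes>\<^bsub>AH2\<^esub> ?r = ?l \<otimes>\<^bsub>AH2\<^esub> \<Phi>\<rho>"
    using right_comodule_algebra.quasi_coaction[OF ca a] by (simp add: strips)
  then have "q \<otimes>\<^bsub>AH2\<^esub> (\<Phi>\<rho> \<otimes>\<^bsub>AH2\<^esub> ?r) \<otimes>\<^bsub>AH2\<^esub> q = q \<otimes>\<^bsub>AH2\<^esub> (?l \<otimes>\<^bsub>AH2\<^esub> \<Phi>\<rho>) \<otimes>\<^bsub>AH2\<^esub> q" by simp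
  moreover have "q \<otimes>\<^bsub>AH2\<^esub> (\<Phi>\<rho> \<otimes>\<^bsub>AH2\<^esub> ?r) = ?r" using c by (simp add: M.m_assoc[symmetric] \<Phi>\<rho>_inv)
  moreover have "q \<otimes>\<^bsub>AH2\<^esub> (?l \<otimes>\<^bsub>AH2\<^esub> \<Phi>\<rho>) \<otimes>\<^bsub>AH2\<^esub> q = q \<otimes>\<^bsub>AH2\<^esub> ?l" using c
    by (simp add: M.m_assoc \<Phi>\<rho>_inv)
  ultimately show ?thesis by simp
qed

lemma alghom_counit: "alghom H2 H (counit_id H H)" "alghom H2 H (id_counit H H)"
  using algH by (simp_all add: alghom_def strips lin_counit_id lin_id_counit modH one_tensor_algebra
    counit_id_pure id_counit_pure
    one_H counit_one module.smult_one[OF modH(1)] counit_id_mult[unfolded strips]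
      id_counit_mult[unfolded strips])

lemma inverse_counit:
  "tmap K A H id (counit_id H H) q = pure K A H \<one>\<^bsub>A\<^esub> \<one>\<^bsub>H\<^esub>" "tmap K A H id (id_counit H H) q
    = pure K A H \<one>\<^bsub>A\<^esub> \<one>\<^bsub>H\<^esub>"
proof -
  interpret M: monoid AH1 by (rule monoid_of_algebra[OF algAH1])
  have *: "f q = \<one>\<^bsub>AH1\<^esub>" if f: "alghom AH2 AH1 f" "f \<Phi>\<rho> = \<one>\<^bsub>AH1\<^esub>" for f
    using alghom_inverse[OF f(1)] f(2) by simp
  note t = alghom_tmap[OF algA algH2 algA algH alghom_id]
  show "tmap K A H id (counit_id H H) q = pure K A H \<one>\<^bsub>A\<^esub> \<one>\<^bsub>H\<^esub>"
    using *[OF t[OF alghom_counit(1)]] right_comodule_algebra.counit_middle[OF ca]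
      by (simp add: one_tensor_algebra)
  show "tmap K A H id (id_counit H H) q = pure K A H \<one>\<^bsub>A\<^esub> \<one>\<^bsub>H\<^esub>"
    using *[OF t[OF alghom_counit(2)]] right_comodule_algebra.counit_last[OF ca]
      by (simp add: one_tensor_algebra)
qed

section \<open>Right actions on tensor powers of the bimodule algebra\<close>

text \<open>\<open>X\<close> and \<open>Y\<close> are \<open>B\<close> as a left module and as a right module, the latter in the form of a
  left module over the opposite algebra. \<open>R2\<close> and \<open>R3\<close> are the componentwise right actions
  of \<open>H \<otimes> H\<close> and \<open>H \<otimes> H \<otimes> H\<close> on tensor powers of \<open>B\<close>, and \<open>M3\<close> is the product of three
  factors bracketed to the right.\<close>

abbreviation X where "X \<equiv> hmod.truncate B"
abbreviation Y where "Y \<equiv> with_lact B (\<lambda>h u. ract B u h)"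
abbreviation Hop where "Hop \<equiv> op_algebra H"
abbreviation BB where "BB \<equiv> tensor_space K B B"
abbreviation BBB where "BBB \<equiv> tensor_space K B BB"
abbreviation R2 where "R2 t s \<equiv> lact (tens_mod K Y Y) s t"
abbreviation R3 where "R3 t r \<equiv> lact (tens_mod K Y (tens_mod K Y Y)) r t"
abbreviation M2 where "M2 \<equiv> fn m"
abbreviation M3 where "M3 t \<equiv> fn m (tmap K B B id (fn m) t)"
abbreviation u where "u \<equiv> bimod_one K e"

lemma bimodB: "hbimodule K H B"
  using algebra_object.obj[OF ba] by (simp add: bimod_cat_def module_monoidal_def)

lemma modB: "module K B" "module K BB" "module K BBB"
proof -
  show "module K B" using bimodB by (simp add: hbimodule_def left_hmodule_def)
  then show "module K BB" "module K BBB" by (simp_all add: module_tensor)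
qed

lemma lmod_X: "lmod X"
proof -
  have l: "left_hmodule K H B" using bimodB by (simp add: hbimodule_def)
  show ?thesis using l unfolding left_hmodule_def left_hmodule_axioms_def by (simp add: strips)
qed

lemma Y_module: "left_hmodule K Hop Y"
proof -
  interpret B: hbimodule K H B by (rule bimodB)
  show ?thesis
    by (rule left_hmoduleI)
      (auto simp: op_strips modB lin_def B.ract_closed B.ract_add_left B.ract_add_right
        B.ract_smult_left B.ract_smult_right B.ract_mult B.ract_one)
qed

lemma YY_module: "left_hmodule K (op_algebra H2) (tens_mod K Y Y)"
  by (rule left_hmodule_op_tensor[OF algH algH Y_module Y_module])

lemma YYY_module: "left_hmodule K (op_algebra H3) (tens_mod K Y (tens_mod K Y Y))"
  by (rule left_hmodule_op_tensor[OF algH algH2 Y_module YY_module])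

lemma lact_ract: "h \<in> carrier H \<Longrightarrow> x \<in> carrier B \<Longrightarrow> h' \<in> carrier H \<Longrightarrow> ract B (lact B h x) h'
  = lact B h (ract B x h')"
  using hbimodule.lact_ract[OF bimodB] .

lemma ract_closed: "x \<in> carrier B \<Longrightarrow> h \<in> carrier H \<Longrightarrow> ract B x h \<in> carrier B"
  and ract_mult: "x \<in> carrier B \<Longrightarrow> h \<in> carrier H \<Longrightarrow> h' \<in> carrier H \<Longrightarrow> ract B x (h \<otimes>\<^bsub>H\<^esub> h')
    = ract B (ract B x h) h'"
  and ract_one: "x \<in> carrier B \<Longrightarrow> ract B x \<one>\<^bsub>H\<^esub> = x"
  using hbimodule.ract_closed[OF bimodB] hbimodule.ract_mult[OF bimodB] hbimodule.ract_one[OF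
    bimodB] by auto

lemma lactB_closed: "h \<in> carrier H \<Longrightarrow> x \<in> carrier B \<Longrightarrow> lact B h x \<in> carrier B"
  using lact_closed[OF lmod_X] by (simp add: strips)

lemma lin_ract_left: "h \<in> carrier H \<Longrightarrow> lin K U B (\<lambda>u. f u) \<Longrightarrow> lin K U B (\<lambda>u. ract B (f u) h)"
  using lin_lact_right[OF Y_module, of h U f] by (simp add: op_strips)

lemma lin_ract_right: "x \<in> carrier B \<Longrightarrow> lin K U H (\<lambda>u. f u) \<Longrightarrow> lin K U B (\<lambda>u. ract B x (f u))"
  using lin_lact_left[OF Y_module, of x U f] by (simp add: op_strips)

lemma R2_pure: "x \<in> carrier B \<Longrightarrow> y \<in> carrier B \<Longrightarrow> h \<in> carrier H \<Longrightarrow> h' \<in> carrier H \<Longrightarrow>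
    R2 (pure K B B x y) (pure K H H h h') = pure K B B (ract B x h) (ract B y h')"
  using lact_tens_mod_pure[OF assoc_unital_algebra_op[OF algH] assoc_unital_algebra_op[OF algH]
    Y_module Y_module, of h h' x y]
  by (simp add: op_strips)

lemma R2_closed: "t \<in> carrier BB \<Longrightarrow> s \<in> carrier HH \<Longrightarrow> R2 t s \<in> carrier BB"
  using lact_closed[OF YY_module, of s t] by (simp add: op_strips)

lemma R2_mult: "t \<in> carrier BB \<Longrightarrow> s \<in> carrier HH \<Longrightarrow> s' \<in> carrier HH \<Longrightarrow> R2 t (s \<otimes>\<^bsub>H2\<^esub> s')
  = R2 (R2 t s) s'"
  using left_hmodule.lact_mult[OF YY_module, of s' s t] by (simp add: op_strips)

lemma lin_R2_left: "s \<in> carrier HH \<Longrightarrow> lin K U BB (\<lambda>u. f u) \<Longrightarrow> lin K U BB (\<lambda>u. R2 (f u) s)"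
  using lin_lact_right[OF YY_module, of s U f] by (simp add: op_strips)

lemma lin_R2_right: "t \<in> carrier BB \<Longrightarrow> lin K U HH (\<lambda>u. f u) \<Longrightarrow> lin K U BB (\<lambda>u. R2 t (f u))"
  using lin_lact_left[OF YY_module, of t U f] by (simp add: op_strips)

lemma R3_pure: "x \<in> carrier B \<Longrightarrow> t \<in> carrier BB \<Longrightarrow> h \<in> carrier H \<Longrightarrow> s \<in> carrier HH \<Longrightarrow>
    R3 (pure K B BB x t) (pure K H HH h s) = pure K B BB (ract B x h) (R2 t s)"
  using lact_tens_mod_pure[OF assoc_unital_algebra_op[OF algH] assoc_unital_algebra_op[OF algH2]
    Y_module YY_module, of h s x t]
  by (simp add: op_strips)

lemma R3_closed: "t \<in> carrier BBB \<Longrightarrow> s \<in> carrier HHH \<Longrightarrow> R3 t s \<in> carrier BBB"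
  using lact_closed[OF YYY_module, of s t] by (simp add: op_strips)

lemma R3_mult: "t \<in> carrier BBB \<Longrightarrow> s \<in> carrier HHH \<Longrightarrow> s' \<in> carrier HHH \<Longrightarrow> R3 t (s \<otimes>\<^bsub>H3\<^esub> s')
  = R3 (R3 t s) s'"
  using left_hmodule.lact_mult[OF YYY_module, of s' s t] by (simp add: op_strips)

lemma lin_R3_left: "s \<in> carrier HHH \<Longrightarrow> lin K U BBB (\<lambda>u. f u) \<Longrightarrow> lin K U BBB (\<lambda>u. R3 (f u) s)"
  using lin_lact_right[OF YYY_module, of s U f] by (simp add: op_strips)

lemma lin_R3_right: "t \<in> carrier BBB \<Longrightarrow> lin K U HHH (\<lambda>u. f u) \<Longrightarrow> lin K U BBB (\<lambda>u. R3 t (f u))"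
  using lin_lact_left[OF YYY_module, of t U f] by (simp add: op_strips)

lemma m_arrow:
  "source m = tensor_bi K H B B" "target m = B" "lin K BB B M2"
  "\<And>h t. h \<in> carrier H \<Longrightarrow> t \<in> carrier BB \<Longrightarrow> M2 (diag_lact K H B B h t) = lact B h (M2 t)"
  "\<And>h t. h \<in> carrier H \<Longrightarrow> t \<in> carrier BB \<Longrightarrow> M2 (diag_ract K H B B t h) = ract B (M2 t) h"
  using algebra_object.mult_hom[OF ba]
  by (auto simp: Hom_def bimod_cat_def module_monoidal_def tensor_bi_def strips linear_maps_def
    lin_def PiE_def)

lemma M2_closed: "t \<in> carrier BB \<Longrightarrow> M2 t \<in> carrier B" by (rule lin_closed[OF m_arrow(3)])

lemma M2_lact: "h \<in> carrier H \<Longrightarrow> t \<in> carrier BB \<Longrightarrow> M2 (lact (tens_mod K X X) (\<Delta> h) t)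
  = lact B h (M2 t)"
  using m_arrow(4)[of h t] by (simp add: diag_lact_def lact_tens_mod strips)

lemma M2_ract: "h \<in> carrier H \<Longrightarrow> t \<in> carrier BB \<Longrightarrow> M2 (R2 t (\<Delta> h)) = ract B (M2 t) h"
  using m_arrow(5)[of h t] by (simp add: diag_ract_def lact_tens_mod strips)

lemma lin_M2: "lin K U BB (\<lambda>u. f u) \<Longrightarrow> lin K U B (\<lambda>u. M2 (f u))"
  by (rule lin_compose[OF m_arrow(3)])

lemma lin_M3: "lin K U BBB (\<lambda>u. f u) \<Longrightarrow> lin K U B (\<lambda>u. M3 (f u))"
  by (rule lin_M2, rule lin_tmap_arg[of K U B BB]) (simp_all add: modB lin_ident m_arrow(3))

lemma M3_pure: "x \<in> carrier B \<Longrightarrow> t \<in> carrier BB \<Longrightarrow> M3 (pure K B BB x t) = M2 (pure K B B x (M2 t))"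
  by (simp add: tmap_pure[OF lin_id m_arrow(3)] modB)

lemma M3_closed: "t \<in> carrier BBB \<Longrightarrow> M3 t \<in> carrier B"
  by (rule lin_closed[OF lin_M3[OF lin_ident]])

text \<open>Left and right actions on \<open>B\<close> commute, hence so do the componentwise actions; three
  tensors are reduced to pure ones in turn.\<close>

lemma act3_R3:
  assumes p: "p \<in> carrier HHH" and t: "t \<in> carrier BBB" and r: "r \<in> carrier HHH"
  shows "act3 X X X p (R3 t r) = R3 (act3 X X X p t) r"
proof -
  note LX = lmod_X lmod_X lmod_X
  have ac: "act3 X X X p t \<in> carrier BBB" if "p \<in> carrier HHH" "t \<in> carrier BBB" for p t
    using act3_closed[OF LX] that by (simp add: strips)
  have la: "lin K BBB BBB (act3 X X X p)" if "p \<in> carrier HHH" for p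
    using lin_act3[OF LX that] by (simp add: strips)
  have lp: "lin K HHH BBB (\<lambda>p. act3 X X X p t)" if "t \<in> carrier BBB" for t
    using lin_lact_left[OF tens3[OF LX], of t H3, OF _ lin_ident] that by (simp add: diag_strips)
  have ap: "act3 X X X (pure K H HH a (pure K H H b c)) (pure K B BB x (pure K B B y z))
     = pure K B BB (lact B a x) (pure K B B (lact B b y) (lact B c z))"
    if "a \<in> carrier H" "b \<in> carrier H" "c \<in> carrier H" "x \<in> carrier B" "y \<in> carrier B" "z \<in> carrier
      B" for a b c x y z
    using lact_tens_mod_pure[OF algH algH2 lmod_X tens2[OF LX(1,2)], of a "pure K H H b c" x
      "pure K B B y z"]
      lact_tens_mod_pure[OF algH algH lmod_X lmod_X, of b c y z] that
    by (simp add: diag_strips pure_closed modH modB)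
  have 1: "\<forall>t\<in>carrier BBB. act3 X X X (pure K H HH a (pure K H H b c)) (R3 t (pure K H HH a' (pure K
    H H b' c')))
     = R3 (act3 X X X (pure K H HH a (pure K H H b c)) t) (pure K H HH a' (pure K H H b' c'))"
    if "a \<in> carrier H" "b \<in> carrier H" "c \<in> carrier H" "a' \<in> carrier H" "b' \<in> carrier H"
      "c' \<in> carrier H" for a b c a' b' c'
    by (rule tensor_ext_right3[of K B B B BBB])
      (use that in \<open>simp_all add: modB lin_compose[OF la lin_R3_left[OF _ lin_ident]] lin_R3_left la
        pure_closed modH
        ap R3_pure R2_pure ract_closed lactB_closed lact_ract\<close>)
  have 2: "\<forall>p\<in>carrier HHH. act3 X X X p (R3 t (pure K H HH a' (pure K H H b' c'))) = R3 (act3 X X X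
    p t) (pure K H HH a' (pure K H H b' c'))"
    if "a' \<in> carrier H" "b' \<in> carrier H" "c' \<in> carrier H" for a' b' c'
    by (rule tensor_ext_right3[of K H H H BBB])
      (use that t 1 in \<open>simp_all add: modB modH lp R3_closed pure_closed lin_R3_left\<close>)
  have "\<forall>r\<in>carrier HHH. act3 X X X p (R3 t r) = R3 (act3 X X X p t) r"
    by (rule tensor_ext_right3[of K H H H BBB])
      (use p t ac 2 in \<open>simp_all add: modB modH lin_compose[OF la] lin_R3_right lin_ident\<close>)
  then show ?thesis using r by simp
qed

text \<open>An algebra in the category of bimodules is associative up to the constraint, in which \<open>\<Phi>\<close>
  acts from the left and its inverse from the right.\<close>

lemma bimodule_algebra_assoc:
  assumes t: "t \<in> carrier (tensor_space K BB B)"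
  shows "M2 (tmap K B B M2 id t) = M3 (R3 (act3 X X X \<Phi> (rebracket K B B B t)) \<Phi>')"
proof -
  have rt: "rebracket K B B B t \<in> carrier BBB" using t modB by (simp add: rebracket_closed)
  have "lact3 K B B B \<Phi> s = lact3 K X X X \<Phi> s" for s by (simp add: lact3_def strips)
  then have l: "lact3 K B B B \<Phi> (rebracket K B B B t) = act3 X X X \<Phi> (rebracket K B B B t)"
    using lact3_eq[OF algH lmod_X lmod_X lmod_X \<Phi>_closed, of "rebracket K B B B t"] rt
      by (simp add: strips)
  have lc: "act3 X X X \<Phi> (rebracket K B B B t) \<in> carrier BBB"
    using act3_closed[OF lmod_X lmod_X lmod_X \<Phi>_closed, of "rebracket K B B B t"] rt
      by (simp add: strips)
  have "ract3 K B B B s r = lact3 K Y Y Y r s" for s r by (simp add: lact3_def ract3_def strips)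
  then have r: "ract3 K B B B s \<Phi>' = R3 s \<Phi>'" if "s \<in> carrier BBB" for s
    using lact3_eq[OF assoc_unital_algebra_op[OF algH] Y_module Y_module Y_module, of \<Phi>' s]
      \<Phi>'_closed that by (simp add: op_strips)
  have rc: "R3 (act3 X X X \<Phi> (rebracket K B B B t)) \<Phi>' \<in> carrier BBB"
    using lc by (simp add: R3_closed \<Phi>'_closed)
  let ?D = "bimod_cat K H"
  have "fn (m \<bullet>\<^bsub>?D\<^esub> (m \<star>\<^bsub>?D\<^esub> Ident ?D B)) t = fn (m \<bullet>\<^bsub>?D\<^esub> (Ident ?D B \<star>\<^bsub>?D\<^esub> m) \<bullet>\<^bsub>?D\<^esub> Assoc ?D B B B)
    t"
    by (simp only: algebra_object.mult_assoc[OF ba])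
  then have "M2 (tmap K B B M2 (\<lambda>x\<in>carrier B. x) t)
      = M2 (tmap K B B (\<lambda>x\<in>carrier B. x) M2 (R3 (act3 X X X \<Phi> (rebracket K B B B t)) \<Phi>'))"
    using t lc rc by (simp add: bimod_cat_def module_monoidal_def m_arrow(1,2) tensor_bi_def strips
      compose_def l r)
  moreover have "tmap K B B M2 (\<lambda>x\<in>carrier B. x) t = tmap K B B M2 id t"
    by (rule tmap_cong[OF t]) (simp_all add: modB)
  moreover have "tmap K B B (\<lambda>x\<in>carrier B. x) M2 s = tmap K B B id M2 s" if "s \<in> carrier BBB" for s
    by (rule tmap_cong[OF that]) (simp_all add: modB)
  ultimately show ?thesis using rc by simp
qed

lemma u_facts:
  shows u_closed: "u \<in> carrier B"
    and u_left: "x \<in> carrier B \<Longrightarrow> M2 (pure K B B u x) = x"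
    and u_right: "x \<in> carrier B \<Longrightarrow> M2 (pure K B B x u) = x"
    and u_lact: "h \<in> carrier H \<Longrightarrow> lact B h u = \<epsilon> h \<odot>\<^bsub>B\<^esub> u"
    and u_ract: "h \<in> carrier H \<Longrightarrow> ract B u h = \<epsilon> h \<odot>\<^bsub>B\<^esub> u"
proof -
  let ?D = "bimod_cat K H" and ?S = "scalars K :: ('k, 'u) space" and ?i = "Scal \<one>\<^bsub>K\<^esub>"
  interpret K: cring K by (rule cringK)
  have e: "source e = unit_bimod K H" "target e = B" "lin K ?S B (fn e)"
    and eqv: "\<forall>h\<in>carrier H. \<forall>x\<in>carrier ?S. fn e (\<epsilon> h \<odot>\<^bsub>?S\<^esub> x) = lact B h (fn e x) \<and> fn e (\<epsilon> h \<odot>\<^bsub>?S\<^esub>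
      x) = ract B (fn e x) h"
    using algebra_object.unit_hom[OF ba]
    by (auto simp: Hom_def bimod_cat_def module_monoidal_def unit_bimod_def strips linear_maps_def
      lin_def PiE_def) metis
  have i: "?i \<in> carrier ?S" by (simp add: scalars_def)
  have S: "module K ?S" using modI by (simp add: unit_left_mod_def strips)
  have bs: "bilin K ?S B B (\<lambda>x u. scalar_of x \<odot>\<^bsub>B\<^esub> u)" "bilin K B ?S B (\<lambda>u x. scalar_of x \<odot>\<^bsub>B\<^esub> u)"
    using bilin_scale[OF modB(1)] by (simp_all add: unit_left_mod_def bilin_def strips)
  show u: "u \<in> carrier B" unfolding bimod_one_def by (rule lin_closed[OF e(3) i])
  show "lact B h u = \<epsilon> h \<odot>\<^bsub>B\<^esub> u" if "h \<in> carrier H" for h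
    using eqv that i lin_smult[OF e(3) counit_closed[OF that] i] unfolding bimod_one_def by metis
  show "ract B u h = \<epsilon> h \<odot>\<^bsub>B\<^esub> u" if "h \<in> carrier H" for h
    using eqv that i lin_smult[OF e(3) counit_closed[OF that] i] unfolding bimod_one_def by metis
  have r: "lin K B B (\<lambda>x\<in>carrier B. x)" by (rule lin_cong[OF _ modB(1) lin_ident]) simp
  show "M2 (pure K B B u x) = x" if x: "x \<in> carrier B"
  proof -
    have "fn (m \<bullet>\<^bsub>?D\<^esub> (e \<star>\<^bsub>?D\<^esub> Ident ?D B)) (pure K ?S B ?i x) = fn (LUnit ?D B) (pure K ?S B ?i x)"
      by (simp only: algebra_object.unit_left[OF ba])
    then show ?thesis
      using x i by (simp add: bimod_cat_def module_monoidal_def e(1,2) tensor_bi_def unit_bimod_def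
        strips compose_def
        pure_closed S modB tmap_pure[OF e(3) r] tlift_pure[OF bs(1)] bimod_one_def
          module.smult_one[OF modB(1)])
  qed
  show "M2 (pure K B B x u) = x" if x: "x \<in> carrier B"
  proof -
    have "fn (m \<bullet>\<^bsub>?D\<^esub> (Ident ?D B \<star>\<^bsub>?D\<^esub> e)) (pure K B ?S x ?i) = fn (RUnit ?D B) (pure K B ?S x ?i)"
      by (simp only: algebra_object.unit_right[OF ba])
    then show ?thesis
      using x i by (simp add: bimod_cat_def module_monoidal_def e(1,2) tensor_bi_def unit_bimod_def
        strips compose_def
        pure_closed S modB tmap_pure[OF r e(3)] tlift_pure[OF bs(2)] bimod_one_def
          module.smult_one[OF modB(1)])
  qed
qed

section \<open>Contracting tensors with elements of the bimodule algebra\<close>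

abbreviation AB where "AB \<equiv> tensor_space K A B"

lemma modAB: "module K AB" by (intro module_tensor modA modB)

text \<open>A contraction keeps the factor in \<open>A\<close> and lets the factors in \<open>H\<close> act from the right on
  given elements of \<open>B\<close>, whose product is then formed. So \<open>contr1 x (\<rho> a)\<close> is \<open>\<psi> (x \<otimes> a)\<close>,
  and \<open>contr2 (x \<otimes> y) q\<close> is \<open>\<zeta> (x \<otimes> y)\<close>. The variants \<open>lcontr1\<close> and \<open>lcontr2\<close> also multiply
  the factor in \<open>A\<close> from the left; they describe a contraction followed by the
  multiplication of \<open>A\<close>. In Sweedler notation,
  \<open>contr2 (x \<otimes> y) (a \<otimes> h \<otimes> g) = a \<otimes> (x h) (y g)\<close>.\<close>

definition contr1 where "contr1 x t = tmap K A B id (\<lambda>h. ract B x h) t"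
definition contr2 where "contr2 v s = tmap K A B id (\<lambda>r. M2 (R2 v r)) s"
definition contr3 where "contr3 w s = tmap K A B id (\<lambda>r. M3 (R3 w r)) s"
definition lcontr1 where "lcontr1 a x t = tmap K A B (\<lambda>b. a \<otimes>\<^bsub>A\<^esub> b) (\<lambda>h. ract B x h) t"
definition lcontr2 where "lcontr2 a v s = tmap K A B (\<lambda>b. a \<otimes>\<^bsub>A\<^esub> b) (\<lambda>r. M2 (R2 v r)) s"

lemmas contr_basic = modA modB modAB algA lin_ract_left lin_ract_right ract_closed lin_M2 lin_M3
  lin_R2_left lin_R2_right
  lin_R3_left lin_R3_right R2_closed R3_closed M2_closed M3_closed lin_compose[OF lin_coact]
    coact_closed H_intros

lemma lin_contractions:
  "x \<in> carrier B \<Longrightarrow> lin K U AH (\<lambda>u. f u) \<Longrightarrow> lin K U AB (\<lambda>u. contr1 x (f u))"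
  "t \<in> carrier AH \<Longrightarrow> lin K U B (\<lambda>u. g u) \<Longrightarrow> lin K U AB (\<lambda>u. contr1 (g u) t)"
  "v \<in> carrier BB \<Longrightarrow> lin K U AHH (\<lambda>u. h u) \<Longrightarrow> lin K U AB (\<lambda>u. contr2 v (h u))"
  "s \<in> carrier AHH \<Longrightarrow> lin K U BB (\<lambda>u. k u) \<Longrightarrow> lin K U AB (\<lambda>u. contr2 (k u) s)"
  "w \<in> carrier BBB \<Longrightarrow> lin K U AHHH (\<lambda>u. h' u) \<Longrightarrow> lin K U AB (\<lambda>u. contr3 w (h' u))"
  "r \<in> carrier AHHH \<Longrightarrow> lin K U BBB (\<lambda>u. k' u) \<Longrightarrow> lin K U AB (\<lambda>u. contr3 (k' u) r)"
  unfolding contr1_def contr2_def contr3_def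
  by (assumption | rule lin_id lin_ident contr_basic)+

lemma lin_contractions_a:
  "a \<in> carrier A \<Longrightarrow> x \<in> carrier B \<Longrightarrow> lin K U AH (\<lambda>u. f u) \<Longrightarrow> lin K U AB (\<lambda>u. lcontr1 a x (f u))"
  "a \<in> carrier A \<Longrightarrow> t \<in> carrier AH \<Longrightarrow> lin K U B (\<lambda>u. g u) \<Longrightarrow> lin K U AB (\<lambda>u. lcontr1 a (g u) t)"
  "x \<in> carrier B \<Longrightarrow> t \<in> carrier AH \<Longrightarrow> lin K U A (\<lambda>u. l u) \<Longrightarrow> lin K U AB (\<lambda>u. lcontr1 (l u) x t)"
  "a \<in> carrier A \<Longrightarrow> v \<in> carrier BB \<Longrightarrow> lin K U AHH (\<lambda>u. h u) \<Longrightarrow> lin K U AB (\<lambda>u. lcontr2 a v (h u))"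
  "a \<in> carrier A \<Longrightarrow> s \<in> carrier AHH \<Longrightarrow> lin K U BB (\<lambda>u. k u) \<Longrightarrow> lin K U AB (\<lambda>u. lcontr2 a (k u) s)"
  "v \<in> carrier BB \<Longrightarrow> s \<in> carrier AHH \<Longrightarrow> lin K U A (\<lambda>u. l u) \<Longrightarrow> lin K U AB (\<lambda>u. lcontr2 (l u) v s)"
  unfolding lcontr1_def lcontr2_def
  by (assumption | rule lin_ident contr_basic)+

lemma contractions_closed:
  "x \<in> carrier B \<Longrightarrow> t \<in> carrier AH \<Longrightarrow> contr1 x t \<in> carrier AB"
  "v \<in> carrier BB \<Longrightarrow> s \<in> carrier AHH \<Longrightarrow> contr2 v s \<in> carrier AB"
  "w \<in> carrier BBB \<Longrightarrow> r \<in> carrier AHHH \<Longrightarrow> contr3 w r \<in> carrier AB"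
  "a \<in> carrier A \<Longrightarrow> x \<in> carrier B \<Longrightarrow> t \<in> carrier AH \<Longrightarrow> lcontr1 a x t \<in> carrier AB"
  "a \<in> carrier A \<Longrightarrow> v \<in> carrier BB \<Longrightarrow> s \<in> carrier AHH \<Longrightarrow> lcontr2 a v s \<in> carrier AB"
  by (rule lin_closed[OF lin_contractions(1)[OF _ lin_ident]] lin_closed[OF lin_contractions(3)[OF _
    lin_ident]]
      lin_closed[OF lin_contractions(5)[OF _ lin_ident]] lin_closed[OF lin_contractions_a(1)[OF _ _
        lin_ident]]
      lin_closed[OF lin_contractions_a(4)[OF _ _ lin_ident]]; assumption)+

lemma lin_inner:
  "x \<in> carrier B \<Longrightarrow> lin K H B (\<lambda>h. ract B x h)" "v \<in> carrier BB \<Longrightarrow> lin K HH B (\<lambda>r. M2 (R2 v r))"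
  "w \<in> carrier BBB \<Longrightarrow> lin K HHH B (\<lambda>r. M3 (R3 w r))" "a \<in> carrier A \<Longrightarrow> lin K A A (\<lambda>b. a \<otimes>\<^bsub>A\<^esub> b)"
  by (assumption | rule lin_ident contr_basic)+

lemma contractions_pure:
  "x \<in> carrier B \<Longrightarrow> b \<in> carrier A \<Longrightarrow> h \<in> carrier H \<Longrightarrow> contr1 x (pure K A H b h) = pure K A B b (ract B
    x h)"
  "v \<in> carrier BB \<Longrightarrow> b \<in> carrier A \<Longrightarrow> r \<in> carrier HH \<Longrightarrow> contr2 v (pure K A HH b r) = pure K A B b (M2
    (R2 v r))"
  "w \<in> carrier BBB \<Longrightarrow> b \<in> carrier A \<Longrightarrow> s \<in> carrier HHH \<Longrightarrow> contr3 w (pure K A HHH b s)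
    = pure K A B b (M3 (R3 w s))"
  "x \<in> carrier B \<Longrightarrow> a \<in> carrier A \<Longrightarrow> b \<in> carrier A \<Longrightarrow> h \<in> carrier H \<Longrightarrow> lcontr1 a x (pure K A H b h)
    = pure K A B (a \<otimes>\<^bsub>A\<^esub> b) (ract B x h)"
  "v \<in> carrier BB \<Longrightarrow> a \<in> carrier A \<Longrightarrow> b \<in> carrier A \<Longrightarrow> r \<in> carrier HH \<Longrightarrow> lcontr2 a v (pure K A HH b r)
    = pure K A B (a \<otimes>\<^bsub>A\<^esub> b) (M2 (R2 v r))"
  unfolding contr1_def contr2_def contr3_def lcontr1_def lcontr2_def
  by (simp_all add: tmap_pure[OF lin_id lin_inner(1)] tmap_pure[OF lin_id lin_inner(2)] tmap_pure[OF
    lin_id lin_inner(3)]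
    tmap_pure[OF lin_inner(4) lin_inner(1)] tmap_pure[OF lin_inner(4) lin_inner(2)] modA modB modH)

lemmas lin_mult_AH = lin_mult_left[OF algAH1, unfolded strips] lin_mult_right[OF algAH1, unfolded
  strips]
lemmas lin_mult_AHH = lin_mult_left[OF algAH2, unfolded strips] lin_mult_right[OF algAH2, unfolded
  strips]
lemmas lin_mult_AHHH = lin_mult_left[OF algAH3, unfolded strips] lin_mult_right[OF algAH3, unfolded
  strips]
lemmas mult_AH_closed = mult_closed[OF algAH1, unfolded strips] mult_closed[OF algAH2, unfolded
  strips] mult_closed[OF algAH3, unfolded strips]
  mult_closed[OF algA] mult_closed[OF algH] mult_closed[OF algH2, unfolded strips] mult_closed[OF
    algH3, unfolded strips]
lemmas mult_AH_pure = mult_pure[OF algA algH] mult_pure[OF algA algH2, unfolded strips] mult_pure[OF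
  algA algH3, unfolded strips]
  mult_pure[OF algH algH] mult_pure[OF algH algH2, unfolded strips]

lemmas contr_intros = lin_contractions lin_contractions_a contractions_closed lin_mult_AH
  lin_mult_AHH lin_mult_AHHH mult_AH_closed
  contr_basic lin_comult lin_coact lin_tmap lin_rebracket

lemmas contr_simps = modA modB modH modAB module_tensor pure_closed mult_AH_closed mult_AH_pure
  contractions_pure
  R2_closed R3_closed R2_pure R3_pure M2_closed ract_closed ract_mult R2_mult R3_mult comult_closed

text \<open>Two successive contractions are a single contraction of a product, because the right
  action is multiplicative. This and the next lemmas are the instances that occur in the
  wreath axioms: in each, an iterated contraction becomes one contraction of a product in
  \<open>A \<otimes> H\<close>, \<open>A \<otimes> H \<otimes> H\<close> or \<open>A \<otimes> H \<otimes> H \<otimes> H\<close>.\<close>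

lemma contract_psi:
  assumes x: "x \<in> carrier B" and s: "s \<in> carrier AH" and t: "t \<in> carrier AH"
  shows "tlift AB (\<lambda>a0 a1. lcontr1 a0 (ract B x a1) t) s = contr1 x (s \<otimes>\<^bsub>AH1\<^esub> t)"
proof -
  have b: "bilin K A H AB (\<lambda>a0 a1. lcontr1 a0 (ract B x a1) t)" if "t \<in> carrier AH" for t
    by (assumption | rule that x contr_intros)+
  have 1: "\<forall>t\<in>carrier AH. lcontr1 a (ract B x h) t = contr1 x (pure K A H a h \<otimes>\<^bsub>AH1\<^esub> t)"
    if ah: "a \<in> carrier A" "h \<in> carrier H" for a h
    by (rule tensor_ext[of K A H AB]) ((assumption | rule ah x contr_intros)+, simp add: ah x
      contr_simps)
  have "\<forall>s\<in>carrier AH. tlift AB (\<lambda>a0 a1. lcontr1 a0 (ract B x a1) t) s = contr1 x (s \<otimes>\<^bsub>AH1\<^esub> t)"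
    by (rule tensor_ext[of K A H AB])
      ((assumption | rule x t lin_tlift_arg[OF lin_ident _ _ _ b] contr_intros)+, simp add: 1 t
        tlift_pure[OF b[OF t]] contr_simps)
  then show ?thesis using s by simp
qed

text \<open>The comultiplication enters because a product in \<open>B\<close> is acted upon diagonally.\<close>

lemma contract_zeta_psi_left:
  assumes v: "v \<in> carrier BB" and s: "s \<in> carrier AHH" and t: "t \<in> carrier AH"
  shows "tlift AB (\<lambda>a0 r. lcontr1 a0 (M2 (R2 v r)) t) s = contr2 v (s \<otimes>\<^bsub>AH2\<^esub> tmap K A HH id \<Delta> t)"
proof -
  have b: "bilin K A HH AB (\<lambda>a0 r. lcontr1 a0 (M2 (R2 v r)) t)"
    by (assumption | rule t v contr_intros)+
  have tt: "tmap K A HH id \<Delta> t \<in> carrier AHH" by (assumption | rule t contr_intros)+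
  have 1: "\<forall>t\<in>carrier AH. lcontr1 a (M2 (R2 v r)) t = contr2 v (pure K A HH a r \<otimes>\<^bsub>AH2\<^esub> tmap K A HH
    id \<Delta> t)"
    if ar: "a \<in> carrier A" "r \<in> carrier HH" for a r
    by (rule tensor_ext[of K A H AB])
      ((assumption | rule ar v contr_intros)+, simp add: ar v contr_simps tmap_pure[OF lin_id
        lin_comult] M2_ract)
  have "\<forall>s\<in>carrier AHH. tlift AB (\<lambda>a0 r. lcontr1 a0 (M2 (R2 v r)) t) s = contr2 v (s \<otimes>\<^bsub>AH2\<^esub> tmap K A
    HH id \<Delta> t)"
    by (rule tensor_ext[of K A HH AB])
      ((assumption | rule v t tt lin_tlift_arg[OF lin_ident _ _ _ b] contr_intros)+, simp add: 1 t
        tlift_pure[OF b] contr_simps)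
  then show ?thesis using s by simp
qed

text \<open>The coaction enters because the factor in \<open>A\<close> produced by the first contraction passes the
  next element of \<open>B\<close>.\<close>

lemma contract_zeta_psi_right:
  assumes x: "x \<in> carrier B" and y: "y \<in> carrier B" and s: "s \<in> carrier AHH" and t: "t \<in> carrier AH"
  shows "tlift AB (\<lambda>a0 h. tlift AB (\<lambda>b g. lcontr2 b (pure K B B (ract B x g) (ract B y h)) s) (\<rho>
    a0)) t
    = contr2 (pure K B B x y) (rebracket K A H H (tmap K AH H \<rho> id t) \<otimes>\<^bsub>AH2\<^esub> s)"
proof -
  have xy: "pure K B B x y \<in> carrier BB" by (simp add: contr_simps x y)
  have b: "bilin K A H AB (\<lambda>b g. lcontr2 b (pure K B B (ract B x g) (ract B y h)) s)"
    if "h \<in> carrier H" for h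
    by (assumption | rule that x y s contr_intros)+
  have b': "bilin K A H AB (\<lambda>a0 h. tlift AB (\<lambda>b g. lcontr2 b (pure K B B (ract B x g) (ract B y h))
    s) (\<rho> a0))"
    by (assumption | rule x y s b contr_intros)+
  have 1: "\<forall>s\<in>carrier AHH. lcontr2 a (pure K B B (ract B x g) (ract B y h)) s
      = contr2 (pure K B B x y) (pure K A HH a (pure K H H g h) \<otimes>\<^bsub>AH2\<^esub> s)"
        if agh: "a \<in> carrier A" "g \<in> carrier H" "h \<in> carrier H" for a g h
    by (rule tensor_ext[of K A HH AB])
      ((assumption | rule agh x y xy contr_intros)+, simp add: agh x y xy contr_simps)
  have 2: "\<forall>w\<in>carrier AH. tlift AB (\<lambda>b g. lcontr2 b (pure K B B (ract B x g) (ract B y h)) s) w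
      = contr2 (pure K B B x y) (rebracket K A H H (pure K AH H w h) \<otimes>\<^bsub>AH2\<^esub> s)"
        if h: "h \<in> carrier H" for h
    by (rule tensor_ext[of K A H AB])
      ((assumption | rule h x y xy s lin_tlift_arg[OF lin_ident _ _ _ b[OF h]] contr_intros)+,
       simp add: 1 s tlift_pure[OF b[OF h]] rebracket_pure h x y xy contr_simps)
  have "\<forall>t\<in>carrier AH. tlift AB (\<lambda>a0 h. tlift AB (\<lambda>b g. lcontr2 b (pure K B B (ract B x g) (ract B y
    h)) s) (\<rho> a0)) t
      = contr2 (pure K B B x y) (rebracket K A H H (tmap K AH H \<rho> id t) \<otimes>\<^bsub>AH2\<^esub> s)"
    by (rule tensor_ext[of K A H AB])
      ((assumption | rule xy s lin_tlift_arg[OF lin_ident _ _ _ b'] contr_intros)+,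
       simp add: 2 tlift_pure[OF b'] tmap_pure[OF lin_coact lin_id] coact_closed contr_simps)
  then show ?thesis using t by simp
qed

lemma E_lin: "lin K AHH AHHH E2" "lin K AHH AHHH E3" "lin K AHH AHHH E4" "lin K AHH AHHH E5"
  using alghom_E[THEN alghomD(1)] by (simp_all add: strips)

lemma E_closed: "s \<in> carrier AHH \<Longrightarrow> E2 s \<in> carrier AHHH" "s \<in> carrier AHH \<Longrightarrow> E3 s \<in> carrier AHHH"
  "s \<in> carrier AHH \<Longrightarrow> E4 s \<in> carrier AHHH" "s \<in> carrier AHH \<Longrightarrow> E5 s \<in> carrier AHHH"
  by (rule lin_closed[OF E_lin(1)] lin_closed[OF E_lin(2)] lin_closed[OF E_lin(3)] lin_closed[OF
    E_lin(4)]; assumption)+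

lemma contract_zeta_zeta_left:
  assumes x: "x \<in> carrier B" and v: "v \<in> carrier BB" and s: "s \<in> carrier AHH" and s': "s' \<in> carrier
    AHH"
  shows "tlift AB (\<lambda>c r. tlift AB (\<lambda>b g. lcontr2 b (pure K B B (ract B x g) (M2 (R2 v r))) s') (\<rho>
    c)) s
    = contr3 (pure K B BB x v) (E5 s \<otimes>\<^bsub>AH3\<^esub> E4 s')"
proof -
  have xv: "pure K B BB x v \<in> carrier BBB" by (simp add: contr_simps x v)
  have b: "bilin K A H AB (\<lambda>b g. lcontr2 b (pure K B B (ract B x g) (M2 (R2 v r))) s')"
    if "r \<in> carrier HH" for r
    by (assumption | rule that x v s' contr_intros)+
  have b': "bilin K A HH AB (\<lambda>c r. tlift AB (\<lambda>b g. lcontr2 b (pure K B B (ract B x g) (M2 (R2 v r)))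
    s') (\<rho> c))"
    by (assumption | rule x v s' b contr_intros)+
  note l = lin_tmap[OF modH(1,1,1,2) lin_id lin_comult] lin_id
  have 1: "\<forall>s'\<in>carrier AHH. lcontr2 a (pure K B B (ract B x g) (M2 (R2 v r))) s'
      = contr3 (pure K B BB x v) (pure K A HHH a (pure K H HH g r) \<otimes>\<^bsub>AH3\<^esub> E4 s')"
    if agr: "a \<in> carrier A" "g \<in> carrier H" "r \<in> carrier HH" for a g r
    by (rule tensor_ext_right3[of K A H H AB])
      ((assumption | rule agr x v xv lin_compose[OF E_lin(3)] lin_mult_AHHH(2) contr_intros)+,
       simp add: agr x v xv contr_simps tmap_pure[OF l(2,1)] tmap_pure[OF lin_id lin_comult] M3_pure
         M2_ract)
  have 2: "\<forall>w\<in>carrier AH. tlift AB (\<lambda>b g. lcontr2 b (pure K B B (ract B x g) (M2 (R2 v r))) s') w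
      = contr3 (pure K B BB x v) (rebracket K A H HH (pure K AH HH w r) \<otimes>\<^bsub>AH3\<^esub> E4 s')"
        if r: "r \<in> carrier HH" for r
    by (rule tensor_ext[of K A H AB])
      ((assumption | rule r x v xv s' E_closed lin_tlift_arg[OF lin_ident _ _ _ b[OF r]]
        contr_intros)+,
       simp add: 1 s' tlift_pure[OF b[OF r]] rebracket_pure r x v xv contr_simps)
  have "\<forall>s\<in>carrier AHH. tlift AB (\<lambda>c r. tlift AB (\<lambda>b g. lcontr2 b (pure K B B (ract B x g) (M2 (R2 v
    r))) s') (\<rho> c)) s
      = contr3 (pure K B BB x v) (E5 s \<otimes>\<^bsub>AH3\<^esub> E4 s')"
    by (rule tensor_ext[of K A HH AB])
      ((assumption | rule xv s' E_closed lin_tlift_arg[OF lin_ident _ _ _ b'] contr_intros)+,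
       simp add: 2 tlift_pure[OF b'] tmap_pure[OF lin_coact lin_id] coact_closed contr_simps)
  then show ?thesis using s by simp
qed

lemma R3_rebracket:
  assumes "v \<in> carrier BB" "z \<in> carrier B" "r \<in> carrier HH" "h \<in> carrier H"
  shows "R3 (rebracket K B B B (pure K BB B v z)) (rebracket K H H H (pure K HH H r h))
    = rebracket K B B B (pure K BB B (R2 v r) (ract B z h))"
proof -
  note o = assoc_unital_algebra_op[OF algH]
  have "rebracket K Y Y Y (lact (tens_mod K (tens_mod K Y Y) Y) (pure K HH H r h) (pure K BB B v z))
      = R3 (rebracket K Y Y Y (pure K BB B v z)) (rebracket K Hop Hop Hop (pure K HH H r h))"
    by (rule semilinear_rebracket[OF o o o Y_module Y_module Y_module]) (use assms in \<open>simp_all add: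
      op_strips contr_simps\<close>)
  moreover have "lact (tens_mod K (tens_mod K Y Y) Y) (pure K HH H r h) (pure K BB B v z)
    = pure K BB B (R2 v r) (ract B z h)"
    using lact_tens_mod_pure[OF assoc_unital_algebra_op[OF algH2] o YY_module Y_module, of r h v z]
      assms by (simp add: op_strips)
  ultimately show ?thesis by (simp add: op_strips)
qed

text \<open>Here the product of three elements is bracketed to the left, so the associativity of \<open>B\<close>
  is used: it accounts for \<open>\<Phi>\<close> acting on the three elements and for its inverse as the last
  factor.\<close>

lemma contract_zeta_zeta_right:
  assumes v: "v \<in> carrier BB" and z: "z \<in> carrier B" and s: "s \<in> carrier AHH" and s': "s' \<in> carrier
    AHH"
  shows "tlift AB (\<lambda>b r. lcontr2 b (pure K B B (M2 (R2 v r)) z) s') s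
    = contr3 (act3 X X X \<Phi> (rebracket K B B B (pure K BB B v z))) (E3 s \<otimes>\<^bsub>AH3\<^esub> (E2 s' \<otimes>\<^bsub>AH3\<^esub> pure K
      A HHH \<one>\<^bsub>A\<^esub> \<Phi>'))"
proof -
  let ?p = "pure K A HHH \<one>\<^bsub>A\<^esub> \<Phi>'"
  have p: "?p \<in> carrier AHHH" by (simp add: contr_simps one_A \<Phi>'_closed)
  have rc: "rebracket K B B B (pure K BB B v z) \<in> carrier BBB" if "v \<in> carrier BB" "z \<in> carrier B"
    for v z
    using that by (intro rebracket_closed pure_closed modB)
  have ac: "act3 X X X \<Phi> t \<in> carrier BBB" if "t \<in> carrier BBB" for t
    using act3_closed[OF lmod_X lmod_X lmod_X \<Phi>_closed, of t] that by (simp add: strips)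
  let ?W = "act3 X X X \<Phi> (rebracket K B B B (pure K BB B v z))"
  have W: "?W \<in> carrier BBB" by (intro ac rc v z)
  have b: "bilin K A HH AB (\<lambda>b r. lcontr2 b (pure K B B (M2 (R2 v r)) z) s')"
    by (assumption | rule v z s' contr_intros)+
  have wc: "rebracket K H H H (pure K HH H r h) \<in> carrier HHH" if "r \<in> carrier HH" "h \<in> carrier H"
    for r h
    using that by (intro rebracket_closed pure_closed modH)
  \<comment> \<open>The right action commutes with \<open>\<Phi>\<close> and with rebracketing, so it can be carried out on
    the factors bracketed to the left, where associativity applies.\<close>
  have key: "M3 (R3 (R3 (R3 ?W (rebracket K H H H (pure K HH H r \<one>\<^bsub>H\<^esub>))) (rebracket K H H H (pure K
    HH H (\<Delta> k) h))) \<Phi>')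
     = M2 (pure K B B (ract B (M2 (R2 v r)) k) (ract B z h))"
    if rkh: "r \<in> carrier HH" "k \<in> carrier H" "h \<in> carrier H" for r k h
  proof -
    let ?t = "pure K BB B (R2 (R2 v r) (\<Delta> k)) (ract B z h)"
    have tc: "?t \<in> carrier (tensor_space K BB B)" using rkh v z by (simp add: contr_simps)
    have "R3 (R3 ?W (rebracket K H H H (pure K HH H r \<one>\<^bsub>H\<^esub>))) (rebracket K H H H (pure K HH H (\<Delta> k)
      h))
      = act3 X X X \<Phi> (rebracket K B B B ?t)"
      using rkh v z by (simp add: act3_R3[symmetric] \<Phi>_closed rc wc ac R3_closed R3_rebracket one_H
        ract_one comult_closed ract_closed R2_closed)
    then have "M3 (R3 (R3 (R3 ?W (rebracket K H H H (pure K HH H r \<one>\<^bsub>H\<^esub>))) (rebracket K H H H (pure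
      K HH H (\<Delta> k) h))) \<Phi>')
      = M2 (tmap K B B M2 id ?t)"
      using bimodule_algebra_assoc[OF tc] by simp
    also have "\<dots> = M2 (pure K B B (ract B (M2 (R2 v r)) k) (ract B z h))"
      using rkh v z by (simp add: tmap_pure[OF m_arrow(3) lin_id] contr_simps M2_ract)
    finally show ?thesis .
  qed
  interpret A: assoc_unital_algebra K A by (rule algA)
  note l = lin_compose[OF lin_rebracket[OF modH(1,1,1)] lin_tmap[OF modH(1,1,2,1) lin_comult
    lin_id]]
  have 1: "\<forall>s'\<in>carrier AHH. lcontr2 a (pure K B B (M2 (R2 v r)) z) s'
      = contr3 ?W (pure K A HHH a (rebracket K H H H (pure K HH H r \<one>\<^bsub>H\<^esub>)) \<otimes>\<^bsub>AH3\<^esub> (E2 s' \<otimes>\<^bsub>AH3\<^esub>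
        ?p))"
    if ar: "a \<in> carrier A" "r \<in> carrier HH" for a r
    by (rule tensor_ext_right3[of K A H H AB])
      ((assumption | rule ar v z W p wc one_H E_lin(1) lin_mult_AHHH contr_intros)+,
       simp add: ar v z W p wc one_H one_A \<Phi>'_closed contr_simps tmap_pure[OF lin_id l] tmap_pure[OF
         lin_comult lin_id] key)
  note l3 = lin_id lin_rebracket[OF modH(1,1,1)]
  have "\<forall>s\<in>carrier AHH. tlift AB (\<lambda>b r. lcontr2 b (pure K B B (M2 (R2 v r)) z) s') s = contr3 ?W (E3
    s \<otimes>\<^bsub>AH3\<^esub> (E2 s' \<otimes>\<^bsub>AH3\<^esub> ?p))"
    by (rule tensor_ext[of K A HH AB])
      ((assumption | rule W p s' E_closed E_lin lin_tlift_arg[OF lin_ident _ _ _ b] contr_intros)+,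
       simp add: 1 s' one_H tlift_pure[OF b] rebracket_pure tmap_pure[OF l3] contr_simps)
  then show ?thesis using s by simp
qed

text \<open>The two contracted elements of \<open>A \<otimes> H \<otimes> H\<close> are equal by \<open>inverse_coaction\<close>.\<close>

lemma zeta_psi_identity:
  assumes "x \<in> carrier B" "y \<in> carrier B" "a \<in> carrier A"
  shows "tlift AB (\<lambda>a0 r. lcontr1 a0 (M2 (R2 (pure K B B x y) r)) (\<rho> a)) q
    = tlift AB (\<lambda>a0 h. tlift AB (\<lambda>b g. lcontr2 b (pure K B B (ract B x g) (ract B y h)) q) (\<rho> a0))
      (\<rho> a)"
  using assms by (simp add: contract_zeta_psi_left contract_zeta_psi_right \<Phi>\<rho>_closed coact_closed
    inverse_coaction pure_closed modB)

text \<open>The two contracted elements of \<open>A \<otimes> H \<otimes> H \<otimes> H\<close> are equal by \<open>inverse_cocycle\<close>. The tensor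
  \<open>t\<close> is the image of \<open>v \<otimes> z\<close> under the associativity constraint, which is how it arises in
  the wreath axiom.\<close>

lemma zeta_zeta_identity:
  assumes "v \<in> carrier BB" "z \<in> carrier B"
    and t: "t = act3 X X X \<Phi> (rebracket K B B B (pure K BB B v z))"
  shows "contr3 t (E5 q \<otimes>\<^bsub>AH3\<^esub> E4 q) = tlift AB (\<lambda>b r. lcontr2 b (pure K B B (M2 (R2 v r)) z) q) q"
  using assms by (simp add: contract_zeta_zeta_right \<Phi>\<rho>_closed inverse_cocycle)

section \<open>Trivial modules\<close>

abbreviation AT where "AT \<equiv> trivial_mod H A"

lemma same_space_AT: "same_space (trivial_mod H A) A"
  unfolding trivial_mod_def by (rule same_space_wrappers)

lemma AT_fields: "carrier AT = carrier A" "zero AT = zero A" "add AT = add A" "smult AT = smult A"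
  "lact AT h a = \<epsilon> h \<odot>\<^bsub>A\<^esub> a"
  by (simp_all add: trivial_mod_def strips)

lemmas strip_AT = AT_fields
  same_space_AT[THEN same_space_pure(2)[OF _ same_space_refl]]
  same_space_AT[THEN same_space_pure(2)[OF same_space_refl]]
  same_space_AT[THEN same_space_pure(3)[OF _ same_space_refl]]
  same_space_AT[THEN same_space_pure(3)[OF same_space_refl]]
  same_space_AT[THEN same_space_tlift]
  same_space_AT[THEN same_space_lin[OF _ same_space_refl]]
  same_space_AT[THEN same_space_lin[OF same_space_refl]]
  same_space_AT[THEN same_space_module]

lemma strip_AT_maps:
  "tmap K AT W = tmap K A W" "tmap K V AT = tmap K V A"
  "rebracket K AT V W = rebracket K A V W"
  "rebracket K U AT W = rebracket K U A W"
  "rebracket K U V AT = rebracket K U V A"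
  by (simp_all add: tmap_def rebracket_def fun_eq_iff strip_AT)

lemmas triv_strips = diag_strips strip_AT strip_AT_maps

lemma lmod_AT: "lmod AT"
proof -
  interpret A: assoc_unital_algebra K A by (rule algA)
  show ?thesis
    by (rule left_hmoduleI)
      (auto simp: triv_strips modA lin_def counit_closed counit_add counit_mult counit_one
        A.smult_l_distr A.smult_r_distr
        quasi_bialgebra.counit_smult[OF qb] A.smult_assoc1[symmetric] A.R.m_comm)
qed

text \<open>Acting on a factor with trivial action means applying the counit to the corresponding
  factor of the acting tensor.\<close>

lemma lact_trivial_left:
  assumes Q: "assoc_unital_algebra K Q" and M: "left_hmodule K Q M"
    and p: "p \<in> carrier (tensor_space K H Q)" and t: "t \<in> carrier (tensor_space K A M)"
  shows "lact (tens_mod K AT M) p t = tmap K A M id (lact M (counit_id H Q p)) t"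
proof -
  note mM = module_left_hmodule[OF M] and mQ = module_algebra[OF Q]
  interpret M: left_hmodule K Q M by (rule M)
  have ll: "lin K M M (lact M r)" if "r \<in> carrier Q" for r
    using lin_lact_right[OF M that lin_ident] .
  have cc: "counit_id H Q p \<in> carrier Q" if "p \<in> carrier (tensor_space K H Q)" for p
    using lin_closed[OF lin_counit_id[OF mQ] that] .
  note l1 = lin_lact_tens_mod_left[OF algH Q lmod_AT M, unfolded triv_strips] and l2
    = lin_lact_tens_mod_right[OF algH Q lmod_AT M, unfolded triv_strips]
  have 1: "\<forall>p\<in>carrier (tensor_space K H Q). lact (tens_mod K AT M) p (pure K A M a x)
    = tmap K A M id (lact M (counit_id H Q p)) (pure K A M a x)"
    if ax: "a \<in> carrier A" "x \<in> carrier M" for a x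
  proof (rule tensor_ext[of K H Q "tensor_space K A M"])
    show "lin K (tensor_space K H Q) (tensor_space K A M) (\<lambda>p. tmap K A M id (lact M (counit_id H Q
      p)) (pure K A M a x))"
      by (assumption | rule ax mM mQ modA lin_id M lin_counit_id tensor_intros)+
    fix h g assume hg: "h \<in> carrier H" "g \<in> carrier Q"
    then have "tmap K A M id (lact M (\<epsilon> h \<odot>\<^bsub>Q\<^esub> g)) (pure K A M a x) = pure K A M a (lact M (\<epsilon> h \<odot>\<^bsub>Q\<^esub>
      g) x)"
      using tmap_pure[OF lin_id ll[OF module_smult_closed[OF mQ counit_closed[OF hg(1)] hg(2)]]
        modA(1) mM modA(1) mM ax] by simp
    with hg show "lact (tens_mod K AT M) (pure K H Q h g) (pure K A M a x) = tmap K A M id (lact M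
      (counit_id H Q (pure K H Q h g))) (pure K A M a x)"
      using ax lact_tens_mod_pure[OF algH Q lmod_AT M, of h g a x]
      by (simp add: triv_strips counit_id_pure mQ mM modA tmap_pure[OF lin_id ll]
        module_smult_closed counit_closed M.lact_smult_left
        pure_smult_left pure_smult_right M.lact_closed)
  qed (use ax mM mQ modA in \<open>simp_all add: modH module_tensor l1 pure_closed\<close>)
  have "\<forall>t\<in>carrier (tensor_space K A M). lact (tens_mod K AT M) p t = tmap K A M id (lact M
    (counit_id H Q p)) t"
    by (rule tensor_ext[of K A M "tensor_space K A M"])
      (use p mM mQ modA 1 in \<open>simp_all add: module_tensor l2 lin_tmap lin_id ll cc\<close>)
  then show ?thesis using t by simp
qed

lemma lact_trivial_right:
  assumes M: "lmod M" and p: "p \<in> carrier HH" and t: "t \<in> carrier (tensor_space K M A)"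
  shows "lact (tens_mod K M AT) p t = tmap K M A (lact M (id_counit H H p)) id t"
proof -
  note mM = module_left_hmodule[OF M]
  interpret M: left_hmodule K H M by (rule M)
  have ll: "lin K M M (lact M r)" if "r \<in> carrier H" for r
    using lin_lact_right[OF M that lin_ident] .
  have cc: "id_counit H H p \<in> carrier H" if "p \<in> carrier HH" for p
    using lin_closed[OF lin_id_counit[OF modH(1)] that] .
  note l1 = lin_lact_tens_mod_left[OF algH algH M lmod_AT, unfolded triv_strips] and l2
    = lin_lact_tens_mod_right[OF algH algH M lmod_AT, unfolded triv_strips]
  have 1: "\<forall>p\<in>carrier HH. lact (tens_mod K M AT) p (pure K M A x a) = tmap K M A (lact M (id_counit
    H H p)) id (pure K M A x a)"
    if ax: "a \<in> carrier A" "x \<in> carrier M" for a x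
  proof (rule tensor_ext[of K H H "tensor_space K M A"])
    show "lin K HH (tensor_space K M A) (\<lambda>p. tmap K M A (lact M (id_counit H H p)) id (pure K M A x
      a))"
      by (assumption | rule ax mM modH modA lin_id M lin_id_counit tensor_intros)+
    fix h g assume hg: "h \<in> carrier H" "g \<in> carrier H"
    then have "tmap K M A (lact M (\<epsilon> g \<odot>\<^bsub>H\<^esub> h)) id (pure K M A x a) = pure K M A (lact M (\<epsilon> g \<odot>\<^bsub>H\<^esub>
      h) x) a"
      using tmap_pure[OF ll[OF module_smult_closed[OF modH(1) counit_closed[OF hg(2)] hg(1)]] lin_id
        mM modA(1) mM modA(1) ax(2,1)] by simp
    with hg show "lact (tens_mod K M AT) (pure K H H h g) (pure K M A x a) = tmap K M A (lact M
      (id_counit H H (pure K H H h g))) id (pure K M A x a)"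
      using ax lact_tens_mod_pure[OF algH algH M lmod_AT, of h g x a]
      by (simp add: triv_strips id_counit_pure modH mM modA tmap_pure[OF ll lin_id]
        module_smult_closed counit_closed M.lact_smult_left
        pure_smult_left pure_smult_right M.lact_closed)
  qed (use ax mM modA in \<open>simp_all add: modH module_tensor l1 pure_closed\<close>)
  have "\<forall>t\<in>carrier (tensor_space K M A). lact (tens_mod K M AT) p t = tmap K M A (lact M (id_counit
    H H p)) id t"
    by (rule tensor_ext[of K M A "tensor_space K M A"])
      (use p mM modA 1 in \<open>simp_all add: module_tensor l2 lin_tmap lin_id ll cc\<close>)
  then show ?thesis using t by simp
qed

lemma tprod_AT_left: "lmod M \<Longrightarrow> h \<in> carrier H \<Longrightarrow> t \<in> carrier (tensor_space K A M) \<Longrightarrow>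
  lact (tprod AT M) h t = tmap K A M id (lact M h) t"
  by (simp add: lact_tprod triv_strips lact_trivial_left[OF algH] comult_closed counit_comult)

lemma tprod_AT_right: "lmod M \<Longrightarrow> h \<in> carrier H \<Longrightarrow> t \<in> carrier (tensor_space K M A) \<Longrightarrow>
  lact (tprod M AT) h t = tmap K M A (lact M h) id t"
  by (simp add: lact_tprod triv_strips lact_trivial_right comult_closed counit_comult)

text \<open>According to the position of the trivial module, the counit is applied to the first,
  second or third factor of \<open>\<Phi>\<close>, and each of these contractions is \<open>1\<close>.\<close>

lemma act3_triv:
  assumes L: "lmod U" "lmod V" "lmod W" and AT: "U = AT \<or> V = AT \<or> W = AT"
    and t: "t \<in> carrier (tensor_space K U (tensor_space K V W))"
  shows "act3 U V W \<Phi> t = t"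
proof -
  note M = L[THEN lmod_module]
  have one: "tmap K H H id (counit_id H H) \<Phi> = pure K H H \<one>\<^bsub>H\<^esub> \<one>\<^bsub>H\<^esub>" "tmap K H H id (id_counit H H)
    \<Phi> = pure K H H \<one>\<^bsub>H\<^esub> \<one>\<^bsub>H\<^esub>"
    by (simp_all add: counit_middle_\<Phi> counit_right_\<Phi> one_tensor_algebra)
  have id: "lact (tens_mod K U (tprod V W)) (pure K H H \<one>\<^bsub>H\<^esub> \<one>\<^bsub>H\<^esub>) t = t"
    using left_hmodule.lact_one[OF tens2[OF L(1) lmod_tprod[OF L(2,3)]], of t] t
      by (simp add: diag_strips one_tensor_algebra)
  from AT show ?thesis
  proof (elim disjE)
    assume U: "U = AT"
    have "act3 U V W \<Phi> t = tmap K A (tensor_space K V W) id (lact (tens_mod K V W) \<one>\<^bsub>H2\<^esub>) t"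
      using lact_trivial_left[OF algH2 tens2[OF L(2,3)], of \<Phi> t] t
        by (simp add: U triv_strips \<Phi>_closed counit_left_\<Phi>)
    also have "\<dots> = t"
      using t M left_hmodule.lact_one[OF tens2[OF L(2,3)]]
        by (intro tmap_id) (simp_all add: U triv_strips module_tensor)
    finally show ?thesis .
  next
    assume V: "V = AT"
    have "act3 U V W \<Phi> t = lact (tens_mod K U (tprod V W)) (tmap K H H id (counit_id H H) \<Phi>) t"
      by (rule lact_base_change[OF algH algH2 algH algH L(1) tens2[OF L(2,3)] L(1) lmod_tprod[OF
        L(2,3)]])
        (use t \<Phi>_closed L in \<open>simp_all add: V triv_strips same_space_def lin_id lin_counit_id modH
          lact_trivial_left[OF algH] tprod_AT_left
          lin_closed[OF lin_counit_id[OF modH(1)]]\<close>)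
    then show ?thesis by (simp add: one id)
  next
    assume W: "W = AT"
    have "act3 U V W \<Phi> t = lact (tens_mod K U (tprod V W)) (tmap K H H id (id_counit H H) \<Phi>) t"
      by (rule lact_base_change[OF algH algH2 algH algH L(1) tens2[OF L(2,3)] L(1) lmod_tprod[OF
        L(2,3)]])
        (use t \<Phi>_closed L in \<open>simp_all add: W triv_strips same_space_def lin_id lin_id_counit modH
          lact_trivial_right tprod_AT_right
          lin_closed[OF lin_id_counit[OF modH(1)]]\<close>)
    then show ?thesis by (simp add: one id)
  qed
qed

lemma assoc_triv:
  assumes L: "lmod U" "lmod V" "lmod W" and AT: "U = AT \<or> V = AT \<or> W = AT"
    and t: "t \<in> carrier (tensor_space K (tensor_space K U V) W)"
  shows "fn (Assoc C U V W) t = rebracket K U V W t"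
  using fn_assoc[OF L t] act3_triv[OF L AT] rebracket_closed[OF t] L[THEN lmod_module] by simp

lemma assoc_triv_pure:
  assumes L: "lmod U" "lmod V" "lmod W" and AT: "U = AT \<or> V = AT \<or> W = AT"
    and "x \<in> carrier U" "y \<in> carrier V" "z \<in> carrier W"
  shows "fn (Assoc C U V W) (pure K (tensor_space K U V) W (pure K U V x y) z)
    = pure K U (tensor_space K V W) x (pure K V W y z)"
  using assms L[THEN lmod_module] by (subst assoc_triv[OF L AT]) (simp_all add: rebracket_pure
    pure_closed module_tensor)

lemma assoc_inv_pure:
  assumes L: "lmod U" "lmod V" "lmod W" and AT: "U = AT \<or> V = AT \<or> W = AT"
    and xyz: "x \<in> carrier U" "y \<in> carrier V" "z \<in> carrier W"
  shows "fn (inv_arr C (Assoc C U V W)) (pure K U (tensor_space K V W) x (pure K V W y z))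
    = pure K (tensor_space K U V) W (pure K U V x y) z"
  using inv_arr_apply[OF assoc_arr_hom[OF L] assoc_bij[OF L], of "pure K (tensor_space K U V) W
    (pure K U V x y) z"]
    assoc_triv_pure[OF L AT xyz] xyz L[THEN lmod_module]
      by (simp add: diag_strips pure_closed module_tensor)

lemma assoc_inv_hom: "lmod U \<Longrightarrow> lmod V \<Longrightarrow> lmod W \<Longrightarrow> inv_arr C (Assoc C U V W) \<in> Hom C (tprod U (tprod V
  W)) (tprod (tprod U V) W)"
  by (rule inv_arr_hom[OF assoc_arr_hom assoc_bij])

lemma lunit_inv: "lmod U \<Longrightarrow> inv_arr C (LUnit C U) \<in> Hom C U (tprod I U)"
  "lmod U \<Longrightarrow> x \<in> carrier U \<Longrightarrow> fn (inv_arr C (LUnit C U)) x = pure K I U (Scal \<one>\<^bsub>K\<^esub>) x"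
  using inv_arr_hom[OF lunit_arr_hom lunit_bij] inv_arr_apply[OF lunit_arr_hom[of U] lunit_bij[of
    U], of "pure K I U (Scal \<one>\<^bsub>K\<^esub>) x"]
  by (auto simp: fn_lunit_pure lmod_module one_I module.smult_one[OF lmod_module] diag_strips
    pure_closed modI)

lemma runit_inv: "lmod U \<Longrightarrow> inv_arr C (RUnit C U) \<in> Hom C U (tprod U I)"
  "lmod U \<Longrightarrow> x \<in> carrier U \<Longrightarrow> fn (inv_arr C (RUnit C U)) x = pure K U I x (Scal \<one>\<^bsub>K\<^esub>)"
  using inv_arr_hom[OF runit_arr_hom runit_bij] inv_arr_apply[OF runit_arr_hom[of U] runit_bij[of
    U], of "pure K U I x (Scal \<one>\<^bsub>K\<^esub>)"]
  by (auto simp: fn_runit_pure lmod_module one_I module.smult_one[OF lmod_module] diag_strips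
    pure_closed modI)

section \<open>The structure morphisms\<close>

abbreviation \<mu> where "\<mu> \<equiv> trivial_mult K H A"
abbreviation \<eta> where "\<eta> \<equiv> trivial_unit K H A"
abbreviation \<psi> where "\<psi> \<equiv> psi K H A B"
abbreviation \<zeta> where "\<zeta> \<equiv> zeta K H A B m"
abbreviation \<sigma> where "\<sigma> \<equiv> sigma K H A B e"

lemma hom_arrow_pureI:
  assumes U: "lmod U" and V: "lmod V" and Z: "lmod Z" and g: "lin K (tensor_space K U V) Z g"
    and eq: "\<And>h u v. h \<in> carrier H \<Longrightarrow> u \<in> carrier U \<Longrightarrow> v \<in> carrier V \<Longrightarrow>
      g (lact (tprod U V) h (pure K U V u v)) = lact Z h (g (pure K U V u v))"
  shows "Arrow (tprod U V) (\<lambda>t\<in>carrier (tprod U V). g t) Z \<in> Hom C (tprod U V) Z"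
proof (rule hom_arrowI[OF lmod_tprod[OF U V] Z])
  note M = U[THEN lmod_module] V[THEN lmod_module] Z[THEN lmod_module]
  show "lin K (tprod U V) Z g" using g by (simp add: diag_strips)
  fix h t assume h: "h \<in> carrier H" and t: "t \<in> carrier (tprod U V)"
  have l: "lin K (tensor_space K U V) (tensor_space K U V) (lact (tprod U V) h)"
    using lin_lact_right[OF lmod_tprod[OF U V] h lin_ident] by (simp add: diag_strips)
  have "\<forall>t\<in>carrier (tensor_space K U V). g (lact (tprod U V) h t) = lact Z h (g t)"
    by (rule tensor_ext[of K U V Z]) (use M h eq in \<open>simp_all add: lin_compose[OF g l]
      lin_lact_right[OF Z h g]\<close>)
  then show "g (lact (tprod U V) h t) = lact Z h (g t)" using t by (simp add: diag_strips)
qed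

lemma bilin_multA: "bilin K A A A (mult A)"
  by (rule bilinI) (assumption | rule lin_ident algA tensor_intros)+

lemma mu_hom: "\<mu> \<in> Hom C (tprod AT AT) AT"
proof -
  interpret A: assoc_unital_algebra K A by (rule algA)
  have "Arrow (tprod AT AT) (\<lambda>t\<in>carrier (tprod AT AT). tlift A (mult A) t) AT \<in> Hom C (tprod AT AT)
    AT"
  proof (rule hom_arrow_pureI[OF lmod_AT lmod_AT lmod_AT])
    show "lin K (tensor_space K AT AT) AT (tlift A (mult A))"
      by (simp add: triv_strips linear_tlift[OF bilin_multA] modA)
    fix h a b assume hab: "h \<in> carrier H" "a \<in> carrier AT" "b \<in> carrier AT"
    have l: "lin K A A (lact AT h)"
      using lin_lact_right[OF lmod_AT hab(1) lin_ident]
        by (simp add: same_space_lin[OF same_space_AT same_space_AT])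
    show "tlift A (mult A) (lact (tprod AT AT) h (pure K AT AT a b)) = lact AT h (tlift A (mult A)
      (pure K AT AT a b))"
      using hab tprod_AT_left[OF lmod_AT hab(1), of "pure K A A a b"]
      by (simp add: triv_strips pure_closed modA tmap_pure[OF lin_id l] tlift_pure[OF bilin_multA]
        counit_closed A.smult_mult_right)
  qed
  then show ?thesis by (simp add: trivial_mult_def Let_def)
qed

lemma fn_mu: "a \<in> carrier A \<Longrightarrow> b \<in> carrier A \<Longrightarrow> fn \<mu> (pure K A A a b) = a \<otimes>\<^bsub>A\<^esub> b"
  by (simp add: trivial_mult_def Let_def triv_strips pure_closed modA tlift_pure[OF bilin_multA])

lemma scalar_arrow_hom:
  assumes Z: "lmod Z" and z: "z \<in> carrier Z" and inv: "\<And>h. h \<in> carrier H \<Longrightarrow> lact Z h z = \<epsilon> h \<odot>\<^bsub>Z\<^esub> z"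
  shows "Arrow I (\<lambda>x\<in>Scal ` carrier K. scalar_of x \<odot>\<^bsub>Z\<^esub> z) Z \<in> Hom C I Z"
proof -
  interpret Z: left_hmodule K H Z by (rule Z)
  have "Arrow I (\<lambda>x\<in>carrier I. scalar_of x \<odot>\<^bsub>Z\<^esub> z) Z \<in> Hom C I Z"
    by (rule hom_arrowI[OF lmod_I Z])
      (use bilin_scale(1)[OF Z.module_axioms] z inv in \<open>auto simp: bilin_def I_fields
        Z.lact_smult_right counit_closed
        Z.smult_assoc1[symmetric] Z.R.m_comm\<close>)
  then show ?thesis by (simp add: I_fields)
qed

lemma eta_hom: "\<eta> \<in> Hom C I AT"
  using scalar_arrow_hom[OF lmod_AT, of "\<one>\<^bsub>A\<^esub>"] by (simp add: trivial_unit_def triv_strips one_A)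

lemma fn_eta: "x \<in> carrier I \<Longrightarrow> fn \<eta> x = scalar_of x \<odot>\<^bsub>A\<^esub> \<one>\<^bsub>A\<^esub>"
  by (simp add: trivial_unit_def I_fields)

lemma lin_lactB: "h \<in> carrier H \<Longrightarrow> lin K B B (lact B h)"
  using lin_lact_right[OF lmod_X _ lin_ident] by (simp add: triv_strips)

lemma u0_closed: "pure K A B \<one>\<^bsub>A\<^esub> u \<in> carrier AB"
  by (simp add: pure_closed modA modB one_A u_closed)

lemma sigma_hom: "\<sigma> \<in> Hom C I (tprod AT X)"
  using scalar_arrow_hom[OF lmod_tprod[OF lmod_AT lmod_X], of "pure K A B \<one>\<^bsub>A\<^esub> u"] u0_closed
  by (simp add: sigma_def triv_strips tprod_AT_left[OF lmod_X] tmap_pure[OF lin_id lin_lactB] modA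
    modB one_A u_closed u_lact pure_smult_right counit_closed)

lemma fn_sigma: "x \<in> carrier I \<Longrightarrow> fn \<sigma> x = scalar_of x \<odot>\<^bsub>AB\<^esub> pure K A B \<one>\<^bsub>A\<^esub> u"
  by (simp add: sigma_def I_fields triv_strips Let_def)

lemma bilin_psi: "bilin K B A AB (\<lambda>x a. contr1 x (\<rho> a))"
  by (assumption | rule contr_intros)+

lemma psi_arrow: "\<psi> = Arrow (tprod X AT) (\<lambda>t\<in>carrier (tprod X AT). tlift AB (\<lambda>x a. contr1 x (\<rho> a))
  t) (tprod AT X)"
  by (simp add: psi_def Let_def contr1_def tmap_def triv_strips)

lemma tprod_AT_X: "h \<in> carrier H \<Longrightarrow> t \<in> carrier AB \<Longrightarrow> lact (tprod AT X) h t = tmap K A B id (lact B h)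
  t"
  using tprod_AT_left[OF lmod_X] by (simp add: triv_strips)

lemma psi_hom: "\<psi> \<in> Hom C (tprod X AT) (tprod AT X)"
  unfolding psi_arrow
proof (rule hom_arrow_pureI[OF lmod_X lmod_AT lmod_tprod[OF lmod_AT lmod_X]])
  show "lin K (tensor_space K X AT) (tprod AT X) (tlift AB (\<lambda>x a. contr1 x (\<rho> a)))"
    by (simp add: triv_strips linear_tlift[OF bilin_psi] modA modB modAB)
  fix h x a assume "h \<in> carrier H" "x \<in> carrier X" "a \<in> carrier AT"
  then have h: "h \<in> carrier H" and x: "x \<in> carrier B" and a: "a \<in> carrier A"
    by (simp_all add: triv_strips)
  have "\<forall>t\<in>carrier AH. contr1 (lact B h x) t = tmap K A B id (lact B h) (contr1 x t)"
    by (rule tensor_ext[of K A H AB])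
      ((assumption | rule h x lin_lactB lactB_closed lin_id contr_intros)+, simp add: h x
        contr_simps lactB_closed tmap_pure[OF lin_id lin_lactB] lact_ract)
  then show "tlift AB (\<lambda>x a. contr1 x (\<rho> a)) (lact (tprod X AT) h (pure K X AT x a))
    = lact (tprod AT X) h (tlift AB (\<lambda>x a. contr1 x (\<rho> a)) (pure K X AT x a))"
    using h x a tprod_AT_right[OF lmod_X h, of "pure K B A x a"]
    by (simp add: triv_strips pure_closed modA modB modAB tmap_pure[OF lin_lactB lin_id]
      tlift_pure[OF bilin_psi] lactB_closed
      contractions_closed coact_closed tprod_AT_X)
qed

lemma fn_psi: "x \<in> carrier B \<Longrightarrow> a \<in> carrier A \<Longrightarrow> fn \<psi> (pure K B A x a) = contr1 x (\<rho> a)"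
  by (simp add: psi_arrow triv_strips pure_closed modA modB modAB tlift_pure[OF bilin_psi])

text \<open>Contractions reproduce the Sweedler-type formulas by which \<open>\<zeta>\<close> and the quasi-smash product
  are defined.\<close>

lemma lcontr2_tlift3:
  assumes xy: "x \<in> carrier B" "y \<in> carrier B" and s: "s \<in> carrier AHH" and a: "a \<in> carrier A"
  shows "tlift3 AB (\<lambda>q1 q2 q3. pure K A B (a \<otimes>\<^bsub>A\<^esub> q1) (bimod_mult K B m (ract B x q2) (ract B y
    q3))) s = lcontr2 a (pure K B B x y) s"
proof -
  have b: "bilin K H H AB (\<lambda>q2 q3. pure K A B c (M2 (pure K B B (ract B x q2) (ract B y q3))))"
    if "c \<in> carrier A" for c
    by (assumption | rule that xy contr_intros)+
  have xyc: "pure K B B x y \<in> carrier BB" using xy by (simp add: contr_simps)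
  have "\<forall>r\<in>carrier HH. tlift AB (\<lambda>q2 q3. pure K A B c (M2 (pure K B B (ract B x q2) (ract B y q3))))
    r
     = pure K A B c (M2 (R2 (pure K B B x y) r))" if c: "c \<in> carrier A" for c
    by (rule tensor_ext[of K H H AB])
      ((assumption | rule c xy xyc lin_tlift_arg[OF lin_ident _ _ _ b] contr_intros)+, simp add:
        tlift_pure[OF b] c xy contr_simps)
  then show ?thesis
    unfolding tlift3_def lcontr2_def tmap_def bimod_mult_def
    by (intro tlift_cong[OF s]) (simp_all add: modA modH mult_closed[OF algA] a)
qed

lemma lcontr2_one:
  assumes v: "v \<in> carrier BB" and s: "s \<in> carrier AHH"
  shows "lcontr2 \<one>\<^bsub>A\<^esub> v s = contr2 v s"
proof -
  interpret A: assoc_unital_algebra K A by (rule algA)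
  show ?thesis unfolding lcontr2_def contr2_def by (rule tmap_cong[OF s]) (simp_all add: modA modH)
qed

lemma bilin_zeta: "bilin K B B AB (\<lambda>x y. contr2 (pure K B B x y) q)"
  by (assumption | rule \<Phi>\<rho>_closed contr_intros)+

lemma zeta_arrow: "\<zeta> = Arrow (tprod X X) (\<lambda>t\<in>carrier (tprod X X). contr2 t q) (tprod AT X)"
proof -
  interpret A: assoc_unital_algebra K A by (rule algA)
  have 1: "tlift3 AB (\<lambda>q1 q2 q3. pure K A B q1 (bimod_mult K B m (ract B x q2) (ract B y q3))) q
    = contr2 (pure K B B x y) q"
    if xy: "x \<in> carrier B" "y \<in> carrier B" for x y
  proof -
    have "tlift3 AB (\<lambda>q1 q2 q3. pure K A B q1 (bimod_mult K B m (ract B x q2) (ract B y q3))) q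
      = tlift3 AB (\<lambda>q1 q2 q3. pure K A B (\<one>\<^bsub>A\<^esub> \<otimes>\<^bsub>A\<^esub> q1) (bimod_mult K B m (ract B x q2) (ract B y
        q3))) q"
      unfolding tlift3_def by (rule tlift_cong[OF \<Phi>\<rho>_closed(2)]) (simp_all add: modA modH)
    then show ?thesis using lcontr2_tlift3[OF xy \<Phi>\<rho>_closed(2) one_A] xy
      by (simp add: lcontr2_one pure_closed modB \<Phi>\<rho>_closed)
  qed
  have 2: "\<forall>t\<in>carrier BB. tlift AB (\<lambda>x y. contr2 (pure K B B x y) q) t = contr2 t q"
    by (rule tensor_ext[of K B B AB])
      ((assumption | rule lin_tlift_arg[OF lin_ident _ _ _ bilin_zeta] \<Phi>\<rho>_closed contr_intros)+,
        simp add: tlift_pure[OF bilin_zeta] modB modAB)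
  have "tlift AB (\<lambda>x y. tlift3 AB (\<lambda>q1 q2 q3. pure K A B q1 (bimod_mult K B m (ract B x q2) (ract B
    y q3))) q) t = contr2 t q"
    if t: "t \<in> carrier BB" for t
    by (rule HOL.trans[OF tlift_cong[OF t modB(1) modB(1)] bspec[OF 2 t]]) (rule 1)
  then show ?thesis by (simp add: zeta_def Let_def tlift3_def triv_strips cong: restrict_cong)
qed

text \<open>Left and right actions on \<open>B\<close> commute. This makes \<open>\<zeta>\<close> equivariant, since it acts on its
  arguments from the right only.\<close>

lemma act2_R2:
  assumes p: "p \<in> carrier HH" and t: "t \<in> carrier BB" and r: "r \<in> carrier HH"
  shows "lact (tens_mod K X X) p (R2 t r) = R2 (lact (tens_mod K X X) p t) r"
proof -
  have ac: "lact (tens_mod K X X) p t \<in> carrier BB" if "p \<in> carrier HH" "t \<in> carrier BB" for p t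
    using lact_closed[OF tens2[OF lmod_X lmod_X], of p t] that by (simp add: diag_strips)
  have la: "lin K U BB (\<lambda>u. lact (tens_mod K X X) p (f u))" if "p \<in> carrier HH" "lin K U BB f"
    for p U f
    using lin_lact_right[OF tens2[OF lmod_X lmod_X], of p U f] that by (simp add: diag_strips)
  have lp: "lin K HH BB (\<lambda>p. lact (tens_mod K X X) p t)" if "t \<in> carrier BB" for t
    using lin_lact_left[OF tens2[OF lmod_X lmod_X], of t H2, OF _ lin_ident] that
      by (simp add: diag_strips)
  have ap: "lact (tens_mod K X X) (pure K H H a b) (pure K B B x y) = pure K B B (lact B a x) (lact
    B b y)"
    if "a \<in> carrier H" "b \<in> carrier H" "x \<in> carrier B" "y \<in> carrier B" for a b x y
    using lact_tens_mod_pure[OF algH algH lmod_X lmod_X, of a b x y] that by (simp add: diag_strips)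
  have 1: "\<forall>t\<in>carrier BB. lact (tens_mod K X X) (pure K H H a b) (R2 t (pure K H H c d))
    = R2 (lact (tens_mod K X X) (pure K H H a b) t) (pure K H H c d)"
    if "a \<in> carrier H" "b \<in> carrier H" "c \<in> carrier H" "d \<in> carrier H" for a b c d
    by (rule tensor_ext[of K B B BB])
      (use that in \<open>simp_all add: modB la lin_R2_left lin_ident pure_closed modH ap R2_pure
        ract_closed lactB_closed lact_ract\<close>)
  have 2: "\<forall>p\<in>carrier HH. lact (tens_mod K X X) p (R2 t (pure K H H c d)) = R2 (lact (tens_mod K X
    X) p t) (pure K H H c d)"
    if "c \<in> carrier H" "d \<in> carrier H" for c d
    by (rule tensor_ext[of K H H BB]) (use that t 1 in \<open>simp_all add: modB modH lp R2_closed
      pure_closed lin_R2_left\<close>)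
  have "\<forall>r\<in>carrier HH. lact (tens_mod K X X) p (R2 t r) = R2 (lact (tens_mod K X X) p t) r"
    by (rule tensor_ext[of K H H BB]) (use p t ac 2 in \<open>simp_all add: modB modH la lin_R2_right
      lin_ident\<close>)
  then show ?thesis using r by simp
qed

lemma zeta_hom: "\<zeta> \<in> Hom C (tprod X X) (tprod AT X)"
  unfolding zeta_arrow
proof (rule hom_arrowI[OF lmod_tprod[OF lmod_X lmod_X] lmod_tprod[OF lmod_AT lmod_X]])
  show "lin K (tprod X X) (tprod AT X) (\<lambda>t. contr2 t q)"
    by (simp add: triv_strips lin_contractions(4)[OF \<Phi>\<rho>_closed(2) lin_ident])
  fix h t assume h: "h \<in> carrier H" and "t \<in> carrier (tprod X X)"
  then have t: "t \<in> carrier BB" by (simp add: triv_strips)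
  let ?ht = "lact (tens_mod K X X) (\<Delta> h) t"
  have ht: "?ht \<in> carrier BB" using lact_closed[OF tens2[OF lmod_X lmod_X], of "\<Delta> h" t] h t
    by (simp add: diag_strips comult_closed)
  have "\<forall>s\<in>carrier AHH. contr2 ?ht s = tmap K A B id (lact B h) (contr2 t s)"
    by (rule tensor_ext[of K A HH AB])
      ((assumption | rule h t ht lin_lactB lin_id contr_intros)+,
       simp add: h t ht contr_simps tmap_pure[OF lin_id lin_lactB] act2_R2[symmetric] M2_lact)
  then show "contr2 (lact (tprod X X) h t) q = lact (tprod AT X) h (contr2 t q)"
    using h t by (simp add: lact_tprod[of h t X X] triv_strips tprod_AT_X contractions_closed
      \<Phi>\<rho>_closed)
qed

lemma fn_zeta: "t \<in> carrier BB \<Longrightarrow> fn \<zeta> t = contr2 t q"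
  by (simp add: zeta_arrow triv_strips)

section \<open>The algebra in the wreath\<close>

lemma fn_comp_hom: "f \<in> Hom C U V \<Longrightarrow> x \<in> carrier U \<Longrightarrow> fn (g \<bullet>\<^bsub>C\<^esub> f) x = fn g (fn f x)"
  using fn_comp homD(3) by metis

lemma Id_X: "Ident C X \<in> Hom C X X" and Id_AT: "Ident C AT \<in> Hom C AT AT"
  using c_ident lmod_X lmod_AT by auto

lemma fn_Id: "x \<in> carrier B \<Longrightarrow> fn (Ident C X) x = x" "a \<in> carrier A \<Longrightarrow> fn (Ident C AT) a = a"
  by (simp_all add: fn_ident triv_strips)

lemma algebra_AT: "algebra_object C AT \<mu> \<eta>"
proof (rule algebra_object.intro)
  interpret A: assoc_unital_algebra K A by (rule algA)
  show "AT \<in> Obj C" by (simp add: C_fields lmod_AT)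
  show "\<mu> \<in> Hom C (AT \<diamondop>\<^bsub>C\<^esub> AT) AT" by (simp add: C_fields(6) mu_hom)
  show "\<eta> \<in> Hom C (Unit C) AT" by (simp add: C_fields(8) eta_hom)
  note mi = tens_arr_hom[OF mu_hom Id_AT] and im = tens_arr_hom[OF Id_AT mu_hom] and as3
    = assoc_arr_hom[OF lmod_AT lmod_AT lmod_AT]
  show "\<mu> \<bullet>\<^bsub>C\<^esub> (\<mu> \<star>\<^bsub>C\<^esub> Ident C AT) = \<mu> \<bullet>\<^bsub>C\<^esub> (Ident C AT \<star>\<^bsub>C\<^esub> \<mu>) \<bullet>\<^bsub>C\<^esub> Assoc C AT AT AT"
  proof (rule hom_tensor3_eqI[OF c_comp_hom[OF mi mu_hom] c_comp_hom[OF as3 c_comp_hom[OF im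
    mu_hom]] lmod_AT lmod_AT lmod_AT])
    fix a b c assume "a \<in> carrier AT" "b \<in> carrier AT" "c \<in> carrier AT"
    then show "fn (\<mu> \<bullet>\<^bsub>C\<^esub> (\<mu> \<star>\<^bsub>C\<^esub> Ident C AT)) (pure K (tensor_space K AT AT) AT (pure K AT AT a b)
      c)
        = fn (\<mu> \<bullet>\<^bsub>C\<^esub> (Ident C AT \<star>\<^bsub>C\<^esub> \<mu>) \<bullet>\<^bsub>C\<^esub> Assoc C AT AT AT) (pure K (tensor_space K AT AT) AT
          (pure K AT AT a b) c)"
      using assoc_triv_pure[OF lmod_AT lmod_AT lmod_AT, of a b c] fn_tens_pure[OF mu_hom Id_AT, of
        "pure K A A a b" c]
        fn_tens_pure[OF Id_AT mu_hom, of a "pure K A A b c"]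
      by (simp add: fn_comp_hom[OF mi] fn_comp_hom[OF as3] fn_comp_hom[OF im] triv_strips
        pure_closed modA module_tensor fn_mu fn_Id A.m_assoc)
  qed
  note ei = tens_arr_hom[OF eta_hom Id_AT] and ie = tens_arr_hom[OF Id_AT eta_hom]
  show "\<mu> \<bullet>\<^bsub>C\<^esub> (\<eta> \<star>\<^bsub>C\<^esub> Ident C AT) = LUnit C AT"
  proof (rule hom_tensor_eqI[OF c_comp_hom[OF ei mu_hom] lunit_arr_hom[OF lmod_AT] lmod_I lmod_AT])
    fix x a assume "x \<in> carrier I" "a \<in> carrier AT"
    then show "fn (\<mu> \<bullet>\<^bsub>C\<^esub> (\<eta> \<star>\<^bsub>C\<^esub> Ident C AT)) (pure K I AT x a) = fn (LUnit C AT) (pure K I AT x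
      a)"
      using fn_tens_pure[OF eta_hom Id_AT, of x a] fn_lunit_pure[OF lmod_module[OF lmod_AT], of x a]
      by (simp add: fn_comp_hom[OF ei] triv_strips pure_closed modA modI fn_mu fn_eta fn_Id
        scalar_of_closed A.smult_mult_left)
  qed
  show "\<mu> \<bullet>\<^bsub>C\<^esub> (Ident C AT \<star>\<^bsub>C\<^esub> \<eta>) = RUnit C AT"
  proof (rule hom_tensor_eqI[OF c_comp_hom[OF ie mu_hom] runit_arr_hom[OF lmod_AT] lmod_AT lmod_I])
    fix a x assume "a \<in> carrier AT" "x \<in> carrier I"
    then show "fn (\<mu> \<bullet>\<^bsub>C\<^esub> (Ident C AT \<star>\<^bsub>C\<^esub> \<eta>)) (pure K AT I a x) = fn (RUnit C AT) (pure K AT I a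
      x)"
      using fn_tens_pure[OF Id_AT eta_hom, of a x] fn_runit_pure[OF lmod_module[OF lmod_AT], of x a]
      by (simp add: fn_comp_hom[OF ie] triv_strips pure_closed modA modI fn_mu fn_eta fn_Id
        scalar_of_closed A.smult_mult_right)
  qed
qed

section \<open>The wreath\<close>

text \<open>The axioms of a wreath share a few composites: \<open>P2\<close> moves an element of \<open>A\<close> past \<open>X\<close> in
  \<open>A \<otimes> X\<close>, \<open>P3\<close> multiplies an element of \<open>A \<otimes> X\<close> by an element of \<open>X\<close> on the right, and \<open>P1\<close>
  multiplies it by an element of \<open>X\<close> on the left, each time collecting the factors in \<open>A\<close>.\<close>

abbreviation MulX where "MulX \<equiv> mult_left C AT \<mu> X"
abbreviation P2 where "P2 \<equiv> MulX \<bullet>\<^bsub>C\<^esub> (Ident C AT \<star>\<^bsub>C\<^esub> \<psi>) \<bullet>\<^bsub>C\<^esub> Assoc C AT X AT"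
abbreviation P3 where "P3 \<equiv> MulX \<bullet>\<^bsub>C\<^esub> (Ident C AT \<star>\<^bsub>C\<^esub> \<zeta>) \<bullet>\<^bsub>C\<^esub> Assoc C AT X X"
abbreviation P1 where "P1 \<equiv> P3 \<bullet>\<^bsub>C\<^esub> (\<psi> \<star>\<^bsub>C\<^esub> Ident C X) \<bullet>\<^bsub>C\<^esub> inv_arr C (Assoc C X AT X)"

lemmas lmod_rules = lmod_AT lmod_X lmod_tprod

lemma MulX_hom: "MulX \<in> Hom C (tprod AT (tprod AT X)) (tprod AT X)"
  unfolding mult_left_def
  by (rule c_comp_hom[OF assoc_inv_hom tens_arr_hom[OF mu_hom Id_X]]) (rule lmod_rules)+

lemma MulX_pure: "a \<in> carrier A \<Longrightarrow> b \<in> carrier A \<Longrightarrow> x \<in> carrier B \<Longrightarrow> fn MulX (pure K A AB a (pure K A B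
  b x)) = pure K A B (a \<otimes>\<^bsub>A\<^esub> b) x"
  using fn_comp_hom[OF assoc_inv_hom[OF lmod_AT lmod_AT lmod_X], of "pure K A AB a (pure K A B b x)"
    "\<mu> \<star>\<^bsub>C\<^esub> Ident C X"]
    assoc_inv_pure[OF lmod_AT lmod_AT lmod_X, of a b x] fn_tens_pure[OF mu_hom Id_X, of "pure K A A
      a b" x]
  by (simp add: mult_left_def triv_strips pure_closed modA modB modAB fn_mu fn_Id)

lemma lin_MulX: "lin K (tensor_space K A AB) AB (fn MulX)"
  using homD(5)[OF MulX_hom] by (simp add: triv_strips)

lemma MulX_contract:
  assumes a: "a \<in> carrier A"
  shows "x \<in> carrier B \<Longrightarrow> t \<in> carrier AH \<Longrightarrow> fn MulX (pure K A AB a (contr1 x t)) = lcontr1 a x t"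
    and "v \<in> carrier BB \<Longrightarrow> s \<in> carrier AHH \<Longrightarrow> fn MulX (pure K A AB a (contr2 v s)) = lcontr2 a v s"
proof -
  assume x: "x \<in> carrier B" and t: "t \<in> carrier AH"
  have "\<forall>t\<in>carrier AH. fn MulX (pure K A AB a (contr1 x t)) = lcontr1 a x t"
    by (rule tensor_ext[of K A H AB])
      ((assumption | rule a x lin_compose[OF lin_MulX] contr_intros)+, simp add: a x contr_simps
        MulX_pure)
  then show "fn MulX (pure K A AB a (contr1 x t)) = lcontr1 a x t" using t by simp
next
  assume v: "v \<in> carrier BB" and s: "s \<in> carrier AHH"
  have "\<forall>s\<in>carrier AHH. fn MulX (pure K A AB a (contr2 v s)) = lcontr2 a v s"
    by (rule tensor_ext[of K A HH AB])
      ((assumption | rule a v lin_compose[OF lin_MulX] contr_intros)+, simp add: a v contr_simps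
        MulX_pure)
  then show "fn MulX (pure K A AB a (contr2 v s)) = lcontr2 a v s" using s by simp
qed

lemma P_homs:
  "Ident C AT \<star>\<^bsub>C\<^esub> \<psi> \<in> Hom C (tprod AT (tprod X AT)) (tprod AT (tprod AT X))"
  "Ident C AT \<star>\<^bsub>C\<^esub> \<zeta> \<in> Hom C (tprod AT (tprod X X)) (tprod AT (tprod AT X))"
  "\<psi> \<star>\<^bsub>C\<^esub> Ident C X \<in> Hom C (tprod (tprod X AT) X) (tprod (tprod AT X) X)"
  "Assoc C AT X AT \<in> Hom C (tprod (tprod AT X) AT) (tprod AT (tprod X AT))"
  "Assoc C AT X X \<in> Hom C (tprod (tprod AT X) X) (tprod AT (tprod X X))"
  "inv_arr C (Assoc C X AT X) \<in> Hom C (tprod X (tprod AT X)) (tprod (tprod X AT) X)"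
  by (intro tens_arr_hom psi_hom zeta_hom Id_AT Id_X assoc_arr_hom assoc_inv_hom lmod_rules)+

lemma P2_hom: "P2 \<in> Hom C (tprod (tprod AT X) AT) (tprod AT X)"
  by (rule c_comp_hom[OF P_homs(4) c_comp_hom[OF P_homs(1) MulX_hom]])

lemma P3_hom: "P3 \<in> Hom C (tprod (tprod AT X) X) (tprod AT X)"
  by (rule c_comp_hom[OF P_homs(5) c_comp_hom[OF P_homs(2) MulX_hom]])

lemma P1_hom: "P1 \<in> Hom C (tprod X (tprod AT X)) (tprod AT X)"
  by (rule c_comp_hom[OF P_homs(6) c_comp_hom[OF P_homs(3) P3_hom]])

lemma lin_P: "lin K (tensor_space K AB A) AB (fn P2)" "lin K (tensor_space K AB B) AB (fn P3)"
  "lin K (tensor_space K B AB) AB (fn P1)"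
  using homD(5)[OF P1_hom] homD(5)[OF P2_hom] homD(5)[OF P3_hom] by (simp_all add: triv_strips)

lemma P2_pure: "a \<in> carrier A \<Longrightarrow> x \<in> carrier B \<Longrightarrow> b \<in> carrier A \<Longrightarrow> fn P2 (pure K AB A (pure K A B a x)
  b) = lcontr1 a x (\<rho> b)"
  using assoc_triv_pure[OF lmod_AT lmod_X lmod_AT, of a x b] fn_tens_pure[OF Id_AT psi_hom, of a
    "pure K B A x b"]
  by (simp add: fn_comp_hom[OF P_homs(4)] fn_comp_hom[OF P_homs(1)] triv_strips pure_closed modA
    modB modAB module_tensor fn_Id fn_psi
    contractions_closed coact_closed MulX_contract)

lemma P3_pure: "a \<in> carrier A \<Longrightarrow> x \<in> carrier B \<Longrightarrow> y \<in> carrier B \<Longrightarrow> fn P3 (pure K AB B (pure K A B a x)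
  y) = lcontr2 a (pure K B B x y) q"
  using assoc_triv_pure[OF lmod_AT lmod_X lmod_X, of a x y] fn_tens_pure[OF Id_AT zeta_hom, of a
    "pure K B B x y"]
  by (simp add: fn_comp_hom[OF P_homs(5)] fn_comp_hom[OF P_homs(2)] triv_strips pure_closed modA
    modB modAB module_tensor fn_Id fn_zeta
    contractions_closed \<Phi>\<rho>_closed MulX_contract)

text \<open>On pure tensors the composites are contractions. Since \<open>\<psi>\<close> and \<open>\<zeta>\<close> produce tensors that
  are not pure, the composites are also evaluated on contractions, by linearity in the
  contracted element.\<close>

lemma P2_contr1:
  assumes x: "x \<in> carrier B" and t: "t \<in> carrier AH" and b: "b \<in> carrier A"
  shows "fn P2 (pure K AB A (contr1 x t) b) = tlift AB (\<lambda>a0 a1. lcontr1 a0 (ract B x a1) (\<rho> b)) t"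
proof -
  have bl: "bilin K A H AB (\<lambda>a0 a1. lcontr1 a0 (ract B x a1) (\<rho> b))"
    by (assumption | rule x b contr_intros)+
  have "\<forall>t\<in>carrier AH. fn P2 (pure K AB A (contr1 x t) b) = tlift AB (\<lambda>a0 a1. lcontr1 a0 (ract B x
    a1) (\<rho> b)) t"
    by (rule tensor_ext[of K A H AB])
      ((assumption | rule b x lin_compose[OF lin_P(1)] lin_tlift_arg[OF lin_ident _ _ _ bl]
        contr_intros)+, simp add: b x contr_simps P2_pure tlift_pure[OF bl])
  then show ?thesis using t by simp
qed

lemma P2_contr2:
  assumes v: "v \<in> carrier BB" and s: "s \<in> carrier AHH" and a: "a \<in> carrier A"
  shows "fn P2 (pure K AB A (contr2 v s) a) = tlift AB (\<lambda>a0 r. lcontr1 a0 (M2 (R2 v r)) (\<rho> a)) s"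
proof -
  have bl: "bilin K A HH AB (\<lambda>a0 r. lcontr1 a0 (M2 (R2 v r)) (\<rho> a))"
    by (assumption | rule v a contr_intros)+
  have "\<forall>s\<in>carrier AHH. fn P2 (pure K AB A (contr2 v s) a) = tlift AB (\<lambda>a0 r. lcontr1 a0 (M2 (R2 v
    r)) (\<rho> a)) s"
    by (rule tensor_ext[of K A HH AB])
      ((assumption | rule a v lin_compose[OF lin_P(1)] lin_tlift_arg[OF lin_ident _ _ _ bl]
        contr_intros)+, simp add: a v contr_simps P2_pure tlift_pure[OF bl])
  then show ?thesis using s by simp
qed

lemma P3_contr2:
  assumes v: "v \<in> carrier BB" and s: "s \<in> carrier AHH" and z: "z \<in> carrier B"
  shows "fn P3 (pure K AB B (contr2 v s) z) = tlift AB (\<lambda>b r. lcontr2 b (pure K B B (M2 (R2 v r)) z)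
    q) s"
proof -
  have bl: "bilin K A HH AB (\<lambda>b r. lcontr2 b (pure K B B (M2 (R2 v r)) z) q)"
    by (assumption | rule v z \<Phi>\<rho>_closed contr_intros)+
  have "\<forall>s\<in>carrier AHH. fn P3 (pure K AB B (contr2 v s) z) = tlift AB (\<lambda>b r. lcontr2 b (pure K B B
    (M2 (R2 v r)) z) q) s"
    by (rule tensor_ext[of K A HH AB])
      ((assumption | rule z v lin_compose[OF lin_P(2)] lin_tlift_arg[OF lin_ident _ _ _ bl]
        contr_intros)+, simp add: z v contr_simps P3_pure tlift_pure[OF bl])
  then show ?thesis using s by simp
qed

lemma bilin_P3:
  assumes "x \<in> carrier B" "y \<in> carrier B"
  shows "bilin K A H AB (\<lambda>b g. lcontr2 b (pure K B B (ract B x g) y) q)"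
  by (assumption | rule assms \<Phi>\<rho>_closed contr_intros)+

lemma P3_contr1:
  assumes x: "x \<in> carrier B" and t: "t \<in> carrier AH" and y: "y \<in> carrier B"
  shows "fn P3 (pure K AB B (contr1 x t) y) = tlift AB (\<lambda>b g. lcontr2 b (pure K B B (ract B x g) y)
    q) t"
proof -
  have "\<forall>t\<in>carrier AH. fn P3 (pure K AB B (contr1 x t) y) = tlift AB (\<lambda>b g. lcontr2 b (pure K B B
    (ract B x g) y) q) t"
    by (rule tensor_ext[of K A H AB])
      ((assumption | rule y x lin_compose[OF lin_P(2)] lin_tlift_arg[OF lin_ident _ _ _ bilin_P3]
        contr_intros)+, simp add: y x contr_simps P3_pure tlift_pure[OF bilin_P3])
  then show ?thesis using t by simp
qed

lemma P1_pure: "x \<in> carrier B \<Longrightarrow> a \<in> carrier A \<Longrightarrow> y \<in> carrier B \<Longrightarrow>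
  fn P1 (pure K B AB x (pure K A B a y)) = tlift AB (\<lambda>b g. lcontr2 b (pure K B B (ract B x g) y) q)
    (\<rho> a)"
  using assoc_inv_pure[OF lmod_X lmod_AT lmod_X, of x a y] fn_tens_pure[OF psi_hom Id_X, of
    "pure K B A x a" y]
  by (simp add: fn_comp_hom[OF P_homs(6)] fn_comp_hom[OF P_homs(3)] triv_strips pure_closed modA
    modB modAB module_tensor fn_Id fn_psi
    contractions_closed coact_closed P3_contr1)

lemma P1_contr1:
  assumes x: "x \<in> carrier B" and t: "t \<in> carrier AH" and y: "y \<in> carrier B"
  shows "fn P1 (pure K B AB x (contr1 y t)) = tlift AB (\<lambda>a0 h. tlift AB (\<lambda>b g. lcontr2 b (pure K B B
    (ract B x g) (ract B y h)) q) (\<rho> a0)) t"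
proof -
  have bl: "bilin K A H AB (\<lambda>a0 h. tlift AB (\<lambda>b g. lcontr2 b (pure K B B (ract B x g) (ract B y h))
    q) (\<rho> a0))"
    by (assumption | rule x y bilin_P3 \<Phi>\<rho>_closed contr_intros)+
  have "\<forall>t\<in>carrier AH. fn P1 (pure K B AB x (contr1 y t)) = tlift AB (\<lambda>a0 h. tlift AB (\<lambda>b g. lcontr2
    b (pure K B B (ract B x g) (ract B y h)) q) (\<rho> a0)) t"
    by (rule tensor_ext[of K A H AB])
      ((assumption | rule y x lin_compose[OF lin_P(3)] lin_tlift_arg[OF lin_ident _ _ _ bl]
        contr_intros)+, simp add: y x contr_simps P1_pure tlift_pure[OF bl])
  then show ?thesis using t by simp
qed

lemma P1_contr2:
  assumes x: "x \<in> carrier B" and s: "s \<in> carrier AHH" and v: "v \<in> carrier BB"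
  shows "fn P1 (pure K B AB x (contr2 v s)) = tlift AB (\<lambda>c r. tlift AB (\<lambda>b g. lcontr2 b (pure K B B
    (ract B x g) (M2 (R2 v r))) q) (\<rho> c)) s"
proof -
  have bl: "bilin K A HH AB (\<lambda>c r. tlift AB (\<lambda>b g. lcontr2 b (pure K B B (ract B x g) (M2 (R2 v r)))
    q) (\<rho> c))"
    by (assumption | rule x v bilin_P3 \<Phi>\<rho>_closed contr_intros)+
  have "\<forall>s\<in>carrier AHH. fn P1 (pure K B AB x (contr2 v s)) = tlift AB (\<lambda>c r. tlift AB (\<lambda>b g. lcontr2
    b (pure K B B (ract B x g) (M2 (R2 v r))) q) (\<rho> c)) s"
    by (rule tensor_ext[of K A HH AB])
      ((assumption | rule v x lin_compose[OF lin_P(3)] lin_tlift_arg[OF lin_ident _ _ _ bl]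
        contr_intros)+, simp add: v x contr_simps P1_pure tlift_pure[OF bl])
  then show ?thesis using s by simp
qed

text \<open>The unit \<open>u\<close> of \<open>B\<close> absorbs the right action through the counit, so that contracting with
  it applies the counit to one factor; the counit identities then leave nothing of \<open>\<rho> a\<close> or
  \<open>q\<close> but the expected terms.\<close>

lemma unit_contractions:
  assumes x: "x \<in> carrier B"
  shows "\<And>a. a \<in> carrier A \<Longrightarrow> lcontr1 \<one>\<^bsub>A\<^esub> u (\<rho> a) = pure K A B a u"
    and "lcontr2 \<one>\<^bsub>A\<^esub> (pure K B B x u) q = pure K A B \<one>\<^bsub>A\<^esub> x"
    and "lcontr2 \<one>\<^bsub>A\<^esub> (pure K B B u x) q = pure K A B \<one>\<^bsub>A\<^esub> x"
    and "contr1 x (\<rho> \<one>\<^bsub>A\<^esub>) = pure K A B \<one>\<^bsub>A\<^esub> x"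
proof -
  interpret A: assoc_unital_algebra K A by (rule algA)
  interpret B: module K B by (rule modB)
  have u: "u \<in> carrier B" by (rule u_closed)
  have xu: "pure K B B x u \<in> carrier BB" "pure K B B u x \<in> carrier BB" using x u
    by (simp_all add: contr_simps)
  have lc: "lin K AH A (id_counit A H)" "lin K HH H (id_counit H H)" "lin K HH H (counit_id H H)"
    by (simp_all add: lin_id_counit lin_counit_id modA modH)
  have "\<forall>t\<in>carrier AH. lcontr1 \<one>\<^bsub>A\<^esub> u t = pure K A B (id_counit A H t) u"
    by (rule tensor_ext[of K A H AB])
      ((assumption | rule u one_A lc contr_intros)+, simp add: u one_A contr_simps u_ract
        id_counit_pure counit_closed pure_smult_left pure_smult_right)
  moreover have "id_counit A H (\<rho> a) = a" if "a \<in> carrier A" for a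
    using right_comodule_algebra.counit_coact[OF ca that] .
  ultimately show "lcontr1 \<one>\<^bsub>A\<^esub> u (\<rho> a) = pure K A B a u" if "a \<in> carrier A" for a using that
    by (simp add: coact_closed)
  have r: "M2 (pure K B B y (c \<odot>\<^bsub>B\<^esub> u)) = c \<odot>\<^bsub>B\<^esub> y" "M2 (pure K B B (c \<odot>\<^bsub>B\<^esub> u) y) = c \<odot>\<^bsub>B\<^esub> y"
    if "c \<in> carrier K" "y \<in> carrier B" for c y
    using that u by (simp_all add: pure_smult_right pure_smult_left modB lin_smult[OF m_arrow(3)]
      pure_closed u_left u_right)
  have rs: "ract B x (c \<odot>\<^bsub>H\<^esub> h) = c \<odot>\<^bsub>B\<^esub> ract B x h" if "c \<in> carrier K" "h \<in> carrier H" for c h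
    using that x by (rule lin_smult[OF lin_inner(1), rotated])
  have "\<forall>s\<in>carrier AHH. lcontr2 \<one>\<^bsub>A\<^esub> (pure K B B x u) s = contr1 x (tmap K A H id (id_counit H H)
    s)"
    by (rule tensor_ext_right3[of K A H H AB])
      ((assumption | rule x xu one_A lc lin_id contr_intros)+, simp add: x u xu one_A contr_simps
        u_ract tmap_pure[OF lin_id lc(2)] id_counit_pure counit_closed r rs counit_smult_closed)
  then show "lcontr2 \<one>\<^bsub>A\<^esub> (pure K B B x u) q = pure K A B \<one>\<^bsub>A\<^esub> x"
    using x by (simp add: \<Phi>\<rho>_closed inverse_counit contractions_pure one_A one_H ract_one)
  have "\<forall>s\<in>carrier AHH. lcontr2 \<one>\<^bsub>A\<^esub> (pure K B B u x) s = contr1 x (tmap K A H id (counit_id H H)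
    s)"
    by (rule tensor_ext_right3[of K A H H AB])
      ((assumption | rule x xu one_A lc lin_id contr_intros)+, simp add: x u xu one_A contr_simps
        u_ract tmap_pure[OF lin_id lc(3)] counit_id_pure counit_closed r rs counit_smult_closed)
  then show "lcontr2 \<one>\<^bsub>A\<^esub> (pure K B B u x) q = pure K A B \<one>\<^bsub>A\<^esub> x"
    using x by (simp add: \<Phi>\<rho>_closed inverse_counit contractions_pure one_A one_H ract_one)
  show "contr1 x (\<rho> \<one>\<^bsub>A\<^esub>) = pure K A B \<one>\<^bsub>A\<^esub> x"
    using x by (simp add: coact_one contractions_pure one_A one_H ract_one)
qed

lemma hom_tensor3r_eqI:
  assumes f: "f \<in> Hom C (tprod U (tprod V W)) Z" and g: "g \<in> Hom C (tprod U (tprod V W)) Z"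
    and "lmod U" "lmod V" "lmod W"
    and "\<And>u v w. u \<in> carrier U \<Longrightarrow> v \<in> carrier V \<Longrightarrow> w \<in> carrier W \<Longrightarrow>
      fn f (pure K U (tensor_space K V W) u (pure K V W v w)) = fn g (pure K U (tensor_space K V W)
        u (pure K V W v w))"
  shows "f = g"
proof (rule hom_eqI[OF f g])
  have "\<forall>x\<in>carrier (tensor_space K U (tensor_space K V W)). fn f x = fn g x"
    using assms homD(5,8)[OF f] homD(5)[OF g] by (intro tensor_ext_right3) (auto simp: lmod_module
      diag_strips)
  then show "\<forall>x\<in>carrier (tprod U (tprod V W)). fn f x = fn g x" by (simp add: diag_strips)
qed

lemma one_I_facts: "\<one>\<^bsub>K\<^esub> \<odot>\<^bsub>AB\<^esub> pure K A B \<one>\<^bsub>A\<^esub> u = pure K A B \<one>\<^bsub>A\<^esub> u" "\<one>\<^bsub>K\<^esub> \<odot>\<^bsub>A\<^esub> \<one>\<^bsub>A\<^esub> = \<one>\<^bsub>A\<^esub>"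
  by (simp_all add: module.smult_one[OF modAB] module.smult_one[OF modA(1)] u0_closed one_A)

lemma fn_units: "fn \<sigma> (Scal \<one>\<^bsub>K\<^esub>) = pure K A B \<one>\<^bsub>A\<^esub> u" "fn \<eta> (Scal \<one>\<^bsub>K\<^esub>) = \<one>\<^bsub>A\<^esub>"
  by (simp_all add: fn_sigma fn_eta one_I one_I_facts)

text \<open>The two sides of an axiom are compared on pure tensors, and on elements of \<open>A\<close> or \<open>X\<close> for
  the axioms on \<open>\<sigma>\<close>. The composites have been evaluated there as contractions, so that each
  axiom becomes one of the contraction identities.\<close>

lemma wreath_AX: "wreath C AT \<mu> \<eta> X \<psi> \<zeta> \<sigma>"
proof (rule wreath.intro[OF algebra_AT wreath_axioms.intro])
  interpret A: assoc_unital_algebra K A by (rule algA)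
  note simps = triv_strips pure_closed modA modB modAB modI module_tensor fn_Id fn_psi fn_zeta fn_mu
    fn_units u_closed
    contractions_closed coact_closed \<Phi>\<rho>_closed one_A one_I u0_closed
  show "X \<in> Obj C" by (simp add: C_fields lmod_X)
  show "\<psi> \<in> Hom C (X \<diamondop>\<^bsub>C\<^esub> AT) (AT \<diamondop>\<^bsub>C\<^esub> X)" by (simp add: C_fields(6) psi_hom)
  show "\<zeta> \<in> Hom C (X \<diamondop>\<^bsub>C\<^esub> X) (AT \<diamondop>\<^bsub>C\<^esub> X)" by (simp add: C_fields(6) zeta_hom)
  show "\<sigma> \<in> Hom C (Unit C) (AT \<diamondop>\<^bsub>C\<^esub> X)" by (simp add: C_fields(6,8) sigma_hom)
  note Xm = tens_arr_hom[OF Id_X mu_hom] and pA = tens_arr_hom[OF psi_hom Id_AT]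
    and iXAA = assoc_inv_hom[OF lmod_X lmod_AT lmod_AT]
  show "\<psi> \<bullet>\<^bsub>C\<^esub> (Ident C X \<star>\<^bsub>C\<^esub> \<mu>) = P2 \<bullet>\<^bsub>C\<^esub> (\<psi> \<star>\<^bsub>C\<^esub> Ident C AT) \<bullet>\<^bsub>C\<^esub> inv_arr C (Assoc C X AT AT)"
  proof (rule hom_tensor3r_eqI[OF c_comp_hom[OF Xm psi_hom] c_comp_hom[OF iXAA c_comp_hom[OF pA
    P2_hom]] lmod_X lmod_AT lmod_AT])
    fix x a b assume "x \<in> carrier X" "a \<in> carrier AT" "b \<in> carrier AT"
    then show "fn (\<psi> \<bullet>\<^bsub>C\<^esub> (Ident C X \<star>\<^bsub>C\<^esub> \<mu>)) (pure K X (tensor_space K AT AT) x (pure K AT AT a b))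
      = fn (P2 \<bullet>\<^bsub>C\<^esub> (\<psi> \<star>\<^bsub>C\<^esub> Ident C AT) \<bullet>\<^bsub>C\<^esub> inv_arr C (Assoc C X AT AT)) (pure K X (tensor_space K
        AT AT) x (pure K AT AT a b))"
      using fn_tens_pure[OF Id_X mu_hom, of x "pure K A A a b"] assoc_inv_pure[OF lmod_X lmod_AT
        lmod_AT, of x a b]
        fn_tens_pure[OF psi_hom Id_AT, of "pure K B A x a" b]
      by (simp add: fn_comp_hom[OF Xm] fn_comp_hom[OF iXAA] fn_comp_hom[OF pA] simps P2_contr1
        contract_psi coact_mult)
  qed
  note Xe = tens_arr_hom[OF Id_X eta_hom] and eX = tens_arr_hom[OF eta_hom Id_X] and rX
    = runit_arr_hom[OF lmod_X]
    and lX = lunit_inv(1)[OF lmod_X] and riX = runit_inv(1)[OF lmod_X]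
  show "\<psi> \<bullet>\<^bsub>C\<^esub> (Ident C X \<star>\<^bsub>C\<^esub> \<eta>) = (\<eta> \<star>\<^bsub>C\<^esub> Ident C X) \<bullet>\<^bsub>C\<^esub> inv_arr C (LUnit C X) \<bullet>\<^bsub>C\<^esub> RUnit C X"
  proof (rule hom_tensor_eqI[OF c_comp_hom[OF Xe psi_hom] c_comp_hom[OF rX c_comp_hom[OF lX eX]]
    lmod_X lmod_I])
    fix x c assume h: "x \<in> carrier X" "c \<in> carrier I"
    have l: "lin K A AB (\<lambda>a. contr1 x (\<rho> a))" using h
      by (intro lin_contractions(1) lin_coact) (simp_all add: triv_strips)
    have g: "contr1 x (\<rho> (scalar_of c \<odot>\<^bsub>A\<^esub> \<one>\<^bsub>A\<^esub>)) = scalar_of c \<odot>\<^bsub>AB\<^esub> pure K A B \<one>\<^bsub>A\<^esub> x"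
      using h lin_smult[OF l scalar_of_closed[OF h(2)] one_A]
        by (simp add: unit_contractions(4) triv_strips)
    have e: "pure K A B \<one>\<^bsub>A\<^esub> (scalar_of c \<odot>\<^bsub>B\<^esub> x) = scalar_of c \<odot>\<^bsub>AB\<^esub> pure K A B \<one>\<^bsub>A\<^esub> x"
      using h by (intro pure_smult_right modA modB scalar_of_closed one_A) (simp_all add:
        triv_strips)
    show "fn (\<psi> \<bullet>\<^bsub>C\<^esub> (Ident C X \<star>\<^bsub>C\<^esub> \<eta>)) (pure K X I x c)
      = fn ((\<eta> \<star>\<^bsub>C\<^esub> Ident C X) \<bullet>\<^bsub>C\<^esub> inv_arr C (LUnit C X) \<bullet>\<^bsub>C\<^esub> RUnit C X) (pure K X I x c)"
      using h fn_tens_pure[OF Id_X eta_hom, of x c] fn_runit_pure[OF lmod_module[OF lmod_X], of c x]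
        lunit_inv(2)[OF lmod_X, of "scalar_of c \<odot>\<^bsub>B\<^esub> x"] fn_tens_pure[OF eta_hom Id_X, of
          "Scal \<one>\<^bsub>K\<^esub>" "scalar_of c \<odot>\<^bsub>B\<^esub> x"]
        module_smult_closed[OF modB(1) scalar_of_closed[OF h(2)], of x] module_smult_closed[OF
          modA(1) scalar_of_closed[OF h(2)] one_A]
      by (simp add: fn_comp_hom[OF Xe] fn_comp_hom[OF rX] fn_comp_hom[OF lX] simps fn_eta g e
        scalar_of_closed)
  qed
  note zA = tens_arr_hom[OF zeta_hom Id_AT] and Xp = tens_arr_hom[OF Id_X psi_hom] and aXXA
    = assoc_arr_hom[OF lmod_X lmod_X lmod_AT]
  show "P2 \<bullet>\<^bsub>C\<^esub> (\<zeta> \<star>\<^bsub>C\<^esub> Ident C AT) = P1 \<bullet>\<^bsub>C\<^esub> (Ident C X \<star>\<^bsub>C\<^esub> \<psi>) \<bullet>\<^bsub>C\<^esub> Assoc C X X AT"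
  proof (rule hom_tensor3_eqI[OF c_comp_hom[OF zA P2_hom] c_comp_hom[OF aXXA c_comp_hom[OF Xp
    P1_hom]] lmod_X lmod_X lmod_AT])
    fix x y a assume "x \<in> carrier X" "y \<in> carrier X" "a \<in> carrier AT"
    then show "fn (P2 \<bullet>\<^bsub>C\<^esub> (\<zeta> \<star>\<^bsub>C\<^esub> Ident C AT)) (pure K (tensor_space K X X) AT (pure K X X x y) a)
      = fn (P1 \<bullet>\<^bsub>C\<^esub> (Ident C X \<star>\<^bsub>C\<^esub> \<psi>) \<bullet>\<^bsub>C\<^esub> Assoc C X X AT) (pure K (tensor_space K X X) AT (pure K
        X X x y) a)"
      using fn_tens_pure[OF zeta_hom Id_AT, of "pure K B B x y" a] assoc_triv_pure[OF lmod_X lmod_X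
        lmod_AT, of x y a]
        fn_tens_pure[OF Id_X psi_hom, of x "pure K B A y a"]
      by (simp add: fn_comp_hom[OF zA] fn_comp_hom[OF aXXA] fn_comp_hom[OF Xp] simps P2_contr2
        P1_contr1 zeta_psi_identity)
  qed
  note Xz = tens_arr_hom[OF Id_X zeta_hom] and zX = tens_arr_hom[OF zeta_hom Id_X] and aXXX
    = assoc_arr_hom[OF lmod_X lmod_X lmod_X]
  show "P1 \<bullet>\<^bsub>C\<^esub> (Ident C X \<star>\<^bsub>C\<^esub> \<zeta>) \<bullet>\<^bsub>C\<^esub> Assoc C X X X = P3 \<bullet>\<^bsub>C\<^esub> (\<zeta> \<star>\<^bsub>C\<^esub> Ident C X)"
  proof (rule hom_tensor3_eqI[OF c_comp_hom[OF aXXX c_comp_hom[OF Xz P1_hom]] c_comp_hom[OF zX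
    P3_hom] lmod_X lmod_X lmod_X])
    have lz: "lin K BBB (tensor_space K B AB) (fn (Ident C X \<star>\<^bsub>C\<^esub> \<zeta>))" using homD(5)[OF Xz]
      by (simp add: triv_strips)
    \<comment> \<open>The constraint of \<open>X \<otimes> X \<otimes> X\<close> does not preserve pure tensors, so the rest of this side
      is evaluated on arbitrary tensors, extending from pure ones by linearity.\<close>
    have N: "\<forall>t\<in>carrier BBB. fn P1 (fn (Ident C X \<star>\<^bsub>C\<^esub> \<zeta>) t) = contr3 t (E5 q \<otimes>\<^bsub>AH3\<^esub> E4 q)"
    proof (rule tensor_ext_right3[of K B B B AB])
      show "lin K BBB AB (\<lambda>t. fn P1 (fn (Ident C X \<star>\<^bsub>C\<^esub> \<zeta>) t))"
        by (rule lin_compose[OF lin_P(3) lz])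
      show "lin K BBB AB (\<lambda>t. contr3 t (E5 q \<otimes>\<^bsub>AH3\<^esub> E4 q))"
        by (intro lin_contractions(6) lin_ident mult_AH_closed E_closed \<Phi>\<rho>_closed)
      fix x y z assume "x \<in> carrier B" "y \<in> carrier B" "z \<in> carrier B"
      then show "fn P1 (fn (Ident C X \<star>\<^bsub>C\<^esub> \<zeta>) (pure K B BB x (pure K B B y z))) = contr3 (pure K B
        BB x (pure K B B y z)) (E5 q \<otimes>\<^bsub>AH3\<^esub> E4 q)"
        using fn_tens_pure[OF Id_X zeta_hom, of x "pure K B B y z"]
          by (simp add: simps P1_contr2 contract_zeta_zeta_left)
    qed (rule modB modAB)+
    fix x y z assume "x \<in> carrier X" "y \<in> carrier X" "z \<in> carrier X"
    then have xyz: "x \<in> carrier B" "y \<in> carrier B" "z \<in> carrier B" by (simp_all add: triv_strips)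
    let ?t = "pure K BB B (pure K B B x y) z"
    have tc: "?t \<in> carrier (tensor_space K BB B)" and rt: "rebracket K B B B ?t \<in> carrier BBB"
      using xyz by (simp_all add: simps rebracket_closed)
    have s: "fn (Assoc C X X X) ?t = act3 X X X \<Phi> (rebracket K B B B ?t)"
      using fn_assoc[OF lmod_X lmod_X lmod_X, of ?t] tc by (simp add: triv_strips)
    have sc: "act3 X X X \<Phi> (rebracket K B B B ?t) \<in> carrier BBB"
      using act3_closed[OF lmod_X lmod_X lmod_X \<Phi>_closed, of "rebracket K B B B ?t"] rt
        by (simp add: triv_strips)
    show "fn (P1 \<bullet>\<^bsub>C\<^esub> (Ident C X \<star>\<^bsub>C\<^esub> \<zeta>) \<bullet>\<^bsub>C\<^esub> Assoc C X X X) (pure K (tensor_space K X X) X (pure K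
      X X x y) z)
      = fn (P3 \<bullet>\<^bsub>C\<^esub> (\<zeta> \<star>\<^bsub>C\<^esub> Ident C X)) (pure K (tensor_space K X X) X (pure K X X x y) z)"
      using xyz tc s sc fn_tens_pure[OF zeta_hom Id_X, of "pure K B B x y" z]
      by (simp add: fn_comp_hom[OF aXXX] fn_comp_hom[OF Xz] fn_comp_hom[OF zX] simps N P3_contr2
        zeta_zeta_identity[OF _ _ HOL.refl])
  qed
  note As = tens_arr_hom[OF Id_AT sigma_hom] and sA = tens_arr_hom[OF sigma_hom Id_AT]
    and rA = runit_inv(1)[OF lmod_AT] and lA = lunit_inv(1)[OF lmod_AT]
  show "MulX \<bullet>\<^bsub>C\<^esub> (Ident C AT \<star>\<^bsub>C\<^esub> \<sigma>) \<bullet>\<^bsub>C\<^esub> inv_arr C (RUnit C AT) = P2 \<bullet>\<^bsub>C\<^esub> (\<sigma> \<star>\<^bsub>C\<^esub> Ident C AT) \<bullet>\<^bsub>C\<^esub>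
    inv_arr C (LUnit C AT)"
  proof (rule hom_eqI[OF c_comp_hom[OF rA c_comp_hom[OF As MulX_hom]] c_comp_hom[OF lA c_comp_hom[OF
    sA P2_hom]]], rule ballI)
    fix a assume "a \<in> carrier AT"
    then show "fn (MulX \<bullet>\<^bsub>C\<^esub> (Ident C AT \<star>\<^bsub>C\<^esub> \<sigma>) \<bullet>\<^bsub>C\<^esub> inv_arr C (RUnit C AT)) a
      = fn (P2 \<bullet>\<^bsub>C\<^esub> (\<sigma> \<star>\<^bsub>C\<^esub> Ident C AT) \<bullet>\<^bsub>C\<^esub> inv_arr C (LUnit C AT)) a"
      using runit_inv(2)[OF lmod_AT, of a] lunit_inv(2)[OF lmod_AT, of a] fn_tens_pure[OF Id_AT
        sigma_hom, of a "Scal \<one>\<^bsub>K\<^esub>"]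
        fn_tens_pure[OF sigma_hom Id_AT, of "Scal \<one>\<^bsub>K\<^esub>" a]
      by (simp add: fn_comp_hom[OF rA] fn_comp_hom[OF As] fn_comp_hom[OF lA] fn_comp_hom[OF sA]
        simps MulX_pure P2_pure unit_contractions(1)[OF u_closed])
  qed
  note Xs = tens_arr_hom[OF Id_X sigma_hom] and sX = tens_arr_hom[OF sigma_hom Id_X]
  have eta_x: "fn ((\<eta> \<star>\<^bsub>C\<^esub> Ident C X) \<bullet>\<^bsub>C\<^esub> inv_arr C (LUnit C X)) x = pure K A B \<one>\<^bsub>A\<^esub> x"
    if "x \<in> carrier X" for x
    using that lunit_inv(2)[OF lmod_X, of x] fn_tens_pure[OF eta_hom Id_X, of "Scal \<one>\<^bsub>K\<^esub>" x]
    by (simp add: fn_comp_hom[OF lX] simps)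
  show "P1 \<bullet>\<^bsub>C\<^esub> (Ident C X \<star>\<^bsub>C\<^esub> \<sigma>) \<bullet>\<^bsub>C\<^esub> inv_arr C (RUnit C X) = (\<eta> \<star>\<^bsub>C\<^esub> Ident C X) \<bullet>\<^bsub>C\<^esub> inv_arr C
    (LUnit C X)"
  proof (rule hom_eqI[OF c_comp_hom[OF riX c_comp_hom[OF Xs P1_hom]] c_comp_hom[OF lX eX]], rule
    ballI)
    fix x assume x: "x \<in> carrier X"
    then have "fn P1 (pure K B AB x (pure K A B \<one>\<^bsub>A\<^esub> u)) = pure K A B \<one>\<^bsub>A\<^esub> x"
      by (simp add: simps P1_pure coact_one tlift_pure[OF bilin_P3] modH one_H ract_one
        unit_contractions)
    then show "fn (P1 \<bullet>\<^bsub>C\<^esub> (Ident C X \<star>\<^bsub>C\<^esub> \<sigma>) \<bullet>\<^bsub>C\<^esub> inv_arr C (RUnit C X)) x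
      = fn ((\<eta> \<star>\<^bsub>C\<^esub> Ident C X) \<bullet>\<^bsub>C\<^esub> inv_arr C (LUnit C X)) x"
      using x eta_x[OF x] runit_inv(2)[OF lmod_X, of x] fn_tens_pure[OF Id_X sigma_hom, of x
        "Scal \<one>\<^bsub>K\<^esub>"]
      by (simp add: fn_comp_hom[OF riX] fn_comp_hom[OF Xs] simps)
  qed
  show "P3 \<bullet>\<^bsub>C\<^esub> (\<sigma> \<star>\<^bsub>C\<^esub> Ident C X) \<bullet>\<^bsub>C\<^esub> inv_arr C (LUnit C X) = (\<eta> \<star>\<^bsub>C\<^esub> Ident C X) \<bullet>\<^bsub>C\<^esub> inv_arr C
    (LUnit C X)"
  proof (rule hom_eqI[OF c_comp_hom[OF lX c_comp_hom[OF sX P3_hom]] c_comp_hom[OF lX eX]], rule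
    ballI)
    fix x assume x: "x \<in> carrier X"
    then show "fn (P3 \<bullet>\<^bsub>C\<^esub> (\<sigma> \<star>\<^bsub>C\<^esub> Ident C X) \<bullet>\<^bsub>C\<^esub> inv_arr C (LUnit C X)) x
      = fn ((\<eta> \<star>\<^bsub>C\<^esub> Ident C X) \<bullet>\<^bsub>C\<^esub> inv_arr C (LUnit C X)) x"
      using eta_x[OF x] lunit_inv(2)[OF lmod_X, of x] fn_tens_pure[OF sigma_hom Id_X, of "Scal \<one>\<^bsub>K\<^esub>"
        x]
      by (simp add: fn_comp_hom[OF lX] fn_comp_hom[OF sX] simps P3_pure unit_contractions)
  qed
qed

section \<open>The wreath product\<close>

text \<open>The diagonal action on \<open>A \<otimes> X\<close> is the action on the second factor, the first one being
  trivial. Both actions are restricted to carriers, so they are equal as functions.\<close>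

lemma quasi_smash_mod_eq: "tprod AT X = quasi_smash_mod K H A B"
proof -
  have s: "tensor_space K AT X = AB" by (simp add: triv_strips)
  have "diag_lact K H AT X = (\<lambda>h\<in>carrier H. \<lambda>t\<in>carrier AB. tmap K A B id (lact B h) t)"
  proof
    fix h
    show "diag_lact K H AT X h = (\<lambda>h\<in>carrier H. \<lambda>t\<in>carrier AB. tmap K A B id (lact B h) t) h"
    proof (cases "h \<in> carrier H")
      case True
      then show ?thesis
        using tprod_AT_X[OF True] by (auto simp: fun_eq_iff tensor_left_def wrapper_fields
          diag_lact_def restrict_def s)
    qed (simp add: diag_lact_def)
  qed
  then show ?thesis by (simp add: tensor_left_def quasi_smash_mod_def s)
qed

text \<open>The common value of the two products on \<open>a \<otimes> x\<close> and \<open>a' \<otimes> x'\<close>, through which the wreath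
  product and the quasi-smash product are compared.\<close>

definition smash where "smash a x a' x' = tlift AB (\<lambda>a0 a1. lcontr2 (a \<otimes>\<^bsub>A\<^esub> a0) (pure K B B (ract B
  x a1) x') q) (\<rho> a')"

lemma lin_smash:
  assumes "a \<in> carrier A" "x \<in> carrier B" "a' \<in> carrier A" "x' \<in> carrier B"
  shows "lin K A AB (\<lambda>a. smash a x a' x')" "lin K B AB (\<lambda>x. smash a x a' x')" "lin K A AB (\<lambda>a'.
    smash a x a' x')" "lin K B AB (\<lambda>x'. smash a x a' x')"
  unfolding smash_def
  by (assumption | rule assms lin_ident \<Phi>\<rho>_closed contr_intros)+

lemma bilin_smash:
  "a \<in> carrier A \<Longrightarrow> x \<in> carrier B \<Longrightarrow> bilin K A B AB (\<lambda>a' x'. smash a x a' x')"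
  "s' \<in> carrier AB \<Longrightarrow> bilin K A B AB (\<lambda>a x. tlift AB (\<lambda>a' x'. smash a x a' x') s')"
proof -
  show b: "bilin K A B AB (\<lambda>a' x'. smash a x a' x')" if "a \<in> carrier A" "x \<in> carrier B" for a x
    by (rule bilinI, rule lin_smash(4)[OF that _ u_closed], assumption, rule lin_smash(3)[OF that
      one_A])
  assume s': "s' \<in> carrier AB"
  show "bilin K A B AB (\<lambda>a x. tlift AB (\<lambda>a' x'. smash a x a' x') s')"
  proof (rule bilinI)
    show "lin K B AB (\<lambda>x. tlift AB (\<lambda>a' x'. smash a x a' x') s')" if "a \<in> carrier A" for a
      by (rule lin_tlift_param[OF s' modA(1) modB(1) modAB]) (rule lin_smash(2)[OF that u_closed])
    show "lin K A AB (\<lambda>a. tlift AB (\<lambda>a' x'. smash a x a' x') s')" if "x \<in> carrier B" for x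
      by (rule lin_tlift_param[OF s' modA(1) modB(1) modAB]) (rule lin_smash(1)[OF one_A that])
  qed
qed

lemma quasi_smash_mult_eq:
  assumes s: "s \<in> carrier AB" and s': "s' \<in> carrier AB"
  shows "quasi_smash_mult K H A B m s s' = tlift AB (\<lambda>a x. tlift AB (\<lambda>a' x'. smash a x a' x') s') s"
proof -
  have "tlift3 AB (\<lambda>q1 q2 q3. pure K A B (a \<otimes>\<^bsub>A\<^esub> a0 \<otimes>\<^bsub>A\<^esub> q1) (bimod_mult K B m (ract B x (a1 \<otimes>\<^bsub>H\<^esub>
    q2)) (ract B x' q3))) q
    = lcontr2 (a \<otimes>\<^bsub>A\<^esub> a0) (pure K B B (ract B x a1) x') q"
    if h: "a \<in> carrier A" "x \<in> carrier B" "x' \<in> carrier B" "a0 \<in> carrier A" "a1 \<in> carrier H"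
      for a x x' a0 a1
  proof -
    have "tlift3 AB (\<lambda>q1 q2 q3. pure K A B (a \<otimes>\<^bsub>A\<^esub> a0 \<otimes>\<^bsub>A\<^esub> q1) (bimod_mult K B m (ract B x (a1 \<otimes>\<^bsub>H\<^esub>
      q2)) (ract B x' q3))) q
      = tlift3 AB (\<lambda>q1 q2 q3. pure K A B (a \<otimes>\<^bsub>A\<^esub> a0 \<otimes>\<^bsub>A\<^esub> q1) (bimod_mult K B m (ract B (ract B x a1)
        q2) (ract B x' q3))) q"
      unfolding tlift3_def
      by (rule tlift_cong[OF \<Phi>\<rho>_closed(2) modA(1) modH(2)], rule tlift_cong[of _ K H H])
        (simp_all add: modH ract_mult h)
    then show ?thesis using h by (simp add: lcontr2_tlift3 \<Phi>\<rho>_closed mult_closed[OF algA]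
      ract_closed)
  qed
  note e = this
  show ?thesis
    unfolding quasi_smash_mult_def Let_def smash_def
    by (rule tlift_cong[OF s modA(1) modB(1)], rule tlift_cong[OF s' modA(1) modB(1)], rule
      tlift_cong[of _ K A H])
      (simp_all add: coact_closed modA modH e)
qed

lemma bilin_quasi_smash: "bilin K AB AB AB (quasi_smash_mult K H A B m)"
proof (rule bilinI)
  fix s assume s: "s \<in> carrier AB"
  show "lin K AB AB (\<lambda>s'. quasi_smash_mult K H A B m s s')"
  proof (rule lin_cong[OF quasi_smash_mult_eq[OF s] modAB])
    show "lin K AB AB (\<lambda>s'. tlift AB (\<lambda>a x. tlift AB (\<lambda>a' x'. smash a x a' x') s') s)"
      by (rule lin_tlift_param[OF s modA(1) modB(1) modAB]) (rule linear_tlift[OF bilin_smash(1)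
        modA(1) modB(1) modAB])
  qed
  show "lin K AB AB (\<lambda>s'. quasi_smash_mult K H A B m s' s)"
    by (rule lin_cong[OF quasi_smash_mult_eq[OF _ s] modAB linear_tlift[OF bilin_smash(2)[OF s]
      modA(1) modB(1) modAB]])
qed

lemma quasi_smash_mult_pure:
  assumes "a \<in> carrier A" "x \<in> carrier B" "a' \<in> carrier A" "x' \<in> carrier B"
  shows "quasi_smash_mult K H A B m (pure K A B a x) (pure K A B a' x') = smash a x a' x'"
  using assms by (simp add: quasi_smash_mult_eq pure_closed modA modB modAB tlift_pure[OF
    bilin_smash(2)] tlift_pure[OF bilin_smash(1)])

text \<open>All associativity constraints in the wreath product have a factor \<open>A\<close>, so its
  multiplication is computed on pure tensors without \<open>\<Phi>\<close>. The two algebras then coincide,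
  not merely up to isomorphism, because arrows are restricted to the carriers of their
  sources.\<close>

lemma wreath_product_eq: "wreath_product C AT \<mu> X \<psi> \<zeta> \<sigma> = quasi_smash_product K H A B m e"
proof -
  interpret A: assoc_unital_algebra K A by (rule algA)
  note simps = triv_strips pure_closed modA modB modAB module_tensor fn_Id fn_psi fn_zeta fn_mu
    contractions_closed coact_closed \<Phi>\<rho>_closed
  \<comment> \<open>\<open>?L\<close> is the multiplication of the wreath product; \<open>?D\<close> moves the second element of \<open>A\<close>
    past the first element of \<open>X\<close>, and \<open>?J\<close> then multiplies within \<open>A\<close> and applies \<open>\<zeta>\<close>.\<close>
  let ?D = "Assoc C AT X X \<bullet>\<^bsub>C\<^esub> (\<psi> \<star>\<^bsub>C\<^esub> Ident C X) \<bullet>\<^bsub>C\<^esub> inv_arr C (Assoc C X AT X)"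
  let ?J = "MulX \<bullet>\<^bsub>C\<^esub> (\<mu> \<star>\<^bsub>C\<^esub> \<zeta>) \<bullet>\<^bsub>C\<^esub> inv_arr C (Assoc C AT AT (tprod X X))"
  let ?L = "?J \<bullet>\<^bsub>C\<^esub> (Ident C AT \<star>\<^bsub>C\<^esub> ?D) \<bullet>\<^bsub>C\<^esub> Assoc C AT X (tprod AT X)"
  have D: "?D \<in> Hom C (tprod X (tprod AT X)) (tprod AT (tprod X X))"
    by (rule c_comp_hom[OF P_homs(6) c_comp_hom[OF P_homs(3) P_homs(5)]])
  note i2 = assoc_inv_hom[OF lmod_AT lmod_AT lmod_tprod[OF lmod_X lmod_X]] and mz = tens_arr_hom[OF
    mu_hom zeta_hom]
  have J: "?J \<in> Hom C (tprod AT (tprod AT (tprod X X))) (tprod AT X)"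
    by (rule c_comp_hom[OF i2 c_comp_hom[OF mz MulX_hom]])
  note AD = tens_arr_hom[OF Id_AT D] and a2 = assoc_arr_hom[OF lmod_AT lmod_X lmod_tprod[OF lmod_AT
    lmod_X]]
  have Lh: "?L \<in> Hom C (tprod (tprod AT X) (tprod AT X)) (tprod AT X)"
    by (rule c_comp_hom[OF a2 c_comp_hom[OF AD J]])
  have D_pure: "fn ?D (pure K B AB x (pure K A B a y)) = rebracket K A B B (pure K AB B (contr1 x (\<rho>
    a)) y)"
    if h: "x \<in> carrier B" "a \<in> carrier A" "y \<in> carrier B" for x a y
    using h assoc_inv_pure[OF lmod_X lmod_AT lmod_X, of x a y] fn_tens_pure[OF psi_hom Id_X, of
      "pure K B A x a" y]
      assoc_triv[OF lmod_AT lmod_X lmod_X, of "pure K AB B (contr1 x (\<rho> a)) y"]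
    by (simp add: fn_comp_hom[OF P_homs(6)] fn_comp_hom[OF P_homs(3)] simps)
  have J_pure: "fn ?J (pure K A (tensor_space K A BB) a (pure K A BB b t)) = lcontr2 (a \<otimes>\<^bsub>A\<^esub> b) t q"
    if h: "a \<in> carrier A" "b \<in> carrier A" "t \<in> carrier BB" for a b t
    using h assoc_inv_pure[OF lmod_AT lmod_AT lmod_tprod[OF lmod_X lmod_X], of a b t]
      fn_tens_pure[OF mu_hom zeta_hom, of "pure K A A a b" t]
    by (simp add: fn_comp_hom[OF i2] fn_comp_hom[OF mz] simps MulX_contract)
  have lJ: "lin K (tensor_space K A (tensor_space K A BB)) AB (fn ?J)" using homD(5)[OF J]
    by (simp add: triv_strips)
  have J_G: "fn ?J (pure K A (tensor_space K A BB) a (rebracket K A B B (pure K AB B (contr1 x t)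
    y)))
     = tlift AB (\<lambda>a0 a1. lcontr2 (a \<otimes>\<^bsub>A\<^esub> a0) (pure K B B (ract B x a1) y) q) t"
    if h: "a \<in> carrier A" "x \<in> carrier B" "y \<in> carrier B" and t: "t \<in> carrier AH" for a x y t
  proof -
    have bl: "bilin K A H AB (\<lambda>a0 a1. lcontr2 (a \<otimes>\<^bsub>A\<^esub> a0) (pure K B B (ract B x a1) y) q)"
      by (assumption | rule h lin_ident \<Phi>\<rho>_closed contr_intros)+
    have "\<forall>t\<in>carrier AH. fn ?J (pure K A (tensor_space K A BB) a (rebracket K A B B (pure K AB B
      (contr1 x t) y)))
     = tlift AB (\<lambda>a0 a1. lcontr2 (a \<otimes>\<^bsub>A\<^esub> a0) (pure K B B (ract B x a1) y) q) t"
      by (rule tensor_ext[of K A H AB])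
        ((assumption | rule h lin_compose[OF lJ] lin_tlift_arg[OF lin_ident _ _ _ bl]
          contr_intros)+,
         simp add: h contr_simps rebracket_pure J_pure tlift_pure[OF bl])
    then show ?thesis using t by simp
  qed
  have L_pure: "fn ?L (pure K AB AB (pure K A B a x) (pure K A B a' x')) = smash a x a' x'"
    if h: "a \<in> carrier A" "x \<in> carrier B" "a' \<in> carrier A" "x' \<in> carrier B" for a x a' x'
    using h assoc_triv_pure[OF lmod_AT lmod_X lmod_tprod[OF lmod_AT lmod_X], of a x "pure K A B a'
      x'"]
      fn_tens_pure[OF Id_AT D, of a "pure K B AB x (pure K A B a' x')"]
    by (simp add: fn_comp_hom[OF a2] fn_comp_hom[OF AD] simps D_pure J_G smash_def)
  have L_fn: "\<forall>t\<in>carrier (tensor_space K AB AB). fn ?L t = tlift AB (quasi_smash_mult K H A B m) t"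
  proof (rule tensor_ext[of K AB AB AB])
    show lL: "lin K (tensor_space K AB AB) AB (fn ?L)" using homD(5)[OF Lh]
      by (simp add: triv_strips)
    show lq: "lin K (tensor_space K AB AB) AB (tlift AB (quasi_smash_mult K H A B m))"
      by (rule linear_tlift[OF bilin_quasi_smash modAB modAB modAB])
    have ql: "lin K AB AB (\<lambda>s. quasi_smash_mult K H A B m s s')" "lin K AB AB (\<lambda>s. quasi_smash_mult
      K H A B m s' s)" if "s' \<in> carrier AB" for s'
      using bilin_quasi_smash that by (simp_all add: bilin_def)
    fix s s' assume s: "s \<in> carrier AB" "s' \<in> carrier AB"
    have "\<forall>s'\<in>carrier AB. fn ?L (pure K AB AB (pure K A B a x) s') = quasi_smash_mult K H A B m
      (pure K A B a x) s'"
      if h: "a \<in> carrier A" "x \<in> carrier B" for a x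
      by (rule tensor_ext[of K A B AB])
        (use h in \<open>simp_all add: modA modB modAB lin_compose[OF lL lin_pure_right] lin_ident
          pure_closed ql L_pure quasi_smash_mult_pure\<close>)
    then have "\<forall>s\<in>carrier AB. fn ?L (pure K AB AB s s') = quasi_smash_mult K H A B m s s'"
      by (intro tensor_ext[of K A B AB])
        (use s in \<open>simp_all add: modA modB modAB lin_compose[OF lL lin_pure_left] lin_ident
          pure_closed ql\<close>)
    then show "fn ?L (pure K AB AB s s') = tlift AB (quasi_smash_mult K H A B m) (pure K AB AB s
      s')"
      using s by (simp add: tlift_pure[OF bilin_quasi_smash modAB modAB modAB])
  qed (rule modAB)+
  note Q = quasi_smash_mod_eq[symmetric]
  let ?q = "Arrow (tprod (tprod AT X) (tprod AT X)) (\<lambda>t\<in>carrier (tprod (tprod AT X) (tprod AT X)).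
    tlift (tprod AT X) (quasi_smash_mult K H A B m) t) (tprod AT X)"
  have "?L = ?q"
  proof (rule arrow.expand, intro conjI)
    show "source ?L = source ?q" "target ?L = target ?q" using homD(3,4)[OF Lh] by simp_all
    have "fn ?L \<in> extensional (carrier (tprod (tprod AT X) (tprod AT X)))" using Lh
      by (simp add: hom_iff)
    then show "fn ?L = fn ?q"
      by (rule extensionalityI) (use L_fn in \<open>simp_all add: triv_strips\<close>)
  qed
  moreover have "\<sigma> = Arrow I (\<lambda>x\<in>Scal ` carrier K. scalar_of x \<odot>\<^bsub>tprod AT X\<^esub> pure K A B \<one>\<^bsub>A\<^esub> u)
    (tprod AT X)"
    by (simp add: sigma_def Let_def)
  ultimately show ?thesis
    unfolding wreath_product_def quasi_smash_product_def Let_def C_fields(6) Q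
      by (simp only: prod.inject simp_thms)
qed

end

theorem proposition5p1:
  fixes K :: "('k, 'c) ring_scheme"
    and H :: "('k, 'u) qba"
    and A :: "('k, 'u) ca"
    and B :: "('k, 'u) bimod"
    and m e :: "(('k, 'u) bimod, ('k, 'u) univ) arrow"
  assumes "field K"
    and "quasi_bialgebra K H"
    and "right_comodule_algebra K H A"
    and "bimodule_algebra K H B m e"
  shows "monoidal_category (left_mod_cat K H)
    \<and> wreath (left_mod_cat K H)
           (trivial_mod H A) (trivial_mult K H A) (trivial_unit K H A) (underlying_left B)
           (psi K H A B) (zeta K H A B m) (sigma K H A B e)
    \<and> wreath_product (left_mod_cat K H)
           (trivial_mod H A) (trivial_mult K H A) (underlying_left B)
           (psi K H A B) (zeta K H A B m) (sigma K H A B e)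
         = quasi_smash_product K H A B m e"
proof -
  interpret wreath_setting K H A B m e
    by (intro wreath_setting.intro quasi_setting.intro wreath_setting_axioms.intro assms)
  show ?thesis
    using monoidal_left_mod_cat wreath_AX wreath_product_eq by simp
qed

end
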